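(* Let $d\in\{2,3\}$, let $f \in L^2(\Omega)$ with $\operatorname{supp} f \subset \Omega \setminus B_{r_2}$, let $(\delta_n)$ be a sequence of positive numbers with $\delta_n \to 0$, and let $u_{\delta_n} \in H^1_0(\Omega)$ be the unique solution to $$\operatorname{div}(s_{\delta_n} A \nabla u_{\delta_n}) = f \mbox{ in } \Omega.$$ Assume that $s_0A$ is doubly complementary. Then: (i) If $\lim_{n \to \infty} \delta_n \| \nabla u_{\delta_n}\|_{L^2(B_{r_2} \setminus B_{r_1})}^2 = + \infty$, then $$v_{\delta_n} \to 0 \mbox{ weakly in } H^1(\Omega \setminus B_{r_3}),$$ where $v_{\delta}\in H^1_0(\Omega)$ is the unique solution to $\operatorname{div}(s_{\delta} A \nabla v_{\delta}) = f_{\delta}$ in $\Omega$ with $f_\delta = c_\delta f$, and $c_\delta>0$ is the normalization constant such that $\delta \int_{B_{r_2} \setminus B_{r_1}} |\nabla v_{\delta}|^2 = 1$. (ii) If the sequence $\big(\delta_n\| \nabla u_{\delta_n}\|_{L^2(B_{r_2} \setminus B_{r_1})}^2 \big)_{n \in \mathbb{N}}$ is bounded, then $$u_{\delta_n} \to u \mbox{ weakly in } H^1(\Omega \setminus B_{r_3}) \mbox{ as } n\to\infty,$$ where $u \in H^1_0(\Omega)$ is the unique solution to $\operatorname{div}(\hat A \nabla u) = f$ in $\Omega$.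
   Context: $B_r$ is the open ball of radius $r$ centered at the origin in $\mathbb{R}^d$. $\Omega\subset\mathbb{R}^d$ is a smooth bounded open set, and $0<r_1<r_2$ with $B_{r_2}\subset\subset\Omega$. $A$ is a symmetric uniformly elliptic matrix-valued function on $\Omega$: $\Lambda^{-1}|\xi|^2\le\langle A(x)\xi,\xi\rangle\le\Lambda|\xi|^2$ for all $\xi\in\mathbb{R}^d$ and a.e. $x\in\Omega$, for some $1\le\Lambda<\infty$. For $\delta\ge0$, $s_\delta=-1+i\delta$ in $B_{r_2}\setminus B_{r_1}$ and $s_\delta=1$ otherwise. Solutions are complex valued. For a diffeomorphism $T$ and a matrix-valued function $a$, $T_*a(y)=\dfrac{DT(x)\,a(x)\,DT(x)^T}{|\det DT(x)|}$ with $x=T^{-1}(y)$. Reflecting complementary media: for $r_1<r_2<r_3$, the media $A$ in $B_{r_3}\setminus B_{r_2}$ and $-A$ in $B_{r_2}\setminus B_{r_1}$ are reflecting complementary if there exists a diffeomorphism $F:B_{r_2}\setminus\bar B_{r_1}\to B_{r_3}\setminus\bar B_{r_2}$ such that $F_*A=A$ in $B_{r_3}\setminus\bar B_{r_2}$, $F(x)=x$ on $\partial B_{r_2}$, and: (1) $F$ has a diffeomorphism extension, still denoted $F$, from $B_{r_2}\setminus\{x_1\}$ onto $\mathbb{R}^d\setminus\bar B_{r_2}$ for some $x_1\in B_{r_1}$; (2) there exists a diffeomorphism $G:\mathbb{R}^d\setminus\bar B_{r_3}\to B_{r_3}\setminus\{x_2\}$ for some $x_2\in B_{r_3}$ such that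 $G(x)=x$ on $\partial B_{r_3}$, and $G\circ F:B_{r_1}\to B_{r_3}$ is a diffeomorphism if one sets $G\circ F(x_1)=x_2$. (In the boundary conditions, $F$ and $G$ denote diffeomorphism extensions of $F$ and $G$ to neighborhoods of $\partial B_{r_2}$ and $\partial B_{r_3}$.) Doubly complementary: $s_0A$ is doubly complementary if for some $r_3>0$ with $B_{r_3}\subset\subset\Omega$, $A$ in $B_{r_3}\setminus B_{r_2}$ and $-A$ in $B_{r_2}\setminus B_{r_1}$ are reflecting complementary and $F_*A=G_*F_*A=A$ in $B_{r_3}\setminus B_{r_2}$ for some $F,G$ as in that definition. These $r_3,F,G$ are fixed. Standing assumption: $A\in[C^3(\overline{B_{r_3}\setminus B_{r_2}})]^{d\times d}$. $\hat A=A$ in $\Omega\setminus B_{r_3}$ and $\hat A=G_*F_*A$ in $B_{r_3}$. *)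

theory Defs
  imports "HOL-Analysis.Analysis"
begin

section \<open>Differentiability classes and diffeomorphisms\<close>

primrec Ck_on :: "nat \<Rightarrow> (real^'d) set \<Rightarrow> (real^'d \<Rightarrow> 'b::real_normed_vector) \<Rightarrow> bool" where
  "Ck_on 0 S f \<longleftrightarrow> continuous_on S f"
| "Ck_on (Suc k) S f \<longleftrightarrow>
     (\<exists>g. (\<forall>i. Ck_on k S (g i)) \<and>
          (\<forall>x\<in>S. (f has_derivative (\<lambda>h. \<Sum>i\<in>UNIV. (h $ i) *\<^sub>R g i x)) (at x)))"

definition smooth_on :: "(real^'d) set \<Rightarrow> (real^'d \<Rightarrow> 'b::real_normed_vector) \<Rightarrow> bool" where
  "smooth_on S f \<longleftrightarrow> (\<forall>k. Ck_on k S f)"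

text \<open>The class usually written \<open>C^k(closure S)\<close>, for open \<open>S\<close>: the derivatives up to
  order \<open>k\<close> exist in \<open>S\<close> and extend continuously to the closure of \<open>S\<close>.\<close>

primrec Ck_closure :: "nat \<Rightarrow> (real^'d) set \<Rightarrow> (real^'d \<Rightarrow> 'b::real_normed_vector) \<Rightarrow> bool" where
  "Ck_closure 0 S f \<longleftrightarrow> continuous_on (closure S) f"
| "Ck_closure (Suc k) S f \<longleftrightarrow>
     continuous_on (closure S) f \<and>
     (\<exists>g. (\<forall>i. Ck_closure k S (g i)) \<and>
          (\<forall>x\<in>S. (f has_derivative (\<lambda>h. \<Sum>i\<in>UNIV. (h $ i) *\<^sub>R g i x)) (at x)))"

definition partial_deriv :: "'d \<Rightarrow> (real^'d \<Rightarrow> 'b::real_normed_vector) \<Rightarrow> real^'d \<Rightarrow> 'b" where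
  "partial_deriv i f x = frechet_derivative f (at x) (axis i 1)"

text \<open>Smooth boundary, by local defining functions: near each boundary point the set is
  the sublevel set of a smooth function without critical points.\<close>

definition smooth_bounded_open :: "(real^'d) set \<Rightarrow> bool" where
  "smooth_bounded_open \<Omega> \<longleftrightarrow> open \<Omega> \<and> bounded \<Omega> \<and>
     (\<forall>x\<in>frontier \<Omega>. \<exists>U \<rho>. open U \<and> x \<in> U \<and> smooth_on U (\<rho> :: real^'d \<Rightarrow> real) \<and>
        (\<forall>y\<in>U. \<exists>i. partial_deriv i \<rho> y \<noteq> 0) \<and> \<Omega> \<inter> U = {y \<in> U. \<rho> y < 0})"

definition diffeo :: "(real^'d) set \<Rightarrow> (real^'d) set \<Rightarrow> (real^'d \<Rightarrow> real^'d) \<Rightarrow> bool" where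
  "diffeo U V T \<longleftrightarrow> open U \<and> open V \<and> bij_betw T U V \<and>
     Ck_on 1 U T \<and> Ck_on 1 V (inv_into U T)"

text \<open>The boundary condition \<open>T(x) = x\<close> on a part \<open>S\<close> of the boundary of \<open>U\<close>: it is imposed on
  a diffeomorphism extension \<open>T'\<close> of \<open>T\<close> to a neighbourhood of \<open>S\<close>; the values of the total
  function \<open>T\<close> itself outside \<open>U\<close> are irrelevant.\<close>

definition fixes_boundary :: "(real^'d) set \<Rightarrow> (real^'d) set \<Rightarrow> (real^'d \<Rightarrow> real^'d) \<Rightarrow> bool" where
  "fixes_boundary U S T \<longleftrightarrow>
     (\<exists>W T'. open W \<and> S \<subseteq> W \<and> diffeo W (T' ` W) T' \<and>
             (\<forall>x\<in>W \<inter> U. T' x = T x) \<and> (\<forall>x\<in>S. T' x = x))"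

text \<open>\<open>pushforward U T a\<close> is \<open>T\<^sub>*a\<close> for \<open>T\<close> injective on \<open>U\<close>; it is meaningful on \<open>T ` U\<close>.\<close>

definition pushforward ::
  "(real^'d) set \<Rightarrow> (real^'d \<Rightarrow> real^'d) \<Rightarrow> (real^'d \<Rightarrow> real^'d^'d) \<Rightarrow> real^'d \<Rightarrow> real^'d^'d" where
  "pushforward U T a y =
     (let x = inv_into U T y; J = matrix (frechet_derivative T (at x))
      in (1 / \<bar>det J\<bar>) *\<^sub>R (J ** a x ** transpose J))"


section \<open>Complementary media\<close>

definition symmetric_uniformly_elliptic :: "(real^'d) set \<Rightarrow> (real^'d \<Rightarrow> real^'d^'d) \<Rightarrow> bool" where
  "symmetric_uniformly_elliptic \<Omega> A \<longleftrightarrow>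
     A \<in> borel_measurable (lebesgue_on \<Omega>) \<and>
     (AE x in lebesgue_on \<Omega>. transpose (A x) = A x) \<and>
     (\<exists>\<Lambda>\<ge>1. AE x in lebesgue_on \<Omega>. \<forall>\<xi>.
        (1 / \<Lambda>) * (norm \<xi>)\<^sup>2 \<le> (A x *v \<xi>) \<bullet> \<xi> \<and> (A x *v \<xi>) \<bullet> \<xi> \<le> \<Lambda> * (norm \<xi>)\<^sup>2)"

text \<open>\<open>A\<close> in the outer shell and \<open>-A\<close> in the inner shell are reflecting complementary, as
  witnessed by \<open>F\<close>, \<open>G\<close> and the points \<open>x1\<close>, \<open>x2\<close>. Here \<open>F\<close> denotes the diffeomorphism already
  extended to \<open>ball 0 r2 - {x1}\<close>. Identities between coefficient matrices hold almost everywhere,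
  like the ellipticity bounds.\<close>

definition reflecting_complementary ::
  "real \<Rightarrow> real \<Rightarrow> real \<Rightarrow> (real^'d \<Rightarrow> real^'d^'d) \<Rightarrow>
   (real^'d \<Rightarrow> real^'d) \<Rightarrow> (real^'d \<Rightarrow> real^'d) \<Rightarrow> real^'d \<Rightarrow> real^'d \<Rightarrow> bool" where
  "reflecting_complementary r1 r2 r3 A F G x1 x2 \<longleftrightarrow>
     r1 < r2 \<and> r2 < r3 \<and>
     diffeo (ball 0 r2 - cball 0 r1) (ball 0 r3 - cball 0 r2) F \<and>
     (AE y in lebesgue_on (ball 0 r3 - cball 0 r2).
        pushforward (ball 0 r2 - cball 0 r1) F A y = A y) \<and>
     fixes_boundary (ball 0 r2 - cball 0 r1) (sphere 0 r2) F \<and>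
     x1 \<in> ball 0 r1 \<and>
     diffeo (ball 0 r2 - {x1}) (- cball 0 r2) F \<and>
     x2 \<in> ball 0 r3 \<and>
     diffeo (- cball 0 r3) (ball 0 r3 - {x2}) G \<and>
     fixes_boundary (- cball 0 r3) (sphere 0 r3) G \<and>
     diffeo (ball 0 r1) (ball 0 r3) ((G \<circ> F)(x1 := x2))"

definition GF_pushforward ::
  "real \<Rightarrow> real \<Rightarrow> (real^'d \<Rightarrow> real^'d^'d) \<Rightarrow>
   (real^'d \<Rightarrow> real^'d) \<Rightarrow> (real^'d \<Rightarrow> real^'d) \<Rightarrow> real^'d \<Rightarrow> real^'d \<Rightarrow> real^'d^'d" where
  "GF_pushforward r2 r3 A F G x1 =
     pushforward (- cball 0 r3) G (pushforward (ball 0 r2 - {x1}) F A)"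

text \<open>\<open>s\<^sub>0A\<close> is doubly complementary in \<open>\<Omega>\<close>, as witnessed by \<open>r3\<close>, \<open>F\<close>, \<open>G\<close> (and \<open>x1\<close>, \<open>x2\<close>);
  \<open>F\<^sub>*A = A\<close> is part of \<open>reflecting_complementary\<close>.\<close>

definition doubly_complementary ::
  "(real^'d) set \<Rightarrow> real \<Rightarrow> real \<Rightarrow> (real^'d \<Rightarrow> real^'d^'d) \<Rightarrow>
   real \<Rightarrow> (real^'d \<Rightarrow> real^'d) \<Rightarrow> (real^'d \<Rightarrow> real^'d) \<Rightarrow> real^'d \<Rightarrow> real^'d \<Rightarrow> bool" where
  "doubly_complementary \<Omega> r1 r2 A r3 F G x1 x2 \<longleftrightarrow>
     r3 > 0 \<and> closure (ball 0 r3) \<subseteq> \<Omega> \<and>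
     reflecting_complementary r1 r2 r3 A F G x1 x2 \<and>
     (AE y in lebesgue_on (ball 0 r3 - cball 0 r2). GF_pushforward r2 r3 A F G x1 y = A y)"

definition A_hat ::
  "real \<Rightarrow> real \<Rightarrow> (real^'d \<Rightarrow> real^'d^'d) \<Rightarrow>
   (real^'d \<Rightarrow> real^'d) \<Rightarrow> (real^'d \<Rightarrow> real^'d) \<Rightarrow> real^'d \<Rightarrow> real^'d \<Rightarrow> real^'d^'d" where
  "A_hat r2 r3 A F G x1 y = (if y \<in> ball 0 r3 then GF_pushforward r2 r3 A F G x1 y else A y)"

definition s_coeff :: "real \<Rightarrow> real \<Rightarrow> real \<Rightarrow> real^'d \<Rightarrow> complex" where
  "s_coeff r1 r2 \<delta> x =
     (if x \<in> ball 0 r2 - ball 0 r1 then -1 + \<i> * complex_of_real \<delta> else 1)"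


section \<open>Sobolev spaces of complex-valued functions\<close>

definition L2_on :: "(real^'d) set \<Rightarrow> (real^'d \<Rightarrow> 'b::euclidean_space) \<Rightarrow> bool" where
  "L2_on S f \<longleftrightarrow> f \<in> borel_measurable (lebesgue_on S) \<and>
     integrable (lebesgue_on S) (\<lambda>x. (norm (f x))\<^sup>2)"

definition L2_norm :: "(real^'d) set \<Rightarrow> (real^'d \<Rightarrow> 'b::euclidean_space) \<Rightarrow> real" where
  "L2_norm S f = sqrt (\<integral>x. (norm (f x))\<^sup>2 \<partial>lebesgue_on S)"

text \<open>The support, relative to \<open>S\<close>, of a function defined up to null sets.\<close>

definition ess_support :: "(real^'d) set \<Rightarrow> (real^'d \<Rightarrow> complex) \<Rightarrow> (real^'d) set" where
  "ess_support S f =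
     {x \<in> S. \<not> (\<exists>U. open U \<and> x \<in> U \<and> (AE y in lebesgue_on (S \<inter> U). f y = 0))}"

definition test_function :: "(real^'d) set \<Rightarrow> (real^'d \<Rightarrow> 'b::real_normed_vector) \<Rightarrow> bool" where
  "test_function S \<phi> \<longleftrightarrow> smooth_on UNIV \<phi> \<and>
     compact (closure {x. \<phi> x \<noteq> 0}) \<and> closure {x. \<phi> x \<noteq> 0} \<subseteq> S"

definition has_weak_gradient ::
  "(real^'d) set \<Rightarrow> (real^'d \<Rightarrow> complex) \<Rightarrow> (real^'d \<Rightarrow> complex^'d) \<Rightarrow> bool" where
  "has_weak_gradient S u g \<longleftrightarrow>
     (\<forall>\<phi> :: real^'d \<Rightarrow> real. test_function S \<phi> \<longrightarrow>
        (\<forall>i. (\<integral>x. partial_deriv i \<phi> x *\<^sub>R u x \<partial>lebesgue_on S) =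
             - (\<integral>x. \<phi> x *\<^sub>R (g x $ i) \<partial>lebesgue_on S)))"

definition H1_on :: "(real^'d) set \<Rightarrow> (real^'d \<Rightarrow> complex) \<Rightarrow> bool" where
  "H1_on S u \<longleftrightarrow> L2_on S u \<and> (\<exists>g. L2_on S g \<and> has_weak_gradient S u g)"

text \<open>For \<open>u\<close> in \<open>H\<^sup>1(S)\<close>, \<open>S\<close> open, the weak gradient is determined up to null sets; the choice of
  the representative does not affect integrals.\<close>

definition weak_gradient :: "(real^'d) set \<Rightarrow> (real^'d \<Rightarrow> complex) \<Rightarrow> real^'d \<Rightarrow> complex^'d" where
  "weak_gradient S u = (SOME g. L2_on S g \<and> has_weak_gradient S u g)"

definition H1_norm :: "(real^'d) set \<Rightarrow> (real^'d \<Rightarrow> complex) \<Rightarrow> real" where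
  "H1_norm S u = sqrt ((L2_norm S u)\<^sup>2 + (L2_norm S (weak_gradient S u))\<^sup>2)"

definition H10_on :: "(real^'d) set \<Rightarrow> (real^'d \<Rightarrow> complex) \<Rightarrow> bool" where
  "H10_on S u \<longleftrightarrow> H1_on S u \<and>
     (\<exists>\<phi>. (\<forall>n. test_function S (\<phi> n)) \<and>
          (\<lambda>n. H1_norm S (\<lambda>x. u x - \<phi> n x)) \<longlonglongrightarrow> 0)"

definition H1_functional :: "(real^'d) set \<Rightarrow> ((real^'d \<Rightarrow> complex) \<Rightarrow> complex) \<Rightarrow> bool" where
  "H1_functional S l \<longleftrightarrow>
     (\<forall>u w. H1_on S u \<longrightarrow> H1_on S w \<longrightarrow> l (\<lambda>x. u x + w x) = l u + l w) \<and>
     (\<forall>c u. H1_on S u \<longrightarrow> l (\<lambda>x. c * u x) = c * l u) \<and>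
     (\<exists>C. \<forall>u. H1_on S u \<longrightarrow> cmod (l u) \<le> C * H1_norm S u)"

definition H1_weakly_converges ::
  "(real^'d) set \<Rightarrow> (nat \<Rightarrow> real^'d \<Rightarrow> complex) \<Rightarrow> (real^'d \<Rightarrow> complex) \<Rightarrow> bool" where
  "H1_weakly_converges S u w \<longleftrightarrow>
     (\<forall>\<^sub>F n in sequentially. H1_on S (u n)) \<and> H1_on S w \<and>
     (\<forall>l. H1_functional S l \<longrightarrow> (\<lambda>n. l (u n)) \<longlonglongrightarrow> l w)"


section \<open>Weak solutions\<close>

definition scaled_matrix ::
  "(real^'d \<Rightarrow> complex) \<Rightarrow> (real^'d \<Rightarrow> real^'d^'d) \<Rightarrow> real^'d \<Rightarrow> complex^'d^'d" where
  "scaled_matrix s A x = (\<chi> i j. s x * complex_of_real (A x $ i $ j))"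

text \<open>\<open>u \<in> H\<^sup>1\<^sub>0(\<Omega>)\<close> and \<open>div (M \<nabla>u) = f\<close> in \<open>\<Omega>\<close> in the sense of distributions.\<close>

definition H10_solution ::
  "(real^'d) set \<Rightarrow> (real^'d \<Rightarrow> complex^'d^'d) \<Rightarrow> (real^'d \<Rightarrow> complex) \<Rightarrow>
   (real^'d \<Rightarrow> complex) \<Rightarrow> bool" where
  "H10_solution \<Omega> M f u \<longleftrightarrow> H10_on \<Omega> u \<and>
     (\<forall>\<phi> :: real^'d \<Rightarrow> real. test_function \<Omega> \<phi> \<longrightarrow>
        (\<integral>x. (\<Sum>i\<in>UNIV. (M x *v weak_gradient \<Omega> u x) $ i * complex_of_real (partial_deriv i \<phi> x))
           \<partial>lebesgue_on \<Omega>) =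
        - (\<integral>x. f x * complex_of_real (\<phi> x) \<partial>lebesgue_on \<Omega>))"

definition unique_H10_solution ::
  "(real^'d) set \<Rightarrow> (real^'d \<Rightarrow> complex^'d^'d) \<Rightarrow> (real^'d \<Rightarrow> complex) \<Rightarrow>
   (real^'d \<Rightarrow> complex) \<Rightarrow> bool" where
  "unique_H10_solution \<Omega> M f u \<longleftrightarrow> H10_solution \<Omega> M f u \<and>
     (\<forall>w. H10_solution \<Omega> M f w \<longrightarrow> (AE x in lebesgue_on \<Omega>. w x = u x))"

end

theory Submission
  imports Defs
begin

text \<open>Put \<open>Psi = G \<circ> F\<close> on \<open>B\<^sub>r\<^sub>1\<close>. A solution \<open>u\<close> is folded to
  \<open>W = 1\<^bsub>|y| > r2\<^esub> u - 1\<^bsub>r2 < |y| < r3\<^esub> u \<circ> F\<^sup>-\<^sup>1 + 1\<^bsub>|y| < r3\<^esub> u \<circ> Psi\<^sup>-\<^sup>1\<close>, and a test function \<open>\<phi>\<close> is lifted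
  to \<open>\<phi>\<close>, \<open>\<phi> \<circ> F\<close>, \<open>\<phi> \<circ> Psi\<close> in \<open>|x| > r2\<close>, \<open>r1 < |x| < r2\<close>, \<open>|x| < r1\<close>. Both operations preserve
  \<open>H\<^sup>1\<^sub>0\<close>, because \<open>F\<close> is the identity on the sphere of radius \<open>r2\<close> and \<open>Psi = F\<close> on that of radius \<open>r1\<close>.
  By the change of variables formula and double complementarity, the \<open>A_hat\<close>-form of \<open>W\<close> against \<open>\<phi>\<close> is
  the \<open>s\<^sub>\<delta> A\<close>-form of \<open>u\<close> against the lift of \<open>\<phi>\<close>, up to an error of size
  \<open>\<delta> \<parallel>grad u\<parallel> \<parallel>grad \<phi>\<parallel>\<close> living in the inner shell. Since the \<open>A_hat\<close>-form is coercive and \<open>f = 0\<close> in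
  \<open>B\<^sub>r\<^sub>2\<close>, the folded solutions converge strongly in \<open>H\<^sup>1\<^sub>0\<close> as soon as \<open>\<delta> \<parallel>grad u\<parallel> \<rightarrow> 0\<close>, which holds
  when \<open>\<delta> \<parallel>grad u\<parallel>\<^sup>2\<close> is bounded; and \<open>W = u\<close> outside \<open>B\<^sub>r\<^sub>3\<close>. In case (i) the factors
  \<open>c\<^sub>\<delta>\<close> tend to \<open>0\<close>, by uniqueness, so that the limit is \<open>0\<close>.\<close>

section \<open>Square integrable functions\<close>

text \<open>A bound on \<open>\<delta> * \<parallel>grad u\<parallel>^2\<close> still allows
  \<open>\<parallel>grad u\<parallel>\<close> to grow like \<open>\<delta>^(-1/2)\<close>, so no
  compactness is at hand for the solutions themselves. Folding helps because the minus sign of the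
  reflected term matches the coefficient \<open>-1\<close> of the inner shell, which leaves only
  \<open>i * \<delta>\<close> uncancelled. The transmission conditions for conormal derivatives are
  never written down: they are absorbed in testing the equation with a lift. The obstacle is that
  lifts and folds of smooth functions have kinks on the spheres of radius \<open>r1\<close>,
  \<open>r2\<close>, \<open>r3\<close>. They are therefore shown to be Lipschitz, by gluing local
  extensions across the spheres, and placed in \<open>H^1_0\<close> by mollification. Strong
  convergence needs no weak compactness: the residual of a fold is bounded linearly in the gradient
  of the test function, so differences of folds have small residuals, coercivity makes the gradients
  Cauchy, the Poincare inequality does the same for the functions, and completeness of
  \<open>L^2\<close> supplies the limit.\<close>

lemma L2_norm_nonneg [simp]: "0 \<le> L2_norm S f"
  by (simp add: L2_norm_def)

lemma L2_norm_sq: "(L2_norm S f)\<^sup>2 = (\<integral>x. (norm (f x))\<^sup>2 \<partial>lebesgue_on S)"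
  by (simp add: L2_norm_def)

lemma L2_on_measurable: "L2_on S f \<Longrightarrow> f \<in> borel_measurable (lebesgue_on S)"
  by (simp add: L2_on_def)

lemma L2_on_bound:
  fixes f :: "real^'d \<Rightarrow> 'b::euclidean_space" and g :: "real^'d \<Rightarrow> 'c::euclidean_space"
  assumes f: "f \<in> borel_measurable (lebesgue_on S)" and g: "L2_on S g"
    and le: "AE x in lebesgue_on S. norm (f x) \<le> K * norm (g x)"
  shows "L2_on S f"
proof -
  have [measurable]: "f \<in> borel_measurable (lebesgue_on S)" "g \<in> borel_measurable (lebesgue_on S)"
    using f g by (auto simp: L2_on_def)
  have "integrable (lebesgue_on S) (\<lambda>x. (norm (f x))\<^sup>2)"
  proof (rule Bochner_Integration.integrable_bound)
    show "integrable (lebesgue_on S) (\<lambda>x. K\<^sup>2 * (norm (g x))\<^sup>2)"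
      using g by (simp add: L2_on_def)
    show "AE x in lebesgue_on S. norm ((norm (f x))\<^sup>2) \<le> norm (K\<^sup>2 * (norm (g x))\<^sup>2)"
      using le
    proof eventually_elim
      case (elim x)
      have "(norm (f x))\<^sup>2 \<le> (K * norm (g x))\<^sup>2"
        using elim by (intro power_mono) auto
      then show ?case by (simp add: power_mult_distrib)
    qed
  qed auto
  then show ?thesis by (simp add: L2_on_def f)
qed

lemma L2_norm_bound:
  fixes f :: "real^'d \<Rightarrow> 'b::euclidean_space" and g :: "real^'d \<Rightarrow> 'c::euclidean_space"
  assumes f: "f \<in> borel_measurable (lebesgue_on S)" and g: "L2_on S g" and K: "0 \<le> K"
    and le: "AE x in lebesgue_on S. norm (f x) \<le> K * norm (g x)"
  shows "L2_norm S f \<le> K * L2_norm S g"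
proof -
  have "(\<integral>x. (norm (f x))\<^sup>2 \<partial>lebesgue_on S) \<le> (\<integral>x. K\<^sup>2 * (norm (g x))\<^sup>2 \<partial>lebesgue_on S)"
  proof (rule integral_mono_AE)
    show "integrable (lebesgue_on S) (\<lambda>x. (norm (f x))\<^sup>2)"
      using L2_on_bound[OF f g le] by (simp add: L2_on_def)
    show "integrable (lebesgue_on S) (\<lambda>x. K\<^sup>2 * (norm (g x))\<^sup>2)"
      using g by (simp add: L2_on_def)
    show "AE x in lebesgue_on S. (norm (f x))\<^sup>2 \<le> K\<^sup>2 * (norm (g x))\<^sup>2"
      using le
    proof eventually_elim
      case (elim x)
      have "(norm (f x))\<^sup>2 \<le> (K * norm (g x))\<^sup>2"
        using elim by (intro power_mono) auto
      then show ?case by (simp add: power_mult_distrib)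
    qed
  qed
  also have "\<dots> = K\<^sup>2 * (\<integral>x. (norm (g x))\<^sup>2 \<partial>lebesgue_on S)"
    by simp
  finally have "(L2_norm S f)\<^sup>2 \<le> (K * L2_norm S g)\<^sup>2"
    by (simp add: L2_norm_sq power_mult_distrib)
  then show ?thesis
    using K by (meson L2_norm_nonneg mult_nonneg_nonneg power2_le_imp_le)
qed

lemma L2_norm_cong:
  assumes "\<And>x. x \<in> S \<Longrightarrow> f x = g x"
  shows "L2_norm S f = L2_norm S g"
  unfolding L2_norm_def by (intro arg_cong[where f=sqrt] Bochner_Integration.integral_cong) (auto simp: assms)

lemma L2_on_cong:
  assumes "\<And>x. x \<in> S \<Longrightarrow> f x = g x"
  shows "L2_on S f \<longleftrightarrow> L2_on S g"
  unfolding L2_on_def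
  by (intro conj_cong measurable_cong Bochner_Integration.integrable_cong) (auto simp: assms)

lemma L2_norm_cong_AE:
  assumes "f \<in> borel_measurable (lebesgue_on S)" "g \<in> borel_measurable (lebesgue_on S)"
    and "AE x in lebesgue_on S. f x = g x"
  shows "L2_norm S f = L2_norm S g"
proof -
  note [measurable] = assms(1,2)
  have "(\<integral>x. (norm (f x))\<^sup>2 \<partial>lebesgue_on S) = (\<integral>x. (norm (g x))\<^sup>2 \<partial>lebesgue_on S)"
    by (rule integral_cong_AE) (use assms(3) in auto)
  then show ?thesis by (simp add: L2_norm_def)
qed

lemma L2_on_bounded_linear:
  fixes f :: "real^'d \<Rightarrow> 'b::euclidean_space" and h :: "'b \<Rightarrow> 'c::euclidean_space"
  assumes f: "L2_on S f" and h: "bounded_linear h"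
  shows "L2_on S (\<lambda>x. h (f x))"
proof -
  obtain K where K: "\<And>x. norm (h x) \<le> K * norm x"
    using bounded_linear.bounded[OF h] by (metis mult.commute)
  have "(\<lambda>x. h (f x)) \<in> borel_measurable (lebesgue_on S)"
    using f linear_continuous_on[OF h] borel_measurable_continuous_on L2_on_measurable by blast
  then show ?thesis
    by (rule L2_on_bound[OF _ f, where K=K]) (simp add: K)
qed

lemma L2_on_add:
  assumes "L2_on S f" "L2_on S g"
  shows "L2_on S (\<lambda>x. f x + g x)"
proof -
  have [measurable]: "f \<in> borel_measurable (lebesgue_on S)" "g \<in> borel_measurable (lebesgue_on S)"
    using assms by (auto simp: L2_on_def)
  have "integrable (lebesgue_on S) (\<lambda>x. (norm (f x + g x))\<^sup>2)"
  proof (rule Bochner_Integration.integrable_bound)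
    show "integrable (lebesgue_on S) (\<lambda>x. 2 * (norm (f x))\<^sup>2 + 2 * (norm (g x))\<^sup>2)"
      using assms by (simp add: L2_on_def)
    have "(norm (f x + g x))\<^sup>2 \<le> 2 * (norm (f x))\<^sup>2 + 2 * (norm (g x))\<^sup>2" for x
    proof -
      have "(norm (f x + g x))\<^sup>2 \<le> (norm (f x) + norm (g x))\<^sup>2"
        by (intro power_mono norm_triangle_ineq) auto
      also have "\<dots> \<le> 2 * (norm (f x))\<^sup>2 + 2 * (norm (g x))\<^sup>2"
        using sum_squares_ge_zero[of "norm (f x) - norm (g x)" 0]
        by (simp add: power2_eq_square algebra_simps)
      finally show ?thesis .
    qed
    then show "AE x in lebesgue_on S. norm ((norm (f x + g x))\<^sup>2) \<le>
        norm (2 * (norm (f x))\<^sup>2 + 2 * (norm (g x))\<^sup>2)"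
      by (intro AE_I2) (simp add: abs_of_nonneg)
  qed auto
  then show ?thesis by (simp add: L2_on_def)
qed

lemma L2_on_uminus: "L2_on S f \<Longrightarrow> L2_on S (\<lambda>x. - f x)"
  by (auto simp: L2_on_def)

lemma L2_on_diff:
  assumes "L2_on S f" "L2_on S g"
  shows "L2_on S (\<lambda>x. f x - g x)"
  using L2_on_add[OF assms(1) L2_on_uminus[OF assms(2)]] by simp

lemma L2_on_zero [simp]: "L2_on S (\<lambda>x. 0)"
  by (simp add: L2_on_def)

lemma L2_norm_zero [simp]: "L2_norm S (\<lambda>x. 0) = 0"
  by (simp add: L2_norm_def)

text \<open>The integral of \<open>(norm (f x) - t * norm (g x))^2\<close> is a nonnegative
  quadratic polynomial in \<open>t\<close>. Pairing norms instead of values lets \<open>f\<close>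
  and \<open>g\<close> have different codomains, as happens when a function is paired with a
  gradient.\<close>

lemma L2_Cauchy_Schwarz:
  fixes f :: "real^'d \<Rightarrow> 'b::euclidean_space" and g :: "real^'d \<Rightarrow> 'c::euclidean_space"
  assumes "L2_on S f" "L2_on S g"
  shows "integrable (lebesgue_on S) (\<lambda>x. norm (f x) * norm (g x))"
    and "(\<integral>x. norm (f x) * norm (g x) \<partial>lebesgue_on S) \<le> L2_norm S f * L2_norm S g"
proof -
  let ?M = "lebesgue_on S"
  have [measurable]: "f \<in> borel_measurable (lebesgue_on S)" "g \<in> borel_measurable (lebesgue_on S)"
    and fi: "integrable ?M (\<lambda>x. (norm (f x))\<^sup>2)" and gi: "integrable ?M (\<lambda>x. (norm (g x))\<^sup>2)"
    using assms by (auto simp: L2_on_def)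
  have young: "2 * (s * t) \<le> s\<^sup>2 + t\<^sup>2" for s t :: real
    using sum_squares_ge_zero[of "s - t" 0] by (simp add: power2_eq_square algebra_simps)
  show ci: "integrable ?M (\<lambda>x. norm (f x) * norm (g x))"
  proof (rule Bochner_Integration.integrable_bound)
    show "integrable ?M (\<lambda>x. (norm (f x))\<^sup>2 + (norm (g x))\<^sup>2)"
      using fi gi by simp
    have "norm (f x) * norm (g x) \<le> (norm (f x))\<^sup>2 + (norm (g x))\<^sup>2" for x
      using young[of "norm (f x)" "norm (g x)"] mult_nonneg_nonneg[of "norm (f x)" "norm (g x)"] norm_ge_zero[of "f x"] norm_ge_zero[of "g x"]
      by linarith
    then show "AE x in ?M. norm (norm (f x) * norm (g x)) \<le> norm ((norm (f x))\<^sup>2 + (norm (g x))\<^sup>2)"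
      by (intro AE_I2) (simp add: abs_of_nonneg)
  qed auto
  let ?a = "\<integral>x. (norm (f x))\<^sup>2 \<partial>?M" and ?b = "\<integral>x. (norm (g x))\<^sup>2 \<partial>?M"
    and ?c = "\<integral>x. norm (f x) * norm (g x) \<partial>?M"
  have quad: "0 \<le> ?a - 2 * t * ?c + t\<^sup>2 * ?b" for t
  proof -
    have "0 \<le> (\<integral>x. (norm (f x) - t * norm (g x))\<^sup>2 \<partial>?M)"
      by (rule integral_nonneg_AE) auto
    also have "\<dots> = (\<integral>x. (norm (f x))\<^sup>2 - 2 * t * (norm (f x) * norm (g x)) + t\<^sup>2 * (norm (g x))\<^sup>2 \<partial>?M)"
      by (intro Bochner_Integration.integral_cong) (auto simp: power2_eq_square algebra_simps)
    also have "\<dots> = ?a - 2 * t * ?c + t\<^sup>2 * ?b"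
      using fi gi ci by simp
    finally show ?thesis .
  qed
  have c0: "0 \<le> ?c" and b0: "0 \<le> ?b" and a0: "0 \<le> ?a"
    by (auto intro!: integral_nonneg_AE)
  have "?c\<^sup>2 \<le> ?a * ?b"
  proof (cases "?b = 0")
    case True
    then have "AE x in ?M. (norm (g x))\<^sup>2 = 0"
      using integral_nonneg_eq_0_iff_AE[OF gi] by auto
    then have "AE x in ?M. norm (f x) * norm (g x) = 0"
      by eventually_elim auto
    then have "?c = 0" by (rule integral_eq_zero_AE)
    then show ?thesis using True by simp
  next
    case False
    then have "0 < ?b" using b0 by linarith
    \<comment> \<open>\<open>t = ?c / ?b\<close> is the minimiser of the quadratic.\<close>
    have "0 \<le> ?a - 2 * (?c / ?b) * ?c + (?c / ?b)\<^sup>2 * ?b" by (rule quad)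
    also have "\<dots> = ?a - ?c\<^sup>2 / ?b"
      using \<open>0 < ?b\<close> by (simp add: power2_eq_square field_simps)
    finally show ?thesis using \<open>0 < ?b\<close> by (simp add: field_simps)
  qed
  then show "?c \<le> L2_norm S f * L2_norm S g"
    unfolding L2_norm_def real_sqrt_mult[symmetric] using c0 by (simp add: real_le_rsqrt)
qed

lemma L2_norm_triangle:
  assumes "L2_on S f" "L2_on S g"
  shows "L2_norm S (\<lambda>x. f x + g x) \<le> L2_norm S f + L2_norm S g"
proof -
  let ?M = "lebesgue_on S"
  have [measurable]: "f \<in> borel_measurable (lebesgue_on S)" "g \<in> borel_measurable (lebesgue_on S)"
    and fi: "integrable ?M (\<lambda>x. (norm (f x))\<^sup>2)" and gi: "integrable ?M (\<lambda>x. (norm (g x))\<^sup>2)"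
    using assms by (auto simp: L2_on_def)
  note CS = L2_Cauchy_Schwarz[OF assms]
  have "(\<integral>x. (norm (f x + g x))\<^sup>2 \<partial>?M)
      \<le> (\<integral>x. (norm (f x))\<^sup>2 + 2 * (norm (f x) * norm (g x)) + (norm (g x))\<^sup>2 \<partial>?M)"
  proof (rule integral_mono)
    show "integrable ?M (\<lambda>x. (norm (f x + g x))\<^sup>2)"
      using L2_on_add[OF assms] by (simp add: L2_on_def)
    show "integrable ?M (\<lambda>x. (norm (f x))\<^sup>2 + 2 * (norm (f x) * norm (g x)) + (norm (g x))\<^sup>2)"
      using fi gi CS by simp
    fix x
    have "(norm (f x + g x))\<^sup>2 \<le> (norm (f x) + norm (g x))\<^sup>2"
      by (intro power_mono norm_triangle_ineq) auto
    then show "(norm (f x + g x))\<^sup>2 \<le> (norm (f x))\<^sup>2 + 2 * (norm (f x) * norm (g x)) + (norm (g x))\<^sup>2"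
      by (simp add: power2_eq_square algebra_simps)
  qed
  also have "\<dots> = (L2_norm S f)\<^sup>2 + 2 * (\<integral>x. norm (f x) * norm (g x) \<partial>?M) + (L2_norm S g)\<^sup>2"
    using fi gi CS by (simp add: L2_norm_sq)
  also have "\<dots> \<le> (L2_norm S f + L2_norm S g)\<^sup>2"
    using CS by (simp add: power2_eq_square algebra_simps)
  finally show ?thesis
    unfolding L2_norm_sq[symmetric] by (meson L2_norm_nonneg add_nonneg_nonneg power2_le_imp_le)
qed

lemma L2_norm_uminus [simp]: "L2_norm S (\<lambda>x. - f x) = L2_norm S f"
  by (simp add: L2_norm_def)

lemma L2_norm_minus_commute: "L2_norm S (\<lambda>x. f x - g x) = L2_norm S (\<lambda>x. g x - f x)"
  by (simp add: L2_norm_def norm_minus_commute)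

lemma L2_norm_triangle_diff:
  assumes "L2_on S f" "L2_on S g" "L2_on S h"
  shows "L2_norm S (\<lambda>x. f x - h x) \<le> L2_norm S (\<lambda>x. f x - g x) + L2_norm S (\<lambda>x. g x - h x)"
  using L2_norm_triangle[OF L2_on_diff[OF assms(1,2)] L2_on_diff[OF assms(2,3)]] by simp

lemma L2_norm_le_diff:
  assumes "L2_on S f" "L2_on S g"
  shows "L2_norm S f \<le> L2_norm S g + L2_norm S (\<lambda>x. f x - g x)"
  using L2_norm_triangle[OF assms(2) L2_on_diff[OF assms]] by simp

lemma L2_norm_eq_0:
  assumes "L2_on S f" "L2_norm S f = 0"
  shows "AE x in lebesgue_on S. f x = 0"
proof -
  have "AE x in lebesgue_on S. (norm (f x))\<^sup>2 = 0"
    using assms integral_nonneg_eq_0_iff_AE[of "lebesgue_on S" "\<lambda>x. (norm (f x))\<^sup>2"]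
    by (auto simp: L2_on_def L2_norm_def)
  then show ?thesis by eventually_elim auto
qed

lemma L2_norm_subset:
  assumes f: "L2_on S f" and T: "T \<in> sets lebesgue" and S: "S \<in> sets lebesgue" and TS: "T \<subseteq> S"
  shows "L2_on T f" "L2_norm T f \<le> L2_norm S f"
proof -
  have i: "integrable lebesgue (\<lambda>x. indicator S x *\<^sub>R (norm (f x))\<^sup>2)"
    using f S by (auto simp: L2_on_def integrable_restrict_space)
  have "integrable lebesgue (\<lambda>x. indicator T x *\<^sub>R indicator S x *\<^sub>R (norm (f x))\<^sup>2)"
    by (rule integrable_mult_indicator[OF T i])
  also have "(\<lambda>x. indicator T x *\<^sub>R indicator S x *\<^sub>R (norm (f x))\<^sup>2) = (\<lambda>x. indicator T x *\<^sub>R (norm (f x))\<^sup>2)"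
    using TS by (intro ext) (auto simp: indicator_def)
  finally have i2: "integrable lebesgue (\<lambda>x. indicator T x *\<^sub>R (norm (f x))\<^sup>2)" .
  then have i3: "integrable (lebesgue_on T) (\<lambda>x. (norm (f x))\<^sup>2)"
    using T by (subst integrable_restrict_space) auto
  have "f \<in> borel_measurable (lebesgue_on T)"
    using f TS L2_on_measurable[OF f] measurable_restrict_mono by blast
  with i3 show "L2_on T f" by (simp add: L2_on_def)
  have "(\<integral>x. indicator T x *\<^sub>R (norm (f x))\<^sup>2 \<partial>lebesgue) \<le> (\<integral>x. indicator S x *\<^sub>R (norm (f x))\<^sup>2 \<partial>lebesgue)"
    by (rule integral_mono[OF i2 i]) (use TS in \<open>auto simp: indicator_def\<close>)
  then show "L2_norm T f \<le> L2_norm S f"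
    unfolding L2_norm_def using T S by (auto simp: integral_restrict_space)
qed

text \<open>On a set of finite measure an \<open>L^2\<close> Cauchy sequence is Cauchy in
  \<open>L^1\<close>; a subsequence then converges almost everywhere, and Fatou's lemma turns this
  into \<open>L^2\<close> convergence of the whole sequence.\<close>

lemma L2_complete:
  fixes f :: "nat \<Rightarrow> real^'d \<Rightarrow> 'b::euclidean_space"
  assumes S: "S \<in> lmeasurable" and L2: "\<And>n. L2_on S (f n)"
    and Cauchy: "\<And>e. e > 0 \<Longrightarrow> \<exists>N. \<forall>m\<ge>N. \<forall>n\<ge>N. L2_norm S (\<lambda>x. f m x - f n x) < e"
  obtains g where "L2_on S g" "(\<lambda>n. L2_norm S (\<lambda>x. f n x - g x)) \<longlonglongrightarrow> 0"
proof -
  let ?M = "lebesgue_on S"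
  have fin: "finite_measure ?M" by (rule finite_measure_lebesgue_on[OF S])
  have one: "L2_on S (\<lambda>x. 1::real)"
    using fin by (auto simp: L2_on_def finite_measure.integrable_const)
  have meas[measurable]: "f n \<in> borel_measurable ?M" for n
    using L2 by (simp add: L2_on_def)
  have int: "integrable ?M (f n)" for n
  proof -
    have "integrable ?M (\<lambda>x. norm (f n x))"
      using L2_Cauchy_Schwarz(1)[OF L2[of n] one] by simp
    then show ?thesis by (simp add: integrable_norm_iff)
  qed
  have L1: "\<exists>N. \<forall>i\<ge>N. \<forall>j\<ge>N. (LINT x|?M. norm (f i x - f j x)) < e" if e: "e > 0" for e
  proof -
    \<comment> \<open>The \<open>+ 1\<close> keeps the divisor positive even when \<open>S\<close>
      is a null set.\<close>
    define c where "c = L2_norm S (\<lambda>x. 1::real) + 1"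
    have c: "c > 0" by (simp add: c_def add_nonneg_pos)
    obtain N where N: "\<And>m n. m \<ge> N \<Longrightarrow> n \<ge> N \<Longrightarrow> L2_norm S (\<lambda>x. f m x - f n x) < e / c"
      using Cauchy[OF divide_pos_pos[OF e c]] by blast
    have "(LINT x|?M. norm (f i x - f j x)) < e" if "i \<ge> N" "j \<ge> N" for i j
    proof -
      have "(LINT x|?M. norm (f i x - f j x)) \<le> L2_norm S (\<lambda>x. f i x - f j x) * L2_norm S (\<lambda>x. 1::real)"
        using L2_Cauchy_Schwarz(2)[OF L2_on_diff[OF L2[of i] L2[of j]] one] by simp
      also have "\<dots> \<le> L2_norm S (\<lambda>x. f i x - f j x) * c"
        by (intro mult_left_mono) (auto simp: c_def)
      also have "\<dots> < e"
        using N[OF that] c by (simp add: field_simps)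
      finally show ?thesis .
    qed
    then show ?thesis by blast
  qed
  obtain r where r: "strict_mono r" "AE x in ?M. Cauchy (\<lambda>i. f (r i) x)"
    using cauchy_L1_AE_cauchy_subseq[OF int L1] by blast
  \<comment> \<open>The default value \<open>0\<close> off the set of convergence keeps
    \<open>g\<close> measurable on all of \<open>S\<close>.\<close>
  define g where "g x = (if Cauchy (\<lambda>i. f (r i) x) then lim (\<lambda>i. f (r i) x) else 0)" for x
  have g[measurable]: "g \<in> borel_measurable ?M"
    unfolding g_def by measurable
  have lim: "AE x in ?M. (\<lambda>i. f (r i) x) \<longlonglongrightarrow> g x"
    using r(2) by eventually_elim (simp add: g_def Cauchy_convergent_iff convergent_LIMSEQ_iff)
  \<comment> \<open>Fatou along the indices \<open>r i \<ge> i\<close>: the Cauchy bound between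
    \<open>f n\<close> and \<open>f (r i)\<close> survives the passage to the pointwise
    limit.\<close>
  have key: "L2_on S (\<lambda>x. f n x - g x) \<and> L2_norm S (\<lambda>x. f n x - g x) \<le> e"
    if "e > 0" and N: "\<And>m n. m \<ge> N \<Longrightarrow> n \<ge> N \<Longrightarrow> L2_norm S (\<lambda>x. f m x - f n x) < e" and "n \<ge> N" for e N n
  proof -
    have "(\<integral>\<^sup>+x. ennreal ((norm (f n x - g x))\<^sup>2) \<partial>?M)
        = (\<integral>\<^sup>+x. liminf (\<lambda>i. ennreal ((norm (f n x - f (r i) x))\<^sup>2)) \<partial>?M)"
    proof (rule nn_integral_cong_AE)
      show "AE x in ?M. ennreal ((norm (f n x - g x))\<^sup>2) = liminf (\<lambda>i. ennreal ((norm (f n x - f (r i) x))\<^sup>2))"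
        using lim
      proof eventually_elim
        case (elim x)
        then have "(\<lambda>i. ennreal ((norm (f n x - f (r i) x))\<^sup>2)) \<longlonglongrightarrow> ennreal ((norm (f n x - g x))\<^sup>2)"
          by (intro tendsto_intros)
        then show ?case by (rule lim_imp_Liminf[OF sequentially_bot, symmetric])
      qed
    qed
    also have "\<dots> \<le> liminf (\<lambda>i. \<integral>\<^sup>+x. ennreal ((norm (f n x - f (r i) x))\<^sup>2) \<partial>?M)"
      by (rule nn_integral_liminf) measurable
    also have "\<dots> \<le> ennreal (e\<^sup>2)"
    proof (rule Liminf_le)
      have "(\<integral>\<^sup>+x. ennreal ((norm (f n x - f (r i) x))\<^sup>2) \<partial>?M) \<le> ennreal (e\<^sup>2)" if "i \<ge> N" for i
      proof -
        have ri: "r i \<ge> N" using r(1) that by (meson le_trans seq_suble)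
        have "(\<integral>\<^sup>+x. ennreal ((norm (f n x - f (r i) x))\<^sup>2) \<partial>?M) = ennreal ((L2_norm S (\<lambda>x. f n x - f (r i) x))\<^sup>2)"
          unfolding L2_norm_sq using L2_on_diff[OF L2[of n] L2[of "r i"]]
          by (intro nn_integral_eq_integral) (auto simp: L2_on_def)
        also have "\<dots> \<le> ennreal (e\<^sup>2)"
          using N[OF \<open>n \<ge> N\<close> ri] by (intro ennreal_leI power_mono) auto
        finally show ?thesis .
      qed
      then show "\<forall>\<^sub>F i in sequentially. (\<integral>\<^sup>+x. ennreal ((norm (f n x - f (r i) x))\<^sup>2) \<partial>?M) \<le> ennreal (e\<^sup>2)"
        using eventually_sequentially by blast
    qed simp
    finally have le: "(\<integral>\<^sup>+x. ennreal ((norm (f n x - g x))\<^sup>2) \<partial>?M) \<le> ennreal (e\<^sup>2)" .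
    have i: "integrable ?M (\<lambda>x. (norm (f n x - g x))\<^sup>2)"
      by (rule integrableI_nonneg) (use le in \<open>auto simp: less_top[symmetric] top_unique\<close>)
    have "ennreal ((L2_norm S (\<lambda>x. f n x - g x))\<^sup>2) \<le> ennreal (e\<^sup>2)"
      using le unfolding L2_norm_sq by (subst nn_integral_eq_integral[OF i, symmetric]) auto
    then have "(L2_norm S (\<lambda>x. f n x - g x))\<^sup>2 \<le> e\<^sup>2" by simp
    then have "L2_norm S (\<lambda>x. f n x - g x) \<le> e"
      using \<open>e > 0\<close> by (meson power2_le_imp_le less_imp_le)
    with i show ?thesis by (simp add: L2_on_def)
  qed
  show ?thesis
  proof
    obtain N where N: "\<And>m n. m \<ge> N \<Longrightarrow> n \<ge> N \<Longrightarrow> L2_norm S (\<lambda>x. f m x - f n x) < 1"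
      using Cauchy[OF zero_less_one] by blast
    have "L2_on S (\<lambda>x. f N x - g x)"
      by (rule conjunct1[OF key[OF zero_less_one N order_refl]])
    from L2_on_diff[OF L2[of N] this] show "L2_on S g" by simp
    show "(\<lambda>n. L2_norm S (\<lambda>x. f n x - g x)) \<longlonglongrightarrow> 0"
    proof (rule LIMSEQ_I)
      fix e :: real assume "e > 0"
      then have e2: "e / 2 > 0" by simp
      obtain N where N: "\<And>m n. m \<ge> N \<Longrightarrow> n \<ge> N \<Longrightarrow> L2_norm S (\<lambda>x. f m x - f n x) < e / 2"
        using Cauchy[OF e2] by blast
      have "L2_norm S (\<lambda>x. f n x - g x) \<le> e / 2" if "n \<ge> N" for n
        by (rule conjunct2[OF key[OF e2 N that]])
      then show "\<exists>N. \<forall>n\<ge>N. norm (L2_norm S (\<lambda>x. f n x - g x) - 0) < e"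
        using \<open>e > 0\<close> by (intro exI[of _ N]) (smt (verit) L2_norm_nonneg real_norm_def field_sum_of_halves)
    qed
  qed
qed

section \<open>Continuously differentiable maps\<close>

text \<open>Packs prescribed partial derivatives into a bounded linear map, so that continuity of a
  derivative can be stated in the operator norm.\<close>

definition partials_blinfun :: "('d \<Rightarrow> 'b::real_normed_vector) \<Rightarrow> (real^'d) \<Rightarrow>\<^sub>L 'b" where
  "partials_blinfun c = (\<Sum>i\<in>UNIV. blinfun_scaleR_left (c i) o\<^sub>L blinfun_inner_left (axis i 1))"

lemma partials_blinfun_apply [simp]:
  "blinfun_apply (partials_blinfun c) v = (\<Sum>i\<in>UNIV. (v $ i) *\<^sub>R c i)"
  by (simp add: partials_blinfun_def blinfun.sum_left inner_axis)

lemma partials_blinfun_eq: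
  "blinfun_apply (partials_blinfun c) = (\<lambda>v. \<Sum>i\<in>UNIV. (v $ i) *\<^sub>R c i)"
  by (rule ext) simp

lemma continuous_on_partials_blinfun:
  assumes "\<And>i. continuous_on S (\<lambda>x. c x i)"
  shows "continuous_on S (\<lambda>x. partials_blinfun (c x))"
  unfolding partials_blinfun_def
  by (intro continuous_intros bounded_linear.continuous_on[OF bounded_linear_blinfun_scaleR_left] assms
        bounded_bilinear.continuous_on[OF bounded_bilinear_blinfun_compose])

text \<open>A coordinate-free counterpart of \<open>Ck_on 1\<close>. Continuity of the derivative in
  the operator norm is the form that the mean value inequality consumes, and compositions are easier
  to treat this way.\<close>

definition C1_on :: "'a::real_normed_vector set \<Rightarrow> ('a \<Rightarrow> 'b::real_normed_vector) \<Rightarrow> bool" where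
  "C1_on U f \<longleftrightarrow> (\<exists>f'. (\<forall>x\<in>U. (f has_derivative blinfun_apply (f' x)) (at x)) \<and> continuous_on U f')"

lemma C1_onE:
  assumes "C1_on U f"
  obtains f' where "\<And>x. x \<in> U \<Longrightarrow> (f has_derivative blinfun_apply (f' x)) (at x)" "continuous_on U f'"
  using assms unfolding C1_on_def by blast

lemma C1_onI:
  "(\<And>x. x \<in> U \<Longrightarrow> (f has_derivative blinfun_apply (f' x)) (at x)) \<Longrightarrow> continuous_on U f' \<Longrightarrow> C1_on U f"
  unfolding C1_on_def by blast

lemma Ck_on_1_imp_C1_on: "Ck_on 1 U f \<Longrightarrow> C1_on U f"
proof -
  assume "Ck_on 1 U f"
  then obtain g where g: "\<And>i. continuous_on U (g i)"
      "\<And>x. x \<in> U \<Longrightarrow> (f has_derivative (\<lambda>h. \<Sum>i\<in>UNIV. (h $ i) *\<^sub>R g i x)) (at x)"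
    by auto
  show "C1_on U f"
  proof (rule C1_onI)
    show "(f has_derivative blinfun_apply (partials_blinfun (\<lambda>i. g i x))) (at x)" if "x \<in> U" for x
      using g(2)[OF that] by (simp add: partials_blinfun_eq)
    show "continuous_on U (\<lambda>x. partials_blinfun (\<lambda>i. g i x))"
      by (rule continuous_on_partials_blinfun) (rule g(1))
  qed
qed

lemma C1_on_differentiable: "C1_on U f \<Longrightarrow> x \<in> U \<Longrightarrow> f differentiable at x"
  unfolding C1_on_def differentiable_def by blast

lemma C1_on_continuous: "C1_on U f \<Longrightarrow> continuous_on U f"
  by (meson C1_on_differentiable continuous_at_imp_continuous_on differentiable_imp_continuous_within)

lemma C1_on_subset: "C1_on U f \<Longrightarrow> V \<subseteq> U \<Longrightarrow> C1_on V f"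
  unfolding C1_on_def by (meson continuous_on_subset subsetD)

lemma C1_on_compose:
  assumes f: "C1_on U f" and g: "C1_on V g" and sub: "f ` U \<subseteq> V"
  shows "C1_on U (g \<circ> f)"
proof -
  obtain f' where f': "\<And>x. x \<in> U \<Longrightarrow> (f has_derivative blinfun_apply (f' x)) (at x)" "continuous_on U f'"
    using C1_onE[OF f] by blast
  obtain g' where g': "\<And>x. x \<in> V \<Longrightarrow> (g has_derivative blinfun_apply (g' x)) (at x)" "continuous_on V g'"
    using C1_onE[OF g] by blast
  show ?thesis
  proof (rule C1_onI)
    show "(g \<circ> f has_derivative blinfun_apply (g' (f x) o\<^sub>L f' x)) (at x)" if "x \<in> U" for x
    proof -
      have "f x \<in> V" using that sub by blast
      from diff_chain_at[OF f'(1)[OF that] g'(1)[OF this]] show ?thesis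
        by (simp add: blinfun_compose.rep_eq)
    qed
    show "continuous_on U (\<lambda>x. g' (f x) o\<^sub>L f' x)"
      by (intro bounded_bilinear.continuous_on[OF bounded_bilinear_blinfun_compose] f'(2) continuous_on_compose2[OF g'(2)] C1_on_continuous[OF f] sub)
  qed
qed

text \<open>Mean value inequality for \<open>f\<close> minus its derivative at \<open>p\<close>, on
  a ball where the derivative moves by less than \<open>\<eta>\<close>. Both endpoints are free,
  which later permits averaging over translates.\<close>

lemma C1_on_strict:
  assumes f: "C1_on U f" and "open U" "p \<in> U" and "\<eta> > 0"
  obtains e where "e > 0" "ball p e \<subseteq> U"
    "\<And>y z. y \<in> ball p e \<Longrightarrow> z \<in> ball p e \<Longrightarrow>
        norm (f z - f y - frechet_derivative f (at p) (z - y)) \<le> \<eta> * norm (z - y)"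
proof -
  obtain f' where f': "\<And>x. x \<in> U \<Longrightarrow> (f has_derivative blinfun_apply (f' x)) (at x)" "continuous_on U f'"
    using C1_onE[OF f] by blast
  have fd: "frechet_derivative f (at p) = blinfun_apply (f' p)"
    using f'(1)[OF \<open>p \<in> U\<close>] frechet_derivative_at by metis
  have "continuous (at p) f'"
    using f'(2) \<open>open U\<close> \<open>p \<in> U\<close> continuous_on_eq_continuous_at by blast
  then obtain d where d: "d > 0" "\<And>x. dist x p < d \<Longrightarrow> dist (f' x) (f' p) < \<eta>"
    using \<open>\<eta> > 0\<close> unfolding continuous_at_eps_delta by blast
  obtain e0 where e0: "e0 > 0" "ball p e0 \<subseteq> U"
    using \<open>open U\<close> \<open>p \<in> U\<close> openE by blast
  show ?thesis
  proof (rule that[of "min d e0"])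
    show "min d e0 > 0" using d e0 by auto
    show sub: "ball p (min d e0) \<subseteq> U" using e0 by auto
    fix y z assume yz: "y \<in> ball p (min d e0)" "z \<in> ball p (min d e0)"
    have "norm ((\<lambda>x. f x - f' p x) z - (\<lambda>x. f x - f' p x) y) \<le> \<eta> * norm (z - y)"
    proof (rule differentiable_bound[of "ball p (min d e0)" _ "\<lambda>x. blinfun_apply (f' x - f' p)"])
      show "convex (ball p (min d e0))" by simp
      fix x assume x: "x \<in> ball p (min d e0)"
      have "((\<lambda>x. f x - f' p x) has_derivative (\<lambda>v. f' x v - f' p v)) (at x)"
        using sub x by (intro has_derivative_diff f'(1) bounded_linear_imp_has_derivative blinfun.bounded_linear_right) auto
      then show "((\<lambda>x. f x - f' p x) has_derivative blinfun_apply (f' x - f' p)) (at x within ball p (min d e0))"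
        by (simp add: blinfun.diff_left[abs_def] has_derivative_at_withinI)
      show "onorm (blinfun_apply (f' x - f' p)) \<le> \<eta>"
        using d(2)[of x] x by (simp add: norm_blinfun.rep_eq[symmetric] dist_norm[symmetric] dist_commute)
    qed (use yz in auto)
    then show "norm (f z - f y - frechet_derivative f (at p) (z - y)) \<le> \<eta> * norm (z - y)"
      by (simp add: fd blinfun.diff_right algebra_simps)
  qed
qed

text \<open>The strict estimate with \<open>\<eta> = 1\<close>, plus a bound for the derivative at
  \<open>p\<close>.\<close>

lemma C1_on_locally_lipschitz:
  assumes f: "C1_on U f" and "open U" "p \<in> U"
  obtains e L where "e > 0" "ball p e \<subseteq> U" "L-lipschitz_on (ball p e) f"
proof -
  obtain e where e: "e > 0" "ball p e \<subseteq> U" "\<And>y z. y \<in> ball p e \<Longrightarrow> z \<in> ball p e \<Longrightarrow>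
        norm (f z - f y - frechet_derivative f (at p) (z - y)) \<le> 1 * norm (z - y)"
    using C1_on_strict[OF f \<open>open U\<close> \<open>p \<in> U\<close> zero_less_one] by metis
  have "bounded_linear (frechet_derivative f (at p))"
    using C1_on_differentiable[OF f \<open>p \<in> U\<close>] frechet_derivative_works has_derivative_bounded_linear by blast
  then obtain K where K: "K > 0" "\<And>x. norm (frechet_derivative f (at p) x) \<le> K * norm x"
    by (metis bounded_linear.pos_bounded mult.commute)
  show ?thesis
  proof (rule that[OF e(1,2), of "K + 1"])
    show "(K + 1)-lipschitz_on (ball p e) f"
    proof (rule lipschitz_onI)
      fix x y assume "x \<in> ball p e" "y \<in> ball p e"
      then have "norm (f x - f y - frechet_derivative f (at p) (x - y)) \<le> norm (x - y)"
        using e(3)[of y x] by simp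
      moreover have "norm (f x - f y) \<le> norm (f x - f y - frechet_derivative f (at p) (x - y)) + norm (frechet_derivative f (at p) (x - y))"
        using norm_triangle_ineq[of "f x - f y - frechet_derivative f (at p) (x - y)" "frechet_derivative f (at p) (x - y)"] by simp
      ultimately show "dist (f x) (f y) \<le> (K + 1) * dist x y"
        using K(2)[of "x - y"] by (simp add: dist_norm algebra_simps)
    qed (use K in auto)
  qed
qed

text \<open>By linearity it suffices to test along \<open>t *\<^sub>R v\<close> with
  \<open>t\<close> small, where the remainder is at most \<open>\<epsilon> * t\<close>.\<close>

lemma has_derivative_norm_le:
  assumes f: "(f has_derivative f') (at x)" and "e > 0"
    and le: "\<And>v. norm v < e \<Longrightarrow> norm (f (x + v) - f x) \<le> C * norm v"
  shows "norm (f' v) \<le> C * norm v"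
proof (cases "v = 0")
  case True
  then show ?thesis
    using has_derivative_bounded_linear[OF f] by (simp add: linear_simps)
next
  case False
  interpret bounded_linear f' by (rule has_derivative_bounded_linear[OF f])
  have "norm (f' v) \<le> C * norm v + \<epsilon>" if "\<epsilon> > 0" for \<epsilon>
  proof -
    obtain d where d: "d > 0" "\<And>y. norm (y - x) < d \<Longrightarrow> norm (f y - f x - f' (y - x)) \<le> (\<epsilon> / norm v) * norm (y - x)"
      using f False \<open>\<epsilon> > 0\<close> unfolding has_derivative_at_alt by (metis divide_pos_pos zero_less_norm_iff)
    \<comment> \<open>Half of the smaller radius, so that \<open>t *\<^sub>R v\<close> lies strictly
      inside both balls.\<close>
    define t where "t = min d e / (2 * norm v)"
    have t: "t > 0" "norm (t *\<^sub>R v) < d" "norm (t *\<^sub>R v) < e"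
      using d \<open>e > 0\<close> False by (auto simp: t_def)
    have "norm (f' (t *\<^sub>R v)) \<le> norm (f (x + t *\<^sub>R v) - f x) + norm (f (x + t *\<^sub>R v) - f x - f' (t *\<^sub>R v))"
      using norm_triangle_ineq4[of "f (x + t *\<^sub>R v) - f x" "f (x + t *\<^sub>R v) - f x - f' (t *\<^sub>R v)"] by simp
    also have "\<dots> \<le> C * norm (t *\<^sub>R v) + (\<epsilon> / norm v) * norm (t *\<^sub>R v)"
      using le[OF t(3)] d(2)[of "x + t *\<^sub>R v"] t(2) by simp
    also have "\<dots> = t * (C * norm v + \<epsilon>)"
      using t(1) False by (simp add: field_simps)
    finally have "t * norm (f' v) \<le> t * (C * norm v + \<epsilon>)"
      using t(1) by (simp add: scaleR)
    then show ?thesis using t(1) by simp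
  qed
  then show ?thesis by (rule field_le_epsilon)
qed

section \<open>The classes \<open>Ck_on\<close> under sums, products and linear maps\<close>

lemma Ck_on_SucE:
  assumes "Ck_on (Suc k) S f"
  obtains g where "\<And>i. Ck_on k S (g i)"
    "\<And>x. x \<in> S \<Longrightarrow> (f has_derivative (\<lambda>h. \<Sum>i\<in>UNIV. (h $ i) *\<^sub>R g i x)) (at x)"
  using assms unfolding Ck_on.simps by blast

lemma Ck_on_SucI:
  assumes "\<And>i. Ck_on k S (g i)"
    "\<And>x. x \<in> S \<Longrightarrow> (f has_derivative (\<lambda>h. \<Sum>i\<in>UNIV. (h $ i) *\<^sub>R g i x)) (at x)"
  shows "Ck_on (Suc k) S f"
  using assms unfolding Ck_on.simps by blast

lemma Ck_on_continuous: "Ck_on k S f \<Longrightarrow> continuous_on S f"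
proof (cases k)
  case (Suc n)
  assume "Ck_on k S f"
  then have "Ck_on (Suc n) S f" by (simp only: Suc)
  then obtain g where "\<And>x. x \<in> S \<Longrightarrow> (f has_derivative (\<lambda>h. \<Sum>i\<in>UNIV. (h $ i) *\<^sub>R g i x)) (at x)"
    by (rule Ck_on_SucE) blast
  then show ?thesis
    by (meson has_derivative_at_withinI has_derivative_continuous_on)
qed simp

lemma Ck_on_Suc_imp: "Ck_on (Suc k) S f \<Longrightarrow> Ck_on k S f"
proof (induction k arbitrary: f)
  case 0
  then show ?case by (metis Ck_on_continuous Ck_on.simps(1))
next
  case (Suc k)
  obtain g where g: "\<And>i. Ck_on (Suc k) S (g i)"
    "\<And>x. x \<in> S \<Longrightarrow> (f has_derivative (\<lambda>h. \<Sum>i\<in>UNIV. (h $ i) *\<^sub>R g i x)) (at x)"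
    using Ck_on_SucE[OF Suc.prems] by blast
  show ?case by (rule Ck_on_SucI[OF Suc.IH[OF g(1)] g(2)])
qed

lemma Ck_on_const: "Ck_on k S (\<lambda>x. c)"
proof (induction k arbitrary: c)
  case (Suc k)
  then show ?case by (auto intro!: exI[of _ "\<lambda>i x. 0"])
qed auto

lemma Ck_on_add: "Ck_on k S f \<Longrightarrow> Ck_on k S g \<Longrightarrow> Ck_on k S (\<lambda>x. f x + g x)"
proof (induction k arbitrary: f g)
  case 0
  then show ?case by (auto intro: continuous_on_add)
next
  case (Suc k)
  obtain f' where f': "\<And>i. Ck_on k S (f' i)" "\<And>x. x \<in> S \<Longrightarrow> (f has_derivative (\<lambda>h. \<Sum>i\<in>UNIV. (h $ i) *\<^sub>R f' i x)) (at x)"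
    using Ck_on_SucE[OF Suc.prems(1)] by blast
  obtain g' where g': "\<And>i. Ck_on k S (g' i)" "\<And>x. x \<in> S \<Longrightarrow> (g has_derivative (\<lambda>h. \<Sum>i\<in>UNIV. (h $ i) *\<^sub>R g' i x)) (at x)"
    using Ck_on_SucE[OF Suc.prems(2)] by blast
  show ?case unfolding Ck_on.simps
  proof (intro exI conjI allI ballI)
    show "Ck_on k S (\<lambda>x. f' i x + g' i x)" for i
      by (rule Suc.IH[OF f'(1) g'(1)])
    show "((\<lambda>x. f x + g x) has_derivative (\<lambda>h. \<Sum>i\<in>UNIV. h $ i *\<^sub>R (f' i x + g' i x))) (at x)" if "x \<in> S" for x
      using has_derivative_add[OF f'(2)[OF that] g'(2)[OF that]]
      by (simp add: scaleR_add_right sum.distrib)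
  qed
qed

text \<open>The Leibniz rule mixes each factor with the derivative of the other, so the induction
  needs both factors at the lower order as well; \<open>Ck_on_Suc_imp\<close> provides this.\<close>

lemma Ck_on_bilinear:
  assumes B: "bounded_bilinear B"
  shows "Ck_on k S f \<Longrightarrow> Ck_on k S g \<Longrightarrow> Ck_on k S (\<lambda>x. B (f x) (g x))"
proof (induction k arbitrary: f g)
  case 0
  then show ?case by (auto intro: bounded_bilinear.continuous_on[OF B])
next
  case (Suc k)
  interpret bounded_bilinear B by (rule B)
  obtain f' where f': "\<And>i. Ck_on k S (f' i)" "\<And>x. x \<in> S \<Longrightarrow> (f has_derivative (\<lambda>h. \<Sum>i\<in>UNIV. (h $ i) *\<^sub>R f' i x)) (at x)"
    using Ck_on_SucE[OF Suc.prems(1)] by blast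
  obtain g' where g': "\<And>i. Ck_on k S (g' i)" "\<And>x. x \<in> S \<Longrightarrow> (g has_derivative (\<lambda>h. \<Sum>i\<in>UNIV. (h $ i) *\<^sub>R g' i x)) (at x)"
    using Ck_on_SucE[OF Suc.prems(2)] by blast
  show ?case unfolding Ck_on.simps
  proof (intro exI conjI allI ballI)
    show "Ck_on k S (\<lambda>x. B (f x) (g' i x) + B (f' i x) (g x))" for i
      by (rule Ck_on_add[OF Suc.IH[OF Ck_on_Suc_imp[OF Suc.prems(1)] g'(1)] Suc.IH[OF f'(1) Ck_on_Suc_imp[OF Suc.prems(2)]]])
    show "((\<lambda>x. B (f x) (g x)) has_derivative (\<lambda>h. \<Sum>i\<in>UNIV. h $ i *\<^sub>R (B (f x) (g' i x) + B (f' i x) (g x)))) (at x)" if "x \<in> S" for x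
      using bounded_bilinear.FDERIV[OF B f'(2)[OF that] g'(2)[OF that]]
      by (simp add: scaleR_add_right sum.distrib sum_left sum_right scaleR_left scaleR_right)
  qed
qed

lemma Ck_on_linear:
  fixes f :: "real^'d \<Rightarrow> 'b::real_normed_vector"
  assumes f: "bounded_linear f"
  shows "Ck_on k S f"
proof (cases k)
  case 0
  then show ?thesis using f by (simp add: linear_continuous_on)
next
  case (Suc n)
  interpret bounded_linear f by (rule f)
  have "f = (\<lambda>h. \<Sum>i\<in>UNIV. (h $ i) *\<^sub>R f (axis i 1))"
  proof
    fix h
    have "f h = f (\<Sum>i\<in>UNIV. (h $ i) *\<^sub>R axis i 1)"
      by (simp add: basis_expansion scalar_mult_eq_scaleR[symmetric])
    then show "f h = (\<Sum>i\<in>UNIV. (h $ i) *\<^sub>R f (axis i 1))" by (simp add: sum scale)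
  qed
  then have "(f has_derivative (\<lambda>h. \<Sum>i\<in>UNIV. (h $ i) *\<^sub>R f (axis i 1))) (at x)" for x
    using bounded_linear_imp_has_derivative[OF f, of "at x"] by simp
  then show ?thesis
    unfolding Suc Ck_on.simps by (intro exI[of _ "\<lambda>i x. f (axis i 1)"]) (auto intro: Ck_on_const)
qed

lemma Ck_on_bounded_linear_comp:
  assumes l: "bounded_linear l"
  shows "Ck_on k S f \<Longrightarrow> Ck_on k S (\<lambda>x. l (f x))"
proof (induction k arbitrary: f)
  case 0
  then show ?case by (auto intro: bounded_linear.continuous_on[OF l])
next
  case (Suc k)
  interpret bounded_linear l by (rule l)
  obtain f' where f': "\<And>i. Ck_on k S (f' i)" "\<And>x. x \<in> S \<Longrightarrow> (f has_derivative (\<lambda>h. \<Sum>i\<in>UNIV. (h $ i) *\<^sub>R f' i x)) (at x)"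
    using Ck_on_SucE[OF Suc.prems] by blast
  show ?case unfolding Ck_on.simps
  proof (intro exI conjI allI ballI)
    show "Ck_on k S (\<lambda>x. l (f' i x))" for i by (rule Suc.IH[OF f'(1)])
    show "((\<lambda>x. l (f x)) has_derivative (\<lambda>h. \<Sum>i\<in>UNIV. h $ i *\<^sub>R l (f' i x))) (at x)" if "x \<in> S" for x
      using bounded_linear.has_derivative[OF l f'(2)[OF that]] by (simp add: sum scale)
  qed
qed

section \<open>A smooth bump function\<close>

text \<open>The family \<open>t\<^sup>-\<^sup>n exp (-1/t)\<close>, extended by zero, is closed under differentiation up to
  linear combinations; this replaces the usual computation of all derivatives of \<open>exp (-1/t)\<close>.\<close>

definition exp_inv :: "nat \<Rightarrow> real \<Rightarrow> real" where
  "exp_inv n t = (if t > 0 then exp (- 1 / t) / t ^ n else 0)"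

text \<open>Under \<open>s = 1 / t\<close> the limit from the right becomes that of
  \<open>s^n / exp s\<close> at infinity; on the left the function is zero.\<close>

lemma exp_inv_tendsto_0: "((exp_inv n) \<longlongrightarrow> 0) (at 0)"
proof -
  have "((\<lambda>t. (inverse t) ^ n / exp (inverse t)) \<longlongrightarrow> 0) (at_right (0::real))"
    by (rule filterlim_compose[OF tendsto_power_div_exp_0 filterlim_inverse_at_top_right])
  then have r: "(exp_inv n \<longlongrightarrow> 0) (at_right 0)"
  proof (rule Lim_transform_eventually)
    show "\<forall>\<^sub>F t in at_right 0. inverse t ^ n / exp (inverse t) = exp_inv n t"
      unfolding eventually_at_right_field
      by (intro exI[of _ 1]) (auto simp: exp_inv_def exp_minus field_simps)
  qed
  have "(exp_inv n \<longlongrightarrow> 0) (at_left 0)"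
    by (rule Lim_transform_eventually[OF tendsto_const])
       (auto simp: exp_inv_def eventually_at_left_field intro!: exI[of _ "-1"])
  with r show ?thesis by (simp add: filterlim_at_split)
qed

lemma exp_inv_deriv:
  "(exp_inv n has_real_derivative (exp_inv (n + 2) t - real n * exp_inv (n + 1) t)) (at t)"
proof -
  consider "t > 0" | "t < 0" | "t = 0" by linarith
  then show ?thesis
  proof cases
    case 1
    have "((\<lambda>t. exp (- 1 / t) / t ^ n) has_real_derivative
         (exp (- 1 / t) / t ^ (n + 2) - real n * (exp (- 1 / t) / t ^ (n + 1)))) (at t)"
    proof (cases n)
      case 0
      then show ?thesis using 1
        by (auto intro!: derivative_eq_intros simp: power2_eq_square divide_simps)
    next
      case (Suc m)
      then show ?thesis using 1
        by (auto intro!: derivative_eq_intros simp: power2_eq_square divide_simps) (cases m; simp add: algebra_simps)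
    qed
    then have "(exp_inv n has_real_derivative
         (exp (- 1 / t) / t ^ (n + 2) - real n * (exp (- 1 / t) / t ^ (n + 1)))) (at t)"
      by (rule has_field_derivative_transform_within_open[of _ _ _ "{0<..}"]) (use 1 in \<open>auto simp: exp_inv_def\<close>)
    then show ?thesis using 1 by (simp add: exp_inv_def)
  next
    case 2
    have "((\<lambda>t. 0) has_real_derivative 0) (at t)" by simp
    then have "(exp_inv n has_real_derivative 0) (at t)"
      by (rule has_field_derivative_transform_within_open[of _ _ _ "{..<0}"]) (use 2 in \<open>auto simp: exp_inv_def\<close>)
    then show ?thesis using 2 by (simp add: exp_inv_def)
  next
    case 3
    \<comment> \<open>The difference quotient of \<open>exp_inv n\<close> at \<open>0\<close> is
      again a member of the family, \<open>exp_inv (Suc n)\<close>.\<close>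
    have "((\<lambda>y. (exp_inv n y - exp_inv n 0) / (y - 0)) \<longlongrightarrow> 0) (at 0)"
    proof (rule Lim_transform_eventually[OF exp_inv_tendsto_0[of "Suc n"]])
      show "\<forall>\<^sub>F y in at 0. exp_inv (Suc n) y = (exp_inv n y - exp_inv n 0) / (y - 0)"
        by (auto simp: exp_inv_def field_simps intro!: always_eventually)
    qed
    then show ?thesis using 3 by (simp add: exp_inv_def has_field_derivative_iff)
  qed
qed

text \<open>The induction runs over all \<open>n\<close> at once, because the derivative involves
  the members \<open>n + 1\<close> and \<open>n + 2\<close> of the family.\<close>

lemma Ck_on_exp_inv:
  assumes q: "\<And>k. Ck_on k UNIV q"
  shows "Ck_on k UNIV (\<lambda>x. exp_inv n (q x))"
proof (induction k arbitrary: n)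
  case 0
  have "continuous_on UNIV (exp_inv n)"
    using DERIV_isCont[OF exp_inv_deriv] by (simp add: continuous_at_imp_continuous_on)
  then show ?case
    using continuous_on_compose2[of UNIV "exp_inv n" UNIV q] Ck_on_continuous[OF q] by auto
next
  case (Suc k)
  obtain q' where q': "\<And>i. Ck_on k UNIV (q' i)" "\<And>x. x \<in> UNIV \<Longrightarrow> (q has_derivative (\<lambda>h. \<Sum>i\<in>UNIV. (h $ i) *\<^sub>R q' i x)) (at x)"
    using Ck_on_SucE[OF q[of "Suc k"]] by blast
  let ?D = "\<lambda>x. exp_inv (n + 2) (q x) + - real n * exp_inv (n + 1) (q x)"
  show ?case unfolding Ck_on.simps
  proof (intro exI conjI allI ballI)
    show "Ck_on k UNIV (\<lambda>x. ?D x * q' i x)" for i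
      by (rule Ck_on_bilinear[OF bounded_bilinear_mult Ck_on_add[OF Suc.IH Ck_on_bilinear[OF bounded_bilinear_mult Ck_on_const Suc.IH]] q'(1)])
    show "((\<lambda>x. exp_inv n (q x)) has_derivative (\<lambda>h. \<Sum>i\<in>UNIV. h $ i *\<^sub>R (?D x * q' i x))) (at x)" for x
      using has_derivative_compose[OF q'(2)[of x, OF UNIV_I] exp_inv_deriv[of n "q x", THEN has_field_derivative_imp_has_derivative]]
      by (simp add: sum_distrib_left sum_distrib_right mult_ac)
  qed
qed

text \<open>Built on \<open>x \<bullet> x\<close> rather than \<open>norm x\<close>, so that the
  inner function is polynomial and smooth at the origin too.\<close>

definition bump :: "real \<Rightarrow> real^'d \<Rightarrow> real" where
  "bump e x = exp_inv 0 (e\<^sup>2 - x \<bullet> x)"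

lemma Ck_on_bump: "Ck_on k UNIV (bump e)"
proof -
  have "Ck_on k UNIV (\<lambda>x::real^'d. e\<^sup>2 + (- (x \<bullet> x)))" for k
    by (rule Ck_on_add[OF Ck_on_const Ck_on_bounded_linear_comp[OF bounded_linear_minus[OF bounded_linear_ident]
          Ck_on_bilinear[OF bounded_bilinear_inner Ck_on_linear Ck_on_linear, OF bounded_linear_ident bounded_linear_ident]]])
  then have "Ck_on k UNIV (\<lambda>x::real^'d. exp_inv 0 (e\<^sup>2 + (- (x \<bullet> x))))" for k
    by (rule Ck_on_exp_inv)
  then show ?thesis by (simp add: bump_def[abs_def])
qed

lemma bump_pos_iff: "e > 0 \<Longrightarrow> bump e x > 0 \<longleftrightarrow> norm x < e"
proof -
  assume "e > 0"
  have "x \<bullet> x < e\<^sup>2 \<longleftrightarrow> norm x < e"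
    unfolding power2_norm_eq_inner[symmetric] using \<open>e > 0\<close>
    by (meson less_imp_le norm_ge_zero power2_less_imp_less power_strict_mono zero_less_numeral)
  then show ?thesis by (auto simp: bump_def exp_inv_def)
qed

lemma bump_nonneg: "bump e x \<ge> 0"
  by (simp add: bump_def exp_inv_def)

lemma bump_minus: "bump e (- x) = bump e x"
  by (simp add: bump_def)

section \<open>Mollification\<close>

lemma partial_deriv_eq: "(f has_derivative f') (at x) \<Longrightarrow> partial_deriv i f x = f' (axis i 1)"
  unfolding partial_deriv_def using frechet_derivative_at by metis

lemma integrable_compact_support:
  fixes F :: "'a::euclidean_space \<Rightarrow> 'b::{banach, second_countable_topology}"
  assumes "continuous_on UNIV F" "compact K" "\<And>x. x \<notin> K \<Longrightarrow> F x = 0"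
  shows "integrable lborel F"
proof -
  have "integrable lborel (\<lambda>x. indicator K x *\<^sub>R F x)"
    using assms by (intro borel_integrable_compact continuous_on_subset[OF assms(1)]) auto
  also have "(\<lambda>x. indicator K x *\<^sub>R F x) = F"
    using assms(3) by (auto simp: indicator_def)
  finally show ?thesis .
qed

lemma lborel_integral_translation:
  fixes F :: "'a::euclidean_space \<Rightarrow> 'b::{banach, second_countable_topology}"
  assumes "F \<in> borel_measurable borel"
  shows "(\<integral>x. F (x + v) \<partial>lborel) = (\<integral>x. F x \<partial>lborel)"
proof -
  have "(\<integral>x. F x \<partial>lborel) = (\<integral>x. F x \<partial>distr lborel borel ((+) v))"
    by (simp add: lborel_distr_plus)
  also have "\<dots> = (\<integral>x. F (v + x) \<partial>lborel)"
    by (rule integral_distr) (use assms in auto)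
  finally show ?thesis by (simp add: add.commute)
qed

definition conv :: "(real^'d \<Rightarrow> real) \<Rightarrow> (real^'d \<Rightarrow> 'b::euclidean_space) \<Rightarrow> real^'d \<Rightarrow> 'b" where
  "conv \<rho> h x = (\<integral>z. \<rho> (x - z) *\<^sub>R h z \<partial>lborel)"

text \<open>Passes from the Lebesgue integral over the whole space to the gauge integral over a box,
  for which continuity in a parameter and differentiation under the integral sign can be
  applied.\<close>

lemma conv_eq_integral:
  assumes "continuous_on UNIV \<rho>" "continuous_on UNIV h" "\<And>x. x \<notin> cbox a b \<Longrightarrow> h x = 0"
  shows "conv \<rho> h x = integral (cbox a b) (\<lambda>z. \<rho> (x - z) *\<^sub>R h z)"
proof -
  have "integrable lborel (\<lambda>z. \<rho> (x - z) *\<^sub>R h z)"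
    by (rule integrable_compact_support[of _ "cbox a b"])
       (auto intro!: continuous_intros continuous_on_compose2[OF assms(1)] assms(2) simp: assms(3))
  then have "conv \<rho> h x = integral UNIV (\<lambda>z. \<rho> (x - z) *\<^sub>R h z)"
    by (simp add: conv_def integral_lborel)
  also have "(\<lambda>z. \<rho> (x - z) *\<^sub>R h z) = (\<lambda>z. if z \<in> cbox a b then \<rho> (x - z) *\<^sub>R h z else 0)"
    using assms(3) by auto
  also have "integral UNIV \<dots> = integral (cbox a b) (\<lambda>z. \<rho> (x - z) *\<^sub>R h z)"
    by (rule integral_restrict_UNIV)
  finally show ?thesis .
qed

lemma conv_continuous:
  assumes "continuous_on UNIV \<rho>" "continuous_on UNIV h" "\<And>x. x \<notin> cbox a b \<Longrightarrow> h x = 0"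
  shows "continuous_on UNIV (conv \<rho> h)"
proof -
  have "continuous_on UNIV (\<lambda>x. integral (cbox a b) (\<lambda>z. \<rho> (x - z) *\<^sub>R h z))"
    by (rule integral_continuous_on_param)
       (auto intro!: continuous_intros continuous_on_compose2[OF assms(1)] continuous_on_compose2[OF assms(2)] simp: split_beta)
  then show ?thesis
    using conv_eq_integral[OF assms] by (simp cong: continuous_on_cong)
qed

text \<open>Differentiation under the integral, with the derivative of the integrand as a bounded
  linear map; evaluating the integrated map at \<open>v\<close> separates the partial
  derivatives.\<close>

lemma conv_has_derivative:
  assumes \<rho>: "\<And>x. (\<rho> has_derivative (\<lambda>v. \<Sum>i\<in>UNIV. (v $ i) *\<^sub>R g i x)) (at x)"
    and g: "\<And>i. continuous_on UNIV (g i)"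
    and h: "continuous_on UNIV h" "\<And>x. x \<notin> cbox a b \<Longrightarrow> h x = 0"
  shows "(conv \<rho> h has_derivative (\<lambda>v. \<Sum>i\<in>UNIV. (v $ i) *\<^sub>R conv (g i) h x)) (at x)"
proof -
  have c\<rho>: "continuous_on UNIV \<rho>"
    using \<rho> by (meson has_derivative_continuous_on has_derivative_at_withinI)
  let ?fx = "\<lambda>x t. partials_blinfun (\<lambda>i. g i (x - t) *\<^sub>R h t)"
  have "((\<lambda>x. integral (cbox a b) (\<lambda>t. \<rho> (x - t) *\<^sub>R h t)) has_derivative
      blinfun_apply (integral (cbox a b) (?fx x))) (at x within UNIV)"
  proof (rule leibniz_rule)
    show "((\<lambda>x. \<rho> (x - t) *\<^sub>R h t) has_derivative blinfun_apply (?fx x t)) (at x within UNIV)" for x t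
    proof -
      have "((\<lambda>x. \<rho> (x - t)) has_derivative (\<lambda>v. \<Sum>i\<in>UNIV. (v $ i) *\<^sub>R g i (x - t))) (at x)"
        using has_derivative_compose[OF has_derivative_diff[OF has_derivative_ident has_derivative_const] \<rho>[of "x - t"]]
        by simp
      from has_derivative_scaleR_left[OF this, of "h t"] show ?thesis
        by (simp add: partials_blinfun_eq scaleR_sum_left)
    qed
    show "(\<lambda>t. \<rho> (x - t) *\<^sub>R h t) integrable_on cbox a b" for x
      by (intro integrable_continuous continuous_intros continuous_on_compose2[OF c\<rho>] continuous_on_subset[OF h(1)]) auto
    show "continuous_on (UNIV \<times> cbox a b) (\<lambda>(x, t). ?fx x t)"
      unfolding split_beta
      by (intro continuous_on_partials_blinfun continuous_intros continuous_on_compose2[OF g]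
            continuous_on_compose2[OF h(1)]) auto
  qed auto
  moreover have "blinfun_apply (integral (cbox a b) (?fx x)) = (\<lambda>v. \<Sum>i\<in>UNIV. (v $ i) *\<^sub>R conv (g i) h x)"
  proof
    fix v :: "real^'a"
    have "(?fx x) integrable_on cbox a b"
      by (intro integrable_continuous continuous_on_partials_blinfun continuous_intros
            continuous_on_compose2[OF g] continuous_on_subset[OF h(1)]) auto
    then have "blinfun_apply (integral (cbox a b) (?fx x)) v
        = integral (cbox a b) (\<lambda>t. \<Sum>i\<in>UNIV. (v $ i) *\<^sub>R (g i (x - t) *\<^sub>R h t))"
      by (subst blinfun_apply_integral) auto
    also have "\<dots> = (\<Sum>i\<in>UNIV. integral (cbox a b) (\<lambda>t. (v $ i) *\<^sub>R (g i (x - t) *\<^sub>R h t)))"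
      by (rule integral_sum) (auto intro!: integrable_continuous continuous_intros
            continuous_on_compose2[OF g] continuous_on_subset[OF h(1)])
    also have "\<dots> = (\<Sum>i\<in>UNIV. (v $ i) *\<^sub>R conv (g i) h x)"
      by (simp add: conv_eq_integral[OF g h] scaleR_scaleR[symmetric] del: scaleR_scaleR)
    finally show "blinfun_apply (integral (cbox a b) (?fx x)) v = (\<Sum>i\<in>UNIV. (v $ i) *\<^sub>R conv (g i) h x)" .
  qed
  moreover have "conv \<rho> h = (\<lambda>x. integral (cbox a b) (\<lambda>t. \<rho> (x - t) *\<^sub>R h t))"
    by (rule ext) (rule conv_eq_integral[OF c\<rho> h])
  ultimately show ?thesis by simp
qed

text \<open>All derivatives fall on \<open>\<rho>\<close>, so \<open>h\<close> need only be
  continuous and vanish outside a box.\<close>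

lemma Ck_on_conv:
  assumes h: "continuous_on UNIV h" "\<And>x. x \<notin> cbox a b \<Longrightarrow> h x = 0"
  shows "Ck_on k UNIV \<rho> \<Longrightarrow> Ck_on k UNIV (conv \<rho> h)"
proof (induction k arbitrary: \<rho>)
  case 0
  then show ?case using conv_continuous[OF _ h] by simp
next
  case (Suc k)
  obtain g where g: "\<And>i. Ck_on k UNIV (g i)"
    "\<And>x. x \<in> UNIV \<Longrightarrow> (\<rho> has_derivative (\<lambda>h. \<Sum>i\<in>UNIV. (h $ i) *\<^sub>R g i x)) (at x)"
    using Ck_on_SucE[OF Suc.prems] by blast
  show ?case
    by (rule Ck_on_SucI[OF Suc.IH[OF g(1)] conv_has_derivative[OF g(2)[OF UNIV_I] Ck_on_continuous[OF g(1)] h]])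
qed

definition mollifier :: "real \<Rightarrow> real^'d \<Rightarrow> real" where
  "mollifier e x = bump e x / (\<integral>y. bump e y \<partial>(lborel :: (real^'d) measure))"

lemma continuous_on_bump: "continuous_on UNIV (bump e)"
  using Ck_on_bump[of 0] by simp

lemma bump_eq_0: "e > 0 \<Longrightarrow> e \<le> norm x \<Longrightarrow> bump e x = 0"
  using bump_pos_iff[of e x] bump_nonneg[of e x] by linarith

lemma bump_integrable: "e > 0 \<Longrightarrow> integrable lborel (bump e)"
  by (rule integrable_compact_support[OF continuous_on_bump compact_cball[of 0 e]]) (auto intro: bump_eq_0)

text \<open>Otherwise the nonnegative bump would vanish almost everywhere, and the open ball on
  which it is positive would be negligible.\<close>

lemma bump_integral_pos:
  assumes "e > 0"
  shows "(\<integral>y. bump e y \<partial>(lborel :: (real^'d) measure)) > 0"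
proof (rule ccontr)
  assume "\<not> ?thesis"
  moreover have "(\<integral>y. bump e y \<partial>(lborel :: (real^'d) measure)) \<ge> 0"
    by (rule integral_nonneg_AE) (simp add: bump_nonneg)
  ultimately have "(\<integral>y. bump e y \<partial>(lborel :: (real^'d) measure)) = 0" by linarith
  then have "AE x in lborel. bump e (x :: real^'d) = 0"
    using integral_nonneg_eq_0_iff_AE[OF bump_integrable[OF assms]] by (auto simp: bump_nonneg)
  then have "AE x in lborel. x \<notin> ball (0 :: real^'d) e"
    by eventually_elim (use bump_pos_iff[OF assms] in force)
  then have "ball (0 :: real^'d) e \<in> null_sets lborel"
    by (subst AE_iff_null_sets) auto
  then have "negligible (ball (0 :: real^'d) e)"
    by (simp add: negligible_iff_null_sets null_sets_completionI)
  then show False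
    using assms negligible_imp_measure0 open_not_negligible[of "ball (0 :: real^'d) e"] by auto
qed

lemma mollifier_nonneg: "e > 0 \<Longrightarrow> mollifier e x \<ge> 0"
  unfolding mollifier_def using bump_nonneg bump_integral_pos by (metis divide_nonneg_pos)

lemma mollifier_eq_0: "e > 0 \<Longrightarrow> e \<le> norm x \<Longrightarrow> mollifier e x = 0"
  by (simp add: mollifier_def bump_eq_0)

lemma Ck_on_mollifier: "Ck_on k UNIV (mollifier e)"
  unfolding mollifier_def[abs_def]
  by (rule Ck_on_bounded_linear_comp[OF bounded_linear_divide Ck_on_bump])

lemma continuous_on_mollifier: "continuous_on UNIV (mollifier e)"
  using Ck_on_mollifier[of 0] by simp

lemma mollifier_minus_commute: "mollifier e (x - y) = mollifier e (y - x)"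
  using bump_minus[of e "x - y"] by (simp add: mollifier_def)

lemma mollifier_integrable:
  fixes h :: "real^'d \<Rightarrow> 'b::euclidean_space"
  assumes "e > 0" "continuous_on UNIV h"
  shows "integrable lborel (\<lambda>z. mollifier e (x - z) *\<^sub>R h z)"
proof (rule integrable_compact_support[of _ "cball x e"])
  show "continuous_on UNIV (\<lambda>z. mollifier e (x - z) *\<^sub>R h z)"
    by (intro continuous_intros continuous_on_compose2[OF continuous_on_mollifier] assms) auto
  show "z \<notin> cball x e \<Longrightarrow> mollifier e (x - z) *\<^sub>R h z = 0" for z
    using assms mollifier_eq_0[of e "x - z"] by (simp add: dist_norm)
qed simp

lemma mollifier_integral:
  fixes x :: "real^'d"
  assumes "e > 0"
  shows "(\<integral>z. mollifier e (x - z) \<partial>lborel) = 1"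
proof -
  have "(\<integral>z. mollifier e (x - z) \<partial>lborel) = (\<integral>z. mollifier e (z + - x) \<partial>lborel)"
    by (simp add: mollifier_minus_commute[of e x])
  also have "\<dots> = (\<integral>z. mollifier e (z :: real^'d) \<partial>lborel)"
    by (rule lborel_integral_translation[of "mollifier e" "-x"]) (simp add: borel_measurable_continuous_onI continuous_on_mollifier)
  also have "\<dots> = 1"
    using bump_integral_pos[OF assms, where 'd='d] by (simp add: mollifier_def)
  finally show ?thesis .
qed

text \<open>The mollifier is a probability density supported in the ball of radius \<open>e\<close>,
  so the convolution is an average of nearby values. With \<open>w = 0\<close> and
  \<open>\<eta> = 0\<close> the same estimate controls supports.\<close>

lemma mollifier_average:
  fixes h :: "real^'d \<Rightarrow> 'b::euclidean_space"
  assumes e: "e > 0" and h: "continuous_on UNIV h"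
    and le: "\<And>z. norm (x - z) < e \<Longrightarrow> norm (h z - w) \<le> \<eta>"
  shows "norm (conv (mollifier e) h x - w) \<le> \<eta>"
proof -
  note i = mollifier_integrable[OF e]
  have one: "integrable lborel (\<lambda>z. mollifier e (x - z))"
    using i[of "\<lambda>z. 1::real" x] by simp
  have "conv (mollifier e) h x - w = (\<integral>z. mollifier e (x - z) *\<^sub>R h z \<partial>lborel) - (\<integral>z. mollifier e (x - z) *\<^sub>R w \<partial>lborel)"
    using mollifier_integral[OF e, of x] one by (simp add: conv_def)
  also have "\<dots> = (\<integral>z. mollifier e (x - z) *\<^sub>R h z - mollifier e (x - z) *\<^sub>R w \<partial>lborel)"
    by (rule Bochner_Integration.integral_diff[symmetric]) (use i[OF h] one in auto)
  also have "\<dots> = (\<integral>z. mollifier e (x - z) *\<^sub>R (h z - w) \<partial>lborel)"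
    by (simp add: scaleR_diff_right)
  finally have eq: "conv (mollifier e) h x - w = (\<integral>z. mollifier e (x - z) *\<^sub>R (h z - w) \<partial>lborel)" .
  have "norm (conv (mollifier e) h x - w) \<le> (\<integral>z. mollifier e (x - z) * \<eta> \<partial>lborel)"
    unfolding eq
  proof (rule order_trans[OF integral_norm_bound integral_mono])
    show "integrable lborel (\<lambda>z. norm (mollifier e (x - z) *\<^sub>R (h z - w)))"
      by (intro integrable_norm i) (intro continuous_intros h)
    show "integrable lborel (\<lambda>z. mollifier e (x - z) * \<eta>)"
      using one by simp
    fix z
    show "norm (mollifier e (x - z) *\<^sub>R (h z - w)) \<le> mollifier e (x - z) * \<eta>"
    proof (cases "norm (x - z) < e")
      case True
      then show ?thesis
        using mollifier_nonneg[OF e, of "x - z"] le[OF True] by (simp add: mult_left_mono)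
    next
      case False
      then show ?thesis using mollifier_eq_0[OF e, of "x - z"] by simp
    qed
  qed
  also have "\<dots> = \<eta>"
    using mollifier_integral[OF e, of x] by simp
  finally show ?thesis .
qed

text \<open>After a translation, an increment of the mollification is the average of the
  corresponding increments of \<open>h\<close>. Lipschitz bounds and linear approximations of
  \<open>h\<close> thus carry over with the same constants.\<close>

lemma mollifier_difference:
  fixes h :: "real^'d \<Rightarrow> 'b::euclidean_space"
  assumes e: "e > 0" and h: "continuous_on UNIV h"
    and le: "\<And>z. norm (x - z) < e \<Longrightarrow> norm (h (z + v) - h z - w) \<le> \<eta>"
  shows "norm (conv (mollifier e) h (x + v) - conv (mollifier e) h x - w) \<le> \<eta>"
proof -
  have hv: "continuous_on UNIV (\<lambda>z. h (z + v))"
    by (intro continuous_on_compose2[OF h] continuous_intros) auto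
  have "conv (mollifier e) h (x + v) = (\<integral>z. mollifier e (x - z) *\<^sub>R h (z + v) \<partial>lborel)"
    unfolding conv_def
    by (subst lborel_integral_translation[symmetric, where v = v])
       (auto intro!: borel_measurable_continuous_onI continuous_intros continuous_on_compose2[OF continuous_on_mollifier] h)
  then have "conv (mollifier e) h (x + v) - conv (mollifier e) h x = conv (mollifier e) (\<lambda>z. h (z + v) - h z) x"
    unfolding conv_def
    using mollifier_integrable[OF e hv, of x] mollifier_integrable[OF e h, of x] by (simp add: scaleR_diff_right)
  then show ?thesis
    using mollifier_average[OF e continuous_on_diff[OF hv h] le] by simp
qed

text \<open>A Minkowski sum with a closed ball, so that compactness is that of a sum of two compact
  sets.\<close>

definition thicken :: "(real^'d) set \<Rightarrow> real \<Rightarrow> (real^'d) set" where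
  "thicken K e = {x + y |x y. x \<in> K \<and> y \<in> cball 0 e}"

lemma compact_thicken: "compact K \<Longrightarrow> compact (thicken K e)"
  unfolding thicken_def by (rule compact_sums) auto

lemma thicken_mono: "e \<le> e' \<Longrightarrow> thicken K e \<subseteq> thicken K e'"
  unfolding thicken_def by fastforce

lemma in_thicken: "x \<in> K \<Longrightarrow> norm (z - x) \<le> e \<Longrightarrow> z \<in> thicken K e"
  unfolding thicken_def by (simp, intro exI[of _ x] exI[of _ "z - x"]) simp

lemma thicken_subset_open:
  assumes "compact K" "open S" "K \<subseteq> S"
  obtains e where "e > 0" "thicken K e \<subseteq> S"
proof -
  obtain e where e: "e > 0" "(\<Union>x\<in>K. cball x e) \<subseteq> S"
    using compact_subset_open_imp_cball_epsilon_subset[OF assms] by blast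
  have "thicken K e \<subseteq> S"
    using e(2) unfolding thicken_def by (force simp: dist_norm)
  with e(1) show ?thesis by (rule that)
qed

lemma conv_mollifier_support:
  fixes h :: "real^'d \<Rightarrow> 'b::euclidean_space"
  assumes e: "e > 0" and h: "continuous_on UNIV h" and K: "\<And>x. x \<notin> K \<Longrightarrow> h x = 0"
    and x: "x \<notin> thicken K e"
  shows "conv (mollifier e) h x = 0"
proof -
  have "norm (conv (mollifier e) h x - 0) \<le> 0"
  proof (rule mollifier_average[OF e h])
    fix z assume "norm (x - z) < e"
    then have "z \<notin> K" using x in_thicken[of z K x e] by auto
    then show "norm (h z - 0) \<le> 0" using K by simp
  qed
  then show ?thesis by simp
qed

lemma test_function_conv_mollifier:
  fixes h :: "real^'d \<Rightarrow> 'b::euclidean_space"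
  assumes e: "e > 0" and h: "continuous_on UNIV h" and K: "compact K" "\<And>x. x \<notin> K \<Longrightarrow> h x = 0"
    and sub: "thicken K e \<subseteq> S"
  shows "test_function S (conv (mollifier e) h)"
proof -
  obtain a where a: "K \<subseteq> cbox (-a) a"
    using bounded_subset_cbox_symmetric[OF compact_imp_bounded[OF K(1)]] by blast
  have h0: "x \<notin> cbox (-a) a \<Longrightarrow> h x = 0" for x
    using a K(2) by blast
  have cl: "closure {x. conv (mollifier e) h x \<noteq> 0} \<subseteq> thicken K e"
    using conv_mollifier_support[OF e h K(2)] compact_imp_closed[OF compact_thicken[OF K(1)]]
    by (intro closure_minimal) auto
  have "compact (closure {x. conv (mollifier e) h x \<noteq> 0})"
    using compact_Int_closed[OF compact_thicken[OF K(1), of e] closed_closure, of "{x. conv (mollifier e) h x \<noteq> 0}"] cl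
    by (simp add: Int_absorb1)
  then show ?thesis
    unfolding test_function_def smooth_on_def
    using Ck_on_conv[OF h h0 Ck_on_mollifier] cl sub by blast
qed

section \<open>Test functions and weak derivatives\<close>

definition grad :: "(real^'d \<Rightarrow> 'b::real_normed_vector) \<Rightarrow> real^'d \<Rightarrow> 'b^'d" where
  "grad f x = (\<chi> i. partial_deriv i f x)"

lemma bounded_linear_coords:
  fixes f :: "real^'d \<Rightarrow> 'b::real_normed_vector"
  assumes "bounded_linear f"
  shows "f v = (\<Sum>i\<in>UNIV. (v $ i) *\<^sub>R f (axis i 1))"
proof -
  interpret bounded_linear f by fact
  have "f v = f (\<Sum>i\<in>UNIV. (v $ i) *\<^sub>R axis i 1)"
    by (simp add: basis_expansion scalar_mult_eq_scaleR[symmetric])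
  then show ?thesis by (simp add: sum scale)
qed

lemma has_derivative_grad:
  assumes "f differentiable (at x)"
  shows "(f has_derivative (\<lambda>v. \<Sum>i\<in>UNIV. (v $ i) *\<^sub>R grad f x $ i)) (at x)"
proof -
  have d: "(f has_derivative frechet_derivative f (at x)) (at x)"
    using assms frechet_derivative_works by blast
  have "frechet_derivative f (at x) = (\<lambda>v. \<Sum>i\<in>UNIV. (v $ i) *\<^sub>R grad f x $ i)"
    unfolding grad_def partial_deriv_def vec_lambda_beta
    by (rule ext) (rule bounded_linear_coords[OF has_derivative_bounded_linear[OF d]])
  with d show ?thesis by simp
qed

lemma grad_eqI:
  assumes "(f has_derivative (\<lambda>v. \<Sum>i\<in>UNIV. (v $ i) *\<^sub>R D $ i)) (at x)"
  shows "grad f x = D"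
proof -
  have "(\<Sum>j\<in>UNIV. (axis i 1 $ j) *\<^sub>R D $ j) = D $ i" for i
  proof -
    have "(\<Sum>j\<in>UNIV. (axis i 1 $ j) *\<^sub>R D $ j) = (\<Sum>j\<in>UNIV. if j = i then D $ j else 0)"
      by (rule sum.cong) (auto simp: axis_def)
    then show ?thesis by simp
  qed
  then show ?thesis
    using partial_deriv_eq[OF assms] by (simp add: grad_def vec_eq_iff)
qed

lemma norm_vec_le_sum: "norm (v :: 'b::real_normed_vector^'d) \<le> (\<Sum>i\<in>UNIV. norm (v $ i))"
  by (simp add: norm_vec_def L2_set_le_sum)

text \<open>The factor \<open>CARD('d)\<close> comes from bounding the norm of the gradient by the
  sum of the norms of its components.\<close>

lemma grad_norm_le:
  fixes f :: "real^'d \<Rightarrow> 'b::real_normed_vector"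
  assumes f: "f differentiable (at x)" and "e > 0"
    and le: "\<And>v. norm v < e \<Longrightarrow> norm (f (x + v) - f x) \<le> L * norm v"
  shows "norm (grad f x) \<le> real CARD('d) * L"
proof -
  have "norm (grad f x $ i) \<le> L" for i
    using has_derivative_norm_le[OF frechet_derivative_works[THEN iffD1, OF f] \<open>e > 0\<close> le, of "axis i 1"]
    by (simp add: grad_def partial_deriv_def)
  then have "(\<Sum>i\<in>UNIV. norm (grad f x $ i)) \<le> (\<Sum>i\<in>(UNIV::'d set). L)"
    by (intro sum_mono)
  with norm_vec_le_sum[of "grad f x"] show ?thesis by simp
qed

lemma grad_zero_outside:
  assumes "closed K" "\<And>x. x \<notin> K \<Longrightarrow> f x = 0" "x \<notin> K"
  shows "grad f x = 0"
proof (rule grad_eqI)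
  have "((\<lambda>x. 0) has_derivative (\<lambda>v. 0)) (at x)" by simp
  then have "(f has_derivative (\<lambda>v. 0)) (at x)"
    by (rule has_derivative_transform_within_open[where s = "- K"]) (use assms in auto)
  then show "(f has_derivative (\<lambda>v. \<Sum>i\<in>UNIV. (v $ i) *\<^sub>R (0::_^_) $ i)) (at x)" by simp
qed

lemma continuous_grad:
  assumes "Ck_on 1 UNIV f"
  shows "continuous_on UNIV (grad f)"
proof -
  obtain g where g: "\<And>i. Ck_on 0 UNIV (g i)"
    "\<And>x. x \<in> UNIV \<Longrightarrow> (f has_derivative (\<lambda>h. \<Sum>i\<in>UNIV. (h $ i) *\<^sub>R g i x)) (at x)"
    using assms Ck_on_SucE[of 0 UNIV f] by auto
  have "grad f = (\<lambda>x. \<chi> i. g i x)"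
  proof
    fix x show "grad f x = (\<chi> i. g i x)"
      using g(2)[OF UNIV_I, of x] by (intro grad_eqI) simp
  qed
  then show ?thesis
    using g(1) by (simp add: continuous_on_vec_lambda)
qed

lemma C1_compact_support_lipschitz:
  fixes f :: "'a::euclidean_space \<Rightarrow> 'b::real_normed_vector"
  assumes f: "C1_on UNIV f" and K: "compact K" "\<And>x. x \<notin> K \<Longrightarrow> f x = 0"
  obtains L where "L-lipschitz_on UNIV f"
proof -
  obtain f' where f'0: "\<And>x. x \<in> UNIV \<Longrightarrow> (f has_derivative blinfun_apply (f' x)) (at x)" "continuous_on UNIV f'"
    using C1_onE[OF f] by blast
  note f' = f'0(1)[OF UNIV_I] f'0(2)
  have "bounded (f' ` K)"
    by (intro compact_imp_bounded compact_continuous_image continuous_on_subset[OF f'(2)] K(1)) simp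
  then obtain C where C: "C > 0" "\<And>x. x \<in> K \<Longrightarrow> norm (f' x) \<le> C"
    by (auto simp: bounded_pos)
  have "norm (f' x) \<le> C" for x
  proof (cases "x \<in> K")
    case False
    have "((\<lambda>x. 0) has_derivative (\<lambda>v. 0)) (at x)" by simp
    then have "(f has_derivative (\<lambda>v. 0)) (at x)"
      by (rule has_derivative_transform_within_open[where s = "- K"])
         (use K False compact_imp_closed in auto)
    then have "blinfun_apply (f' x) = (\<lambda>v. 0)"
      using f'(1)[of x] has_derivative_unique by blast
    then have "f' x = 0" by (intro blinfun_eqI) simp
    then show ?thesis using C by simp
  qed (use C in auto)
  then have "C-lipschitz_on UNIV f"
    using C(1) f'(1) by (intro bounded_derivative_imp_lipschitz) (auto simp: norm_blinfun.rep_eq[symmetric])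
  then show ?thesis by (rule that)
qed

text \<open>Translation invariance gives every difference quotient integral zero; the quotients are
  dominated by the Lipschitz constant on a fixed neighbourhood of the support.\<close>

lemma integral_partial_deriv_eq_0:
  fixes F :: "real^'d \<Rightarrow> 'b::euclidean_space"
  assumes F: "Ck_on 1 UNIV F" and K: "compact K" "\<And>x. x \<notin> K \<Longrightarrow> F x = 0"
  shows "(\<integral>x. partial_deriv i F x \<partial>lborel) = 0"
proof -
  have C1: "C1_on UNIV F" by (rule Ck_on_1_imp_C1_on[OF F])
  obtain L where L: "L-lipschitz_on UNIV F"
    by (rule C1_compact_support_lipschitz[OF C1 K])
  have cF: "continuous_on UNIV F" by (rule C1_on_continuous[OF C1])
  have intF: "integrable lborel F" by (rule integrable_compact_support[OF cF K])
  \<comment> \<open>Step lengths \<open>1 / (n + 1)\<close> are at most \<open>1\<close>, so all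
    quotients vanish outside \<open>thicken K 1\<close>.\<close>
  define s where "s n x = real (Suc n) *\<^sub>R (F (x + (1 / real (Suc n)) *\<^sub>R axis i 1) - F x)" for n x
  let ?B = "thicken K 1"
  have cs: "continuous_on UNIV (s n)" for n
    unfolding s_def by (intro continuous_intros continuous_on_compose2[OF cF]) auto
  have s0: "(\<integral>x. s n x \<partial>lborel) = 0" for n
  proof -
    let ?v = "(1 / real (Suc n)) *\<^sub>R axis i 1"
    have "integrable lborel (\<lambda>x. F (x + ?v))"
    proof (rule integrable_compact_support[OF _ compact_thicken[OF K(1), of 1]])
      show "continuous_on UNIV (\<lambda>x. F (x + ?v))"
        by (intro continuous_intros continuous_on_compose2[OF cF]) auto
      show "F (x + ?v) = 0" if "x \<notin> thicken K 1" for x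
      proof -
        have "norm (x - (x + ?v)) \<le> 1" by simp
        then show ?thesis using K(2) in_thicken that by blast
      qed
    qed
    moreover have "(\<integral>x. F (x + ?v) \<partial>lborel) = (\<integral>x. F x \<partial>lborel)"
      by (rule lborel_integral_translation) (simp add: borel_measurable_continuous_onI cF)
    ultimately show ?thesis
      using intF by (simp add: s_def)
  qed
  have "(\<lambda>n. \<integral>x. s n x \<partial>lborel) \<longlonglongrightarrow> (\<integral>x. partial_deriv i F x \<partial>lborel)"
  proof (rule integral_dominated_convergence[where w = "\<lambda>x. indicator ?B x * L"])
    have "continuous_on UNIV (\<lambda>x. grad F x $ i)"
      by (intro continuous_intros continuous_grad F)
    then show "(\<lambda>x. partial_deriv i F x) \<in> borel_measurable lborel"
      by (simp add: grad_def borel_measurable_continuous_onI)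
    show "s n \<in> borel_measurable lborel" for n
      using cs by (simp add: borel_measurable_continuous_onI)
    have "integrable lborel (\<lambda>x. indicator ?B x *\<^sub>R L)"
      using compact_thicken[OF K(1)] by (intro borel_integrable_compact) auto
    then show "integrable lborel (\<lambda>x. indicator ?B x * L)" by simp
    show "AE x in lborel. (\<lambda>n. s n x) \<longlonglongrightarrow> partial_deriv i F x"
    proof (intro AE_I2 LIMSEQ_I)
      fix x and r :: real assume "r > 0"
      then obtain e where e: "e > 0" "\<And>y z. y \<in> ball x e \<Longrightarrow> z \<in> ball x e \<Longrightarrow>
          norm (F z - F y - frechet_derivative F (at x) (z - y)) \<le> (r/2) * norm (z - y)"
        using C1_on_strict[OF C1 open_UNIV UNIV_I, of "r/2" x] by (metis half_gt_zero)
      obtain N where N: "1 / real (Suc N) < e"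
        using e(1) reals_Archimedean by (metis inverse_eq_divide)
      have bl: "bounded_linear (frechet_derivative F (at x))"
        using C1_on_differentiable[OF C1] frechet_derivative_works has_derivative_bounded_linear by blast
      have "norm (s n x - partial_deriv i F x) < r" if "n \<ge> N" for n
      proof -
        let ?t = "1 / real (Suc n)"
        have t: "?t > 0" "?t < e"
          using N that by (auto intro: le_less_trans[rotated] simp: frac_le)
        have "norm (F (x + ?t *\<^sub>R axis i 1) - F x - frechet_derivative F (at x) (?t *\<^sub>R axis i 1)) \<le> (r/2) * ?t"
          using e(2)[of x "x + ?t *\<^sub>R axis i 1"] e(1) t by (simp add: dist_norm)
        then have "norm (?t *\<^sub>R (s n x - partial_deriv i F x)) \<le> ?t * (r/2)"
          by (simp add: s_def partial_deriv_def scaleR_diff_right linear_scale[OF bounded_linear.linear[OF bl]] mult.commute del: of_nat_Suc)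
        then have "norm (s n x - partial_deriv i F x) \<le> r / 2"
          unfolding norm_scaleR abs_of_pos[OF t(1)] using mult_le_cancel_left_pos[OF t(1)] by blast
        then show ?thesis using \<open>r > 0\<close> by linarith
      qed
      then show "\<exists>N. \<forall>n\<ge>N. norm (s n x - partial_deriv i F x) < r" by blast
    qed
    show "AE x in lborel. norm (s n x) \<le> indicator ?B x * L" for n
    proof (rule AE_I2)
      fix x
      let ?v = "(1 / real (Suc n)) *\<^sub>R axis i (1::real)"
      show "norm (s n x) \<le> indicator ?B x * L"
      proof (cases "x \<in> ?B")
        case True
        have "norm (F (x + ?v) - F x) \<le> L * norm ?v"
          using lipschitz_onD[OF L, of "x + ?v" x] by (simp add: dist_norm)
        then show ?thesis
          unfolding s_def norm_scaleR using True by (simp add: field_simps del: of_nat_Suc)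
      next
        case False
        have "x \<notin> K" using False in_thicken[of x K x 1] by auto
        moreover have "x + ?v \<notin> K" using False in_thicken[of "x + ?v" K x 1] by auto
        ultimately show ?thesis using K(2) False by (simp add: s_def)
      qed
    qed
  qed
  then show ?thesis by (simp add: s0 LIMSEQ_const_iff)
qed

lemma test_function_support:
  assumes "test_function S \<phi>"
  shows "\<exists>K. compact K \<and> K \<subseteq> S \<and> (\<forall>x. x \<notin> K \<longrightarrow> \<phi> x = 0) \<and> (\<forall>x. x \<notin> K \<longrightarrow> grad \<phi> x = 0)"
proof -
  let ?K = "closure {x. \<phi> x \<noteq> 0}"
  have K: "compact ?K" "?K \<subseteq> S" using assms by (auto simp: test_function_def)
  have z: "\<phi> x = 0" if "x \<notin> ?K" for x
    using that closure_subset[of "{x. \<phi> x \<noteq> 0}"] by auto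
  have gz: "grad \<phi> x = 0" if "x \<notin> ?K" for x
    by (rule grad_zero_outside[OF closed_closure _ that]) (rule z)
  show ?thesis
    using K z gz by blast
qed

lemma test_function_Ck: "test_function S \<phi> \<Longrightarrow> Ck_on k UNIV \<phi>"
  by (simp add: test_function_def smooth_on_def)

lemma test_function_C1: "test_function S \<phi> \<Longrightarrow> C1_on UNIV \<phi>"
  by (rule Ck_on_1_imp_C1_on[OF test_function_Ck])

lemma test_function_differentiable: "test_function S \<phi> \<Longrightarrow> \<phi> differentiable (at x)"
  by (rule C1_on_differentiable[OF test_function_C1 UNIV_I])

lemma test_function_continuous: "test_function S \<phi> \<Longrightarrow> continuous_on UNIV \<phi>"
  by (rule C1_on_continuous[OF test_function_C1])

lemma test_functionI:
  assumes sm: "\<And>k. Ck_on k UNIV \<phi>" and K: "compact K" "K \<subseteq> S" "\<And>x. x \<notin> K \<Longrightarrow> \<phi> x = 0"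
  shows "test_function S \<phi>"
proof -
  have cl: "closure {x. \<phi> x \<noteq> 0} \<subseteq> K"
    using K(3) compact_imp_closed[OF K(1)] by (intro closure_minimal) auto
  then have "compact (closure {x. \<phi> x \<noteq> 0})"
    using compact_Int_closed[OF K(1) closed_closure, of "{x. \<phi> x \<noteq> 0}"] by (simp add: Int_absorb1)
  with cl sm K(2) show ?thesis by (auto simp: test_function_def smooth_on_def)
qed

lemma test_function_linear:
  assumes \<phi>: "test_function S \<phi>" and l: "bounded_linear l"
  shows "test_function S (\<lambda>x. l (\<phi> x))" and "grad (\<lambda>x. l (\<phi> x)) x = (\<chi> i. l (grad \<phi> x $ i))"
proof -
  obtain K where K: "compact K" "K \<subseteq> S" "\<And>x. x \<notin> K \<Longrightarrow> \<phi> x = 0" "\<And>x. x \<notin> K \<Longrightarrow> grad \<phi> x = 0"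
    using test_function_support[OF \<phi>] by blast
  interpret bounded_linear l by fact
  show "test_function S (\<lambda>x. l (\<phi> x))"
    by (rule test_functionI[OF Ck_on_bounded_linear_comp[OF l test_function_Ck[OF \<phi>]] K(1,2)]) (simp add: K(3) zero)
  show "grad (\<lambda>x. l (\<phi> x)) x = (\<chi> i. l (grad \<phi> x $ i))"
    using has_derivative[OF has_derivative_grad[OF test_function_differentiable[OF \<phi>], of x]]
    by (intro grad_eqI) (simp add: sum scale)
qed

lemma test_function_add:
  assumes \<phi>: "test_function S \<phi>" and \<psi>: "test_function S \<psi>"
  shows "test_function S (\<lambda>x. \<phi> x + \<psi> x)" and "grad (\<lambda>x. \<phi> x + \<psi> x) x = grad \<phi> x + grad \<psi> x"
proof -
  obtain K where K: "compact K" "K \<subseteq> S" "\<And>x. x \<notin> K \<Longrightarrow> \<phi> x = 0" "\<And>x. x \<notin> K \<Longrightarrow> grad \<phi> x = 0"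
    using test_function_support[OF \<phi>] by blast
  obtain K' where K': "compact K'" "K' \<subseteq> S" "\<And>x. x \<notin> K' \<Longrightarrow> \<psi> x = 0" "\<And>x. x \<notin> K' \<Longrightarrow> grad \<psi> x = 0"
    using test_function_support[OF \<psi>] by blast
  show "test_function S (\<lambda>x. \<phi> x + \<psi> x)"
    by (rule test_functionI[OF Ck_on_add[OF test_function_Ck[OF \<phi>] test_function_Ck[OF \<psi>]] compact_Un[OF K(1) K'(1)]])
       (use K K' in auto)
  show "grad (\<lambda>x. \<phi> x + \<psi> x) x = grad \<phi> x + grad \<psi> x"
    using has_derivative_add[OF has_derivative_grad[OF test_function_differentiable[OF \<phi>], of x]
        has_derivative_grad[OF test_function_differentiable[OF \<psi>], of x]]
    by (intro grad_eqI) (simp add: scaleR_add_right sum.distrib)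
qed

lemma L2_on_compact_support:
  fixes F :: "real^'d \<Rightarrow> 'b::euclidean_space"
  assumes "continuous_on UNIV F" "compact K" "\<And>x. x \<notin> K \<Longrightarrow> F x = 0" "S \<in> sets lebesgue"
  shows "L2_on S F"
proof -
  have "integrable lborel (\<lambda>x. (norm (F x))\<^sup>2)"
    by (rule integrable_compact_support[OF _ assms(2)]) (auto intro!: continuous_intros assms(1) simp: assms(3))
  then have "integrable lebesgue (\<lambda>x. (norm (F x))\<^sup>2)"
    by (simp add: integrable_completion)
  moreover have "F \<in> borel_measurable lebesgue"
    using assms(1) by (simp add: borel_measurable_continuous_onI measurable_completion)
  ultimately have "L2_on UNIV F"
    by (simp add: L2_on_def lebesgue_on_UNIV_eq)
  then show ?thesis
    by (rule L2_norm_subset(1)) (use assms(4) in auto)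
qed

lemma test_function_L2:
  fixes \<phi> :: "real^'d \<Rightarrow> 'b::euclidean_space"
  assumes "test_function T \<phi>" "S \<in> sets lebesgue"
  shows "L2_on S \<phi>" "L2_on S (grad \<phi>)"
proof -
  obtain K where K: "compact K" "K \<subseteq> T" "\<And>x. x \<notin> K \<Longrightarrow> \<phi> x = 0" "\<And>x. x \<notin> K \<Longrightarrow> grad \<phi> x = 0"
    using test_function_support[OF assms(1)] by blast
  show "L2_on S \<phi>"
    by (rule L2_on_compact_support[OF test_function_continuous[OF assms(1)] K(1,3) assms(2)])
  show "L2_on S (grad \<phi>)"
    by (rule L2_on_compact_support[OF continuous_grad[OF test_function_Ck[OF assms(1)]] K(1,4) assms(2)])
qed

lemma integral_lebesgue_on_eq_lborel:
  fixes F :: "'a::euclidean_space \<Rightarrow> 'b::{banach, second_countable_topology}"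
  assumes "F \<in> borel_measurable borel" "\<And>x. x \<notin> S \<Longrightarrow> F x = 0" "S \<in> sets lebesgue"
  shows "integral\<^sup>L (lebesgue_on S) F = integral\<^sup>L lborel F"
proof -
  have "integral\<^sup>L (lebesgue_on S) F = (\<integral>x. indicator S x *\<^sub>R F x \<partial>lebesgue)"
    by (rule integral_restrict_space) (use assms in simp)
  also have "(\<lambda>x. indicator S x *\<^sub>R F x) = F"
    using assms(2) by (auto simp: indicator_def)
  also have "integral\<^sup>L lebesgue F = integral\<^sup>L lborel F"
    by (rule integral_completion) (use assms in simp)
  finally show ?thesis .
qed

lemma integrable_L2_mult:
  fixes a :: "real^'d \<Rightarrow> 'b::euclidean_space" and b :: "real^'d \<Rightarrow> 'c::euclidean_space"
  assumes a: "L2_on S a" and b: "L2_on S b" and B: "bounded_bilinear (B :: 'b \<Rightarrow> 'c \<Rightarrow> 'e::euclidean_space)"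
  shows "integrable (lebesgue_on S) (\<lambda>x. B (a x) (b x))"
proof -
  obtain K where K: "\<And>x y. norm (B x y) \<le> norm x * norm y * K"
    using bounded_bilinear.bounded[OF B] by blast
  have "continuous_on UNIV (\<lambda>p. B (fst p) (snd p))"
    by (intro bounded_bilinear.continuous_on[OF B] continuous_intros)
  then have m: "(\<lambda>p. B (fst p) (snd p)) \<in> borel_measurable borel"
    by (rule borel_measurable_continuous_onI)
  have [measurable]: "a \<in> borel_measurable (lebesgue_on S)" "b \<in> borel_measurable (lebesgue_on S)"
    using a b by (auto simp: L2_on_def)
  have "(\<lambda>x. (a x, b x)) \<in> borel_measurable (lebesgue_on S)" by measurable
  from measurable_compose[OF this m] have mB: "(\<lambda>x. B (a x) (b x)) \<in> borel_measurable (lebesgue_on S)" by simp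
  show ?thesis
  proof (rule Bochner_Integration.integrable_bound)
    show "integrable (lebesgue_on S) (\<lambda>x. \<bar>K\<bar> * (norm (a x) * norm (b x)))"
      using L2_Cauchy_Schwarz(1)[OF a b] by simp
    show "AE x in lebesgue_on S. norm (B (a x) (b x)) \<le> norm (\<bar>K\<bar> * (norm (a x) * norm (b x)))"
    proof (rule AE_I2)
      fix x
      have "norm (a x) * norm (b x) * K \<le> norm (a x) * norm (b x) * \<bar>K\<bar>"
        by (intro mult_left_mono) auto
      with K[of "a x" "b x"] show "norm (B (a x) (b x)) \<le> norm (\<bar>K\<bar> * (norm (a x) * norm (b x)))"
        by (simp add: abs_mult mult_ac)
    qed
  qed (rule mB)
qed

lemma norm_integral_L2_mult:
  fixes a :: "real^'d \<Rightarrow> 'b::euclidean_space" and b :: "real^'d \<Rightarrow> 'c::euclidean_space"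
    and h :: "real^'d \<Rightarrow> 'e::euclidean_space"
  assumes a: "L2_on S a" and b: "L2_on S b" and "K \<ge> 0"
    and i: "integrable (lebesgue_on S) h" and le: "AE x in lebesgue_on S. norm (h x) \<le> K * (norm (a x) * norm (b x))"
  shows "norm (\<integral>x. h x \<partial>lebesgue_on S) \<le> K * (L2_norm S a * L2_norm S b)"
proof -
  have "norm (\<integral>x. h x \<partial>lebesgue_on S) \<le> (\<integral>x. norm (h x) \<partial>lebesgue_on S)"
    by (rule integral_norm_bound)
  also have "\<dots> \<le> (\<integral>x. K * (norm (a x) * norm (b x)) \<partial>lebesgue_on S)"
    by (rule integral_mono_AE) (use i le L2_Cauchy_Schwarz(1)[OF a b] in auto)
  also have "\<dots> \<le> K * (L2_norm S a * L2_norm S b)"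
    using L2_Cauchy_Schwarz(2)[OF a b] \<open>K \<ge> 0\<close> by (simp add: mult_left_mono)
  finally show ?thesis .
qed

text \<open>The derivative of the product has integral zero. Compact support of
  \<open>\<psi>\<close> in \<open>S\<close> already removes boundary terms, so \<open>\<phi>\<close>
  may be a test function for any other set.\<close>

lemma test_function_integration_by_parts:
  fixes \<psi> :: "real^'d \<Rightarrow> real" and \<phi> :: "real^'d \<Rightarrow> complex"
  assumes \<psi>: "test_function S \<psi>" and \<phi>: "test_function T \<phi>" and S: "S \<in> sets lebesgue"
  shows "(\<integral>x. partial_deriv i \<psi> x *\<^sub>R \<phi> x \<partial>lebesgue_on S) =
             - (\<integral>x. \<psi> x *\<^sub>R (grad \<phi> x $ i) \<partial>lebesgue_on S)"
proof -
  obtain K where K: "compact K" "K \<subseteq> S" "\<And>x. x \<notin> K \<Longrightarrow> \<psi> x = 0" "\<And>x. x \<notin> K \<Longrightarrow> grad \<psi> x = 0"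
    using test_function_support[OF \<psi>] by blast
  have pd0: "partial_deriv i \<psi> x = 0" if "x \<notin> K" for x
    using K(4)[OF that] by (simp add: grad_def vec_eq_iff)
  let ?F = "\<lambda>x. \<psi> x *\<^sub>R \<phi> x"
  have D: "partial_deriv i ?F x = \<psi> x *\<^sub>R (grad \<phi> x $ i) + partial_deriv i \<psi> x *\<^sub>R \<phi> x" for x
  proof -
    have "(?F has_derivative (\<lambda>h. \<psi> x *\<^sub>R frechet_derivative \<phi> (at x) h + frechet_derivative \<psi> (at x) h *\<^sub>R \<phi> x)) (at x)"
      by (intro has_derivative_scaleR frechet_derivative_works[THEN iffD1] test_function_differentiable[OF \<psi>]
            test_function_differentiable[OF \<phi>])
    from partial_deriv_eq[OF this] show ?thesis by (simp add: grad_def partial_deriv_def)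
  qed
  have "continuous_on UNIV (\<lambda>x. grad \<psi> x $ i)"
    by (intro continuous_intros continuous_grad test_function_Ck[OF \<psi>])
  then have cp: "continuous_on UNIV (partial_deriv i \<psi>)"
    by (simp add: grad_def)
  have c1: "continuous_on UNIV (\<lambda>x. \<psi> x *\<^sub>R (grad \<phi> x $ i))"
    by (intro continuous_intros test_function_continuous[OF \<psi>] continuous_grad test_function_Ck[OF \<phi>])
  have c2: "continuous_on UNIV (\<lambda>x. partial_deriv i \<psi> x *\<^sub>R \<phi> x)"
    by (intro continuous_intros cp test_function_continuous[OF \<phi>])
  have i1: "integrable lborel (\<lambda>x. \<psi> x *\<^sub>R (grad \<phi> x $ i))"
    by (rule integrable_compact_support[OF c1 K(1)]) (simp add: K(3))
  have i2: "integrable lborel (\<lambda>x. partial_deriv i \<psi> x *\<^sub>R \<phi> x)"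
    by (rule integrable_compact_support[OF c2 K(1)]) (simp add: pd0)
  have "0 = (\<integral>x. partial_deriv i ?F x \<partial>lborel)"
    by (rule integral_partial_deriv_eq_0[symmetric, OF Ck_on_bilinear[OF bounded_bilinear_scaleR
            test_function_Ck[OF \<psi>] test_function_Ck[OF \<phi>]] K(1)]) (simp add: K(3))
  also have "\<dots> = (\<integral>x. \<psi> x *\<^sub>R (grad \<phi> x $ i) \<partial>lborel) + (\<integral>x. partial_deriv i \<psi> x *\<^sub>R \<phi> x \<partial>lborel)"
    unfolding D using i1 i2 by simp
  finally have "(\<integral>x. partial_deriv i \<psi> x *\<^sub>R \<phi> x \<partial>lborel) = - (\<integral>x. \<psi> x *\<^sub>R (grad \<phi> x $ i) \<partial>lborel)"
    by (simp add: eq_neg_iff_add_eq_0 add.commute)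
  moreover have "(\<integral>x. partial_deriv i \<psi> x *\<^sub>R \<phi> x \<partial>lebesgue_on S) = (\<integral>x. partial_deriv i \<psi> x *\<^sub>R \<phi> x \<partial>lborel)"
    by (rule integral_lebesgue_on_eq_lborel) (use c2 K pd0 S in \<open>auto intro!: borel_measurable_continuous_onI\<close>)
  moreover have "(\<integral>x. \<psi> x *\<^sub>R (grad \<phi> x $ i) \<partial>lebesgue_on S) = (\<integral>x. \<psi> x *\<^sub>R (grad \<phi> x $ i) \<partial>lborel)"
    by (rule integral_lebesgue_on_eq_lborel) (use c1 K S in \<open>auto intro!: borel_measurable_continuous_onI\<close>)
  ultimately show ?thesis by simp
qed

section \<open>Mollification of Lipschitz functions\<close>

text \<open>Strict (two-point) differentiability. Unlike plain differentiability it passes to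
  mollifications without any scaling argument.\<close>

definition strict_grad :: "(real^'d \<Rightarrow> 'b::real_normed_vector) \<Rightarrow> real^'d \<Rightarrow> 'b^'d \<Rightarrow> bool" where
  "strict_grad h x D \<longleftrightarrow> (\<forall>\<eta>>0. \<exists>e>0. \<forall>y\<in>ball x e. \<forall>z\<in>ball x e.
     norm (h z - h y - (\<Sum>i\<in>UNIV. ((z - y) $ i) *\<^sub>R D $ i)) \<le> \<eta> * norm (z - y))"

lemma C1_on_strict_grad:
  assumes f: "C1_on U f" and "open U" "x \<in> U"
  shows "strict_grad f x (grad f x)"
  unfolding strict_grad_def
proof (intro allI impI)
  fix \<eta> :: real assume "\<eta> > 0"
  then obtain e where e: "e > 0" "\<And>y z. y \<in> ball x e \<Longrightarrow> z \<in> ball x e \<Longrightarrow>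
          norm (f z - f y - frechet_derivative f (at x) (z - y)) \<le> \<eta> * norm (z - y)"
    using C1_on_strict[OF f \<open>open U\<close> \<open>x \<in> U\<close>, of \<eta>] by metis
  have "bounded_linear (frechet_derivative f (at x))"
    using C1_on_differentiable[OF f \<open>x \<in> U\<close>] frechet_derivative_works has_derivative_bounded_linear by blast
  then have "frechet_derivative f (at x) v = (\<Sum>i\<in>UNIV. (v $ i) *\<^sub>R grad f x $ i)" for v
    unfolding grad_def partial_deriv_def vec_lambda_beta by (rule bounded_linear_coords)
  then show "\<exists>e>0. \<forall>y\<in>ball x e. \<forall>z\<in>ball x e.
     norm (f z - f y - (\<Sum>i\<in>UNIV. ((z - y) $ i) *\<^sub>R grad f x $ i)) \<le> \<eta> * norm (z - y)"
    using e by auto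
qed

text \<open>Folds and lifts of test functions are only Lipschitz. This collects what dominated
  convergence needs in order to place them in \<open>H^1_0\<close>: one compact support, a uniform
  gradient bound, and convergence of the gradients at points of strict differentiability.\<close>

lemma mollify_lipschitz:
  fixes h :: "real^'d \<Rightarrow> 'b::euclidean_space"
  assumes S: "open S" and K: "compact K" "K \<subseteq> S" "\<And>x. x \<notin> K \<Longrightarrow> h x = 0"
    and L: "L-lipschitz_on UNIV h"
  obtains \<phi> B C where "\<And>n. test_function S (\<phi> n)" "compact B" "B \<subseteq> S" "K \<subseteq> B"
    "\<And>n x. x \<notin> B \<Longrightarrow> \<phi> n x = 0" "C \<ge> 0" "\<And>n x. norm (\<phi> n x - h x) \<le> C / real (Suc n)"
    "\<And>n x. norm (grad (\<phi> n) x) \<le> real CARD('d) * L"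
    "\<And>x D. strict_grad h x D \<Longrightarrow> (\<lambda>n. grad (\<phi> n) x) \<longlonglongrightarrow> D"
proof -
  have L0: "L \<ge> 0" using L lipschitz_on_nonneg by blast
  have h: "continuous_on UNIV h" using L lipschitz_on_continuous_on by blast
  have Lip: "norm (h (x + v) - h x) \<le> L * norm v" for x v
    using lipschitz_onD[OF L, of "x + v" x] by (simp add: dist_norm)
  obtain e where e: "e > 0" "thicken K e \<subseteq> S"
    using thicken_subset_open[OF K(1) S K(2)] by blast
  \<comment> \<open>Radii bounded by \<open>e\<close> keep all supports inside
    \<open>thicken K e\<close>.\<close>
  define \<epsilon> where "\<epsilon> n = e / real (Suc n)" for n
  have \<epsilon>: "\<epsilon> n > 0" "\<epsilon> n \<le> e" for n
    using e(1) by (auto simp: \<epsilon>_def field_simps)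
  define \<phi> where "\<phi> n = conv (mollifier (\<epsilon> n)) h" for n
  have test: "test_function S (\<phi> n)" for n
    unfolding \<phi>_def by (rule test_function_conv_mollifier[OF \<epsilon>(1) h K(1,3)])
      (use thicken_mono[OF \<epsilon>(2)] e(2) in blast)+
  have supp: "\<phi> n x = 0" if "x \<notin> thicken K e" for n x
    unfolding \<phi>_def using conv_mollifier_support[OF \<epsilon>(1) h K(3)] thicken_mono[OF \<epsilon>(2)] that by blast
  have KB: "K \<subseteq> thicken K e" using e(1) in_thicken[of _ K _ e] by force
  have close: "norm (\<phi> n x - h x) \<le> L * e / real (Suc n)" for n x
    unfolding \<phi>_def
  proof (rule mollifier_average[OF \<epsilon>(1) h])
    fix z assume z: "norm (x - z) < \<epsilon> n"
    have "norm (h z - h x) \<le> L * norm (z - x)" using Lip[of x "z - x"] by simp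
    also have "\<dots> \<le> L * \<epsilon> n" using z L0 by (intro mult_left_mono) (auto simp: norm_minus_commute)
    finally show "norm (h z - h x) \<le> L * e / real (Suc n)" by (simp add: \<epsilon>_def)
  qed
  have gb: "norm (grad (\<phi> n) x) \<le> real CARD('d) * L" for n x
  proof (rule grad_norm_le[OF test_function_differentiable[OF test] zero_less_one])
    fix v :: "real^'d"
    show "norm (\<phi> n (x + v) - \<phi> n x) \<le> L * norm v"
      using mollifier_difference[OF \<epsilon>(1) h, of x n v 0 "L * norm v"] Lip by (simp add: \<phi>_def)
  qed
  have gl: "(\<lambda>n. grad (\<phi> n) x) \<longlonglongrightarrow> D" if D: "strict_grad h x D" for x D
  proof (rule vec_tendstoI, rule LIMSEQ_I)
    fix i and r :: real assume "r > 0"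
    then have "r / 2 > 0" by simp
    then obtain d where d: "d > 0" "\<And>y z. y \<in> ball x d \<Longrightarrow> z \<in> ball x d \<Longrightarrow>
        norm (h z - h y - (\<Sum>i\<in>UNIV. ((z - y) $ i) *\<^sub>R D $ i)) \<le> (r / 2) * norm (z - y)"
      using D unfolding strict_grad_def by meson
    \<comment> \<open>Averaging radius and increment are both kept below \<open>d / 2\<close>, so
      that both endpoints stay in the ball of radius \<open>d\<close>.\<close>
    obtain N where N: "e / real (Suc N) < d / 2"
      using reals_Archimedean[of "d / (2 * e)"] d(1) e(1) by (auto simp: field_simps)
    have "norm (grad (\<phi> n) x $ i - D $ i) < r" if "n \<ge> N" for n
    proof -
      have en: "\<epsilon> n < d / 2"
      proof -
        have "\<epsilon> n \<le> e / real (Suc N)" using that e(1) by (simp add: \<epsilon>_def frac_le)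
        with N show ?thesis by linarith
      qed
      let ?l = "\<lambda>v. \<Sum>i\<in>UNIV. ((v::real^'d) $ i) *\<^sub>R D $ i"
      have bl: "bounded_linear ?l"
        by (intro bounded_linear_sum bounded_linear_scaleR_const bounded_linear_vec_nth)
      \<comment> \<open>Subtracting the linear map \<open>?l\<close> turns convergence of gradients
        into a bound on a derivative, which follows from the increments estimated by
        \<open>mollifier_difference\<close>.\<close>
      have "((\<lambda>y. \<phi> n y - ?l y) has_derivative (\<lambda>v. (\<Sum>i\<in>UNIV. (v $ i) *\<^sub>R grad (\<phi> n) x $ i) - ?l v)) (at x)"
        by (intro has_derivative_diff has_derivative_grad test_function_differentiable[OF test]
              bounded_linear_imp_has_derivative bl)
      then have "norm ((\<Sum>j\<in>UNIV. (axis i (1::real) $ j) *\<^sub>R grad (\<phi> n) x $ j) - ?l (axis i 1)) \<le> (r / 2) * norm (axis i (1::real) :: real^'d)"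
      proof (rule has_derivative_norm_le[where e = "d / 2"])
        show "d / 2 > 0" using d by simp
        fix v :: "real^'d" assume v: "norm v < d / 2"
        have "norm (conv (mollifier (\<epsilon> n)) h (x + v) - conv (mollifier (\<epsilon> n)) h x - ?l v) \<le> (r / 2) * norm v"
        proof (rule mollifier_difference[OF \<epsilon>(1) h])
          fix z assume z: "norm (x - z) < \<epsilon> n"
          have 1: "z \<in> ball x d" using z en d(1) by (simp add: dist_norm)
          have "norm (x - (z + v)) \<le> norm (x - z) + norm v"
            using norm_triangle_ineq4[of "x - z" v] by (simp add: algebra_simps)
          then have 2: "z + v \<in> ball x d" using z en v by (simp add: dist_norm)
          show "norm (h (z + v) - h z - ?l v) \<le> (r / 2) * norm v"
            using d(2)[OF 1 2] by simp
        qed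
        then show "norm (\<phi> n (x + v) - ?l (x + v) - (\<phi> n x - ?l x)) \<le> (r / 2) * norm v"
          by (simp add: \<phi>_def linear_add[OF bounded_linear.linear[OF bl]] scaleR_add_left sum.distrib algebra_simps)
      qed
      moreover have "(\<Sum>j\<in>UNIV. (axis i (1::real) $ j) *\<^sub>R (w::'b^'d) $ j) = w $ i" for w
      proof -
        have "(\<Sum>j\<in>UNIV. (axis i (1::real) $ j) *\<^sub>R w $ j) = (\<Sum>j\<in>UNIV. if j = i then w $ j else 0)"
          by (rule sum.cong) (auto simp: axis_def)
        then show ?thesis by simp
      qed
      ultimately show ?thesis using \<open>r > 0\<close> by simp
    qed
    then show "\<exists>N. \<forall>n\<ge>N. norm (grad (\<phi> n) x $ i - D $ i) < r" by blast
  qed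
  show ?thesis
    by (rule that[OF test compact_thicken[OF K(1)] e(2) KB supp _ close gb gl]) (use L0 e(1) in auto)
qed

section \<open>The fundamental lemma of the calculus of variations\<close>

lemma open_in_lebesgue [simp]: "open S \<Longrightarrow> S \<in> sets lebesgue"
  by (simp add: borel_open)

lemma L2_on_indicator_compact:
  assumes "compact B" "S \<in> sets lebesgue"
  shows "L2_on S (\<lambda>x. indicator B x :: real)"
proof -
  have "integrable lborel (\<lambda>x. indicator B x *\<^sub>R (1::real))"
    by (rule borel_integrable_compact) (use assms in auto)
  then have "integrable lebesgue (\<lambda>x. indicator B x :: real)"
    by (simp add: integrable_completion)
  moreover have "(\<lambda>x. (norm (indicator B x :: real))\<^sup>2) = (\<lambda>x. indicator B x)"
    by (auto simp: indicator_def)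
  ultimately have "L2_on UNIV (\<lambda>x. indicator B x :: real)"
    using assms(1) by (simp add: L2_on_def lebesgue_on_UNIV_eq borel_compact)
  then show ?thesis
    by (rule L2_norm_subset(1)) (use assms in auto)
qed

text \<open>Mollifications of \<open>w\<close> are admissible test functions that converge
  uniformly, with supports in one compact set \<open>B\<close>. The bound by \<open>1\<close> yields
  the dominating function \<open>C + 1\<close> times \<open>norm (g x)\<close> on
  \<open>B\<close>.\<close>

lemma integral_lipschitz_weak_zero:
  fixes g :: "real^'d \<Rightarrow> complex" and w :: "real^'d \<Rightarrow> real"
  assumes S: "open S" and g: "L2_on S g"
    and zero: "\<And>\<psi>::real^'d \<Rightarrow> real. test_function S \<psi> \<Longrightarrow> (\<integral>x. \<psi> x *\<^sub>R g x \<partial>lebesgue_on S) = 0"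
    and K: "compact K" "K \<subseteq> S" "\<And>x. x \<notin> K \<Longrightarrow> w x = 0" and L: "L-lipschitz_on UNIV w"
    and bd: "\<And>x. \<bar>w x\<bar> \<le> 1"
  shows "(\<integral>x. w x *\<^sub>R g x \<partial>lebesgue_on S) = 0"
proof -
  obtain \<phi> B C where \<phi>: "\<And>n. test_function S (\<phi> n)" "compact B" "B \<subseteq> S" "K \<subseteq> B"
    "\<And>n x. x \<notin> B \<Longrightarrow> \<phi> n x = 0" "C \<ge> 0" "\<And>n x. norm (\<phi> n x - w x) \<le> C / real (Suc n)"
    using mollify_lipschitz[OF S K L] by metis
  have gm[measurable]: "g \<in> borel_measurable (lebesgue_on S)" using g by (simp add: L2_on_def)
  have Ssets: "S \<in> sets lebesgue" using S by simp
  have wc: "continuous_on UNIV w" using L lipschitz_on_continuous_on by blast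
  have wm[measurable]: "w \<in> borel_measurable (lebesgue_on S)"
    using L2_on_compact_support[OF wc K(1,3) Ssets] L2_on_measurable by blast
  have \<phi>m[measurable]: "\<phi> n \<in> borel_measurable (lebesgue_on S)" for n
    using test_function_L2(1)[OF \<phi>(1) Ssets] L2_on_measurable by blast
  have "(\<lambda>n. \<integral>x. \<phi> n x *\<^sub>R g x \<partial>lebesgue_on S) \<longlonglongrightarrow> (\<integral>x. w x *\<^sub>R g x \<partial>lebesgue_on S)"
  proof (rule integral_dominated_convergence[where w = "\<lambda>x. (C + 1) * (norm (indicator B x :: real) * norm (g x))"])
    show "integrable (lebesgue_on S) (\<lambda>x. (C + 1) * (norm (indicator B x :: real) * norm (g x)))"
      using L2_Cauchy_Schwarz(1)[OF L2_on_indicator_compact[OF \<phi>(2) Ssets] g] by simp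
    show "AE x in lebesgue_on S. (\<lambda>n. \<phi> n x *\<^sub>R g x) \<longlonglongrightarrow> w x *\<^sub>R g x"
    proof (rule AE_I2)
      fix x
      have "(\<lambda>n. \<phi> n x - w x) \<longlonglongrightarrow> 0"
      proof (rule Lim_null_comparison)
        show "\<forall>\<^sub>F n in sequentially. norm (\<phi> n x - w x) \<le> C / real (Suc n)"
          using \<phi>(7) by simp
        show "(\<lambda>n. C / real (Suc n)) \<longlonglongrightarrow> 0"
          by (rule real_tendsto_divide_at_top[OF tendsto_const]) (rule filterlim_compose[OF filterlim_real_sequentially filterlim_Suc])
      qed
      then have "(\<lambda>n. \<phi> n x) \<longlonglongrightarrow> w x" by (simp add: LIM_zero_iff)
      then show "(\<lambda>n. \<phi> n x *\<^sub>R g x) \<longlonglongrightarrow> w x *\<^sub>R g x" by (intro tendsto_intros)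
    qed
    show "AE x in lebesgue_on S. norm (\<phi> n x *\<^sub>R g x) \<le> (C + 1) * (norm (indicator B x :: real) * norm (g x))" for n
    proof (rule AE_I2)
      fix x
      show "norm (\<phi> n x *\<^sub>R g x) \<le> (C + 1) * (norm (indicator B x :: real) * norm (g x))"
      proof (cases "x \<in> B")
        case True
        have "C / real (Suc n) \<le> C" using \<phi>(6) by (simp add: field_simps)
        then have "\<bar>\<phi> n x\<bar> \<le> C + 1" using \<phi>(7)[of n x] bd[of x] by auto
        then show ?thesis using True by (simp add: mult_right_mono)
      qed (simp add: \<phi>(5))
    qed
  qed auto
  moreover have "(\<integral>x. \<phi> n x *\<^sub>R g x \<partial>lebesgue_on S) = 0" for n
    by (rule zero[OF \<phi>(1)])
  ultimately show ?thesis by (simp add: LIMSEQ_const_iff)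
qed

text \<open>Cutoffs built from the distance to \<open>K\<close> decrease to the indicator of
  \<open>K\<close> and are Lipschitz, though with growing constants.\<close>

lemma integral_compact_weak_zero:
  fixes g :: "real^'d \<Rightarrow> complex"
  assumes S: "open S" and g: "L2_on S g"
    and zero: "\<And>\<psi>::real^'d \<Rightarrow> real. test_function S \<psi> \<Longrightarrow> (\<integral>x. \<psi> x *\<^sub>R g x \<partial>lebesgue_on S) = 0"
    and K: "compact K" "K \<subseteq> S"
  shows "(\<integral>x. indicator K x *\<^sub>R g x \<partial>lebesgue_on S) = 0"
\<comment> \<open>The empty set is split off because \<open>infdist\<close> to it is
  \<open>0\<close> by convention.\<close>
proof (cases "K = {}")
  case False
  obtain e where e: "e > 0" "thicken K e \<subseteq> S"
    using thicken_subset_open[OF K(1) S K(2)] by blast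
  let ?B = "thicken K e"
  have B: "compact ?B" by (rule compact_thicken[OF K(1)])
  have Ssets: "S \<in> sets lebesgue" using S by simp
  \<comment> \<open>Equal to \<open>1\<close> on \<open>K\<close> and to \<open>0\<close> at
    distance \<open>e / (n + 1)\<close> or more, hence supported in
    \<open>thicken K e\<close>.\<close>
  define w where "w n x = max 0 (1 - (real (Suc n) / e) * infdist x K)" for n x
  have w01: "0 \<le> w n x" "w n x \<le> 1" for n x
    using e(1) infdist_nonneg[of x K] by (auto simp: w_def)
  have wL: "(real (Suc n) / e)-lipschitz_on UNIV (w n)" for n
  proof (rule lipschitz_onI)
    fix x y
    have max0: "\<bar>max 0 (1 - a) - max 0 (1 - b)\<bar> \<le> \<bar>a - b\<bar>" for a b :: real
      by (auto simp: max_def abs_if)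
    have "\<bar>w n x - w n y\<bar> \<le> \<bar>(real (Suc n) / e) * infdist x K - (real (Suc n) / e) * infdist y K\<bar>"
      unfolding w_def by (rule max0)
    also have "\<dots> = (real (Suc n) / e) * \<bar>infdist x K - infdist y K\<bar>"
      using e(1) by (subst right_diff_distrib[symmetric]) (simp add: abs_mult)
    also have "\<dots> \<le> (real (Suc n) / e) * dist x y"
      using e(1) infdist_triangle_abs[of x K y] by (intro mult_left_mono) auto
    finally show "dist (w n x) (w n y) \<le> (real (Suc n) / e) * dist x y" by (simp add: dist_real_def)
  qed (use e in auto)
  have w0: "w n x = 0" if "x \<notin> ?B" for n x
  proof -
    obtain y where y: "y \<in> K" "infdist x K = dist x y"
      using infdist_attains_inf[OF compact_imp_closed[OF K(1)] False] by blast
    have "dist x y > e"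
      using in_thicken[OF y(1), of x e] that by (auto simp: dist_norm not_le[symmetric])
    then have "infdist x K \<ge> e" using y(2) by simp
    then have "1 \<le> (1 / e) * infdist x K" using e(1) by (simp add: field_simps)
    also have "\<dots> \<le> (real (Suc n) / e) * infdist x K"
      using e(1) infdist_nonneg[of x K] by (intro mult_right_mono divide_right_mono) auto
    finally show ?thesis by (simp add: w_def)
  qed
  have gm[measurable]: "g \<in> borel_measurable (lebesgue_on S)" using g by (simp add: L2_on_def)
  have wm[measurable]: "w n \<in> borel_measurable (lebesgue_on S)" for n
    using L2_on_compact_support[OF lipschitz_on_continuous_on[OF wL] B w0 Ssets] L2_on_measurable by blast
  have Km[measurable]: "(\<lambda>x. indicator K x :: real) \<in> borel_measurable (lebesgue_on S)"
    using L2_on_indicator_compact[OF K(1) Ssets] L2_on_measurable by blast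
  have "(\<lambda>n. \<integral>x. w n x *\<^sub>R g x \<partial>lebesgue_on S) \<longlonglongrightarrow> (\<integral>x. indicator K x *\<^sub>R g x \<partial>lebesgue_on S)"
  proof (rule integral_dominated_convergence[where w = "\<lambda>x. norm (indicator ?B x :: real) * norm (g x)"])
    show "integrable (lebesgue_on S) (\<lambda>x. norm (indicator ?B x :: real) * norm (g x))"
      by (rule L2_Cauchy_Schwarz(1)[OF L2_on_indicator_compact[OF B Ssets] g])
    show "AE x in lebesgue_on S. (\<lambda>n. w n x *\<^sub>R g x) \<longlonglongrightarrow> indicator K x *\<^sub>R g x"
    proof (rule AE_I2)
      fix x
      have "(\<lambda>n. w n x) \<longlonglongrightarrow> indicator K x"
      proof (cases "x \<in> K")
        case True
        then show ?thesis by (simp add: w_def)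
      next
        case False
        then have i: "infdist x K > 0"
          using in_closed_iff_infdist_zero[OF compact_imp_closed[OF K(1)] \<open>K \<noteq> {}\<close>, of x] infdist_nonneg[of x K] by force
        obtain N where N: "e / infdist x K < real N" using reals_Archimedean2 by blast
        have "w n x = 0" if "n \<ge> N" for n
        proof -
          have "e / infdist x K < real (Suc n)" using N that by linarith
          then have "e < real (Suc n) * infdist x K"
            using i by (simp add: field_simps)
          then have "1 < (real (Suc n) / e) * infdist x K"
            using e(1) by (simp add: field_simps)
          then show ?thesis by (simp add: w_def)
        qed
        then have "(\<lambda>n. w n x) \<longlonglongrightarrow> 0"
          by (intro tendsto_eventually) (auto simp: eventually_sequentially)
        then show ?thesis using False by simp
      qed
      then show "(\<lambda>n. w n x *\<^sub>R g x) \<longlonglongrightarrow> indicator K x *\<^sub>R g x"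
        by (intro tendsto_intros)
    qed
    show "AE x in lebesgue_on S. norm (w n x *\<^sub>R g x) \<le> norm (indicator ?B x :: real) * norm (g x)" for n
    proof (rule AE_I2)
      fix x show "norm (w n x *\<^sub>R g x) \<le> norm (indicator ?B x :: real) * norm (g x)"
        using w0[of x n] w01[of n x] by (cases "x \<in> ?B") (auto simp: mult_left_le_one_le)
    qed
  qed auto
  moreover have "(\<integral>x. w n x *\<^sub>R g x \<partial>lebesgue_on S) = 0" for n
    by (rule integral_lipschitz_weak_zero[OF S g zero B e(2) w0 wL]) (use w01[of n] in auto)
  ultimately show ?thesis by (simp add: LIMSEQ_const_iff)
qed simp

text \<open>Up to a null set, the set where \<open>r\<close> is positive is a countable union of
  compact sets; on each of them \<open>r\<close> is positive with integral zero, so each is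
  null.\<close>

lemma AE_nonpos_of_compact_integrals:
  fixes r :: "real^'d \<Rightarrow> real"
  assumes S: "open S" and r: "L2_on S r"
    and zero: "\<And>K. compact K \<Longrightarrow> K \<subseteq> S \<Longrightarrow> (\<integral>x. indicator K x *\<^sub>R r x \<partial>lebesgue_on S) = 0"
  shows "AE x in lebesgue_on S. r x \<le> 0"
proof -
  have Ssets: "S \<in> sets lebesgue" using S by simp
  have rm[measurable]: "r \<in> borel_measurable (lebesgue_on S)" using r by (simp add: L2_on_def)
  have "{x \<in> space (lebesgue_on S). 0 < r x} \<in> sets (lebesgue_on S)" by measurable
  then have A: "{x \<in> S. 0 < r x} \<in> sets lebesgue"
    using Ssets by (simp add: sets_restrict_space_iff)
  obtain C N where C: "fsigma C" "N \<in> null_sets lebesgue" "C \<union> N = {x \<in> S. 0 < r x}" "disjnt C N"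
    using lebesgue_set_almost_fsigma[OF A] .
  obtain F :: "nat \<Rightarrow> (real^'d) set" where F: "range F \<subseteq> Collect compact" "C = \<Union>(range F)"
    using C(1) fsigma_Union_compact by metis
  have "AE x in lebesgue_on S. x \<notin> F n" for n
  proof -
    have Fc: "compact (F n)" using F(1) by auto
    have Fn: "F n \<subseteq> {x \<in> S. 0 < r x}" using F(2) C(3) by auto
    have i: "integrable (lebesgue_on S) (\<lambda>x. indicator (F n) x *\<^sub>R r x)"
      by (rule integrable_L2_mult[OF L2_on_indicator_compact[OF Fc Ssets] r bounded_bilinear_scaleR])
    have "(\<integral>x. indicator (F n) x *\<^sub>R r x \<partial>lebesgue_on S) = 0"
      by (rule zero[OF Fc]) (use Fn in auto)
    moreover have "AE x in lebesgue_on S. 0 \<le> indicator (F n) x *\<^sub>R r x"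
      by (intro AE_I2) (use Fn in \<open>auto simp: indicator_def\<close>)
    ultimately have "AE x in lebesgue_on S. indicator (F n) x *\<^sub>R r x = 0"
      using integral_nonneg_eq_0_iff_AE[OF i] by blast
    then show ?thesis
      by eventually_elim (use Fn in \<open>auto simp: indicator_def split: if_splits\<close>)
  qed
  then have 1: "AE x in lebesgue_on S. \<forall>n. x \<notin> F n" by (simp add: AE_all_countable)
  have "AE x in lebesgue. x \<notin> N" using C(2) by (rule AE_not_in)
  then have 2: "AE x in lebesgue_on S. x \<notin> N"
    by (subst AE_restrict_space_iff) (use Ssets in \<open>auto elim: eventually_mono\<close>)
  show ?thesis
    using 1 2 AE_space[of "lebesgue_on S"]
  proof eventually_elim
    case (elim x)
    then have "x \<notin> C \<union> N" using F(2) by auto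
    then show ?case using C(3) elim(3) by auto
  qed
qed

text \<open>The one-sided bound is applied to \<open>Re\<close>, \<open>Im\<close> and their
  negatives.\<close>

lemma fundamental_lemma:
  fixes g :: "real^'d \<Rightarrow> complex"
  assumes S: "open S" and g: "L2_on S g"
    and weak: "\<And>\<psi>::real^'d \<Rightarrow> real. test_function S \<psi> \<Longrightarrow> (\<integral>x. \<psi> x *\<^sub>R g x \<partial>lebesgue_on S) = 0"
  shows "AE x in lebesgue_on S. g x = 0"
proof -
  have Ssets: "S \<in> sets lebesgue" using S by simp
  have half: "AE x in lebesgue_on S. l (g x) \<le> 0" if l: "bounded_linear l" for l :: "complex \<Rightarrow> real"
  proof (rule AE_nonpos_of_compact_integrals[OF S L2_on_bounded_linear[OF g l]])
    fix K assume K: "compact K" "K \<subseteq> S"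
    interpret bounded_linear l by fact
    have i: "integrable (lebesgue_on S) (\<lambda>x. indicator K x *\<^sub>R g x)"
      by (rule integrable_L2_mult[OF L2_on_indicator_compact[OF K(1) Ssets] g bounded_bilinear_scaleR])
    have "(\<integral>x. indicator K x *\<^sub>R l (g x) \<partial>lebesgue_on S) = (\<integral>x. l (indicator K x *\<^sub>R g x) \<partial>lebesgue_on S)"
      by (simp add: scale)
    also have "\<dots> = l (\<integral>x. indicator K x *\<^sub>R g x \<partial>lebesgue_on S)"
      by (rule integral_bounded_linear[OF l i])
    also have "\<dots> = 0"
      by (simp only: integral_compact_weak_zero[OF S g weak K] zero)
    finally show "(\<integral>x. indicator K x *\<^sub>R l (g x) \<partial>lebesgue_on S) = 0" .
  qed
  have "AE x in lebesgue_on S. Re (g x) \<le> 0" "AE x in lebesgue_on S. - Re (g x) \<le> 0"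
    "AE x in lebesgue_on S. Im (g x) \<le> 0" "AE x in lebesgue_on S. - Im (g x) \<le> 0"
    using half[OF bounded_linear_Re] half[OF bounded_linear_minus[OF bounded_linear_Re]]
      half[OF bounded_linear_Im] half[OF bounded_linear_minus[OF bounded_linear_Im]] by auto
  then show ?thesis
    by eventually_elim (auto simp: complex_eq_iff)
qed

section \<open>Weak gradients\<close>

lemma L2_on_vec_nth: "L2_on S g \<Longrightarrow> L2_on S (\<lambda>x. g x $ i)"
  by (rule L2_on_bounded_linear[OF _ bounded_linear_vec_nth])

lemma partial_deriv_L2:
  fixes \<psi> :: "real^'d \<Rightarrow> 'b::euclidean_space"
  assumes "test_function T \<psi>" "S \<in> sets lebesgue"
  shows "L2_on S (partial_deriv i \<psi>)"
  using L2_on_vec_nth[OF test_function_L2(2)[OF assms], of i] by (simp add: grad_def)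

lemma weak_gradient_unique:
  fixes u :: "real^'d \<Rightarrow> complex"
  assumes S: "open S" and g: "L2_on S g" "has_weak_gradient S u g" and g': "L2_on S g'" "has_weak_gradient S u g'"
  shows "AE x in lebesgue_on S. g x = g' x"
proof -
  have Ssets: "S \<in> sets lebesgue" using S by simp
  have "AE x in lebesgue_on S. g x $ i - g' x $ i = 0" for i
  proof (rule fundamental_lemma[OF S])
    show "L2_on S (\<lambda>x. g x $ i - g' x $ i)"
      by (rule L2_on_diff[OF L2_on_vec_nth[OF g(1)] L2_on_vec_nth[OF g'(1)]])
    fix \<psi> :: "real^'d \<Rightarrow> real" assume \<psi>: "test_function S \<psi>"
    have I: "integrable (lebesgue_on S) (\<lambda>x. \<psi> x *\<^sub>R (g x $ i))" "integrable (lebesgue_on S) (\<lambda>x. \<psi> x *\<^sub>R (g' x $ i))"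
      by (rule integrable_L2_mult[OF test_function_L2(1)[OF \<psi> Ssets] L2_on_vec_nth[OF g(1)] bounded_bilinear_scaleR])
         (rule integrable_L2_mult[OF test_function_L2(1)[OF \<psi> Ssets] L2_on_vec_nth[OF g'(1)] bounded_bilinear_scaleR])
    have "(\<integral>x. \<psi> x *\<^sub>R (g x $ i) \<partial>lebesgue_on S) = (\<integral>x. \<psi> x *\<^sub>R (g' x $ i) \<partial>lebesgue_on S)"
    proof -
      have "- (\<integral>x. \<psi> x *\<^sub>R (g x $ i) \<partial>lebesgue_on S) = - (\<integral>x. \<psi> x *\<^sub>R (g' x $ i) \<partial>lebesgue_on S)"
        using g(2) g'(2) \<psi> unfolding has_weak_gradient_def by simp
      then show ?thesis by simp
    qed
    then show "(\<integral>x. \<psi> x *\<^sub>R (g x $ i - g' x $ i) \<partial>lebesgue_on S) = 0"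
      using I by (simp add: scaleR_diff_right)
  qed
  then have "AE x in lebesgue_on S. \<forall>i. g x $ i - g' x $ i = 0" by (simp add: AE_all_countable AE_finite_allI)
  then show ?thesis by eventually_elim (simp add: vec_eq_iff)
qed

lemma weak_gradient_works:
  assumes "H1_on S u"
  shows "L2_on S (weak_gradient S u)" "has_weak_gradient S u (weak_gradient S u)"
proof -
  have "\<exists>g. L2_on S g \<and> has_weak_gradient S u g" using assms by (simp add: H1_on_def)
  from someI_ex[OF this] show "L2_on S (weak_gradient S u)" "has_weak_gradient S u (weak_gradient S u)"
    unfolding weak_gradient_def by blast+
qed

lemma weak_gradient_AE:
  assumes "open S" "L2_on S u" "L2_on S g" "has_weak_gradient S u g"
  shows "AE x in lebesgue_on S. weak_gradient S u x = g x"
proof -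
  have "H1_on S u" using assms by (auto simp: H1_on_def)
  from weak_gradient_unique[OF assms(1) weak_gradient_works[OF this] assms(3,4)] show ?thesis .
qed

lemma weak_gradient_integrable:
  assumes "S \<in> sets lebesgue" "L2_on S u" "L2_on S g" "test_function T (\<psi> :: real^'d \<Rightarrow> real)"
  shows "integrable (lebesgue_on S) (\<lambda>x. partial_deriv i \<psi> x *\<^sub>R (u x :: complex))"
    and "integrable (lebesgue_on S) (\<lambda>x. \<psi> x *\<^sub>R ((g x :: complex^'d) $ i))"
  by (rule integrable_L2_mult[OF partial_deriv_L2[OF assms(4,1)] assms(2) bounded_bilinear_scaleR])
     (rule integrable_L2_mult[OF test_function_L2(1)[OF assms(4,1)] L2_on_vec_nth[OF assms(3)] bounded_bilinear_scaleR])

lemma has_weak_gradient_add: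
  assumes S: "S \<in> sets lebesgue" and u: "L2_on S u" "L2_on S g" "has_weak_gradient S u g"
    and v: "L2_on S v" "L2_on S k" "has_weak_gradient S v k"
  shows "has_weak_gradient S (\<lambda>x. u x + v x) (\<lambda>x. g x + k x)"
  unfolding has_weak_gradient_def
proof (intro allI impI)
  fix \<phi> :: "real^'a \<Rightarrow> real" and i assume \<phi>: "test_function S \<phi>"
  note I = weak_gradient_integrable[OF S u(1,2) \<phi>] weak_gradient_integrable[OF S v(1,2) \<phi>]
  show "(\<integral>x. partial_deriv i \<phi> x *\<^sub>R (u x + v x) \<partial>lebesgue_on S) = - (\<integral>x. \<phi> x *\<^sub>R ((g x + k x) $ i) \<partial>lebesgue_on S)"
    using u(3) v(3) \<phi> I by (simp add: has_weak_gradient_def scaleR_add_right)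
qed

lemma has_weak_gradient_cmult:
  assumes S: "S \<in> sets lebesgue" and u: "L2_on S u" "L2_on S g" "has_weak_gradient S u g"
  shows "has_weak_gradient S (\<lambda>x. c * u x) (\<lambda>x. c *s g x)"
  unfolding has_weak_gradient_def
proof (intro allI impI)
  fix \<phi> :: "real^'a \<Rightarrow> real" and i assume \<phi>: "test_function S \<phi>"
  have "(\<integral>x. partial_deriv i \<phi> x *\<^sub>R (c * u x) \<partial>lebesgue_on S) = c * (\<integral>x. partial_deriv i \<phi> x *\<^sub>R u x \<partial>lebesgue_on S)"
    by (simp add: mult_scaleR_right[symmetric] del: mult_scaleR_right)
  moreover have "(\<integral>x. \<phi> x *\<^sub>R ((c *s g x) $ i) \<partial>lebesgue_on S) = c * (\<integral>x. \<phi> x *\<^sub>R (g x $ i) \<partial>lebesgue_on S)"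
    by (simp add: mult_scaleR_right[symmetric] del: mult_scaleR_right)
  ultimately show "(\<integral>x. partial_deriv i \<phi> x *\<^sub>R (c * u x) \<partial>lebesgue_on S) = - (\<integral>x. \<phi> x *\<^sub>R ((c *s g x) $ i) \<partial>lebesgue_on S)"
    using u(3) \<phi> by (simp add: has_weak_gradient_def)
qed

lemma has_weak_gradient_test:
  fixes \<phi> :: "real^'d \<Rightarrow> complex"
  assumes "test_function T \<phi>" "S \<in> sets lebesgue"
  shows "has_weak_gradient S \<phi> (grad \<phi>)"
  unfolding has_weak_gradient_def using test_function_integration_by_parts[OF _ assms] by blast

section \<open>The space of functions vanishing on the boundary\<close>

text \<open>The closure of the pairs \<open>(\<phi>, grad \<phi>)\<close> in \<open>L\<^sup>2 \<times> L\<^sup>2\<close>: membership of \<open>u\<close> in \<open>H\<^sup>1\<^sub>0\<close> together with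
  the choice of a representative \<open>g\<close> of its gradient.\<close>

definition H0pair :: "(real^'d) set \<Rightarrow> (real^'d \<Rightarrow> complex) \<Rightarrow> (real^'d \<Rightarrow> complex^'d) \<Rightarrow> bool" where
  "H0pair S u g \<longleftrightarrow> L2_on S u \<and> L2_on S g \<and>
     (\<forall>\<epsilon>>0. \<exists>\<phi>. test_function S \<phi> \<and> L2_norm S (\<lambda>x. u x - \<phi> x) < \<epsilon> \<and> L2_norm S (\<lambda>x. g x - grad \<phi> x) < \<epsilon>)"

lemma H0pair_L2: "H0pair S u g \<Longrightarrow> L2_on S u" "H0pair S u g \<Longrightarrow> L2_on S g"
  by (auto simp: H0pair_def)

lemma tendsto_0_if_less_inverse:
  assumes "\<And>n. 0 \<le> a n" "\<And>n. a n < 1 / real (Suc n)"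
  shows "a \<longlonglongrightarrow> 0"
proof (rule Lim_null_comparison)
  show "\<forall>\<^sub>F n in sequentially. norm (a n) \<le> 1 / real (Suc n)"
    using assms by (intro always_eventually allI) (simp add: less_imp_le del: of_nat_Suc)
  show "(\<lambda>n. 1 / real (Suc n)) \<longlonglongrightarrow> 0"
    by (rule real_tendsto_divide_at_top[OF tendsto_const]) (rule filterlim_compose[OF filterlim_real_sequentially filterlim_Suc])
qed

lemma H0pair_sequence:
  assumes "H0pair S u g"
  shows "\<exists>\<phi>. (\<forall>n. test_function S (\<phi> n)) \<and> (\<lambda>n. L2_norm S (\<lambda>x. u x - \<phi> n x)) \<longlonglongrightarrow> 0 \<and>
    (\<lambda>n. L2_norm S (\<lambda>x. g x - grad (\<phi> n) x)) \<longlonglongrightarrow> 0"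
proof -
  have "\<exists>\<phi>. test_function S \<phi> \<and> L2_norm S (\<lambda>x. u x - \<phi> x) < 1 / real (Suc n) \<and> L2_norm S (\<lambda>x. g x - grad \<phi> x) < 1 / real (Suc n)" for n
    using assms unfolding H0pair_def by (simp del: of_nat_Suc)
  then obtain \<phi> where \<phi>: "test_function S (\<phi> n)" "L2_norm S (\<lambda>x. u x - \<phi> n x) < 1 / real (Suc n)"
     "L2_norm S (\<lambda>x. g x - grad (\<phi> n) x) < 1 / real (Suc n)" for n
    by metis
  have "(\<lambda>n. L2_norm S (\<lambda>x. u x - \<phi> n x)) \<longlonglongrightarrow> 0"
    by (rule tendsto_0_if_less_inverse[OF L2_norm_nonneg \<phi>(2)])
  moreover have "(\<lambda>n. L2_norm S (\<lambda>x. g x - grad (\<phi> n) x)) \<longlonglongrightarrow> 0"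
    by (rule tendsto_0_if_less_inverse[OF L2_norm_nonneg \<phi>(3)])
  ultimately show ?thesis using \<phi>(1) by blast
qed

lemma H0pair_limit:
  assumes u: "L2_on S u" "L2_on S g" and p: "\<And>n. H0pair S (v n) (k n)"
    and l: "(\<lambda>n. L2_norm S (\<lambda>x. u x - v n x)) \<longlonglongrightarrow> 0" "(\<lambda>n. L2_norm S (\<lambda>x. g x - k n x)) \<longlonglongrightarrow> 0"
    and S: "S \<in> sets lebesgue"
  shows "H0pair S u g"
  unfolding H0pair_def
proof (intro conjI u allI impI)
  fix \<epsilon> :: real assume "\<epsilon> > 0"
  then have e2: "\<epsilon> / 2 > 0" by simp
  have "\<forall>\<^sub>F n in sequentially. L2_norm S (\<lambda>x. u x - v n x) < \<epsilon>/2 \<and> L2_norm S (\<lambda>x. g x - k n x) < \<epsilon>/2"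
    by (intro eventually_conj order_tendstoD(2)[OF l(1) e2] order_tendstoD(2)[OF l(2) e2])
  then obtain n where n: "L2_norm S (\<lambda>x. u x - v n x) < \<epsilon>/2" "L2_norm S (\<lambda>x. g x - k n x) < \<epsilon>/2"
    using eventually_happens by force
  obtain \<phi> where \<phi>: "test_function S \<phi>" "L2_norm S (\<lambda>x. v n x - \<phi> x) < \<epsilon>/2" "L2_norm S (\<lambda>x. k n x - grad \<phi> x) < \<epsilon>/2"
    using p[of n] e2 unfolding H0pair_def by blast
  note L = H0pair_L2[OF p[of n]] test_function_L2[OF \<phi>(1) S]
  show "\<exists>\<phi>. test_function S \<phi> \<and> L2_norm S (\<lambda>x. u x - \<phi> x) < \<epsilon> \<and> L2_norm S (\<lambda>x. g x - grad \<phi> x) < \<epsilon>"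
    using L2_norm_triangle_diff[OF u(1) L(1,3)] L2_norm_triangle_diff[OF u(2) L(2,4)] n \<phi> by (intro exI[of _ \<phi>]) linarith
qed

lemma H0pair_test:
  fixes \<phi> :: "real^'d \<Rightarrow> complex"
  assumes "test_function S \<phi>" "S \<in> sets lebesgue"
  shows "H0pair S \<phi> (grad \<phi>)"
  unfolding H0pair_def using test_function_L2[OF assms] assms(1) by (intro conjI allI impI exI[of _ \<phi>]) auto

lemma H0pair_add:
  assumes S: "S \<in> sets lebesgue" and p: "H0pair S u g" "H0pair S v k"
  shows "H0pair S (\<lambda>x. u x + v x) (\<lambda>x. g x + k x)"
  unfolding H0pair_def
proof (intro conjI L2_on_add H0pair_L2[OF p(1)] H0pair_L2[OF p(2)] allI impI)
  fix \<epsilon> :: real assume "\<epsilon> > 0"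
  then have e2: "\<epsilon> / 2 > 0" by simp
  obtain \<phi> where \<phi>: "test_function S \<phi>" "L2_norm S (\<lambda>x. u x - \<phi> x) < \<epsilon>/2" "L2_norm S (\<lambda>x. g x - grad \<phi> x) < \<epsilon>/2"
    using p(1) e2 unfolding H0pair_def by blast
  obtain \<psi> where \<psi>: "test_function S \<psi>" "L2_norm S (\<lambda>x. v x - \<psi> x) < \<epsilon>/2" "L2_norm S (\<lambda>x. k x - grad \<psi> x) < \<epsilon>/2"
    using p(2) e2 unfolding H0pair_def by blast
  note L = L2_on_diff[OF H0pair_L2(1)[OF p(1)] test_function_L2(1)[OF \<phi>(1) S]]
    L2_on_diff[OF H0pair_L2(2)[OF p(1)] test_function_L2(2)[OF \<phi>(1) S]]
    L2_on_diff[OF H0pair_L2(1)[OF p(2)] test_function_L2(1)[OF \<psi>(1) S]]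
    L2_on_diff[OF H0pair_L2(2)[OF p(2)] test_function_L2(2)[OF \<psi>(1) S]]
  have "L2_norm S (\<lambda>x. u x + v x - (\<phi> x + \<psi> x)) < \<epsilon>"
    using L2_norm_triangle[OF L(1,3)] \<phi>(2) \<psi>(2) by (simp add: algebra_simps)
  moreover have "L2_norm S (\<lambda>x. g x + k x - grad (\<lambda>x. \<phi> x + \<psi> x) x) < \<epsilon>"
    using L2_norm_triangle[OF L(2,4)] \<phi>(3) \<psi>(3) by (simp add: test_function_add(2)[OF \<phi>(1) \<psi>(1)] algebra_simps)
  ultimately show "\<exists>\<phi>. test_function S \<phi> \<and> L2_norm S (\<lambda>x. u x + v x - \<phi> x) < \<epsilon> \<and> L2_norm S (\<lambda>x. g x + k x - grad \<phi> x) < \<epsilon>"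
    using test_function_add(1)[OF \<phi>(1) \<psi>(1)] by (intro exI[of _ "\<lambda>x. \<phi> x + \<psi> x"]) simp
qed

lemma norm_vec_mono:
  assumes "\<And>i. norm ((v :: 'b::real_normed_vector^'d) $ i) \<le> K * norm ((w :: 'c::real_normed_vector^'d) $ i)" "0 \<le> K"
  shows "norm v \<le> K * norm w"
proof -
  have "norm v \<le> L2_set (\<lambda>i. K * norm (w $ i)) UNIV"
    unfolding norm_vec_def by (rule L2_set_mono) (use assms in auto)
  also have "\<dots> = K * norm w"
    unfolding norm_vec_def using L2_set_right_distrib[OF assms(2)] by metis
  finally show ?thesis .
qed

lemma bounded_linear_vec_map:
  fixes l :: "'b::euclidean_space \<Rightarrow> 'c::euclidean_space"
  assumes "bounded_linear l"
  shows "bounded_linear (\<lambda>v::'b^'d. \<chi> i. l (v $ i))"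
proof -
  interpret bounded_linear l by fact
  obtain K where K: "K \<ge> 0" "\<And>x. norm (l x) \<le> norm x * K"
    using nonneg_bounded by blast
  show ?thesis
  proof (rule bounded_linear_intro[where K = K])
    show "norm (\<chi> i. l (v $ i)) \<le> norm v * K" for v :: "'b^'d"
      using norm_vec_mono[of "\<chi> i. l (v $ i)" K v] K by (simp add: mult.commute)
  qed (simp_all add: vec_eq_iff add scale)
qed

text \<open>Real-linear \<open>l\<close> covers scalar multiples and also conjugation, which
  produces the test function in \<open>coercive_bound\<close>.\<close>

lemma H0pair_linear:
  fixes l :: "complex \<Rightarrow> complex"
  assumes S: "S \<in> sets lebesgue" and p: "H0pair S u g" and l: "bounded_linear l"
  shows "H0pair S (\<lambda>x. l (u x)) (\<lambda>x. \<chi> i. l (g x $ i))"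
proof -
  interpret bounded_linear l by fact
  obtain K where K: "K \<ge> 0" "\<And>x. norm (l x) \<le> norm x * K"
    using nonneg_bounded by blast
  have L: "L2_on S (\<lambda>x. l (u x))" by (rule L2_on_bounded_linear[OF H0pair_L2(1)[OF p] l])
  have Lg: "L2_on S (\<lambda>x. \<chi> i. l (g x $ i))"
    by (rule L2_on_bounded_linear[OF H0pair_L2(2)[OF p] bounded_linear_vec_map[OF l]])
  show ?thesis
    unfolding H0pair_def
  proof (intro conjI L Lg allI impI)
    fix \<epsilon> :: real assume "\<epsilon> > 0"
    \<comment> \<open>\<open>K + 1\<close> instead of \<open>K\<close>, so that \<open>K = 0\<close>
      needs no separate case.\<close>
    then have e2: "\<epsilon> / (K + 1) > 0" using K by simp
    obtain \<phi> where \<phi>: "test_function S \<phi>" "L2_norm S (\<lambda>x. u x - \<phi> x) < \<epsilon>/(K+1)" "L2_norm S (\<lambda>x. g x - grad \<phi> x) < \<epsilon>/(K+1)"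
      using p e2 unfolding H0pair_def by blast
    note t = test_function_linear[OF \<phi>(1) l]
    have small: "K * r < \<epsilon>" if "r < \<epsilon> / (K + 1)" "0 \<le> r" for r
    proof -
      have "(K + 1) * r < \<epsilon>" using that K by (simp add: field_simps)
      then show ?thesis using that by (simp add: algebra_simps)
    qed
    have "L2_norm S (\<lambda>x. l (u x) - l (\<phi> x)) \<le> K * L2_norm S (\<lambda>x. u x - \<phi> x)"
    proof (rule L2_norm_bound)
      show "(\<lambda>x. l (u x) - l (\<phi> x)) \<in> borel_measurable (lebesgue_on S)"
        using L2_on_diff[OF L test_function_L2(1)[OF t(1) S]] by (rule L2_on_measurable)
      show "L2_on S (\<lambda>x. u x - \<phi> x)"
        by (rule L2_on_diff[OF H0pair_L2(1)[OF p] test_function_L2(1)[OF \<phi>(1) S]])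
      show "AE x in lebesgue_on S. norm (l (u x) - l (\<phi> x)) \<le> K * norm (u x - \<phi> x)"
        using K(2) by (auto simp: diff[symmetric] mult.commute)
    qed fact
    moreover have "L2_norm S (\<lambda>x. (\<chi> i. l (g x $ i)) - grad (\<lambda>x. l (\<phi> x)) x) \<le> K * L2_norm S (\<lambda>x. g x - grad \<phi> x)"
    proof (rule L2_norm_bound)
      show "(\<lambda>x. (\<chi> i. l (g x $ i)) - grad (\<lambda>x. l (\<phi> x)) x) \<in> borel_measurable (lebesgue_on S)"
        using L2_on_diff[OF Lg test_function_L2(2)[OF t(1) S]] by (rule L2_on_measurable)
      show "L2_on S (\<lambda>x. g x - grad \<phi> x)"
        by (rule L2_on_diff[OF H0pair_L2(2)[OF p] test_function_L2(2)[OF \<phi>(1) S]])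
      have "norm ((\<chi> i. l (g x $ i)) - grad (\<lambda>x. l (\<phi> x)) x) \<le> K * norm (g x - grad \<phi> x)" for x
        using K by (intro norm_vec_mono) (auto simp: t(2) diff[symmetric] mult.commute)
      then show "AE x in lebesgue_on S. norm ((\<chi> i. l (g x $ i)) - grad (\<lambda>x. l (\<phi> x)) x) \<le> K * norm (g x - grad \<phi> x)"
        by simp
    qed fact
    ultimately show "\<exists>\<phi>. test_function S \<phi> \<and> L2_norm S (\<lambda>x. l (u x) - \<phi> x) < \<epsilon> \<and> L2_norm S (\<lambda>x. (\<chi> i. l (g x $ i)) - grad \<phi> x) < \<epsilon>"
      using t(1) small[OF \<phi>(2) L2_norm_nonneg] small[OF \<phi>(3) L2_norm_nonneg]
      by (intro exI[of _ "\<lambda>x. l (\<phi> x)"]) auto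
  qed
qed

lemma H0pair_cmult:
  assumes "S \<in> sets lebesgue" "H0pair S u g"
  shows "H0pair S (\<lambda>x. c * u x) (\<lambda>x. c *s g x)"
  using H0pair_linear[OF assms bounded_linear_mult_right[of c]] by (simp add: vector_scalar_mult_def)

lemma minus_one_smult: "(- 1) *s (v :: complex^'d) = - v"
  by (simp add: vec_eq_iff)

lemma H0pair_diff:
  assumes S: "S \<in> sets lebesgue" and p: "H0pair S u g" "H0pair S v k"
  shows "H0pair S (\<lambda>x. u x - v x) (\<lambda>x. g x - k x)"
  using H0pair_add[OF S p(1) H0pair_cmult[OF S p(2), of "-1"]] by (simp add: minus_one_smult)

text \<open>The approximating test functions integrate by parts exactly; the defect of the pair is
  therefore bounded by its \<open>L^2\<close> distance to them.\<close>

lemma H0pair_weak_gradient: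
  fixes u :: "real^'d \<Rightarrow> complex"
  assumes S: "S \<in> sets lebesgue" and p: "H0pair S u g"
  shows "has_weak_gradient S u g"
  unfolding has_weak_gradient_def
proof (intro allI impI)
  fix \<psi> :: "real^'d \<Rightarrow> real" and i assume \<psi>: "test_function S \<psi>"
  obtain \<phi> where \<phi>: "\<And>n. test_function S (\<phi> n)" "(\<lambda>n. L2_norm S (\<lambda>x. u x - \<phi> n x)) \<longlonglongrightarrow> 0"
    "(\<lambda>n. L2_norm S (\<lambda>x. g x - grad (\<phi> n) x)) \<longlonglongrightarrow> 0"
    using H0pair_sequence[OF p] by blast
  note L\<psi> = test_function_L2(1)[OF \<psi> S] partial_deriv_L2[OF \<psi> S, of i]
  let ?A = "\<integral>x. partial_deriv i \<psi> x *\<^sub>R u x \<partial>lebesgue_on S" and ?B = "\<integral>x. \<psi> x *\<^sub>R (g x $ i) \<partial>lebesgue_on S"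
  let ?r = "\<lambda>n. L2_norm S (partial_deriv i \<psi>) * L2_norm S (\<lambda>x. u x - \<phi> n x) + L2_norm S \<psi> * L2_norm S (\<lambda>x. g x - grad (\<phi> n) x)"
  have "norm (?A + ?B) \<le> ?r n" for n
  proof -
    note L\<phi> = test_function_L2[OF \<phi>(1)[of n] S]
    note d1 = L2_on_diff[OF H0pair_L2(1)[OF p] L\<phi>(1)] and d2 = L2_on_diff[OF H0pair_L2(2)[OF p] L\<phi>(2)]
    note I = weak_gradient_integrable[OF S H0pair_L2[OF p] \<psi>, of i] weak_gradient_integrable[OF S L\<phi> \<psi>, of i]
      weak_gradient_integrable[OF S d1 d2 \<psi>, of i]
    have e: "(\<integral>x. partial_deriv i \<psi> x *\<^sub>R \<phi> n x \<partial>lebesgue_on S) = - (\<integral>x. \<psi> x *\<^sub>R (grad (\<phi> n) x $ i) \<partial>lebesgue_on S)"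
      by (rule test_function_integration_by_parts[OF \<psi> \<phi>(1) S])
    have "?A + ?B = (\<integral>x. partial_deriv i \<psi> x *\<^sub>R (u x - \<phi> n x) \<partial>lebesgue_on S) + (\<integral>x. \<psi> x *\<^sub>R ((g x - grad (\<phi> n) x) $ i) \<partial>lebesgue_on S)"
      using e I by (simp add: scaleR_diff_right)
    moreover have "norm (\<integral>x. partial_deriv i \<psi> x *\<^sub>R (u x - \<phi> n x) \<partial>lebesgue_on S) \<le> 1 * (L2_norm S (partial_deriv i \<psi>) * L2_norm S (\<lambda>x. u x - \<phi> n x))"
      by (rule norm_integral_L2_mult[OF L\<psi>(2) d1 _ I(5)]) auto
    moreover have "norm (\<integral>x. \<psi> x *\<^sub>R ((g x - grad (\<phi> n) x) $ i) \<partial>lebesgue_on S) \<le> 1 * (L2_norm S \<psi> * L2_norm S (\<lambda>x. g x - grad (\<phi> n) x))"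
    proof (rule norm_integral_L2_mult[OF L\<psi>(1) d2 _ I(6)])
      show "AE x in lebesgue_on S. norm (\<psi> x *\<^sub>R ((g x - grad (\<phi> n) x) $ i)) \<le> 1 * (norm (\<psi> x) * norm (g x - grad (\<phi> n) x))"
      proof (rule AE_I2)
        fix x
        have "norm ((g x - grad (\<phi> n) x) $ i) \<le> norm (g x - grad (\<phi> n) x)" by (rule Finite_Cartesian_Product.norm_nth_le)
        then show "norm (\<psi> x *\<^sub>R ((g x - grad (\<phi> n) x) $ i)) \<le> 1 * (norm (\<psi> x) * norm (g x - grad (\<phi> n) x))"
          by (simp add: mult_left_mono)
      qed
    qed simp
    ultimately show ?thesis
      using norm_triangle_ineq[of "\<integral>x. partial_deriv i \<psi> x *\<^sub>R (u x - \<phi> n x) \<partial>lebesgue_on S" "\<integral>x. \<psi> x *\<^sub>R ((g x - grad (\<phi> n) x) $ i) \<partial>lebesgue_on S"]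
      by simp
  qed
  moreover have "?r \<longlonglongrightarrow> 0"
    using tendsto_add[OF tendsto_mult_left[OF \<phi>(2)] tendsto_mult_left[OF \<phi>(3)]] by simp
  ultimately have "norm (?A + ?B) \<le> 0"
    by (intro LIMSEQ_le_const) auto
  then show "?A = - ?B" by (simp add: eq_neg_iff_add_eq_0)
qed

text \<open>Frees the norm from the representative that \<open>weak_gradient\<close> happens to
  select.\<close>

lemma H1_norm_eq:
  assumes S: "open S" and u: "L2_on S u" "L2_on S g" "has_weak_gradient S u g"
  shows "H1_norm S u = sqrt ((L2_norm S u)\<^sup>2 + (L2_norm S g)\<^sup>2)"
proof -
  have "H1_on S u" using u by (auto simp: H1_on_def)
  then have "L2_on S (weak_gradient S u)" by (rule weak_gradient_works)
  then have "L2_norm S (weak_gradient S u) = L2_norm S g"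
    using weak_gradient_AE[OF S u] u(2) by (intro L2_norm_cong_AE) (auto simp: L2_on_def)
  then show ?thesis by (simp add: H1_norm_def)
qed

text \<open>Together with \<open>H10_imp_H0pair\<close> this trades the choice inside
  \<open>weak_gradient\<close> for an explicit gradient, up to null sets. The gradients of folds and
  lifts are explicit, hence this form.\<close>

lemma H0pair_imp_H10:
  assumes S: "open S" and p: "H0pair S u g"
  shows "H10_on S u" "AE x in lebesgue_on S. weak_gradient S u x = g x"
proof -
  have Ss: "S \<in> sets lebesgue" using S by simp
  note w = H0pair_weak_gradient[OF Ss p] and L = H0pair_L2[OF p]
  show "AE x in lebesgue_on S. weak_gradient S u x = g x"
    by (rule weak_gradient_AE[OF S L w])
  obtain \<phi> where \<phi>: "\<And>n. test_function S (\<phi> n)" "(\<lambda>n. L2_norm S (\<lambda>x. u x - \<phi> n x)) \<longlonglongrightarrow> 0"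
    "(\<lambda>n. L2_norm S (\<lambda>x. g x - grad (\<phi> n) x)) \<longlonglongrightarrow> 0"
    using H0pair_sequence[OF p] by blast
  have "H1_norm S (\<lambda>x. u x - \<phi> n x) = sqrt ((L2_norm S (\<lambda>x. u x - \<phi> n x))\<^sup>2 + (L2_norm S (\<lambda>x. g x - grad (\<phi> n) x))\<^sup>2)" for n
  proof -
    have d: "H0pair S (\<lambda>x. u x - \<phi> n x) (\<lambda>x. g x - grad (\<phi> n) x)"
      by (rule H0pair_diff[OF Ss p H0pair_test[OF \<phi>(1) Ss]])
    show ?thesis by (rule H1_norm_eq[OF S H0pair_L2[OF d] H0pair_weak_gradient[OF Ss d]])
  qed
  moreover have "(\<lambda>n. sqrt ((L2_norm S (\<lambda>x. u x - \<phi> n x))\<^sup>2 + (L2_norm S (\<lambda>x. g x - grad (\<phi> n) x))\<^sup>2)) \<longlonglongrightarrow> sqrt (0\<^sup>2 + 0\<^sup>2)"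
    by (intro tendsto_intros \<phi>)
  ultimately have "(\<lambda>n. H1_norm S (\<lambda>x. u x - \<phi> n x)) \<longlonglongrightarrow> 0" by simp
  moreover have "H1_on S u" using L w by (auto simp: H1_on_def)
  ultimately show "H10_on S u" using \<phi>(1) by (auto simp: H10_on_def)
qed

lemma H10_imp_H0pair:
  assumes S: "open S" and u: "H10_on S u"
  shows "H0pair S u (weak_gradient S u)"
proof -
  have Ss: "S \<in> sets lebesgue" using S by simp
  have H1: "H1_on S u" using u by (simp add: H10_on_def)
  note w = weak_gradient_works[OF H1]
  have L: "L2_on S u" using H1 by (simp add: H1_on_def)
  obtain \<phi> where \<phi>: "\<And>n. test_function S (\<phi> n)" "(\<lambda>n. H1_norm S (\<lambda>x. u x - \<phi> n x)) \<longlonglongrightarrow> 0"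
    using u by (auto simp: H10_on_def)
  show ?thesis
    unfolding H0pair_def
  proof (intro conjI L w allI impI)
    fix \<epsilon> :: real assume "\<epsilon> > 0"
    then have "\<forall>\<^sub>F n in sequentially. H1_norm S (\<lambda>x. u x - \<phi> n x) < \<epsilon>"
      using order_tendstoD(2)[OF \<phi>(2)] by blast
    then obtain n where n: "H1_norm S (\<lambda>x. u x - \<phi> n x) < \<epsilon>"
      using eventually_happens by force
    note t = test_function_L2[OF \<phi>(1)[of n] Ss] has_weak_gradient_test[OF \<phi>(1)[of n] Ss]
    have wd: "has_weak_gradient S (\<lambda>x. u x - \<phi> n x) (\<lambda>x. weak_gradient S u x - grad (\<phi> n) x)"
      using has_weak_gradient_add[OF Ss L w L2_on_uminus[OF t(1)] L2_on_uminus[OF t(2)]]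
        has_weak_gradient_cmult[OF Ss t, of "-1"] by (simp add: minus_one_smult)
    note eq = H1_norm_eq[OF S L2_on_diff[OF L t(1)] L2_on_diff[OF w(1) t(2)] wd]
    have "L2_norm S (\<lambda>x. u x - \<phi> n x) < \<epsilon>" "L2_norm S (\<lambda>x. weak_gradient S u x - grad (\<phi> n) x) < \<epsilon>"
      using n real_sqrt_sum_squares_ge1[of "L2_norm S (\<lambda>x. u x - \<phi> n x)" "L2_norm S (\<lambda>x. weak_gradient S u x - grad (\<phi> n) x)"]
        real_sqrt_sum_squares_ge2[of "L2_norm S (\<lambda>x. weak_gradient S u x - grad (\<phi> n) x)" "L2_norm S (\<lambda>x. u x - \<phi> n x)"]
      unfolding eq by linarith+
    then show "\<exists>\<phi>. test_function S \<phi> \<and> L2_norm S (\<lambda>x. u x - \<phi> x) < \<epsilon> \<and> L2_norm S (\<lambda>x. weak_gradient S u x - grad \<phi> x) < \<epsilon>"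
      using \<phi>(1) by blast
  qed
qed

text \<open>The \<open>i\<close>-th derivative of \<open>(x $ i) * \<bar>\<phi> x\<bar>^2\<close>
  has integral zero. This expresses the integral of \<open>\<bar>\<phi> x\<bar>^2\<close> by
  \<open>\<phi>\<close> and its \<open>i\<close>-th derivative with weight
  \<open>-2 * (x $ i)\<close>, which is at most \<open>2 * \<bar>R\<bar>\<close> in modulus on
  \<open>S\<close>.\<close>

lemma test_function_poincare:
  fixes \<phi> :: "real^'d \<Rightarrow> complex"
  assumes \<phi>: "test_function S \<phi>" and S: "S \<in> sets lebesgue" and R: "S \<subseteq> cball 0 R"
  shows "L2_norm S \<phi> \<le> 2 * \<bar>R\<bar> * L2_norm S (grad \<phi>)"
proof -
  \<comment> \<open>Any single coordinate direction will do.\<close>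
  define i :: 'd where "i = undefined"
  obtain K where K: "compact K" "K \<subseteq> S" "\<And>x. x \<notin> K \<Longrightarrow> \<phi> x = 0" "\<And>x. x \<notin> K \<Longrightarrow> grad \<phi> x = 0"
    using test_function_support[OF \<phi>] by blast
  have outside: "\<phi> x = 0" if "x \<notin> S" for x using K(2,3) that by blast
  note c\<phi> = test_function_continuous[OF \<phi>]
  have cg: "continuous_on UNIV (\<lambda>x. grad \<phi> x $ i)"
    by (intro continuous_intros continuous_grad test_function_Ck[OF \<phi>])
  have cx: "continuous_on UNIV (\<lambda>x::real^'d. x $ i)" by (intro continuous_intros)
  let ?F = "\<lambda>x. (x $ i) * (\<phi> x \<bullet> \<phi> x)"
  have D: "partial_deriv i ?F x = (\<phi> x \<bullet> \<phi> x) + 2 * ((x $ i) * (\<phi> x \<bullet> (grad \<phi> x $ i)))" for x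
  proof -
    have d: "(\<phi> has_derivative frechet_derivative \<phi> (at x)) (at x)"
      using frechet_derivative_works test_function_differentiable[OF \<phi>] by blast
    have "(?F has_derivative (\<lambda>h. (x $ i) * (\<phi> x \<bullet> frechet_derivative \<phi> (at x) h + frechet_derivative \<phi> (at x) h \<bullet> \<phi> x) + (h $ i) * (\<phi> x \<bullet> \<phi> x))) (at x)"
      by (intro has_derivative_mult has_derivative_inner d bounded_linear_imp_has_derivative bounded_linear_vec_nth)
    from partial_deriv_eq[OF this] show ?thesis
      by (simp add: grad_def partial_deriv_def inner_commute)
  qed
  have c1: "continuous_on UNIV (\<lambda>x. \<phi> x \<bullet> \<phi> x)" by (intro continuous_intros c\<phi>)
  have c2: "continuous_on UNIV (\<lambda>x. (x $ i) * (\<phi> x \<bullet> (grad \<phi> x $ i)))" by (intro continuous_intros c\<phi> cg)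
  have i1: "integrable lborel (\<lambda>x. \<phi> x \<bullet> \<phi> x)"
    by (rule integrable_compact_support[OF c1 K(1)]) (simp add: K(3))
  have i2: "integrable lborel (\<lambda>x. (x $ i) * (\<phi> x \<bullet> (grad \<phi> x $ i)))"
    by (rule integrable_compact_support[OF c2 K(1)]) (simp add: K(3))
  have "0 = (\<integral>x. partial_deriv i ?F x \<partial>lborel)"
    by (rule integral_partial_deriv_eq_0[symmetric, OF Ck_on_bilinear[OF bounded_bilinear_mult Ck_on_linear[OF bounded_linear_vec_nth]
            Ck_on_bilinear[OF bounded_bilinear_inner test_function_Ck[OF \<phi>] test_function_Ck[OF \<phi>]]] K(1)]) (simp add: K(3))
  also have "\<dots> = (\<integral>x. \<phi> x \<bullet> \<phi> x \<partial>lborel) + 2 * (\<integral>x. (x $ i) * (\<phi> x \<bullet> (grad \<phi> x $ i)) \<partial>lborel)"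
    unfolding D using i1 i2 by simp
  finally have eq: "(\<integral>x. \<phi> x \<bullet> \<phi> x \<partial>lborel) = - 2 * (\<integral>x. (x $ i) * (\<phi> x \<bullet> (grad \<phi> x $ i)) \<partial>lborel)"
    by simp
  have "(L2_norm S \<phi>)\<^sup>2 = (\<integral>x. \<phi> x \<bullet> \<phi> x \<partial>lborel)"
  proof -
    have "(L2_norm S \<phi>)\<^sup>2 = (\<integral>x. \<phi> x \<bullet> \<phi> x \<partial>lebesgue_on S)"
      by (simp add: L2_norm_sq power2_norm_eq_inner)
    also have "\<dots> = (\<integral>x. \<phi> x \<bullet> \<phi> x \<partial>lborel)"
      by (rule integral_lebesgue_on_eq_lborel) (use c1 K S in \<open>auto intro!: borel_measurable_continuous_onI\<close>)
    finally show ?thesis .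
  qed
  also have "\<dots> \<le> 2 * norm (\<integral>x. (x $ i) * (\<phi> x \<bullet> (grad \<phi> x $ i)) \<partial>lborel)"
    unfolding eq by simp
  also have "(\<integral>x. (x $ i) * (\<phi> x \<bullet> (grad \<phi> x $ i)) \<partial>lborel) = (\<integral>x. (x $ i) * (\<phi> x \<bullet> (grad \<phi> x $ i)) \<partial>lebesgue_on S)"
    by (rule integral_lebesgue_on_eq_lborel[symmetric]) (simp_all add: borel_measurable_continuous_onI[OF c2] outside S)
  also have "norm \<dots> \<le> \<bar>R\<bar> * (L2_norm S \<phi> * L2_norm S (grad \<phi>))"
  proof (rule norm_integral_L2_mult[OF test_function_L2[OF \<phi> S]])
    have "L2_on S (\<lambda>x. (x $ i) *\<^sub>R \<phi> x)"
      by (rule L2_on_compact_support[OF _ K(1) _ S]) (auto intro!: continuous_intros c\<phi> simp: K(3))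
    from integrable_L2_mult[OF this L2_on_vec_nth[OF test_function_L2(2)[OF \<phi> S]] bounded_bilinear_inner]
    show "integrable (lebesgue_on S) (\<lambda>x. (x $ i) * (\<phi> x \<bullet> (grad \<phi> x $ i)))" by simp
    show "AE x in lebesgue_on S. norm ((x $ i) * (\<phi> x \<bullet> (grad \<phi> x $ i))) \<le> \<bar>R\<bar> * (norm (\<phi> x) * norm (grad \<phi> x))"
    proof (rule AE_I2)
      fix x assume "x \<in> space (lebesgue_on S)"
      then have "norm x \<le> \<bar>R\<bar>" using R by (auto simp: space_restrict_space)
      then have "\<bar>x $ i\<bar> \<le> \<bar>R\<bar>" using component_le_norm_cart[of x i] by linarith
      moreover have "\<bar>\<phi> x \<bullet> (grad \<phi> x $ i)\<bar> \<le> norm (\<phi> x) * norm (grad \<phi> x)"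
        using Cauchy_Schwarz_ineq2[of "\<phi> x" "grad \<phi> x $ i"] mult_left_mono[OF Finite_Cartesian_Product.norm_nth_le[of "grad \<phi> x" i] norm_ge_zero[of "\<phi> x"]]
        by linarith
      ultimately show "norm ((x $ i) * (\<phi> x \<bullet> (grad \<phi> x $ i))) \<le> \<bar>R\<bar> * (norm (\<phi> x) * norm (grad \<phi> x))"
        unfolding real_norm_def abs_mult by (rule mult_mono) auto
    qed
  qed simp
  finally have "L2_norm S \<phi> * L2_norm S \<phi> \<le> (2 * \<bar>R\<bar> * L2_norm S (grad \<phi>)) * L2_norm S \<phi>"
    by (simp add: power2_eq_square mult_ac)
  then show ?thesis
    using L2_norm_nonneg[of S \<phi>] L2_norm_nonneg[of S "grad \<phi>"]
    by (cases "L2_norm S \<phi> = 0") (auto simp: mult_le_cancel_right)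
qed

lemma L2_norm_tendsto:
  assumes "L2_on S g" "\<And>n. L2_on S (k n)" "(\<lambda>n. L2_norm S (\<lambda>x. g x - k n x)) \<longlonglongrightarrow> 0"
  shows "(\<lambda>n. L2_norm S (k n)) \<longlonglongrightarrow> L2_norm S g"
proof -
  have "\<bar>L2_norm S (k n) - L2_norm S g\<bar> \<le> L2_norm S (\<lambda>x. g x - k n x)" for n
    using L2_norm_le_diff[OF assms(1) assms(2)[of n]] L2_norm_le_diff[OF assms(2)[of n] assms(1)]
      L2_norm_minus_commute[of S g "k n"] by auto
  then have "(\<lambda>n. L2_norm S (k n) - L2_norm S g) \<longlonglongrightarrow> 0"
    by (intro Lim_null_comparison[OF _ assms(3)]) auto
  then show ?thesis by (simp add: LIM_zero_iff)
qed

lemma H0pair_poincare: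
  assumes p: "H0pair S u g" and S: "S \<in> sets lebesgue" and R: "S \<subseteq> cball 0 R"
  shows "L2_norm S u \<le> 2 * \<bar>R\<bar> * L2_norm S g"
proof -
  obtain \<phi> where \<phi>: "\<And>n. test_function S (\<phi> n)" "(\<lambda>n. L2_norm S (\<lambda>x. u x - \<phi> n x)) \<longlonglongrightarrow> 0"
    "(\<lambda>n. L2_norm S (\<lambda>x. g x - grad (\<phi> n) x)) \<longlonglongrightarrow> 0"
    using H0pair_sequence[OF p] by blast
  have 1: "(\<lambda>n. L2_norm S (\<phi> n)) \<longlonglongrightarrow> L2_norm S u"
    by (rule L2_norm_tendsto[OF H0pair_L2(1)[OF p] test_function_L2(1)[OF \<phi>(1) S] \<phi>(2)])
  have 2: "(\<lambda>n. 2 * \<bar>R\<bar> * L2_norm S (grad (\<phi> n))) \<longlonglongrightarrow> 2 * \<bar>R\<bar> * L2_norm S g"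
    by (intro tendsto_mult_left L2_norm_tendsto[OF H0pair_L2(2)[OF p] test_function_L2(2)[OF \<phi>(1) S] \<phi>(3)])
  show ?thesis
    by (rule LIMSEQ_le[OF 1 2]) (use test_function_poincare[OF \<phi>(1) S R] in blast)
qed

section \<open>Coercive forms\<close>

lemma LIMSEQ_of_norm_bound:
  fixes a :: "nat \<Rightarrow> 'a::real_normed_vector"
  assumes "\<And>n. norm (a n - c) \<le> b n" "b \<longlonglongrightarrow> 0"
  shows "a \<longlonglongrightarrow> c"
proof -
  have "(\<lambda>n. a n - c) \<longlonglongrightarrow> 0"
    by (rule Lim_null_comparison[OF always_eventually assms(2)]) (simp add: assms(1))
  then show ?thesis by (simp add: LIM_zero_iff)
qed

text \<open>Bilinear, without conjugation, as in the definition of weak solutions; conjugates are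
  written out where positivity is at stake.\<close>

definition bdot :: "complex^'d \<Rightarrow> complex^'d \<Rightarrow> complex" where
  "bdot v w = (\<Sum>i\<in>UNIV. v $ i * w $ i)"

lemma norm_bdot_le: "norm (bdot v w) \<le> norm v * norm w * real CARD('d)"
  for v w :: "complex^'d"
proof -
  have "norm (bdot v w) \<le> (\<Sum>i\<in>(UNIV::'d set). norm v * norm w)"
    unfolding bdot_def
    by (rule sum_norm_le) (simp add: norm_mult mult_mono Finite_Cartesian_Product.norm_nth_le)
  then show ?thesis by (simp add: mult_ac)
qed

lemma bounded_bilinear_bdot: "bounded_bilinear bdot"
proof (rule bounded_bilinear.intro)
  show "bdot (a + a') b = bdot a b + bdot a' b" for a a' b :: "complex^'d"
    by (simp add: bdot_def sum.distrib distrib_right)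
  show "bdot a (b + b') = bdot a b + bdot a b'" for a b b' :: "complex^'d"
    by (simp add: bdot_def sum.distrib distrib_left)
  show "bdot (r *\<^sub>R a) b = r *\<^sub>R bdot a b" for r and a b :: "complex^'d"
    by (simp add: bdot_def scaleR_sum_right)
  show "bdot a (r *\<^sub>R b) = r *\<^sub>R bdot a b" for r and a b :: "complex^'d"
    by (simp add: bdot_def scaleR_sum_right)
  show "\<exists>K. \<forall>a b :: complex^'d. norm (bdot a b) \<le> norm a * norm b * K"
    using norm_bdot_le by blast
qed

lemma bdot_smult_left: "bdot (c *s v) w = c * bdot v w"
  by (simp add: bdot_def sum_distrib_left mult_ac)

lemma bdot_smult_right: "bdot v (c *s w) = c * bdot v w"
  by (simp add: bdot_def sum_distrib_left mult_ac)

lemma borel_measurable_vecI: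
  fixes f :: "'a \<Rightarrow> 'b::euclidean_space^'d"
  assumes "\<And>i. (\<lambda>x. f x $ i) \<in> borel_measurable M"
  shows "f \<in> borel_measurable M"
proof -
  have "(\<lambda>x. \<Sum>i\<in>UNIV. axis i (f x $ i)) \<in> borel_measurable M"
  proof (rule borel_measurable_sum)
    fix i :: 'd
    have "continuous_on UNIV (\<lambda>z::'b. axis i z :: 'b^'d)"
      unfolding axis_def
    proof (rule continuous_on_vec_lambda)
      fix j :: 'd
      show "continuous_on UNIV (\<lambda>z::'b. if j = i then z else 0)"
        by (cases "j = i") (auto intro: continuous_intros)
    qed
    from borel_measurable_continuous_on[OF this assms] show "(\<lambda>x. axis i (f x $ i)) \<in> borel_measurable M" .
  qed
  moreover have "(\<Sum>i\<in>UNIV. axis i (v $ i)) = v" for v :: "'b^'d"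
  proof -
    have "(\<Sum>i\<in>UNIV. axis i (v $ i)) $ j = v $ j" for j
    proof -
      have "(\<Sum>i\<in>UNIV. axis i (v $ i) $ j) = (\<Sum>i\<in>UNIV. if i = j then v $ i else 0)"
        by (rule sum.cong) (auto simp: axis_def)
      then show ?thesis by simp
    qed
    then show ?thesis by (simp add: vec_eq_iff)
  qed
  ultimately show ?thesis by simp
qed

lemma borel_measurable_vec_nth:
  fixes f :: "'a \<Rightarrow> 'b::euclidean_space^'d"
  assumes "f \<in> borel_measurable M"
  shows "(\<lambda>x. f x $ i) \<in> borel_measurable M"
  by (rule borel_measurable_continuous_on[OF linear_continuous_on[OF bounded_linear_vec_nth] assms])

text \<open>Entrywise bounds suit the push-forward formula, whose entries are sums of products; the
  price is a power of the dimension in operator bounds.\<close>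

definition bounded_matrix :: "(real^'d) set \<Rightarrow> (real^'d \<Rightarrow> complex^'d^'d) \<Rightarrow> real \<Rightarrow> bool" where
  "bounded_matrix S M K \<longleftrightarrow> 0 \<le> K \<and> (\<forall>i j. (\<lambda>x. M x $ i $ j) \<in> borel_measurable (lebesgue_on S)) \<and>
     (AE x in lebesgue_on S. \<forall>i j. norm (M x $ i $ j) \<le> K)"

lemma norm_matrix_vector_le:
  fixes M :: "complex^'d^'d"
  assumes "\<And>i j. norm (M $ i $ j) \<le> K"
  shows "norm (M *v \<xi>) \<le> (real CARD('d))\<^sup>2 * K * norm \<xi>"
proof -
  have c: "norm ((M *v \<xi>) $ i) \<le> real CARD('d) * (K * norm \<xi>)" for i
  proof -
    have "norm ((M *v \<xi>) $ i) \<le> (\<Sum>j\<in>(UNIV::'d set). K * norm \<xi>)"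
      unfolding matrix_vector_mult_def vec_lambda_beta
    proof (rule sum_norm_le)
      fix j
      have "0 \<le> K" using assms norm_ge_zero order_trans by blast
      then show "norm (M $ i $ j * \<xi> $ j) \<le> K * norm \<xi>"
        using assms[of i j] Finite_Cartesian_Product.norm_nth_le[of \<xi> j] by (simp add: norm_mult mult_mono)
    qed
    then show ?thesis by simp
  qed
  have "norm (M *v \<xi>) \<le> (\<Sum>i\<in>(UNIV::'d set). real CARD('d) * (K * norm \<xi>))"
    by (rule order_trans[OF norm_vec_le_sum]) (intro sum_mono c)
  then show ?thesis by (simp add: power2_eq_square mult_ac)
qed

lemma bounded_matrix_L2:
  fixes M :: "real^'d \<Rightarrow> complex^'d^'d"
  assumes M: "bounded_matrix S M K" and g: "L2_on S g"
  shows "L2_on S (\<lambda>x. M x *v g x)"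
    and "L2_norm S (\<lambda>x. M x *v g x) \<le> (real CARD('d))\<^sup>2 * K * L2_norm S g"
proof -
  have m: "(\<lambda>x. M x *v g x) \<in> borel_measurable (lebesgue_on S)"
  proof (rule borel_measurable_vecI)
    fix i
    have "(\<lambda>x. \<Sum>j\<in>UNIV. M x $ i $ j * g x $ j) \<in> borel_measurable (lebesgue_on S)"
      using M by (intro borel_measurable_sum borel_measurable_times borel_measurable_vec_nth[OF L2_on_measurable[OF g]])
        (auto simp: bounded_matrix_def)
    then show "(\<lambda>x. (M x *v g x) $ i) \<in> borel_measurable (lebesgue_on S)"
      by (simp add: matrix_vector_mult_def)
  qed
  have le: "AE x in lebesgue_on S. norm (M x *v g x) \<le> ((real CARD('d))\<^sup>2 * K) * norm (g x)"
  proof -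
    have "AE x in lebesgue_on S. \<forall>i j. norm (M x $ i $ j) \<le> K" using M by (simp add: bounded_matrix_def)
    then show ?thesis by eventually_elim (simp add: norm_matrix_vector_le)
  qed
  show "L2_on S (\<lambda>x. M x *v g x)" by (rule L2_on_bound[OF m g le])
  show "L2_norm S (\<lambda>x. M x *v g x) \<le> (real CARD('d))\<^sup>2 * K * L2_norm S g"
    by (rule L2_norm_bound[OF m g _ le]) (use M in \<open>auto simp: bounded_matrix_def\<close>)
qed

definition form :: "(real^'d) set \<Rightarrow> (real^'d \<Rightarrow> complex^'d^'d) \<Rightarrow> (real^'d \<Rightarrow> complex^'d) \<Rightarrow> (real^'d \<Rightarrow> complex^'d) \<Rightarrow> complex" where
  "form S M g k = (\<integral>x. bdot (M x *v g x) (k x) \<partial>lebesgue_on S)"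

lemma form_integrable:
  assumes "bounded_matrix S M K" "L2_on S g" "L2_on S k"
  shows "integrable (lebesgue_on S) (\<lambda>x. bdot (M x *v g x) (k x))"
  by (rule integrable_L2_mult[OF bounded_matrix_L2(1)[OF assms(1,2)] assms(3) bounded_bilinear_bdot])

text \<open>The cube of the dimension is its square from the matrix-vector product times one more
  factor from \<open>bdot\<close>.\<close>

lemma norm_form_le:
  fixes M :: "real^'d \<Rightarrow> complex^'d^'d"
  assumes M: "bounded_matrix S M K" and g: "L2_on S g" and k: "L2_on S k"
  shows "norm (form S M g k) \<le> (real CARD('d)^3 * K) * (L2_norm S g * L2_norm S k)"
proof -
  have "norm (form S M g k) \<le> real CARD('d) * (L2_norm S (\<lambda>x. M x *v g x) * L2_norm S k)"
    unfolding form_def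
    by (rule norm_integral_L2_mult[OF bounded_matrix_L2(1)[OF M g] k _ form_integrable[OF M g k]])
       (auto intro!: order_trans[OF norm_bdot_le] simp: mult_ac)
  also have "\<dots> \<le> real CARD('d) * (((real CARD('d))\<^sup>2 * K * L2_norm S g) * L2_norm S k)"
    by (intro mult_left_mono mult_right_mono bounded_matrix_L2(2)[OF M g]) auto
  also have "\<dots> = (real CARD('d)^3 * K) * (L2_norm S g * L2_norm S k)"
    by (simp add: power2_eq_square power3_eq_cube mult_ac)
  finally show ?thesis .
qed

lemma form_diff_left:
  assumes "bounded_matrix S M K" "L2_on S g" "L2_on S g'" "L2_on S k"
  shows "form S M (\<lambda>x. g x - g' x) k = form S M g k - form S M g' k"
  unfolding form_def
  using form_integrable[OF assms(1,2,4)] form_integrable[OF assms(1,3,4)]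
  by (simp add: matrix_vector_mult_diff_distrib bounded_bilinear.diff_left[OF bounded_bilinear_bdot])

lemma form_diff_right:
  assumes "bounded_matrix S M K" "L2_on S g" "L2_on S k" "L2_on S k'"
  shows "form S M g (\<lambda>x. k x - k' x) = form S M g k - form S M g k'"
  unfolding form_def
  using form_integrable[OF assms(1,2,3)] form_integrable[OF assms(1,2,4)]
  by (simp add: bounded_bilinear.diff_right[OF bounded_bilinear_bdot])

lemma form_add_right:
  assumes "bounded_matrix S M K" "L2_on S g" "L2_on S k" "L2_on S k'"
  shows "form S M g (\<lambda>x. k x + k' x) = form S M g k + form S M g k'"
  unfolding form_def
  using form_integrable[OF assms(1,2,3)] form_integrable[OF assms(1,2,4)]
  by (simp add: bounded_bilinear.add_right[OF bounded_bilinear_bdot])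

lemma form_smult_right: "form S M g (\<lambda>x. c *s k x) = c * form S M g k"
  by (simp add: form_def bdot_smult_right)

lemma form_smult_left: "form S M (\<lambda>x. c *s g x) k = c * form S M g k"
  by (simp add: form_def bdot_smult_left vector_scalar_commute)

lemma form_cong_AE:
  assumes "bounded_matrix S M K" "L2_on S g" "L2_on S g'" "L2_on S k"
    and "AE x in lebesgue_on S. g x = g' x"
  shows "form S M g k = form S M g' k"
  unfolding form_def
proof (rule integral_cong_AE)
  show "AE x in lebesgue_on S. bdot (M x *v g x) (k x) = bdot (M x *v g' x) (k x)"
    using assms(5) by eventually_elim simp
qed (use form_integrable[OF assms(1,2,4)] form_integrable[OF assms(1,3,4)] in auto)

lemma form_tendsto_right:
  fixes M :: "real^'d \<Rightarrow> complex^'d^'d"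
  assumes M: "bounded_matrix S M K" and g: "L2_on S g" and k: "L2_on S k" "\<And>n. L2_on S (k' n)"
    and l: "(\<lambda>n. L2_norm S (\<lambda>x. k x - k' n x)) \<longlonglongrightarrow> 0"
  shows "(\<lambda>n. form S M g (k' n)) \<longlonglongrightarrow> form S M g k"
proof -
  let ?C = "real CARD('d)^3 * K"
  have "norm (form S M g (k' n) - form S M g k) \<le> ?C * (L2_norm S g * L2_norm S (\<lambda>x. k x - k' n x))" for n
  proof -
    have "norm (form S M g (k' n) - form S M g k) = norm (form S M g (\<lambda>x. k x - k' n x))"
      by (simp add: form_diff_right[OF M g k(1) k(2)] norm_minus_commute)
    also have "\<dots> \<le> ?C * (L2_norm S g * L2_norm S (\<lambda>x. k x - k' n x))"
      by (rule norm_form_le[OF M g L2_on_diff[OF k(1) k(2)]])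
    finally show ?thesis .
  qed
  moreover have "(\<lambda>n. ?C * (L2_norm S g * L2_norm S (\<lambda>x. k x - k' n x))) \<longlonglongrightarrow> 0"
    by (rule tendsto_mult_right_zero[OF tendsto_mult_right_zero[OF l]])
  ultimately show ?thesis by (rule LIMSEQ_of_norm_bound)
qed

lemma form_tendsto_left:
  fixes M :: "real^'d \<Rightarrow> complex^'d^'d"
  assumes M: "bounded_matrix S M K" and g: "L2_on S g" "\<And>n. L2_on S (g' n)" and k: "L2_on S k"
    and l: "(\<lambda>n. L2_norm S (\<lambda>x. g x - g' n x)) \<longlonglongrightarrow> 0"
  shows "(\<lambda>n. form S M (g' n) k) \<longlonglongrightarrow> form S M g k"
proof -
  let ?C = "real CARD('d)^3 * K"
  have "norm (form S M (g' n) k - form S M g k) \<le> ?C * (L2_norm S (\<lambda>x. g x - g' n x) * L2_norm S k)" for n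
  proof -
    have "norm (form S M (g' n) k - form S M g k) = norm (form S M (\<lambda>x. g x - g' n x) k)"
      by (simp add: form_diff_left[OF M g(1) g(2) k] norm_minus_commute)
    also have "\<dots> \<le> ?C * (L2_norm S (\<lambda>x. g x - g' n x) * L2_norm S k)"
      by (rule norm_form_le[OF M L2_on_diff[OF g(1) g(2)] k])
    finally show ?thesis .
  qed
  moreover have "(\<lambda>n. ?C * (L2_norm S (\<lambda>x. g x - g' n x) * L2_norm S k)) \<longlonglongrightarrow> 0"
    by (rule tendsto_mult_right_zero[OF tendsto_mult_left_zero[OF l]])
  ultimately show ?thesis by (rule LIMSEQ_of_norm_bound)
qed

section \<open>Weak formulations\<close>

definition pairing :: "(real^'d) set \<Rightarrow> (real^'d \<Rightarrow> complex) \<Rightarrow> (real^'d \<Rightarrow> complex) \<Rightarrow> complex" where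
  "pairing S f u = (\<integral>x. f x * u x \<partial>lebesgue_on S)"

lemma pairing_integrable:
  "L2_on S f \<Longrightarrow> L2_on S u \<Longrightarrow> integrable (lebesgue_on S) (\<lambda>x. f x * u x :: complex)"
  by (rule integrable_L2_mult[OF _ _ bounded_bilinear_mult])

lemma norm_pairing_le:
  assumes "L2_on S f" "L2_on S u"
  shows "norm (pairing S f u) \<le> L2_norm S f * L2_norm S u"
  unfolding pairing_def
  using norm_integral_L2_mult[OF assms zero_le_one pairing_integrable[OF assms]] by (simp add: norm_mult)

lemma pairing_tendsto:
  assumes f: "L2_on S f" and u: "L2_on S u" "\<And>n. L2_on S (v n)" and l: "(\<lambda>n. L2_norm S (\<lambda>x. u x - v n x)) \<longlonglongrightarrow> 0"
  shows "(\<lambda>n. pairing S f (v n)) \<longlonglongrightarrow> pairing S f u"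
proof -
  have "norm (pairing S f (v n) - pairing S f u) \<le> L2_norm S f * L2_norm S (\<lambda>x. u x - v n x)" for n
  proof -
    have "pairing S f (v n) - pairing S f u = - pairing S f (\<lambda>x. u x - v n x)"
      unfolding pairing_def using pairing_integrable[OF f u(1)] pairing_integrable[OF f u(2)]
      by (simp add: right_diff_distrib)
    then show ?thesis using norm_pairing_le[OF f L2_on_diff[OF u(1) u(2)]] by simp
  qed
  moreover have "(\<lambda>n. L2_norm S f * L2_norm S (\<lambda>x. u x - v n x)) \<longlonglongrightarrow> 0"
    by (rule tendsto_mult_right_zero[OF l])
  ultimately show ?thesis by (rule LIMSEQ_of_norm_bound)
qed

text \<open>Test functions may be taken complex valued, since the form is bilinear (not sesquilinear).\<close>

definition weak_sol :: "(real^'d) set \<Rightarrow> (real^'d \<Rightarrow> complex^'d^'d) \<Rightarrow> (real^'d \<Rightarrow> complex) \<Rightarrow> (real^'d \<Rightarrow> complex^'d) \<Rightarrow> bool" where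
  "weak_sol S M f g \<longleftrightarrow> (\<forall>\<phi>. test_function S \<phi> \<longrightarrow> form S M g (grad \<phi>) = - pairing S f \<phi>)"

lemma H10_solution_iff:
  fixes M :: "real^'d \<Rightarrow> complex^'d^'d"
  assumes S: "open S" and M: "bounded_matrix S M K" and f: "L2_on S f"
  shows "H10_solution S M f u \<longleftrightarrow> H10_on S u \<and> weak_sol S M f (weak_gradient S u)"
proof (cases "H10_on S u")
  case True
  have Ss: "S \<in> sets lebesgue" using S by simp
  let ?g = "weak_gradient S u"
  have g: "L2_on S ?g" using H0pair_L2(2)[OF H10_imp_H0pair[OF S True]] .
  have eq: "(\<integral>x. (\<Sum>i\<in>UNIV. (M x *v ?g x) $ i * complex_of_real (partial_deriv i \<phi> x)) \<partial>lebesgue_on S)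
      = form S M ?g (grad (\<lambda>x. complex_of_real (\<phi> x)))" if "test_function S \<phi>" for \<phi>
    unfolding form_def bdot_def test_function_linear(2)[OF that bounded_linear_of_real]
    by (simp add: grad_def)
  show ?thesis
  proof
    assume sol: "H10_solution S M f u"
    have real: "form S M ?g (grad (\<lambda>x. complex_of_real (\<phi> x))) = - pairing S f (\<lambda>x. complex_of_real (\<phi> x))"
      if "test_function S \<phi>" for \<phi>
      using sol that eq[OF that] by (simp add: H10_solution_def pairing_def)
    have "form S M ?g (grad \<phi>) = - pairing S f \<phi>" if \<phi>: "test_function S \<phi>" for \<phi>
    proof -
      let ?r = "\<lambda>x. complex_of_real (Re (\<phi> x))" and ?i = "\<lambda>x. complex_of_real (Im (\<phi> x))"
      note tR = test_function_linear(1)[OF \<phi> bounded_linear_Re] and tI = test_function_linear(1)[OF \<phi> bounded_linear_Im]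
      note tr = test_function_linear(1)[OF tR bounded_linear_of_real[where 'a = complex]]
        and ti = test_function_linear(1)[OF tI bounded_linear_of_real[where 'a = complex]]
      have gd: "grad \<phi> = (\<lambda>x. grad ?r x + \<i> *s grad ?i x)"
        by (auto simp: fun_eq_iff vec_eq_iff test_function_linear(2)[OF tR bounded_linear_of_real]
              test_function_linear(2)[OF tI bounded_linear_of_real]
              test_function_linear(2)[OF \<phi> bounded_linear_Re] test_function_linear(2)[OF \<phi> bounded_linear_Im]
              complex_eq_iff)
      note L = test_function_L2[OF tr Ss] test_function_L2[OF ti Ss]
      have Li: "L2_on S (\<lambda>x. \<i> *s grad ?i x)"
        using H0pair_L2(2)[OF H0pair_cmult[OF Ss H0pair_test[OF ti Ss], of \<i>]] .
      have "form S M ?g (grad \<phi>) = form S M ?g (grad ?r) + \<i> * form S M ?g (grad ?i)"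
        unfolding gd by (simp add: form_add_right[OF M g L(2) Li] form_smult_right)
      also have "\<dots> = - pairing S f ?r - \<i> * pairing S f ?i"
        by (simp add: real[OF tR] real[OF tI])
      also have "\<dots> = - pairing S f \<phi>"
      proof -
        have "pairing S f \<phi> = (\<integral>x. f x * ?r x + \<i> * (f x * ?i x) \<partial>lebesgue_on S)"
          unfolding pairing_def
          by (intro Bochner_Integration.integral_cong) (auto simp: complex_eq_iff algebra_simps)
        also have "\<dots> = pairing S f ?r + \<i> * pairing S f ?i"
          unfolding pairing_def using pairing_integrable[OF f L(1)] pairing_integrable[OF f L(3)] by simp
        finally show ?thesis by simp
      qed
      finally show ?thesis .
    qed
    then show "H10_on S u \<and> weak_sol S M f ?g" using True by (simp add: weak_sol_def)
  next
    assume "H10_on S u \<and> weak_sol S M f ?g"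
    then have sol: "weak_sol S M f ?g" by blast
    show "H10_solution S M f u"
      unfolding H10_solution_def
    proof (intro conjI allI impI True)
      fix \<phi> :: "real^'d \<Rightarrow> real" assume \<phi>: "test_function S \<phi>"
      note t = test_function_linear(1)[OF \<phi> bounded_linear_of_real[where 'a = complex]]
      show "(\<integral>x. (\<Sum>i\<in>UNIV. (M x *v ?g x) $ i * complex_of_real (partial_deriv i \<phi> x)) \<partial>lebesgue_on S)
          = - (\<integral>x. f x * complex_of_real (\<phi> x) \<partial>lebesgue_on S)"
        unfolding eq[OF \<phi>] using sol t unfolding weak_sol_def pairing_def by blast
    qed
  qed
qed (simp add: H10_solution_def)

text \<open>Density of test functions in \<open>H^1_0\<close>. This is what admits the lift of a
  test function, which is not smooth, as a test in the equation.\<close>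

lemma weak_sol_H0pair:
  assumes S: "S \<in> sets lebesgue" and M: "bounded_matrix S M K" and f: "L2_on S f" and g: "L2_on S g"
    and sol: "weak_sol S M f g" and p: "H0pair S v k"
  shows "form S M g k = - pairing S f v"
proof -
  obtain \<phi> where \<phi>: "\<And>n. test_function S (\<phi> n)" "(\<lambda>n. L2_norm S (\<lambda>x. v x - \<phi> n x)) \<longlonglongrightarrow> 0"
    "(\<lambda>n. L2_norm S (\<lambda>x. k x - grad (\<phi> n) x)) \<longlonglongrightarrow> 0"
    using H0pair_sequence[OF p] by blast
  have 1: "(\<lambda>n. form S M g (grad (\<phi> n))) \<longlonglongrightarrow> form S M g k"
    by (rule form_tendsto_right[OF M g H0pair_L2(2)[OF p] test_function_L2(2)[OF \<phi>(1) S] \<phi>(3)])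
  have 2: "(\<lambda>n. - pairing S f (\<phi> n)) \<longlonglongrightarrow> - pairing S f v"
    by (intro tendsto_minus pairing_tendsto[OF f H0pair_L2(1)[OF p] test_function_L2(1)[OF \<phi>(1) S] \<phi>(2)])
  have "form S M g (grad (\<phi> n)) = - pairing S f (\<phi> n)" for n
    using sol \<phi>(1) by (simp add: weak_sol_def)
  then show ?thesis using LIMSEQ_unique[OF 1] 2 by simp
qed

text \<open>The factor \<open>\<theta>\<close> rotates the form: a coefficient whose real part
  changes sign can still be positive definite after such a rotation.\<close>

definition coercive :: "(real^'d) set \<Rightarrow> (real^'d \<Rightarrow> complex^'d^'d) \<Rightarrow> complex \<Rightarrow> real \<Rightarrow> bool" where
  "coercive S M \<theta> \<mu> \<longleftrightarrow> \<mu> > 0 \<and>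
     (AE x in lebesgue_on S. \<forall>\<xi>. \<mu> * (norm \<xi>)\<^sup>2 \<le> Re (\<theta> * bdot (M x *v \<xi>) (\<chi> i. cnj (\<xi> $ i))))"

text \<open>The a priori estimate of Lax-Milgram type: testing with the conjugate of the function
  itself gives \<open>\<mu> * \<parallel>g\<parallel>^2 \<le> \<bar>\<theta>\<bar> * e *
  \<parallel>g\<parallel>\<close>. The conjugate is reached through approximating test functions,
  since the hypothesis speaks only of those.\<close>

lemma coercive_bound:
  fixes M :: "real^'d \<Rightarrow> complex^'d^'d"
  assumes S: "S \<in> sets lebesgue" and M: "bounded_matrix S M K" and co: "coercive S M \<theta> \<mu>"
    and p: "H0pair S w g" and e: "e \<ge> 0"
    and le: "\<And>\<phi>. test_function S \<phi> \<Longrightarrow> norm (form S M g (grad \<phi>)) \<le> e * L2_norm S (grad \<phi>)"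
  shows "L2_norm S g \<le> norm \<theta> * e / \<mu>"
proof -
  let ?k = "\<lambda>x. \<chi> i. cnj (g x $ i)"
  have pc: "H0pair S (\<lambda>x. cnj (w x)) ?k" by (rule H0pair_linear[OF S p bounded_linear_cnj])
  obtain \<phi> where \<phi>: "\<And>n. test_function S (\<phi> n)"
    "(\<lambda>n. L2_norm S (\<lambda>x. ?k x - grad (\<phi> n) x)) \<longlonglongrightarrow> 0"
    using H0pair_sequence[OF pc] by blast
  note g = H0pair_L2(2)[OF p] and k = H0pair_L2(2)[OF pc]
  have 1: "(\<lambda>n. norm (form S M g (grad (\<phi> n)))) \<longlonglongrightarrow> norm (form S M g ?k)"
    by (intro tendsto_norm form_tendsto_right[OF M g k test_function_L2(2)[OF \<phi>(1) S] \<phi>(2)])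
  have 2: "(\<lambda>n. e * L2_norm S (grad (\<phi> n))) \<longlonglongrightarrow> e * L2_norm S ?k"
    by (intro tendsto_mult_left L2_norm_tendsto[OF k test_function_L2(2)[OF \<phi>(1) S] \<phi>(2)])
  have "norm (form S M g ?k) \<le> e * L2_norm S ?k"
    by (rule LIMSEQ_le[OF 1 2]) (use le[OF \<phi>(1)] in blast)
  also have "L2_norm S ?k = L2_norm S g"
    by (simp add: L2_norm_def norm_vec_def)
  finally have fle: "norm (form S M g ?k) \<le> e * L2_norm S g" .
  have mu: "\<mu> > 0" using co by (simp add: coercive_def)
  have i: "integrable (lebesgue_on S) (\<lambda>x. bdot (M x *v g x) (?k x))"
    by (rule form_integrable[OF M g k])
  have "\<mu> * (L2_norm S g)\<^sup>2 = (\<integral>x. \<mu> * (norm (g x))\<^sup>2 \<partial>lebesgue_on S)"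
    by (simp add: L2_norm_sq)
  also have "\<dots> \<le> (\<integral>x. Re (\<theta> * bdot (M x *v g x) (?k x)) \<partial>lebesgue_on S)"
  proof (rule integral_mono_AE)
    show "integrable (lebesgue_on S) (\<lambda>x. \<mu> * (norm (g x))\<^sup>2)" using g by (simp add: L2_on_def)
    show "integrable (lebesgue_on S) (\<lambda>x. Re (\<theta> * bdot (M x *v g x) (?k x)))"
      using i by (intro integrable_Re) simp
    have "AE x in lebesgue_on S. \<forall>\<xi>. \<mu> * (norm \<xi>)\<^sup>2 \<le> Re (\<theta> * bdot (M x *v \<xi>) (\<chi> i. cnj (\<xi> $ i)))"
      using co by (simp add: coercive_def)
    then show "AE x in lebesgue_on S. \<mu> * (norm (g x))\<^sup>2 \<le> Re (\<theta> * bdot (M x *v g x) (?k x))"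
      by eventually_elim blast
  qed
  also have "\<dots> = Re (\<theta> * form S M g ?k)"
    unfolding form_def using i by (subst integral_Re) auto
  also have "\<dots> \<le> norm \<theta> * norm (form S M g ?k)"
    using complex_Re_le_cmod[of "\<theta> * form S M g ?k"] by (simp add: norm_mult)
  also have "\<dots> \<le> norm \<theta> * (e * L2_norm S g)"
    using fle by (intro mult_left_mono) auto
  finally have "(\<mu> * L2_norm S g) * L2_norm S g \<le> (norm \<theta> * e) * L2_norm S g"
    by (simp add: power2_eq_square mult_ac)
  then have "\<mu> * L2_norm S g \<le> norm \<theta> * e"
    using L2_norm_nonneg[of S g] e by (cases "L2_norm S g = 0") (auto simp: mult_le_cancel_right)
  then show ?thesis using mu by (simp add: field_simps)
qed

text \<open>The difference satisfies the a priori bound with \<open>e = 0\<close>; the Poincare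
  inequality passes from gradients to functions.\<close>

lemma coercive_unique:
  fixes M :: "real^'d \<Rightarrow> complex^'d^'d"
  assumes S: "open S" "S \<subseteq> cball 0 R" and M: "bounded_matrix S M K" and co: "coercive S M \<theta> \<mu>" and f: "L2_on S f"
    and p: "H0pair S u g" "weak_sol S M f g" and q: "H0pair S v k" "weak_sol S M f k"
  shows "AE x in lebesgue_on S. u x = v x" "AE x in lebesgue_on S. g x = k x"
proof -
  have Ss: "S \<in> sets lebesgue" using S by simp
  have d: "H0pair S (\<lambda>x. u x - v x) (\<lambda>x. g x - k x)" by (rule H0pair_diff[OF Ss p(1) q(1)])
  have "L2_norm S (\<lambda>x. g x - k x) \<le> norm \<theta> * 0 / \<mu>"
  proof (rule coercive_bound[OF Ss M co d order_refl])
    fix \<phi> :: "real^'d \<Rightarrow> complex" assume \<phi>: "test_function S \<phi>"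
    show "norm (form S M (\<lambda>x. g x - k x) (grad \<phi>)) \<le> 0 * L2_norm S (grad \<phi>)"
      using p(2) q(2) \<phi> form_diff_left[OF M H0pair_L2(2)[OF p(1)] H0pair_L2(2)[OF q(1)] test_function_L2(2)[OF \<phi> Ss]]
      by (simp add: weak_sol_def)
  qed
  then have g0: "L2_norm S (\<lambda>x. g x - k x) = 0" using L2_norm_nonneg[of S "\<lambda>x. g x - k x"] by simp
  moreover have "L2_norm S (\<lambda>x. u x - v x) \<le> 2 * \<bar>R\<bar> * L2_norm S (\<lambda>x. g x - k x)"
    by (rule H0pair_poincare[OF d Ss S(2)])
  ultimately have u0: "L2_norm S (\<lambda>x. u x - v x) = 0"
    using L2_norm_nonneg[of S "\<lambda>x. u x - v x"] by simp
  show "AE x in lebesgue_on S. u x = v x"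
    using L2_norm_eq_0[OF H0pair_L2(1)[OF d] u0] by simp
  show "AE x in lebesgue_on S. g x = k x"
    using L2_norm_eq_0[OF H0pair_L2(2)[OF d] g0] by simp
qed

section \<open>Change of variables\<close>

text \<open>For bijective \<open>\<sigma>\<close> an isometry between coordinate spaces over
  different index types. It preserves Lebesgue measure, and conjugation by it preserves
  determinants.\<close>

definition reindex :: "('m \<Rightarrow> 'd) \<Rightarrow> 'a^'d \<Rightarrow> 'a^'m" where
  "reindex \<sigma> x = (\<chi> j. x $ \<sigma> j)"

lemma reindex_inv:
  assumes "bij \<sigma>"
  shows "reindex (inv \<sigma>) (reindex \<sigma> x) = x" "reindex \<sigma> (reindex (inv \<sigma>) y) = y"
  using assms by (auto simp: reindex_def vec_eq_iff bij_is_surj surj_f_inv_f bij_is_inj)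

lemma bounded_linear_reindex:
  "bounded_linear (reindex \<sigma> :: real^'d \<Rightarrow> real^'m)"
  unfolding linear_conv_bounded_linear[symmetric]
  by (rule linearI) (auto simp: reindex_def vec_eq_iff)

text \<open>A transposition conjugated by a bijection is again a transposition, so the length of the
  product, and with it the parity, is kept.\<close>

lemma swapidseq_conj:
  assumes "swapidseq n p" and \<sigma>: "bij (\<sigma> :: 'm \<Rightarrow> 'd)"
  shows "swapidseq n (inv \<sigma> \<circ> p \<circ> \<sigma>)"
  using assms(1)
proof induction
  case id
  then show ?case using \<sigma> by (simp add: bij_is_inj fun_eq_iff)
next
  case (comp_Suc n p a b)
  have "inv \<sigma> \<circ> (Transposition.transpose a b \<circ> p) \<circ> \<sigma> = Transposition.transpose (inv \<sigma> a) (inv \<sigma> b) \<circ> (inv \<sigma> \<circ> p \<circ> \<sigma>)"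
  proof
    fix x
    have "inv \<sigma> (Transposition.transpose a b z) = Transposition.transpose (inv \<sigma> a) (inv \<sigma> b) (inv \<sigma> z)" for z
      using inj_eq[OF bij_is_inj[OF bij_imp_bij_inv[OF \<sigma>]]] by (auto simp: Transposition.transpose_def)
    then show "(inv \<sigma> \<circ> (Transposition.transpose a b \<circ> p) \<circ> \<sigma>) x = (Transposition.transpose (inv \<sigma> a) (inv \<sigma> b) \<circ> (inv \<sigma> \<circ> p \<circ> \<sigma>)) x"
      by simp
  qed
  moreover have "inv \<sigma> a \<noteq> inv \<sigma> b"
    using comp_Suc.hyps inj_eq[OF bij_is_inj[OF bij_imp_bij_inv[OF \<sigma>]]] by blast
  ultimately show ?case using comp_Suc.IH swapidseq.comp_Suc by metis
qed

lemma sign_conj: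
  assumes "p permutes (UNIV :: 'd::finite set)" and \<sigma>: "bij (\<sigma> :: 'm \<Rightarrow> 'd)"
  shows "sign (inv \<sigma> \<circ> p \<circ> \<sigma>) = sign p"
proof -
  have "permutation p" using assms(1) permutation_permutes finite by blast
  then obtain n where n: "swapidseq n p" by (auto simp: permutation_def)
  have "evenperm p = even n" "evenperm (inv \<sigma> \<circ> p \<circ> \<sigma>) = even n"
    using evenperm_unique[OF n] evenperm_unique[OF swapidseq_conj[OF n \<sigma>]] by auto
  then show ?thesis by (simp add: sign_def)
qed

text \<open>Conjugation by \<open>\<sigma>\<close> is a sign-preserving bijection between the
  permutations of the two index types and matches the terms of the Leibniz formula.\<close>

lemma det_reindex:
  fixes A :: "real^'d^'d" and \<sigma> :: "'m::finite \<Rightarrow> 'd"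
  assumes \<sigma>: "bij \<sigma>"
  shows "det (\<chi> j k. A $ \<sigma> j $ \<sigma> k) = det A"
proof -
  let ?c = "\<lambda>p. inv \<sigma> \<circ> p \<circ> \<sigma>"
  have s: "\<sigma> (inv \<sigma> z) = z" "inv \<sigma> (\<sigma> y) = y" for z y
    using \<sigma> by (auto simp: bij_is_surj surj_f_inv_f bij_is_inj)
  have bij: "bij_betw ?c {p. p permutes (UNIV :: 'd set)} {p. p permutes (UNIV :: 'm set)}"
  proof (rule bij_betw_byWitness[where f' = "\<lambda>q. \<sigma> \<circ> q \<circ> inv \<sigma>"])
    show "\<forall>p\<in>{p. p permutes (UNIV :: 'd set)}. \<sigma> \<circ> (?c p) \<circ> inv \<sigma> = p"
      by (auto simp: fun_eq_iff s)
    show "\<forall>q\<in>{p. p permutes (UNIV :: 'm set)}. ?c (\<sigma> \<circ> q \<circ> inv \<sigma>) = q"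
      by (auto simp: fun_eq_iff s)
    show "?c ` {p. p permutes (UNIV :: 'd set)} \<subseteq> {p. p permutes (UNIV :: 'm set)}"
      using \<sigma> by (auto intro!: bij_imp_permutes bij_comp bij_imp_bij_inv dest: permutes_bij)
    show "(\<lambda>q. \<sigma> \<circ> q \<circ> inv \<sigma>) ` {p. p permutes (UNIV :: 'm set)} \<subseteq> {p. p permutes (UNIV :: 'd set)}"
      using \<sigma> by (auto intro!: bij_imp_permutes bij_comp bij_imp_bij_inv dest: permutes_bij)
  qed
  have "det (\<chi> j k. A $ \<sigma> j $ \<sigma> k) = (\<Sum>q | q permutes (UNIV::'m set). of_int (sign q) * (\<Prod>j\<in>UNIV. A $ \<sigma> j $ \<sigma> (q j)))"
    by (simp add: det_def)
  also have "\<dots> = (\<Sum>p | p permutes (UNIV::'d set). of_int (sign (?c p)) * (\<Prod>j\<in>UNIV. A $ \<sigma> j $ \<sigma> (?c p j)))"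
    by (rule sum.reindex_bij_betw[OF bij, symmetric])
  also have "\<dots> = (\<Sum>p | p permutes (UNIV::'d set). of_int (sign p) * (\<Prod>i\<in>UNIV. A $ i $ p i))"
  proof (rule sum.cong[OF refl])
    fix p assume "p \<in> {p. p permutes (UNIV::'d set)}"
    then have p: "p permutes (UNIV::'d set)" by simp
    have "(\<Prod>j\<in>UNIV. A $ \<sigma> j $ \<sigma> (?c p j)) = (\<Prod>j\<in>UNIV. A $ \<sigma> j $ p (\<sigma> j))"
      by (simp add: s)
    also have "\<dots> = (\<Prod>i\<in>UNIV. A $ i $ p i)"
      by (rule prod.reindex_bij_betw[OF \<sigma>])
    finally show "of_int (sign (?c p)) * (\<Prod>j\<in>UNIV. A $ \<sigma> j $ \<sigma> (?c p j)) = of_int (sign p) * (\<Prod>i\<in>UNIV. A $ i $ p i)"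
      by (simp add: sign_conj[OF p \<sigma>])
  qed
  also have "\<dots> = det A" by (simp add: det_def)
  finally show ?thesis .
qed

text \<open>Lebesgue measure is determined by its values on boxes; reindexing takes boxes to boxes
  and permutes their side lengths.\<close>

lemma distr_lborel_reindex:
  fixes \<sigma> :: "'m::finite \<Rightarrow> 'd::finite"
  assumes \<sigma>: "bij \<sigma>"
  shows "distr lborel borel (reindex \<sigma>) = (lborel :: (real^'m) measure)"
proof (rule lborel_eqI[symmetric])
  have m[measurable]: "(reindex \<sigma> :: real^'d \<Rightarrow> real^'m) \<in> borel \<rightarrow>\<^sub>M borel"
    by (intro borel_measurable_continuous_onI linear_continuous_on bounded_linear_reindex)
  show "sets (distr lborel borel (reindex \<sigma>)) = sets (borel :: (real^'m) measure)" by simp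
  fix l u :: "real^'m" assume lu: "\<And>b. b \<in> Basis \<Longrightarrow> l \<bullet> b \<le> u \<bullet> b"
  have s: "\<sigma> (inv \<sigma> z) = z" "inv \<sigma> (\<sigma> y) = y" for z y
    using \<sigma> by (auto simp: bij_is_surj surj_f_inv_f bij_is_inj)
  let ?r = "reindex (inv \<sigma>) :: real^'m \<Rightarrow> real^'d"
  have le: "l $ j \<le> u $ j" for j using lu[of "axis j 1"] by (simp add: inner_axis)
  have pre: "reindex \<sigma> -` box l u = box (?r l) (?r u)"
    unfolding mem_box_cart set_eq_iff vimage_eq reindex_def vec_lambda_beta by (metis s)
  have prodB: "(\<Prod>b\<in>Basis. (v :: real^'k::finite) \<bullet> b) = (\<Prod>i\<in>UNIV. v $ i)" for v :: "real^'k"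
  proof -
    have B: "(Basis :: (real^'k) set) = (\<lambda>i. axis i 1) ` UNIV" by (auto simp: Basis_vec_def)
    have "inj (\<lambda>i::'k. axis i (1::real))" by (auto simp: inj_on_def axis_eq_axis)
    then show ?thesis unfolding B by (subst prod.reindex) (auto simp: inner_axis)
  qed
  have "emeasure (distr lborel borel (reindex \<sigma>)) (box l u) = emeasure lborel (box (?r l) (?r u))"
    by (subst emeasure_distr) (auto simp: pre)
  also have "\<dots> = ennreal (\<Prod>b\<in>Basis. (?r u - ?r l) \<bullet> b)"
    by (rule emeasure_lborel_box) (auto simp: Basis_vec_def inner_axis reindex_def le)
  also have "(\<Prod>b\<in>Basis. (?r u - ?r l) \<bullet> b) = (\<Prod>b\<in>Basis. (u - l) \<bullet> b)"
  proof -
    have "(\<Prod>i\<in>UNIV. (?r u - ?r l) $ i) = (\<Prod>i\<in>UNIV. (u - l) $ (inv \<sigma> i))"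
      by (simp add: reindex_def)
    also have "\<dots> = (\<Prod>j\<in>UNIV. (u - l) $ j)"
      by (rule prod.reindex_bij_betw[OF bij_imp_bij_inv[OF \<sigma>]])
    finally show ?thesis by (simp only: prodB)
  qed
  finally show "emeasure (distr lborel borel (reindex \<sigma>)) (box l u) = ennreal (\<Prod>b\<in>Basis. (u - l) \<bullet> b)" .
qed

text \<open>Passing to completions is possible because the push-forward measure has the same null
  sets as Lebesgue measure.\<close>

lemma distr_lebesgue_reindex:
  fixes \<sigma> :: "'m::finite \<Rightarrow> 'd::finite"
  assumes \<sigma>: "bij \<sigma>"
  shows "distr lebesgue lebesgue (reindex \<sigma>) = (lebesgue :: (real^'m) measure)"
    and "(reindex \<sigma> :: real^'d \<Rightarrow> real^'m) \<in> lebesgue \<rightarrow>\<^sub>M lebesgue"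
proof -
  have m: "(reindex \<sigma> :: real^'d \<Rightarrow> real^'m) \<in> lborel \<rightarrow>\<^sub>M lborel"
    using borel_measurable_continuous_onI[OF linear_continuous_on[OF bounded_linear_reindex[of \<sigma>]]] by simp
  have d: "distr lebesgue lborel (reindex \<sigma>) = (lborel :: (real^'m) measure)"
  proof -
    have "distr lebesgue lborel (reindex \<sigma>) = distr lborel (lborel :: (real^'m) measure) (reindex \<sigma>)"
      using m by (simp add: distr_completion)
    also have "\<dots> = distr lborel borel (reindex \<sigma>)" by (rule distr_cong) auto
    finally show ?thesis using distr_lborel_reindex[OF \<sigma>] by simp
  qed
  have n: "null_sets (distr lebesgue lborel (reindex \<sigma>)) = null_sets (lborel :: (real^'m) measure)"
    by (simp add: d)
  show "distr lebesgue lebesgue (reindex \<sigma>) = (lebesgue :: (real^'m) measure)"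
    using completion.completion_distr_eq[OF measurable_completion[OF m] n] d by simp
  show "(reindex \<sigma> :: real^'d \<Rightarrow> real^'m) \<in> lebesgue \<rightarrow>\<^sub>M lebesgue"
    by (rule completion.measurable_completion2[OF measurable_completion[OF m]]) (simp add: n)
qed

lemma integral_reindex:
  fixes \<sigma> :: "'m::finite \<Rightarrow> 'd::finite" and f :: "real^'d \<Rightarrow> 'b::{banach,second_countable_topology}"
  assumes \<sigma>: "bij \<sigma>" and S: "S \<in> sets lebesgue"
  shows "integrable (lebesgue_on (reindex \<sigma> ` S)) (\<lambda>y. f (reindex (inv \<sigma>) y)) \<longleftrightarrow> integrable (lebesgue_on S) f"
    and "integral\<^sup>L (lebesgue_on (reindex \<sigma> ` S)) (\<lambda>y. f (reindex (inv \<sigma>) y)) = integral\<^sup>L (lebesgue_on S) f"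
    and "reindex \<sigma> ` S \<in> sets lebesgue"
proof -
  let ?r = "reindex \<sigma> :: real^'d \<Rightarrow> real^'m" and ?i = "reindex (inv \<sigma>) :: real^'m \<Rightarrow> real^'d"
  note ri = reindex_inv[OF \<sigma>]
  have \<sigma>': "bij (inv \<sigma>)" by (rule bij_imp_bij_inv[OF \<sigma>])
  have img: "?r ` S = ?i -` S"
  proof (intro set_eqI iffI)
    fix y assume "y \<in> ?i -` S"
    then show "y \<in> ?r ` S" using ri(2)[of y] by (metis imageI vimageE)
  qed (auto simp: ri)
  show rS: "?r ` S \<in> sets lebesgue"
    using measurable_sets[OF distr_lebesgue_reindex(2)[OF \<sigma>'] S] unfolding img by simp
  have ind: "indicator (?r ` S) y *\<^sub>R f (?i y) = (indicator S (?i y) *\<^sub>R f (?i y))" for y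
    unfolding img by (simp add: indicator_def)
  have key: "integrable lebesgue (\<lambda>y. h (?i y)) \<longleftrightarrow> integrable lebesgue h"
    "integral\<^sup>L lebesgue (\<lambda>y. h (?i y)) = integral\<^sup>L lebesgue h" for h :: "real^'d \<Rightarrow> 'b"
  proof -
    have meas: "h \<in> borel_measurable lebesgue" if "(\<lambda>y. h (?i y)) \<in> borel_measurable lebesgue"
      using measurable_compose[OF distr_lebesgue_reindex(2)[OF \<sigma>] that] by (simp add: ri)
    show "integrable lebesgue (\<lambda>y. h (?i y)) \<longleftrightarrow> integrable lebesgue h"
    proof
      assume "integrable lebesgue (\<lambda>y. h (?i y))"
      then have "integrable (distr lebesgue lebesgue ?i) h"
        using integrable_distr_eq[OF distr_lebesgue_reindex(2)[OF \<sigma>'] meas] by simp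
      then show "integrable lebesgue h" by (simp add: distr_lebesgue_reindex(1)[OF \<sigma>'])
    next
      assume "integrable lebesgue h"
      then have "integrable (distr lebesgue lebesgue ?i) h" by (simp add: distr_lebesgue_reindex(1)[OF \<sigma>'])
      then show "integrable lebesgue (\<lambda>y. h (?i y))"
        by (rule integrable_distr[OF distr_lebesgue_reindex(2)[OF \<sigma>']])
    qed
    then show "integral\<^sup>L lebesgue (\<lambda>y. h (?i y)) = integral\<^sup>L lebesgue h"
      using integral_distr[OF distr_lebesgue_reindex(2)[OF \<sigma>'], of h] distr_lebesgue_reindex(1)[OF \<sigma>']
      by (cases "integrable lebesgue h") (auto simp: not_integrable_integral_eq)
  qed
  show "integrable (lebesgue_on (?r ` S)) (\<lambda>y. f (?i y)) \<longleftrightarrow> integrable (lebesgue_on S) f"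
    using key(1)[of "\<lambda>x. indicator S x *\<^sub>R f x"] rS S by (simp add: integrable_restrict_space ind)
  show "integral\<^sup>L (lebesgue_on (?r ` S)) (\<lambda>y. f (?i y)) = integral\<^sup>L (lebesgue_on S) f"
    using key(2)[of "\<lambda>x. indicator S x *\<^sub>R f x"] rS S by (simp add: integral_restrict_space ind)
qed

lemma absolutely_integrable_on_iff_lebesgue_on:
  "S \<in> sets lebesgue \<Longrightarrow> f absolutely_integrable_on S \<longleftrightarrow> integrable (lebesgue_on S) f"
  by (simp add: set_integrable_def integrable_restrict_space)

lemma change_of_variables_wellorder:
  fixes f :: "real^'m::{finite,wellorder} \<Rightarrow> real^'n" and g :: "real^'m::_ \<Rightarrow> real^'m::_"
  assumes S: "S \<in> sets lebesgue"
    and der: "\<And>x. x \<in> S \<Longrightarrow> (g has_derivative g' x) (at x within S)"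
    and inj: "inj_on g S" and gS: "g ` S \<in> sets lebesgue"
  shows "integrable (lebesgue_on S) (\<lambda>x. \<bar>det (matrix (g' x))\<bar> *\<^sub>R f (g x)) \<longleftrightarrow> integrable (lebesgue_on (g ` S)) f"
    and "integrable (lebesgue_on (g ` S)) f \<Longrightarrow>
       integral\<^sup>L (lebesgue_on S) (\<lambda>x. \<bar>det (matrix (g' x))\<bar> *\<^sub>R f (g x)) = integral\<^sup>L (lebesgue_on (g ` S)) f"
proof -
  let ?D = "\<lambda>x. \<bar>det (matrix (g' x))\<bar> *\<^sub>R f (g x)"
  note cv = has_absolute_integral_change_of_variables[OF S der inj, of f]
  show iff: "integrable (lebesgue_on S) ?D \<longleftrightarrow> integrable (lebesgue_on (g ` S)) f"
    using cv S gS by (auto simp: absolutely_integrable_on_iff_lebesgue_on)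
  assume i: "integrable (lebesgue_on (g ` S)) f"
  then have j: "integrable (lebesgue_on S) ?D" using iff by simp
  have "integral S ?D = integral (g ` S) f"
    using cv[of "integral S ?D"] j i S gS by (auto simp: absolutely_integrable_on_iff_lebesgue_on)
  then show "integral\<^sup>L (lebesgue_on S) ?D = integral\<^sup>L (lebesgue_on (g ` S)) f"
    using lebesgue_integral_eq_integral[OF j S] lebesgue_integral_eq_integral[OF i gS] by simp
qed

text \<open>Conjugating \<open>g\<close> by the reindexing transports the formula; the Jacobian
  determinant is unchanged by \<open>det_reindex\<close>.\<close>

lemma change_of_variables_reindex:
  fixes f :: "real^'d \<Rightarrow> real^'n" and g :: "real^'d \<Rightarrow> real^'d" and \<sigma> :: "'m::{finite,wellorder} \<Rightarrow> 'd"
  assumes \<sigma>: "bij \<sigma>" and S: "S \<in> sets lebesgue"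
    and der: "\<And>x. x \<in> S \<Longrightarrow> (g has_derivative g' x) (at x within S)"
    and inj: "inj_on g S" and gS: "g ` S \<in> sets lebesgue"
  shows "integrable (lebesgue_on S) (\<lambda>x. \<bar>det (matrix (g' x))\<bar> *\<^sub>R f (g x)) \<longleftrightarrow> integrable (lebesgue_on (g ` S)) f"
    and "integrable (lebesgue_on (g ` S)) f \<Longrightarrow>
       integral\<^sup>L (lebesgue_on S) (\<lambda>x. \<bar>det (matrix (g' x))\<bar> *\<^sub>R f (g x)) = integral\<^sup>L (lebesgue_on (g ` S)) f"
proof -
  let ?r = "reindex \<sigma> :: real^'d \<Rightarrow> real^'m::_" and ?i = "reindex (inv \<sigma>) :: real^'m::_ \<Rightarrow> real^'d"
  note ri = reindex_inv[OF \<sigma>]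
  note R = integral_reindex[OF \<sigma> S] and RG = integral_reindex[OF \<sigma> gS]
  let ?g = "\<lambda>y. ?r (g (?i y))" and ?g' = "\<lambda>y v. ?r (g' (?i y) (?i v))"
  have img: "?g ` (?r ` S) = ?r ` (g ` S)" by (simp add: image_image ri)
  have der': "(?g has_derivative ?g' y) (at y within ?r ` S)" if y: "y \<in> ?r ` S" for y
  proof -
    obtain x where x: "x \<in> S" "y = ?r x" using y by blast
    have "(g has_derivative g' (?i y)) (at (?i y) within ?i ` (?r ` S))"
      using der[OF x(1)] x by (simp add: ri image_image)
    from diff_chain_within[OF bounded_linear_imp_has_derivative[OF bounded_linear_reindex] this]
    have "(g \<circ> ?i has_derivative g' (?i y) \<circ> ?i) (at y within ?r ` S)" .
    from bounded_linear.has_derivative[OF bounded_linear_reindex this]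
    show ?thesis by (simp add: o_def)
  qed
  have inj': "inj_on ?g (?r ` S)"
    using inj by (auto simp: inj_on_def ri) (metis ri)
  have det: "det (matrix (?g' y)) = det (matrix (g' (?i y)))" for y
  proof -
    have eq: "inv \<sigma> i = k \<longleftrightarrow> i = \<sigma> k" for i k
      using \<sigma> by (metis bij_inv_eq_iff)
    have ax: "?i (axis k 1) = axis (\<sigma> k) 1" for k
      by (simp add: reindex_def axis_def vec_eq_iff eq)
    have "matrix (?g' y) = (\<chi> j k. matrix (g' (?i y)) $ \<sigma> j $ \<sigma> k)"
      by (simp add: matrix_def vec_eq_iff ax) (simp add: reindex_def)
    then show ?thesis by (simp add: det_reindex[OF \<sigma>])
  qed
  note cv = change_of_variables_wellorder[OF R(3) der' inj', of "\<lambda>y. f (?i y)"]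
  note A = R(1,2)[of "\<lambda>x. \<bar>det (matrix (g' x))\<bar> *\<^sub>R f (g x)"] and B = RG(1,2)[of f]
  have gr: "?g ` (?r ` S) \<in> sets lebesgue" unfolding img by (rule RG(3))
  show iff: "integrable (lebesgue_on S) (\<lambda>x. \<bar>det (matrix (g' x))\<bar> *\<^sub>R f (g x)) \<longleftrightarrow> integrable (lebesgue_on (g ` S)) f"
    using cv(1)[OF _ gr] A(1) B(1) unfolding img det by (simp add: ri)
  assume "integrable (lebesgue_on (g ` S)) f"
  then show "integral\<^sup>L (lebesgue_on S) (\<lambda>x. \<bar>det (matrix (g' x))\<bar> *\<^sub>R f (g x)) = integral\<^sup>L (lebesgue_on (g ` S)) f"
    using cv(2)[OF _ gr] A(2) B unfolding img det by (simp add: ri)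
qed

text \<open>The library has the transformation formula only for index types that are wellordered;
  in dimensions two and three one can reindex by a numeral type.\<close>

lemma change_of_variables_vec:
  fixes f :: "real^'d \<Rightarrow> real^'n" and g :: "real^'d \<Rightarrow> real^'d"
  assumes dim: "CARD('d) \<in> {2, 3}" and S: "S \<in> sets lebesgue"
    and der: "\<And>x. x \<in> S \<Longrightarrow> (g has_derivative g' x) (at x within S)"
    and inj: "inj_on g S" and gS: "g ` S \<in> sets lebesgue"
  shows "(integrable (lebesgue_on S) (\<lambda>x. \<bar>det (matrix (g' x))\<bar> *\<^sub>R f (g x)) \<longleftrightarrow> integrable (lebesgue_on (g ` S)) f)
     \<and> (integrable (lebesgue_on (g ` S)) f \<longrightarrow>
       integral\<^sup>L (lebesgue_on S) (\<lambda>x. \<bar>det (matrix (g' x))\<bar> *\<^sub>R f (g x)) = integral\<^sup>L (lebesgue_on (g ` S)) f)"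
proof -
  consider "CARD('d) = 2" | "CARD('d) = 3" using dim by auto
  then show ?thesis
  proof cases
    case 1
    then have "card (UNIV :: 2 set) = card (UNIV :: 'd set)" by simp
    then obtain \<sigma> :: "2 \<Rightarrow> 'd" where "bij \<sigma>" using finite_same_card_bij[of "UNIV::2 set" "UNIV :: 'd set"] by auto
    from change_of_variables_reindex[OF this S der inj gS] show ?thesis by blast
  next
    case 2
    then have "card (UNIV :: 3 set) = card (UNIV :: 'd set)" by simp
    then obtain \<sigma> :: "3 \<Rightarrow> 'd" where "bij \<sigma>" using finite_same_card_bij[of "UNIV::3 set" "UNIV :: 'd set"] by auto
    from change_of_variables_reindex[OF this S der inj gS] show ?thesis by blast
  qed
qed

text \<open>The complex numbers are embedded into \<open>real^2\<close> by a bounded linear map with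
  bounded linear left inverse, which respects integrability and integrals.\<close>

lemma change_of_variables_complex:
  fixes f :: "real^'d \<Rightarrow> complex" and g :: "real^'d \<Rightarrow> real^'d"
  assumes dim: "CARD('d) \<in> {2, 3}" and S: "S \<in> sets lebesgue"
    and der: "\<And>x. x \<in> S \<Longrightarrow> (g has_derivative g' x) (at x within S)"
    and inj: "inj_on g S" and gS: "g ` S \<in> sets lebesgue"
  shows "integrable (lebesgue_on S) (\<lambda>x. \<bar>det (matrix (g' x))\<bar> *\<^sub>R f (g x)) \<longleftrightarrow> integrable (lebesgue_on (g ` S)) f"
     and "integrable (lebesgue_on (g ` S)) f \<Longrightarrow>
       integral\<^sup>L (lebesgue_on S) (\<lambda>x. \<bar>det (matrix (g' x))\<bar> *\<^sub>R f (g x)) = integral\<^sup>L (lebesgue_on (g ` S)) f"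
proof -
  define l :: "complex \<Rightarrow> real^2" where "l z = (\<chi> i. if i = 1 then Re z else Im z)" for z
  define r :: "real^2 \<Rightarrow> complex" where "r v = Complex (v $ 1) (v $ 2)" for v
  have rl: "r (l z) = z" for z by (simp add: l_def r_def)
  have bl: "bounded_linear l"
    unfolding linear_conv_bounded_linear[symmetric] by (rule linearI) (auto simp: l_def vec_eq_iff)
  have br: "bounded_linear r"
    unfolding linear_conv_bounded_linear[symmetric] by (rule linearI) (auto simp: r_def complex_eq_iff)
  have int: "integrable M h \<longleftrightarrow> integrable M (\<lambda>x. l (h x))" for M :: "(real^'d) measure" and h
    using integrable_bounded_linear[OF bl, of M h] integrable_bounded_linear[OF br, of M "\<lambda>x. l (h x)"] by (auto simp: rl)
  have ll: "l (c *\<^sub>R z) = c *\<^sub>R l z" for c z using bl by (simp add: linear_simps)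
  let ?D = "\<lambda>x. \<bar>det (matrix (g' x))\<bar> *\<^sub>R f (g x)"
  note cv = change_of_variables_vec[OF dim S der inj gS, of "\<lambda>y. l (f y)"]
  show iff: "integrable (lebesgue_on S) ?D \<longleftrightarrow> integrable (lebesgue_on (g ` S)) f"
    unfolding int[of _ ?D] int[of _ f] ll using cv by simp
  assume i: "integrable (lebesgue_on (g ` S)) f"
  then have j: "integrable (lebesgue_on S) ?D" using iff by simp
  have "l (integral\<^sup>L (lebesgue_on S) ?D) = l (integral\<^sup>L (lebesgue_on (g ` S)) f)"
    using cv i unfolding integral_bounded_linear[OF bl i, symmetric] integral_bounded_linear[OF bl j, symmetric]
    by (simp add: int[of _ f] ll)
  then show "integral\<^sup>L (lebesgue_on S) ?D = integral\<^sup>L (lebesgue_on (g ` S)) f" by (metis rl)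
qed

section \<open>Push-forward of elliptic matrices\<close>

definition cmat :: "real^'n^'m \<Rightarrow> complex^'n^'m" where
  "cmat A = (\<chi> i j. complex_of_real (A $ i $ j))"

lemma cmat_mult: "cmat (A ** B) = cmat A ** cmat B"
  by (simp add: cmat_def matrix_matrix_mult_def vec_eq_iff)

lemma cmat_transpose: "cmat (transpose A) = transpose (cmat A)"
  by (simp add: cmat_def transpose_def vec_eq_iff)

lemma cmat_scaleR_vec: "cmat (c *\<^sub>R A) *v v = complex_of_real c *s (cmat A *v v)"
  by (simp add: cmat_def matrix_vector_mult_def vec_eq_iff sum_distrib_left mult_ac)

lemma cmat_mat_1: "cmat (mat 1) = mat 1"
  by (simp add: cmat_def mat_def vec_eq_iff)

lemma scaled_matrix_one: "scaled_matrix (\<lambda>x. 1) A x = cmat (A x)"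
  by (simp add: scaled_matrix_def cmat_def)

lemma scaled_matrix_vec: "scaled_matrix s A x *v v = s x *s (cmat (A x) *v v)"
  by (simp add: scaled_matrix_def cmat_def matrix_vector_mult_def vec_eq_iff sum_distrib_left mult_ac)

lemma bdot_matrix_transpose: "bdot (M *v v) w = bdot v (transpose M *v w)"
  for M :: "complex^'d^'d"
proof -
  have "bdot (M *v v) w = (\<Sum>i\<in>UNIV. \<Sum>j\<in>UNIV. M $ i $ j * v $ j * w $ i)"
    by (simp add: bdot_def matrix_vector_mult_def sum_distrib_right)
  also have "\<dots> = (\<Sum>j\<in>UNIV. \<Sum>i\<in>UNIV. M $ i $ j * v $ j * w $ i)"
    by (rule sum.swap)
  also have "\<dots> = bdot v (transpose M *v w)"
    by (simp add: bdot_def matrix_vector_mult_def transpose_def sum_distrib_left mult_ac)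
  finally show ?thesis .
qed

lemma inner_matrix_transpose: "(M *v v) \<bullet> w = v \<bullet> (transpose M *v w)"
  for M :: "real^'d^'d"
proof -
  have "(M *v v) \<bullet> w = (\<Sum>i\<in>UNIV. \<Sum>j\<in>UNIV. M $ i $ j * v $ j * w $ i)"
    by (simp add: inner_vec_def matrix_vector_mult_def sum_distrib_right)
  also have "\<dots> = (\<Sum>j\<in>UNIV. \<Sum>i\<in>UNIV. M $ i $ j * v $ j * w $ i)"
    by (rule sum.swap)
  also have "\<dots> = v \<bullet> (transpose M *v w)"
    by (simp add: inner_vec_def matrix_vector_mult_def transpose_def sum_distrib_left mult_ac)
  finally show ?thesis .
qed

text \<open>A pointwise bundle of symmetry, lower bound and entry bound: push-forwards are treated
  by linear algebra at one point and quantified almost everywhere afterwards.\<close>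

definition elliptic_at :: "real \<Rightarrow> real \<Rightarrow> real^'d^'d \<Rightarrow> bool" where
  "elliptic_at c C M \<longleftrightarrow> transpose M = M \<and> (\<forall>\<xi>. c * (norm \<xi>)\<^sup>2 \<le> (M *v \<xi>) \<bullet> \<xi>) \<and> (\<forall>i j. \<bar>M $ i $ j\<bar> \<le> C)"

text \<open>When \<open>\<xi>\<close> is split into real and imaginary parts, symmetry of
  \<open>M\<close> cancels the mixed terms; what remains is a sum of two real quadratic
  forms.\<close>

lemma elliptic_at_complex:
  fixes \<xi> :: "complex^'d"
  assumes "elliptic_at c C M"
  shows "c * (norm \<xi>)\<^sup>2 \<le> Re (bdot (cmat M *v \<xi>) (\<chi> i. cnj (\<xi> $ i)))"
    and "Im (bdot (cmat M *v \<xi>) (\<chi> i. cnj (\<xi> $ i))) = 0"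
proof -
  let ?a = "\<chi> i. Re (\<xi> $ i)" and ?b = "\<chi> i. Im (\<xi> $ i)"
  have dot: "(M *v v) \<bullet> w = (\<Sum>i\<in>UNIV. \<Sum>j\<in>UNIV. M $ i $ j * v $ j * w $ i)" for v w :: "real^'d"
    by (simp add: inner_vec_def matrix_vector_mult_def sum_distrib_right)
  have sym: "(M *v v) \<bullet> w = (M *v w) \<bullet> v" for v w
  proof -
    have "(M *v v) \<bullet> w = v \<bullet> (transpose M *v w)" by (rule inner_matrix_transpose)
    moreover have "transpose M = M" using assms by (simp add: elliptic_at_def)
    ultimately show ?thesis by (simp only: inner_commute[of v])
  qed
  have e: "bdot (cmat M *v \<xi>) (\<chi> i. cnj (\<xi> $ i)) = (\<Sum>i\<in>UNIV. \<Sum>j\<in>UNIV. complex_of_real (M $ i $ j) * \<xi> $ j * cnj (\<xi> $ i))"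
    by (simp add: bdot_def matrix_vector_mult_def cmat_def sum_distrib_right)
  have re: "Re (bdot (cmat M *v \<xi>) (\<chi> i. cnj (\<xi> $ i))) = (M *v ?a) \<bullet> ?a + (M *v ?b) \<bullet> ?b"
    unfolding e dot by (simp add: sum.distrib[symmetric] algebra_simps)
  have im: "Im (bdot (cmat M *v \<xi>) (\<chi> i. cnj (\<xi> $ i))) = (M *v ?b) \<bullet> ?a - (M *v ?a) \<bullet> ?b"
    unfolding e dot by (simp add: sum_subtractf[symmetric] algebra_simps)
  have n: "(norm \<xi>)\<^sup>2 = (norm ?a)\<^sup>2 + (norm ?b)\<^sup>2"
    by (simp add: power2_norm_eq_inner inner_vec_def inner_complex_def sum.distrib)
  show "c * (norm \<xi>)\<^sup>2 \<le> Re (bdot (cmat M *v \<xi>) (\<chi> i. cnj (\<xi> $ i)))"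
    using assms unfolding re n elliptic_at_def by (simp add: distrib_left add_mono)
  show "Im (bdot (cmat M *v \<xi>) (\<chi> i. cnj (\<xi> $ i))) = 0"
    unfolding im using sym by simp
qed

lemma norm_real_matrix_vector_le:
  fixes M :: "real^'d^'d"
  assumes "\<And>i j. \<bar>M $ i $ j\<bar> \<le> K"
  shows "norm (M *v \<xi>) \<le> (real CARD('d))\<^sup>2 * K * norm \<xi>"
proof -
  have c: "norm ((M *v \<xi>) $ i) \<le> real CARD('d) * (K * norm \<xi>)" for i
  proof -
    have "norm ((M *v \<xi>) $ i) \<le> (\<Sum>j\<in>(UNIV::'d set). K * norm \<xi>)"
      unfolding matrix_vector_mult_def vec_lambda_beta
    proof (rule sum_norm_le)
      fix j
      have "0 \<le> K" using assms abs_ge_zero order_trans by blast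
      then show "norm (M $ i $ j * \<xi> $ j) \<le> K * norm \<xi>"
        using assms[of i j] Finite_Cartesian_Product.norm_nth_le[of \<xi> j] by (simp add: abs_mult mult_mono)
    qed
    then show ?thesis by simp
  qed
  have "norm (M *v \<xi>) \<le> (\<Sum>i\<in>(UNIV::'d set). real CARD('d) * (K * norm \<xi>))"
    by (rule order_trans[OF norm_vec_le_sum]) (intro sum_mono c)
  then show ?thesis by (simp add: power2_eq_square mult_ac)
qed

lemma abs_det_le:
  fixes J :: "real^'d^'d"
  assumes "\<And>i j. \<bar>J $ i $ j\<bar> \<le> K"
  shows "\<bar>det J\<bar> \<le> fact CARD('d) * K ^ CARD('d)"
proof -
  have "\<bar>det J\<bar> \<le> (\<Sum>p | p permutes (UNIV::'d set). K ^ CARD('d))"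
    unfolding det_def
  proof (rule order_trans[OF sum_abs sum_mono])
    fix p assume "p \<in> {p. p permutes (UNIV::'d set)}"
    have "\<bar>\<Prod>i\<in>UNIV. J $ i $ p i\<bar> \<le> (\<Prod>i\<in>(UNIV::'d set). K)"
      unfolding abs_prod by (rule prod_mono) (simp add: assms)
    then show "\<bar>of_int (sign p) * (\<Prod>i\<in>UNIV. J $ i $ p i)\<bar> \<le> K ^ CARD('d)"
      by (simp add: abs_mult sign_def)
  qed
  also have "\<dots> = fact CARD('d) * K ^ CARD('d)"
    by (simp add: card_permutations[OF refl])
  finally show ?thesis .
qed

definition push_matrix :: "real^'d^'d \<Rightarrow> real^'d^'d \<Rightarrow> real^'d^'d" where
  "push_matrix J M = (1 / \<bar>det J\<bar>) *\<^sub>R (J ** M ** transpose J)"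

text \<open>\<open>D\<close> bounds the determinants of \<open>J\<close> and of its inverse
  \<open>L\<close>, hence \<open>1 / D \<le> \<bar>det J\<bar> \<le> D\<close>. For the lower bound,
  \<open>\<xi>\<close> is recovered from \<open>transpose J *v \<xi>\<close> by means of
  \<open>L\<close>, at the cost of the factor \<open>(real CARD('d))^2 * K\<close>. The bounds on
  \<open>D\<close>, \<open>K\<close> and \<open>det J\<close> are exported for later use.\<close>

lemma elliptic_at_push:
  fixes J :: "real^'d^'d"
  assumes M: "elliptic_at c C M" and c: "c \<ge> 0" and LJ: "L ** J = mat 1" "J ** L = mat 1"
    and K: "\<And>i j. \<bar>J $ i $ j\<bar> \<le> K" "\<And>i j. \<bar>L $ i $ j\<bar> \<le> K"
    and D: "D = fact CARD('d) * K ^ CARD('d)"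
  shows "elliptic_at (c / (D * ((real CARD('d))\<^sup>2 * K)\<^sup>2)) (D * ((real CARD('d))\<^sup>2 * (K * C * K))) (push_matrix J M)"
    and "D > 0" "\<bar>det J\<bar> \<le> D" "1 / D \<le> \<bar>det J\<bar>" "K > 0"
proof -
  have detJ: "det L * det J = 1" using LJ(1) by (metis det_I det_mul)
  have bJ: "\<bar>det J\<bar> \<le> D" and bL: "\<bar>det L\<bar> \<le> D"
    using abs_det_le[of J K] abs_det_le[of L K] K D by auto
  have nz: "det J \<noteq> 0" using detJ by auto
  show Dpos: "D > 0" using bJ nz by linarith
  show "\<bar>det J\<bar> \<le> D" by (rule bJ)
  have prod1: "\<bar>det L\<bar> * \<bar>det J\<bar> = 1" using detJ by (metis abs_mult abs_one)
  show lo: "1 / D \<le> \<bar>det J\<bar>"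
  proof -
    have "1 \<le> D * \<bar>det J\<bar>" using mult_right_mono[OF bL, of "\<bar>det J\<bar>"] prod1 by simp
    then show ?thesis using Dpos by (simp add: field_simps)
  qed
  have K0: "K \<ge> 0" using K(1) abs_ge_zero order_trans by blast
  show Kpos: "K > 0" using Dpos D K0 by (cases "K = 0") (auto simp: power_0_left)
  have hi: "1 / \<bar>det J\<bar> \<le> D" using lo Dpos nz by (simp add: field_simps)
  have lo': "1 / D \<le> 1 / \<bar>det J\<bar>" using bJ nz by (simp add: frac_le)
  let ?d = "real CARD('d)"
  have entry: "\<bar>(J ** M ** transpose J) $ i $ j\<bar> \<le> ?d\<^sup>2 * (K * C * K)" for i j
  proof -
    have "(J ** M ** transpose J) $ i $ j = (\<Sum>l\<in>UNIV. \<Sum>k\<in>UNIV. J $ i $ k * M $ k $ l * J $ j $ l)"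
      by (simp add: matrix_matrix_mult_def transpose_def sum_distrib_right)
    also have "\<bar>\<dots>\<bar> \<le> (\<Sum>l\<in>(UNIV::'d set). \<Sum>k\<in>(UNIV::'d set). K * C * K)"
    proof (intro order_trans[OF sum_abs sum_mono] order_trans[OF sum_abs] sum_mono)
      fix l k
      have "\<bar>M $ k $ l\<bar> \<le> C" using M by (simp add: elliptic_at_def)
      then show "\<bar>J $ i $ k * M $ k $ l * J $ j $ l\<bar> \<le> K * C * K"
        unfolding abs_mult using K(1) K0 by (intro mult_mono) auto
    qed
    finally show ?thesis by (simp add: power2_eq_square mult_ac)
  qed
  have tr: "transpose (J ** M ** transpose J) = J ** M ** transpose J"
    using M by (simp add: elliptic_at_def matrix_transpose_mul matrix_mul_assoc)
  show "elliptic_at (c / (D * (?d\<^sup>2 * K)\<^sup>2)) (D * (?d\<^sup>2 * (K * C * K))) (push_matrix J M)"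
    unfolding elliptic_at_def
  proof (intro conjI allI)
    show "transpose (push_matrix J M) = push_matrix J M"
      using tr by (simp add: push_matrix_def transpose_def vec_eq_iff)
    fix i j
    have "\<bar>push_matrix J M $ i $ j\<bar> = (1 / \<bar>det J\<bar>) * \<bar>(J ** M ** transpose J) $ i $ j\<bar>"
      by (simp add: push_matrix_def abs_mult)
    also have "\<dots> \<le> D * (?d\<^sup>2 * (K * C * K))"
      by (rule mult_mono[OF hi entry]) (use Dpos in auto)
    finally show "\<bar>push_matrix J M $ i $ j\<bar> \<le> D * (?d\<^sup>2 * (K * C * K))" .
  next
    fix \<xi> :: "real^'d"
    let ?\<eta> = "transpose J *v \<xi>"
    have "transpose L *v ?\<eta> = \<xi>"
      using LJ(2) by (metis matrix_transpose_mul matrix_vector_mul_assoc matrix_vector_mul_lid transpose_mat)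
    then have "norm \<xi> \<le> ?d\<^sup>2 * K * norm ?\<eta>"
      using norm_real_matrix_vector_le[of "transpose L" K ?\<eta>] K(2) by (simp add: transpose_def)
    then have sq: "(norm \<xi>)\<^sup>2 \<le> (?d\<^sup>2 * K)\<^sup>2 * (norm ?\<eta>)\<^sup>2"
      using power_mono[of "norm \<xi>" "?d\<^sup>2 * K * norm ?\<eta>" 2] by (simp add: power_mult_distrib)
    have "((J ** M ** transpose J) *v \<xi>) \<bullet> \<xi> = (J *v (M *v ?\<eta>)) \<bullet> \<xi>"
      by (simp only: matrix_vector_mul_assoc matrix_mul_assoc)
    also have "\<dots> = (M *v ?\<eta>) \<bullet> ?\<eta>"
      by (rule inner_matrix_transpose)
    finally have eq: "((J ** M ** transpose J) *v \<xi>) \<bullet> \<xi> = (M *v ?\<eta>) \<bullet> ?\<eta>" .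
    have ge: "c * (norm ?\<eta>)\<^sup>2 \<le> (M *v ?\<eta>) \<bullet> ?\<eta>" using M by (simp add: elliptic_at_def)
    have dpos: "?d\<^sup>2 * K > 0" using Kpos by simp
    have "c / (D * (?d\<^sup>2 * K)\<^sup>2) * (norm \<xi>)\<^sup>2 \<le> c / (D * (?d\<^sup>2 * K)\<^sup>2) * ((?d\<^sup>2 * K)\<^sup>2 * (norm ?\<eta>)\<^sup>2)"
      using sq c Dpos by (intro mult_left_mono) auto
    also have "\<dots> = (1 / D) * (c * (norm ?\<eta>)\<^sup>2)"
    proof -
      have "c / (D * q) * (q * n) = (1 / D) * (c * n)" if "q > 0" for q n
        using that Dpos by (simp add: field_simps)
      then show ?thesis using zero_less_power[OF dpos] by blast
    qed
    also have "\<dots> \<le> (1 / \<bar>det J\<bar>) * ((M *v ?\<eta>) \<bullet> ?\<eta>)"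
      using lo' ge c by (intro mult_mono) auto
    also have "\<dots> = (push_matrix J M *v \<xi>) \<bullet> \<xi>"
      by (simp only: push_matrix_def scaleR_matrix_vector_assoc[symmetric] inner_scaleR_left eq)
    finally show "c / (D * (?d\<^sup>2 * K)\<^sup>2) * (norm \<xi>)\<^sup>2 \<le> (push_matrix J M *v \<xi>) \<bullet> \<xi>" .
  qed
qed

section \<open>Diffeomorphisms with bounded Jacobians\<close>

definition jac :: "(real^'d \<Rightarrow> real^'d) \<Rightarrow> real^'d \<Rightarrow> real^'d^'d" where
  "jac T x = matrix (frechet_derivative T (at x))"

text \<open>The inverse \<open>S\<close> is an explicit argument and \<open>K\<close> bounds both
  Jacobians. This makes the notion symmetric, and composition with either map bounded on
  \<open>L^2\<close>.\<close>

definition tame_diffeo ::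
  "(real^'d) set \<Rightarrow> (real^'d) set \<Rightarrow> (real^'d \<Rightarrow> real^'d) \<Rightarrow> (real^'d \<Rightarrow> real^'d) \<Rightarrow> real \<Rightarrow> bool" where
  "tame_diffeo U V T S K \<longleftrightarrow> open U \<and> open V \<and> (\<forall>x\<in>U. T x \<in> V \<and> S (T x) = x) \<and> (\<forall>y\<in>V. S y \<in> U \<and> T (S y) = y) \<and>
     C1_on U T \<and> C1_on V S \<and> (\<forall>x\<in>U. \<forall>i j. \<bar>jac T x $ i $ j\<bar> \<le> K) \<and> (\<forall>y\<in>V. \<forall>i j. \<bar>jac S y $ i $ j\<bar> \<le> K)"

lemma tame_diffeo_sym: "tame_diffeo U V T S K \<Longrightarrow> tame_diffeo V U S T K"
  by (auto simp: tame_diffeo_def)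

text \<open>The chain rule for gradients, extended to arbitrary vector fields: on
  \<open>g = grad \<phi>\<close> it gives \<open>grad (\<phi> \<circ> S)\<close>.\<close>

definition pull :: "(real^'d \<Rightarrow> real^'d) \<Rightarrow> (real^'d \<Rightarrow> complex^'d) \<Rightarrow> real^'d \<Rightarrow> complex^'d" where
  "pull S g y = transpose (cmat (jac S y)) *v g (S y)"

lemma grad_compose:
  fixes \<phi> :: "real^'d \<Rightarrow> complex"
  assumes S: "S differentiable (at y)" and \<phi>: "\<phi> differentiable (at (S y))"
  shows "grad (\<phi> \<circ> S) y = pull S (grad \<phi>) y"
proof (rule grad_eqI)
  have dS: "(S has_derivative frechet_derivative S (at y)) (at y)"
    using S frechet_derivative_works by blast
  have comp: "frechet_derivative S (at y) v $ i = (\<Sum>j\<in>UNIV. jac S y $ i $ j * v $ j)" for v i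
    by (subst bounded_linear_coords[OF has_derivative_bounded_linear[OF dS]]) (simp add: jac_def matrix_def mult.commute)
  have "(\<phi> \<circ> S has_derivative (\<lambda>v. \<Sum>i\<in>UNIV. (frechet_derivative S (at y) v $ i) *\<^sub>R grad \<phi> (S y) $ i)) (at y)"
    using diff_chain_at[OF dS has_derivative_grad[OF \<phi>]] by (simp add: o_def)
  moreover have "(\<Sum>i\<in>UNIV. (frechet_derivative S (at y) v $ i) *\<^sub>R grad \<phi> (S y) $ i)
      = (\<Sum>j\<in>UNIV. (v $ j) *\<^sub>R pull S (grad \<phi>) y $ j)" for v
  proof -
    have "(\<Sum>i\<in>UNIV. (frechet_derivative S (at y) v $ i) *\<^sub>R grad \<phi> (S y) $ i)
        = (\<Sum>i\<in>UNIV. \<Sum>j\<in>UNIV. (jac S y $ i $ j * v $ j) *\<^sub>R grad \<phi> (S y) $ i)"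
      by (simp add: comp scaleR_sum_left)
    also have "\<dots> = (\<Sum>j\<in>UNIV. \<Sum>i\<in>UNIV. (jac S y $ i $ j * v $ j) *\<^sub>R grad \<phi> (S y) $ i)"
      by (rule sum.swap)
    also have "\<dots> = (\<Sum>j\<in>UNIV. (v $ j) *\<^sub>R pull S (grad \<phi>) y $ j)"
      by (simp add: pull_def transpose_def cmat_def matrix_vector_mult_def scaleR_conv_of_real sum_distrib_left mult_ac)
    finally show ?thesis .
  qed
  ultimately show "(\<phi> \<circ> S has_derivative (\<lambda>v. \<Sum>i\<in>UNIV. (v $ i) *\<^sub>R pull S (grad \<phi>) y $ i)) (at y)"
    by simp
qed

lemma jac_compose:
  assumes S: "S differentiable (at y)" and T: "T differentiable (at (S y))"
  shows "jac (T \<circ> S) y = jac T (S y) ** jac S y"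
proof -
  have dS: "(S has_derivative frechet_derivative S (at y)) (at y)"
    using S frechet_derivative_works by blast
  have dT: "(T has_derivative frechet_derivative T (at (S y))) (at (S y))"
    using T frechet_derivative_works by blast
  have "frechet_derivative (T \<circ> S) (at y) = frechet_derivative T (at (S y)) \<circ> frechet_derivative S (at y)"
    using diff_chain_at[OF dS dT] frechet_derivative_at by metis
  then show ?thesis
    unfolding jac_def using matrix_compose[OF has_derivative_linear[OF dS] has_derivative_linear[OF dT]] by simp
qed

lemma jac_cong_open:
  assumes "open U" "x \<in> U" "\<And>z. z \<in> U \<Longrightarrow> T z = T' z"
  shows "jac T x = jac T' x"
proof -
  have "(T has_derivative D) (at x) \<longleftrightarrow> (T' has_derivative D) (at x)" for D
    using has_derivative_transform_within_open[OF _ assms(1,2), of T D UNIV T']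
      has_derivative_transform_within_open[OF _ assms(1,2), of T' D UNIV T] assms(3) by auto
  then show ?thesis by (simp add: jac_def frechet_derivative_def)
qed

lemma jac_ident: "jac (\<lambda>x. x) y = mat 1"
  by (simp add: jac_def matrix_id_mat_1[unfolded id_def])

lemma tame_diffeo_jac_inverse:
  assumes t: "tame_diffeo U V T S K" and x: "x \<in> U"
  shows "jac S (T x) ** jac T x = mat 1" "jac T x ** jac S (T x) = mat 1"
proof -
  have T: "T differentiable (at x)" using t x C1_on_differentiable by (auto simp: tame_diffeo_def)
  have S: "S differentiable (at (T x))" using t x C1_on_differentiable by (auto simp: tame_diffeo_def)
  have "jac S (T x) ** jac T x = jac (S \<circ> T) x" by (rule jac_compose[OF T S, symmetric])
  also have "\<dots> = jac (\<lambda>x. x) x"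
    by (rule jac_cong_open[of U]) (use t x in \<open>auto simp: tame_diffeo_def\<close>)
  finally show 1: "jac S (T x) ** jac T x = mat 1" by (simp add: jac_ident)
  then show "jac T x ** jac S (T x) = mat 1" by (simp add: matrix_left_right_inverse)
qed

lemma continuous_on_jac:
  assumes "C1_on U T"
  shows "continuous_on U (\<lambda>x. jac T x $ i $ j)"
proof -
  obtain f' where f': "\<And>x. x \<in> U \<Longrightarrow> (T has_derivative blinfun_apply (f' x)) (at x)" "continuous_on U f'"
    using C1_onE[OF assms] by blast
  have "jac T x $ i $ j = blinfun_apply (f' x) (axis j 1) $ i" if "x \<in> U" for x
    using f'(1)[OF that] frechet_derivative_at[of T "blinfun_apply (f' x)" x] by (simp add: jac_def matrix_def)
  moreover have "continuous_on U (\<lambda>x. blinfun_apply (f' x) (axis j 1) $ i)"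
    by (intro continuous_intros f'(2))
  ultimately show ?thesis by (simp cong: continuous_on_cong)
qed

lemma negligible_AE_lebesgue_on:
  assumes "S \<in> sets lebesgue"
  shows "(AE x in lebesgue_on S. P x) \<longleftrightarrow> negligible {x \<in> S. \<not> P x}"
proof -
  have "(AE x in lebesgue_on S. P x) \<longleftrightarrow> (AE x in lebesgue. x \<in> S \<longrightarrow> P x)"
    by (rule AE_restrict_space_iff) (use assms in simp)
  also have "\<dots> \<longleftrightarrow> (\<exists>N\<in>null_sets lebesgue. {x \<in> S. \<not> P x} \<subseteq> N)"
    by (simp add: eventually_ae_filter)
  also have "\<dots> \<longleftrightarrow> negligible {x \<in> S. \<not> P x}"
    using negligible_iff_null_sets negligible_subset by blast
  finally show ?thesis .
qed

lemma tame_diffeo_image: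
  assumes "tame_diffeo U V T S K"
  shows "T ` U = V" "inj_on T U"
  using assms by (auto simp: tame_diffeo_def inj_on_def image_iff) metis+

lemma tame_diffeo_differentiable_on:
  assumes "tame_diffeo U V T S K" "X \<subseteq> U"
  shows "T differentiable_on X"
  using assms by (meson C1_on_differentiable differentiable_at_imp_differentiable_on subsetD tame_diffeo_def)

text \<open>Differentiable images of negligible sets are negligible.\<close>

lemma tame_diffeo_AE:
  assumes t: "tame_diffeo U V T S K" and P: "AE x in lebesgue_on U. P x"
  shows "AE y in lebesgue_on V. P (S y)"
proof -
  have o: "open U" "open V" using t by (auto simp: tame_diffeo_def)
  have "{y \<in> V. \<not> P (S y)} \<subseteq> T ` {x \<in> U. \<not> P x}"
    using t by (auto simp: tame_diffeo_def image_iff) metis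
  moreover have "negligible (T ` {x \<in> U. \<not> P x})"
    by (rule negligible_differentiable_image_negligible[OF order_refl])
       (use P o in \<open>auto simp: negligible_AE_lebesgue_on intro!: tame_diffeo_differentiable_on[OF t]\<close>)
  ultimately show ?thesis
    using o by (auto simp: negligible_AE_lebesgue_on intro: negligible_subset)
qed

text \<open>A preimage under \<open>S\<close> is an image under \<open>T\<close>, and differentiable
  maps carry Lebesgue measurable sets to Lebesgue measurable sets.\<close>

lemma tame_diffeo_measurable:
  assumes t: "tame_diffeo U V T S K" and f: "f \<in> borel_measurable (lebesgue_on U)"
  shows "(\<lambda>y. f (S y)) \<in> borel_measurable (lebesgue_on V)"
proof (rule measurableI)
  have o: "U \<in> sets lebesgue" "V \<in> sets lebesgue" using t by (auto simp: tame_diffeo_def)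
  fix B :: "'b set" assume B: "B \<in> sets borel"
  have eq: "(\<lambda>y. f (S y)) -` B \<inter> space (lebesgue_on V) = T ` {x \<in> U. f x \<in> B}"
    using t by (auto simp: tame_diffeo_def image_iff) metis
  have "f -` B \<inter> space (lebesgue_on U) \<in> sets (lebesgue_on U)" by (rule measurable_sets[OF f B])
  then have "{x \<in> U. f x \<in> B} \<in> sets lebesgue"
    using o(1) by (auto simp: sets_restrict_space_iff vimage_def Int_def conj_commute)
  then have "T ` {x \<in> U. f x \<in> B} \<in> sets lebesgue"
    by (rule differentiable_image_in_sets_lebesgue[OF _ order_refl]) (auto intro!: tame_diffeo_differentiable_on[OF t])
  moreover have "T ` {x \<in> U. f x \<in> B} \<subseteq> V" using t by (auto simp: tame_diffeo_def)
  ultimately show "(\<lambda>y. f (S y)) -` B \<inter> space (lebesgue_on V) \<in> sets (lebesgue_on V)"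
    unfolding eq using o(2) by (simp add: sets_restrict_space_iff)
qed simp

lemma tame_diffeo_change_of_variables:
  fixes f :: "real^'d \<Rightarrow> complex"
  assumes dim: "CARD('d) \<in> {2, 3}" and t: "tame_diffeo U V T S K"
  shows "integrable (lebesgue_on U) (\<lambda>x. \<bar>det (jac T x)\<bar> *\<^sub>R f (T x)) \<longleftrightarrow> integrable (lebesgue_on V) f"
    and "integrable (lebesgue_on V) f \<Longrightarrow>
       integral\<^sup>L (lebesgue_on U) (\<lambda>x. \<bar>det (jac T x)\<bar> *\<^sub>R f (T x)) = integral\<^sup>L (lebesgue_on V) f"
proof -
  have o: "U \<in> sets lebesgue" "V \<in> sets lebesgue" using t by (auto simp: tame_diffeo_def)
  have der: "(T has_derivative frechet_derivative T (at x)) (at x within U)" if "x \<in> U" for x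
    using t that C1_on_differentiable frechet_derivative_works has_derivative_at_withinI
    unfolding tame_diffeo_def by blast
  note im = tame_diffeo_image[OF t]
  note cv = change_of_variables_complex[OF dim o(1) der im(2) o(2)[folded im(1)], of f]
  show "integrable (lebesgue_on U) (\<lambda>x. \<bar>det (jac T x)\<bar> *\<^sub>R f (T x)) \<longleftrightarrow> integrable (lebesgue_on V) f"
    using cv(1) unfolding im(1) jac_def .
  show "integrable (lebesgue_on V) f \<Longrightarrow>
       integral\<^sup>L (lebesgue_on U) (\<lambda>x. \<bar>det (jac T x)\<bar> *\<^sub>R f (T x)) = integral\<^sup>L (lebesgue_on V) f"
    using cv(2) unfolding im(1) jac_def .
qed

lemma tame_diffeo_det:
  fixes T :: "real^'d \<Rightarrow> real^'d"
  assumes t: "tame_diffeo U V T S K" and x: "x \<in> U"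
  shows "\<bar>det (jac T x)\<bar> \<le> fact CARD('d) * K ^ CARD('d)" "1 / (fact CARD('d) * K ^ CARD('d)) \<le> \<bar>det (jac T x)\<bar>"
    "0 < fact CARD('d) * K ^ CARD('d)"
proof -
  \<comment> \<open>The zero matrix is a dummy: only the determinant bounds of
    \<open>elliptic_at_push\<close> are wanted.\<close>
  have e: "elliptic_at 0 0 (0 :: real^'d^'d)" by (simp add: elliptic_at_def transpose_def vec_eq_iff)
  have K: "\<bar>jac T x $ i $ j\<bar> \<le> K" "\<bar>jac S (T x) $ i $ j\<bar> \<le> K" for i j
    using t x by (auto simp: tame_diffeo_def)
  note P = elliptic_at_push[OF e order_refl tame_diffeo_jac_inverse[OF t x] K refl]
  show "\<bar>det (jac T x)\<bar> \<le> fact CARD('d) * K ^ CARD('d)" "1 / (fact CARD('d) * K ^ CARD('d)) \<le> \<bar>det (jac T x)\<bar>"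
    "0 < fact CARD('d) * K ^ CARD('d)"
    by (rule P)+
qed

text \<open>The composed integrand lacks the Jacobian required by the transformation formula; it is
  inserted using the lower bound of \<open>tame_diffeo_det\<close>, whence the constant under the
  square root.\<close>

lemma tame_diffeo_L2:
  fixes u :: "real^'d \<Rightarrow> 'b::euclidean_space"
  assumes dim: "CARD('d) \<in> {2, 3}" and t: "tame_diffeo U V T S K" and u: "L2_on U u"
  shows "L2_on V (\<lambda>y. u (S y))"
    and "L2_norm V (\<lambda>y. u (S y)) \<le> sqrt (fact CARD('d) * K ^ CARD('d)) * L2_norm U u"
proof -
  let ?D = "fact CARD('d) * K ^ CARD('d) :: real"
  note t' = tame_diffeo_sym[OF t]
  have [measurable]: "(\<lambda>y. u (S y)) \<in> borel_measurable (lebesgue_on V)"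
    by (rule tame_diffeo_measurable[OF t L2_on_measurable[OF u]])
  \<comment> \<open>Read as a complex function in order to fit the transformation formula.\<close>
  let ?f = "\<lambda>x. complex_of_real ((norm (u x))\<^sup>2)"
  let ?g = "\<lambda>y. \<bar>det (jac S y)\<bar> * (norm (u (S y)))\<^sup>2"
  have i: "integrable (lebesgue_on U) ?f"
    using u by (simp only: L2_on_def complex_of_real_integrable_eq)
  have e: "\<bar>det (jac S y)\<bar> *\<^sub>R ?f (S y) = complex_of_real (?g y)" for y by (simp add: scaleR_conv_of_real)
  have gi: "integrable (lebesgue_on V) ?g"
    using tame_diffeo_change_of_variables(1)[OF dim t', of ?f] i unfolding e by (simp only: complex_of_real_integrable_eq)
  have "complex_of_real (\<integral>y. ?g y \<partial>lebesgue_on V) = complex_of_real (\<integral>x. (norm (u x))\<^sup>2 \<partial>lebesgue_on U)"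
    using tame_diffeo_change_of_variables(2)[OF dim t' i] unfolding e integral_complex_of_real .
  then have gint: "(\<integral>y. ?g y \<partial>lebesgue_on V) = (\<integral>x. (norm (u x))\<^sup>2 \<partial>lebesgue_on U)"
    by (simp only: of_real_eq_iff)
  have le: "(norm (u (S y)))\<^sup>2 \<le> ?D * ?g y" if "y \<in> V" for y
  proof -
    note d = tame_diffeo_det[OF t' that]
    have "1 \<le> ?D * \<bar>det (jac S y)\<bar>" using d(2,3) by (simp add: field_simps)
    from mult_right_mono[OF this, of "(norm (u (S y)))\<^sup>2"] show ?thesis by (simp add: mult_ac)
  qed
  have ui: "integrable (lebesgue_on V) (\<lambda>y. (norm (u (S y)))\<^sup>2)"
  proof (rule Bochner_Integration.integrable_bound)
    show "integrable (lebesgue_on V) (\<lambda>y. ?D * ?g y)" using gi by simp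
    show "AE y in lebesgue_on V. norm ((norm (u (S y)))\<^sup>2) \<le> norm (?D * ?g y)"
    proof (rule AE_I2)
      fix y assume "y \<in> space (lebesgue_on V)"
      then have "(norm (u (S y)))\<^sup>2 \<le> ?D * ?g y" using le by simp
      then show "norm ((norm (u (S y)))\<^sup>2) \<le> norm (?D * ?g y)"
        by (metis abs_ge_self norm_ge_zero order_trans power2_abs real_norm_def abs_power2)
    qed
  qed measurable
  then show "L2_on V (\<lambda>y. u (S y))" by (simp add: L2_on_def)
  have "(\<integral>y. (norm (u (S y)))\<^sup>2 \<partial>lebesgue_on V) \<le> (\<integral>y. ?D * ?g y \<partial>lebesgue_on V)"
    by (rule integral_mono[OF ui]) (use gi le in auto)
  also have "\<dots> = ?D * (\<integral>x. (norm (u x))\<^sup>2 \<partial>lebesgue_on U)" using gint by simp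
  finally show "L2_norm V (\<lambda>y. u (S y)) \<le> sqrt ?D * L2_norm U u"
    unfolding L2_norm_def real_sqrt_mult[symmetric] by (rule real_sqrt_le_mono)
qed

lemma bounded_matrix_jac:
  assumes t: "tame_diffeo U V T S K" and "0 \<le> K"
  shows "bounded_matrix V (\<lambda>y. transpose (cmat (jac S y))) K"
proof -
  have o: "open V" "C1_on V S" using t by (auto simp: tame_diffeo_def)
  have "(\<lambda>y. jac S y $ j $ i) \<in> borel_measurable (lebesgue_on V)" for i j
    using continuous_imp_measurable_on_sets_lebesgue[OF continuous_on_jac[OF o(2)]] o(1) by simp
  then show ?thesis
    using t \<open>0 \<le> K\<close> by (auto simp: bounded_matrix_def transpose_def cmat_def tame_diffeo_def)
qed

lemma tame_diffeo_pull_L2: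
  fixes g :: "real^'d \<Rightarrow> complex^'d"
  assumes dim: "CARD('d) \<in> {2, 3}" and t: "tame_diffeo U V T S K" and K: "0 \<le> K" and g: "L2_on U g"
  shows "L2_on V (pull S g)"
    and "L2_norm V (pull S g) \<le> ((real CARD('d))\<^sup>2 * K * sqrt (fact CARD('d) * K ^ CARD('d))) * L2_norm U g"
proof -
  note B = bounded_matrix_L2[OF bounded_matrix_jac[OF t K] tame_diffeo_L2(1)[OF dim t g]]
  show "L2_on V (pull S g)" using B(1) by (simp add: pull_def[abs_def])
  have "L2_norm V (pull S g) \<le> (real CARD('d))\<^sup>2 * K * L2_norm V (\<lambda>y. g (S y))"
    using B(2) by (simp add: pull_def[abs_def])
  also have "\<dots> \<le> (real CARD('d))\<^sup>2 * K * (sqrt (fact CARD('d) * K ^ CARD('d)) * L2_norm U g)"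
    by (intro mult_left_mono tame_diffeo_L2(2)[OF dim t g]) (use K in auto)
  finally show "L2_norm V (pull S g) \<le> ((real CARD('d))\<^sup>2 * K * sqrt (fact CARD('d) * K ^ CARD('d))) * L2_norm U g"
    by (simp add: mult_ac)
qed

lemma pushforward_eq_push_matrix:
  "pushforward U T a y = push_matrix (jac T (inv_into U T y)) (a (inv_into U T y))"
  by (simp add: pushforward_def push_matrix_def jac_def Let_def)

text \<open>\<open>L ** J = mat 1\<close> lets the factor \<open>transpose J\<close> of the
  push-forward undo \<open>transpose L\<close>, and transposition moves the remaining
  \<open>J\<close> onto \<open>k\<close>.\<close>

lemma bdot_push_matrix:
  assumes "L ** J = mat 1"
  shows "bdot (cmat (push_matrix J M) *v (transpose (cmat L) *v g)) k
    = complex_of_real (1 / \<bar>det J\<bar>) * bdot (cmat M *v g) (transpose (cmat J) *v k)"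
proof -
  have "transpose (cmat J) *v (transpose (cmat L) *v g) = g"
    using assms by (metis cmat_mat_1 cmat_mult matrix_transpose_mul matrix_vector_mul_assoc matrix_vector_mul_lid transpose_mat)
  then have "cmat (push_matrix J M) *v (transpose (cmat L) *v g) = complex_of_real (1 / \<bar>det J\<bar>) *s (cmat J *v (cmat M *v g))"
    unfolding push_matrix_def cmat_scaleR_vec by (simp add: cmat_mult cmat_transpose matrix_vector_mul_assoc[symmetric])
  then show ?thesis by (simp only: bdot_smult_left bdot_matrix_transpose)
qed

text \<open>Invariance of the Dirichlet form under push-forward: the factor
  \<open>1 / \<bar>det J\<bar>\<close> in the transported matrix cancels the Jacobian of the change
  of variables.\<close>

lemma tame_diffeo_form:
  fixes g k :: "real^'d \<Rightarrow> complex^'d"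
  assumes dim: "CARD('d) \<in> {2, 3}" and t: "tame_diffeo U V T S K"
    and i: "integrable (lebesgue_on U) (\<lambda>x. bdot (cmat (A x) *v g x) (pull T k x))"
  shows "integrable (lebesgue_on V) (\<lambda>y. bdot (cmat (push_matrix (jac T (S y)) (A (S y))) *v pull S g y) (k y))"
    and "(\<integral>y. bdot (cmat (push_matrix (jac T (S y)) (A (S y))) *v pull S g y) (k y) \<partial>lebesgue_on V)
       = (\<integral>x. bdot (cmat (A x) *v g x) (pull T k x) \<partial>lebesgue_on U)"
proof -
  let ?f = "\<lambda>y. bdot (cmat (push_matrix (jac T (S y)) (A (S y))) *v pull S g y) (k y)"
  have eq: "\<bar>det (jac T x)\<bar> *\<^sub>R ?f (T x) = bdot (cmat (A x) *v g x) (pull T k x)" if "x \<in> U" for x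
  proof -
    have s: "S (T x) = x" using t that by (auto simp: tame_diffeo_def)
    have "det (jac S (T x)) * det (jac T x) = 1"
      using tame_diffeo_jac_inverse(1)[OF t that] by (metis det_I det_mul)
    then have "det (jac T x) \<noteq> 0" by auto
    then show ?thesis
      using bdot_push_matrix[OF tame_diffeo_jac_inverse(1)[OF t that], of "A x" "g x" "k (T x)"]
      by (simp add: s pull_def scaleR_conv_of_real)
  qed
  have "integrable (lebesgue_on U) (\<lambda>x. \<bar>det (jac T x)\<bar> *\<^sub>R ?f (T x))"
    using i eq by (subst Bochner_Integration.integrable_cong[OF refl]) auto
  then show I: "integrable (lebesgue_on V) ?f"
    using tame_diffeo_change_of_variables(1)[OF dim t, of ?f] by simp
  have "integral\<^sup>L (lebesgue_on V) ?f = (\<integral>x. \<bar>det (jac T x)\<bar> *\<^sub>R ?f (T x) \<partial>lebesgue_on U)"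
    by (rule tame_diffeo_change_of_variables(2)[OF dim t I, symmetric])
  also have "\<dots> = (\<integral>x. bdot (cmat (A x) *v g x) (pull T k x) \<partial>lebesgue_on U)"
    by (rule Bochner_Integration.integral_cong) (use eq in auto)
  finally show "integral\<^sup>L (lebesgue_on V) ?f = (\<integral>x. bdot (cmat (A x) *v g x) (pull T k x) \<partial>lebesgue_on U)" .
qed

section \<open>Gluing of Lipschitz maps\<close>

text \<open>Carrying the inverse as data allows restriction and composition without returning to
  \<open>inv_into\<close>.\<close>

definition C1_pair ::
  "(real^'d) set \<Rightarrow> (real^'d) set \<Rightarrow> (real^'d \<Rightarrow> real^'d) \<Rightarrow> (real^'d \<Rightarrow> real^'d) \<Rightarrow> bool" where
  "C1_pair U V T S \<longleftrightarrow> open U \<and> open V \<and> (\<forall>x\<in>U. T x \<in> V \<and> S (T x) = x) \<and> (\<forall>y\<in>V. S y \<in> U \<and> T (S y) = y) \<and>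
     C1_on U T \<and> C1_on V S"

lemma diffeo_C1_pair: "diffeo U V T \<Longrightarrow> C1_pair U V T (inv_into U T)"
  unfolding diffeo_def C1_pair_def bij_betw_def
  by (auto intro!: Ck_on_1_imp_C1_on inv_into_into simp: inv_into_f_f f_inv_into_f simp del: One_nat_def)

lemma C1_pairD:
  assumes "C1_pair U V T S"
  shows "x \<in> U \<Longrightarrow> T x \<in> V \<and> S (T x) = x" "y \<in> V \<Longrightarrow> S y \<in> U \<and> T (S y) = y"
  using assms unfolding C1_pair_def by blast+

lemma C1_pair_compose:
  assumes "C1_pair U V T S" "C1_pair U' V' T' S'"
  shows "C1_pair {x \<in> U. T x \<in> U'} {y \<in> V'. S' y \<in> V} (T' \<circ> T) (S \<circ> S')"
proof -
  note a = assms[unfolded C1_pair_def]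
  have eq: "{x \<in> U. T x \<in> U'} = U \<inter> T -` U'" "{y \<in> V'. S' y \<in> V} = V' \<inter> S' -` V" by auto
  have "open {x \<in> U. T x \<in> U'}"
    unfolding eq by (rule continuous_open_preimage) (use a in \<open>auto intro: C1_on_continuous\<close>)
  moreover have "open {y \<in> V'. S' y \<in> V}"
    unfolding eq by (rule continuous_open_preimage) (use a in \<open>auto intro: C1_on_continuous\<close>)
  moreover have "C1_on {x \<in> U. T x \<in> U'} (T' \<circ> T)"
    by (rule C1_on_compose[of _ _ U']) (use a C1_on_subset in \<open>auto intro: C1_on_subset\<close>)
  moreover have "C1_on {y \<in> V'. S' y \<in> V} (S \<circ> S')"
    by (rule C1_on_compose[of _ _ V]) (use a C1_on_subset in \<open>auto intro: C1_on_subset\<close>)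
  ultimately show ?thesis using a unfolding C1_pair_def by auto
qed

text \<open>Regularity of \<open>T\<close> up to the boundary of \<open>K\<close>: near
  \<open>p\<close> it is the restriction of a diffeomorphism of a full neighbourhood, and this
  extension may depend on \<open>p\<close>.\<close>

definition loc_diffeo :: "(real^'d) set \<Rightarrow> (real^'d \<Rightarrow> real^'d) \<Rightarrow> real^'d \<Rightarrow> bool" where
  "loc_diffeo K T p \<longleftrightarrow> (\<exists>W Z T' S' e. C1_pair W Z T' S' \<and> e > 0 \<and> ball p e \<subseteq> W \<and> (\<forall>x\<in>ball p e \<inter> K. T' x = T x))"

lemma loc_diffeo_mono: "loc_diffeo K T p \<Longrightarrow> K' \<subseteq> K \<Longrightarrow> loc_diffeo K' T p"
  unfolding loc_diffeo_def by (meson Int_iff subsetD)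

lemma loc_diffeo_continuous:
  assumes "\<And>p. p \<in> K \<Longrightarrow> loc_diffeo K T p"
  shows "continuous_on K T"
  unfolding continuous_on_eq_continuous_within
proof
  fix p assume p: "p \<in> K"
  obtain W Z T' S' e where w: "C1_pair W Z T' S'" "e > 0" "ball p e \<subseteq> W" "\<And>x. x \<in> ball p e \<inter> K \<Longrightarrow> T' x = T x"
    using assms[OF p] unfolding loc_diffeo_def by blast
  have "isCont T' p"
    using w C1_on_continuous[of W T'] continuous_on_eq_continuous_at[of W T'] unfolding C1_pair_def
    by (meson centre_in_ball subsetD)
  then have "continuous (at p within K) T'" by (rule continuous_at_imp_continuous_within)
  then show "continuous (at p within K) T"
    by (rule continuous_transform_within[OF _ w(2) p]) (use w(4) in \<open>auto simp: dist_commute\<close>)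
qed

text \<open>Compactness of \<open>K\<close> makes \<open>S\<close> continuous, so near
  \<open>q\<close> the values of \<open>S\<close> stay where \<open>T\<close> agrees with its local
  extension; there \<open>S\<close> agrees with the inverse of that extension.\<close>

lemma loc_diffeo_inverse:
  assumes K: "compact K" and T: "\<And>x. x \<in> K \<Longrightarrow> T x \<in> L \<and> S (T x) = x" and S: "\<And>y. y \<in> L \<Longrightarrow> S y \<in> K \<and> T (S y) = y"
    and loc: "\<And>p. p \<in> K \<Longrightarrow> loc_diffeo K T p" and q: "q \<in> L"
  shows "loc_diffeo L S q"
proof -
  have "T ` K = L" using T S by (auto simp: image_iff) metis
  then have cS: "continuous_on L S"
    using continuous_on_inv[OF loc_diffeo_continuous[OF loc] K, of S] T by auto
  have p: "S q \<in> K" using S q by auto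
  obtain W Z T' S' e where w: "C1_pair W Z T' S'" "e > 0" "ball (S q) e \<subseteq> W" "\<And>x. x \<in> ball (S q) e \<inter> K \<Longrightarrow> T' x = T x"
    using loc[OF p] unfolding loc_diffeo_def by blast
  have "T' (S q) = q" using w(2,4) p S[OF q] by auto
  moreover have "S q \<in> W" using w(2,3) by auto
  ultimately have "q \<in> Z" using w(1) unfolding C1_pair_def by metis
  then obtain d1 where d1: "d1 > 0" "ball q d1 \<subseteq> Z"
    using w(1) openE unfolding C1_pair_def by metis
  obtain d2 where d2: "d2 > 0" "\<And>y. y \<in> L \<Longrightarrow> dist y q < d2 \<Longrightarrow> dist (S y) (S q) < e"
    using cS q w(2) unfolding continuous_on_iff by metis
  have "S' y = S y" if y: "y \<in> ball q (min d1 d2) \<inter> L" for y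
  proof -
    have "S y \<in> ball (S q) e \<inter> K" using d2(2)[of y] y S[of y] by (auto simp: dist_commute)
    then have "T' (S y) = y" "S y \<in> W" using w(3,4) S[of y] y by auto
    then show ?thesis using w(1) unfolding C1_pair_def by metis
  qed
  moreover have "C1_pair Z W S' T'" using w(1) unfolding C1_pair_def by auto
  ultimately show ?thesis
    unfolding loc_diffeo_def using d1 d2(1) by (intro exI[of _ Z] exI[of _ W] exI[of _ S'] exI[of _ T'] exI[of _ "min d1 d2"]) auto
qed

lemma compact_locally_bounded:
  fixes q :: "'a::metric_space \<Rightarrow> real"
  assumes K: "compact K" and loc: "\<And>p. p \<in> K \<Longrightarrow> \<exists>e>0. \<exists>L. \<forall>x\<in>ball p e. x \<in> U \<longrightarrow> q x \<le> L"
  obtains L where "\<And>x. x \<in> K \<Longrightarrow> x \<in> U \<Longrightarrow> q x \<le> L"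
proof -
  obtain e L where eL: "\<And>p. p \<in> K \<Longrightarrow> e p > 0" "\<And>p x. p \<in> K \<Longrightarrow> x \<in> ball p (e p) \<Longrightarrow> x \<in> U \<Longrightarrow> q x \<le> L p"
    using loc by metis
  have "K \<subseteq> (\<Union>p\<in>K. ball p (e p))" using eL(1) by force
  then obtain C where C: "C \<subseteq> K" "finite C" "K \<subseteq> (\<Union>p\<in>C. ball p (e p))"
    using compactE_image[OF K, of K "\<lambda>p. ball p (e p)"] by auto
  \<comment> \<open>\<open>insert 0\<close> keeps \<open>Max\<close> meaningful when the finite
    subcover is empty.\<close>
  have "q x \<le> Max (insert 0 (L ` C))" if x: "x \<in> K" "x \<in> U" for x
  proof -
    obtain p where p: "p \<in> C" "x \<in> ball p (e p)" using C(3) x(1) by blast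
    then have "q x \<le> L p" using eL(2) C(1) x(2) by blast
    also have "\<dots> \<le> Max (insert 0 (L ` C))" using p(1) C(2) by (intro Max_ge) auto
    finally show ?thesis .
  qed
  then show ?thesis by (rule that)
qed

text \<open>Near each point of \<open>K\<close> the Jacobian is that of a continuously
  differentiable extension, hence locally bounded; compactness makes the bound uniform.
  \<open>T\<close> stands for the map completed on the boundary, \<open>T0\<close> for the original
  one.\<close>

lemma loc_diffeo_jac_bounded:
  assumes K: "compact K" and loc: "\<And>p. p \<in> K \<Longrightarrow> loc_diffeo K T p"
    and U: "open U" "U \<subseteq> K" and eq: "\<And>x. x \<in> U \<Longrightarrow> T x = T0 x"
  shows "\<exists>C. \<forall>x\<in>U. \<forall>i j. \<bar>jac T0 x $ i $ j\<bar> \<le> C"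
proof -
  have "\<exists>e>0. \<exists>L. \<forall>x\<in>ball p e. x \<in> U \<longrightarrow> (\<Sum>i\<in>UNIV. \<Sum>j\<in>UNIV. \<bar>jac T0 x $ i $ j\<bar>) \<le> L" if p: "p \<in> K" for p
  proof -
    obtain W Z T' S' e where w: "C1_pair W Z T' S'" "e > 0" "ball p e \<subseteq> W" "\<And>x. x \<in> ball p e \<inter> K \<Longrightarrow> T' x = T x"
      using loc[OF p] unfolding loc_diffeo_def by blast
    let ?q = "\<lambda>x. \<Sum>i\<in>UNIV. \<Sum>j\<in>UNIV. \<bar>jac T' x $ i $ j\<bar>"
    have "C1_on W T'" "open W" using w(1) by (auto simp: C1_pair_def)
    then have "continuous_on W ?q" by (intro continuous_intros continuous_on_jac)
    then have "isCont ?q p"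
      using \<open>open W\<close> w(2,3) by (meson centre_in_ball continuous_on_eq_continuous_at subsetD)
    then obtain d where d: "d > 0" "\<And>x. dist x p < d \<Longrightarrow> dist (?q x) (?q p) < 1"
      unfolding continuous_at_eps_delta by (metis zero_less_one)
    have "(\<Sum>i\<in>UNIV. \<Sum>j\<in>UNIV. \<bar>jac T0 x $ i $ j\<bar>) \<le> ?q p + 1" if x: "x \<in> ball p (min d e)" "x \<in> U" for x
    proof -
      have "jac T0 x = jac T' x"
        by (rule jac_cong_open[of "U \<inter> ball p e"]) (use x U w(4) eq in auto)
      moreover have "?q x \<le> ?q p + 1" using d(2)[of x] x by (auto simp: dist_commute dist_real_def)
      ultimately show ?thesis by simp
    qed
    then show ?thesis using d(1) w(2) by (intro exI[of _ "min d e"] conjI exI[of _ "?q p + 1"]) auto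
  qed
  then obtain L where L: "\<And>x. x \<in> K \<Longrightarrow> x \<in> U \<Longrightarrow> (\<Sum>i\<in>UNIV. \<Sum>j\<in>UNIV. \<bar>jac T0 x $ i $ j\<bar>) \<le> L"
    using compact_locally_bounded[OF K, of U "\<lambda>x. \<Sum>i\<in>UNIV. \<Sum>j\<in>UNIV. \<bar>jac T0 x $ i $ j\<bar>"] by blast
  have "\<bar>jac T0 x $ i $ j\<bar> \<le> L" if "x \<in> U" for x i j
  proof -
    have "\<bar>jac T0 x $ i $ j\<bar> \<le> (\<Sum>j\<in>UNIV. \<bar>jac T0 x $ i $ j\<bar>)" by (rule member_le_sum) auto
    also have "\<dots> \<le> (\<Sum>i\<in>UNIV. \<Sum>j\<in>UNIV. \<bar>jac T0 x $ i $ j\<bar>)"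
      by (rule member_le_sum[of i UNIV "\<lambda>i. \<Sum>j\<in>UNIV. \<bar>jac T0 x $ i $ j\<bar>"]) (auto intro: sum_nonneg)
    also have "\<dots> \<le> L" using L that U(2) by blast
    finally show ?thesis .
  qed
  then show ?thesis by blast
qed

section \<open>Lipschitz functions glued across a sphere\<close>

definition loc_ext :: "(real^'d) set \<Rightarrow> (real^'d \<Rightarrow> complex) \<Rightarrow> real^'d \<Rightarrow> bool" where
  "loc_ext K h p \<longleftrightarrow> (\<exists>h' e L. e > 0 \<and> L-lipschitz_on (ball p e) h' \<and> (\<forall>x\<in>ball p e \<inter> K. h' x = h x))"

lemma lipschitz_on_ball_mono: "L-lipschitz_on (ball p e) h \<Longrightarrow> d \<le> e \<Longrightarrow> L-lipschitz_on (ball p d) h"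
  by (rule lipschitz_on_subset) (auto intro: subset_ball)

lemma loc_ext_C1:
  assumes "C1_on UNIV \<phi>"
  shows "loc_ext K \<phi> p"
proof -
  obtain e L where "e > 0" "L-lipschitz_on (ball p e) \<phi>"
    using C1_on_locally_lipschitz[OF assms open_UNIV UNIV_I] by blast
  then show ?thesis unfolding loc_ext_def by blast
qed

lemma loc_ext_compose:
  assumes \<phi>: "C1_on UNIV \<phi>" and T: "loc_diffeo K T p"
  shows "loc_ext K (\<lambda>x. \<phi> (T x)) p"
proof -
  obtain W Z T' S' e where w: "C1_pair W Z T' S'" "e > 0" "ball p e \<subseteq> W" "\<And>x. x \<in> ball p e \<inter> K \<Longrightarrow> T' x = T x"
    using T unfolding loc_diffeo_def by blast
  have W: "open W" "C1_on W T'" "p \<in> W" using w by (auto simp: C1_pair_def)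
  have "C1_on W (\<phi> \<circ> T')" by (rule C1_on_compose[OF W(2) \<phi>]) simp
  then obtain d L where d: "d > 0" "ball p d \<subseteq> W" "L-lipschitz_on (ball p d) (\<phi> \<circ> T')"
    using C1_on_locally_lipschitz[OF _ W(1,3)] by blast
  show ?thesis
    unfolding loc_ext_def
    using d w(2,4) lipschitz_on_ball_mono[OF d(3), of "min d e"]
    by (intro exI[of _ "\<phi> \<circ> T'"] exI[of _ "min d e"] exI[of _ L]) auto
qed

lemma loc_ext_combine:
  assumes "loc_ext K f p" "loc_ext K g p" "loc_ext K h p"
  shows "loc_ext K (\<lambda>x. f x - g x + h x) p"
proof -
  obtain f' e L where f: "e > 0" "L-lipschitz_on (ball p e) f'" "\<And>x. x \<in> ball p e \<inter> K \<Longrightarrow> f' x = f x"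
    using assms(1) unfolding loc_ext_def by blast
  obtain g' e2 L2 where g: "e2 > 0" "L2-lipschitz_on (ball p e2) g'" "\<And>x. x \<in> ball p e2 \<inter> K \<Longrightarrow> g' x = g x"
    using assms(2) unfolding loc_ext_def by blast
  obtain h' e3 L3 where h: "e3 > 0" "L3-lipschitz_on (ball p e3) h'" "\<And>x. x \<in> ball p e3 \<inter> K \<Longrightarrow> h' x = h x"
    using assms(3) unfolding loc_ext_def by blast
  let ?d = "min e (min e2 e3)"
  have "(L + L2 + L3)-lipschitz_on (ball p ?d) (\<lambda>x. f' x - g' x + h' x)"
    by (intro lipschitz_on_add lipschitz_on_diff lipschitz_on_ball_mono[OF f(2)] lipschitz_on_ball_mono[OF g(2)]
          lipschitz_on_ball_mono[OF h(2)]) auto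
  moreover have "f' x - g' x + h' x = f x - g x + h x" if "x \<in> ball p ?d \<inter> K" for x
    using that f(3)[of x] g(3)[of x] h(3)[of x] by simp
  ultimately show ?thesis
    unfolding loc_ext_def using f(1) g(1) h(1)
    by (intro exI[of _ "\<lambda>x. f' x - g' x + h' x"] exI[of _ ?d] exI[of _ "L + L2 + L3"]) auto
qed

lemma loc_ext_cong:
  assumes "loc_ext K f p" "\<And>x. x \<in> K \<Longrightarrow> f x = g x"
  shows "loc_ext K g p"
proof -
  obtain f' e L where f: "e > 0" "L-lipschitz_on (ball p e) f'" "\<And>x. x \<in> ball p e \<inter> K \<Longrightarrow> f' x = f x"
    using assms(1) unfolding loc_ext_def by blast
  then have "\<forall>x\<in>ball p e \<inter> K. f' x = g x" using assms(2) by simp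
  with f(1,2) show ?thesis unfolding loc_ext_def by blast
qed

definition loc_lip :: "(real^'d \<Rightarrow> complex) \<Rightarrow> real^'d \<Rightarrow> bool" where
  "loc_lip h p \<longleftrightarrow> (\<exists>e>0. \<exists>L. L-lipschitz_on (ball p e) h)"

lemma loc_lip_interior:
  assumes "loc_ext K h p" "e > 0" "ball p e \<subseteq> K"
  shows "loc_lip h p"
proof -
  obtain h' d L where h: "d > 0" "L-lipschitz_on (ball p d) h'" "\<And>x. x \<in> ball p d \<inter> K \<Longrightarrow> h' x = h x"
    using assms(1) unfolding loc_ext_def by blast
  have "L-lipschitz_on (ball p (min d e)) h'"
    by (rule lipschitz_on_ball_mono[OF h(2)]) simp
  then have "L-lipschitz_on (ball p (min d e)) h"
    using h(3) assms(3) by (auto simp: lipschitz_on_def subset_iff)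
  then show ?thesis unfolding loc_lip_def using h(1) assms(2) by (intro exI[of _ "min d e"]) auto
qed

lemma segment_crosses_sphere:
  fixes x y :: "'a::real_normed_vector"
  assumes "norm x \<le> r" "r \<le> norm y"
  obtains z where "norm z = r" "z \<in> closed_segment x y"
proof -
  have c: "continuous_on (closed_segment x y) norm" by (intro continuous_intros)
  have "connected (norm ` closed_segment x y)"
    by (rule connected_continuous_image[OF c]) simp
  then have "r \<in> norm ` closed_segment x y"
    using assms connectedD_interval[of "norm ` closed_segment x y" "norm x" "norm y" r] by auto
  then show ?thesis using that by blast
qed

text \<open>A segment joining the two sides meets the sphere inside the ball, and lengths add along
  a segment, so the larger of the two constants also serves pairs on opposite sides.\<close>

lemma loc_lip_glue:
  assumes K1: "loc_ext K1 h p" "\<And>x. x \<in> ball p e \<Longrightarrow> norm x \<le> r \<Longrightarrow> x \<in> K1"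
    and K2: "loc_ext K2 h p" "\<And>x. x \<in> ball p e \<Longrightarrow> r \<le> norm x \<Longrightarrow> x \<in> K2" and e: "e > 0"
  shows "loc_lip h p"
proof -
  obtain a d1 L1 where a: "d1 > 0" "L1-lipschitz_on (ball p d1) a" "\<And>x. x \<in> ball p d1 \<inter> K1 \<Longrightarrow> a x = h x"
    using K1(1) unfolding loc_ext_def by blast
  obtain b d2 L2 where b: "d2 > 0" "L2-lipschitz_on (ball p d2) b" "\<And>x. x \<in> ball p d2 \<inter> K2 \<Longrightarrow> b x = h x"
    using K2(1) unfolding loc_ext_def by blast
  define d where "d = min e (min d1 d2)"
  define L where "L = max L1 L2"
  have la: "dist (a x) (a y) \<le> L * dist x y" if "x \<in> ball p d" "y \<in> ball p d" for x y
  proof -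
    have "dist (a x) (a y) \<le> L1 * dist x y" using lipschitz_onD[OF a(2), of x y] that by (auto simp: d_def)
    also have "\<dots> \<le> L * dist x y" by (intro mult_right_mono) (auto simp: L_def)
    finally show ?thesis .
  qed
  have lb: "dist (b x) (b y) \<le> L * dist x y" if "x \<in> ball p d" "y \<in> ball p d" for x y
  proof -
    have "dist (b x) (b y) \<le> L2 * dist x y" using lipschitz_onD[OF b(2), of x y] that by (auto simp: d_def)
    also have "\<dots> \<le> L * dist x y" by (intro mult_right_mono) (auto simp: L_def)
    finally show ?thesis .
  qed
  have ha: "h x = a x" if "x \<in> ball p d" "norm x \<le> r" for x
    using a(3)[of x] K1(2)[of x] that by (auto simp: d_def)
  have hb: "h x = b x" if "x \<in> ball p d" "r \<le> norm x" for x
    using b(3)[of x] K2(2)[of x] that by (auto simp: d_def)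
  have cross: "dist (h x) (h y) \<le> L * dist x y"
    if xy: "x \<in> ball p d" "y \<in> ball p d" "norm x \<le> r" "r \<le> norm y" for x y
  proof -
    obtain z where z: "norm z = r" "z \<in> closed_segment x y" using segment_crosses_sphere[OF xy(3,4)] .
    have zb: "z \<in> ball p d" using z(2) xy(1,2) closed_segment_subset[OF _ _ convex_ball] by blast
    have "dist (h x) (h y) \<le> dist (a x) (a z) + dist (b z) (b y)"
      using dist_triangle[of "h x" "h y" "h z"] ha[OF xy(1,3)] hb[OF xy(2,4)] ha[OF zb] hb[OF zb] z(1) by simp
    also have "\<dots> \<le> L * dist x z + L * dist z y" by (intro add_mono la lb xy zb)
    also have "\<dots> = L * dist x y"
    proof -
      have "dist x y = dist x z + dist z y" using z(2) by (simp add: between_mem_segment[symmetric] between)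
      then show ?thesis by (simp add: distrib_left)
    qed
    finally show ?thesis .
  qed
  have "L-lipschitz_on (ball p d) h"
  proof (rule lipschitz_onI)
    show "0 \<le> L" using lipschitz_on_nonneg[OF a(2)] by (simp add: L_def)
    fix x y assume xy: "x \<in> ball p d" "y \<in> ball p d"
    consider "norm x \<le> r" "norm y \<le> r" | "norm x \<le> r" "r \<le> norm y" | "r \<le> norm x" "norm y \<le> r" | "r \<le> norm x" "r \<le> norm y"
      by linarith
    then show "dist (h x) (h y) \<le> L * dist x y"
    proof cases
      case 1
      then show ?thesis using la[OF xy] ha xy by simp
    next
      case 2
      then show ?thesis using cross[OF xy] by simp
    next
      case 3
      then show ?thesis using cross[OF xy(2,1)] by (simp add: dist_commute)
    next
      case 4
      then show ?thesis using lb[OF xy] hb xy by simp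
    qed
  qed
  moreover have "d > 0" using e a(1) b(1) by (simp add: d_def)
  ultimately show ?thesis unfolding loc_lip_def by blast
qed

text \<open>Compactness yields one constant for the local estimates; following the segment between
  two points makes them global with the same constant.\<close>

lemma loc_lip_imp_lipschitz:
  fixes h :: "real^'d \<Rightarrow> complex"
  assumes loc: "\<And>p. loc_lip h p" and K: "compact K" "\<And>x. x \<notin> K \<Longrightarrow> h x = 0"
  obtains L where "L-lipschitz_on UNIV h"
proof -
  obtain e L where eL: "\<And>p. e p > 0" "\<And>p. (L p)-lipschitz_on (ball p (e p)) h"
    using loc unfolding loc_lip_def by metis
  have "K \<subseteq> (\<Union>p\<in>K. ball p (e p))" using eL(1) by force
  then obtain C where C: "C \<subseteq> K" "finite C" "K \<subseteq> (\<Union>p\<in>C. ball p (e p))"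
    using compactE_image[OF K(1), of K "\<lambda>p. ball p (e p)"] by auto
  define M where "M = Max (insert 0 (L ` C))"
  have M0: "M \<ge> 0" unfolding M_def using C(2) by (intro Max_ge) auto
  have LM: "L p \<le> M" if "p \<in> C" for p unfolding M_def using C(2) that by (intro Max_ge) auto
  \<comment> \<open>Only pairs containing the centre \<open>p\<close> are compared, which suffices
    for moving along a segment. Outside \<open>K\<close> the function vanishes near
    \<open>p\<close>.\<close>
  have uni: "\<exists>d>0. \<forall>y\<in>ball p d. dist (h p) (h y) \<le> M * dist p y" for p
  proof (cases "p \<in> K")
    case True
    then obtain q where q: "q \<in> C" "p \<in> ball q (e q)" using C(3) by blast
    then obtain d where d: "d > 0" "ball p d \<subseteq> ball q (e q)" using openE[OF open_ball] by metis
    have "dist (h p) (h y) \<le> M * dist p y" if "y \<in> ball p d" for y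
    proof -
      have "dist (h p) (h y) \<le> L q * dist p y" using lipschitz_onD[OF eL(2)[of q], of p y] q(2) d(2) that by blast
      also have "\<dots> \<le> M * dist p y" using LM[OF q(1)] by (intro mult_right_mono) auto
      finally show ?thesis .
    qed
    then show ?thesis using d(1) by blast
  next
    case False
    then obtain d where d: "d > 0" "ball p d \<subseteq> - K"
      using openE[of "- K" p] compact_imp_closed[OF K(1)] by auto
    have "dist (h p) (h y) \<le> M * dist p y" if "y \<in> ball p d" for y
      using K(2)[of p] K(2)[of y] d(2) False that M0 by auto
    then show ?thesis using d(1) by blast
  qed
  have hc: "continuous_on UNIV h"
  proof (rule continuous_at_imp_continuous_on, rule ballI)
    fix p
    have "continuous_on (ball p (e p)) h" using eL(2)[of p] lipschitz_on_continuous_on by blast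
    then show "isCont h p" using eL(1)[of p] continuous_on_eq_continuous_at[of "ball p (e p)" h] by auto
  qed
  have "M-lipschitz_on UNIV h"
  proof (rule lipschitz_onI)
    fix x y :: "real^'d"
    let ?s = "\<lambda>t. x + t *\<^sub>R (y - x)"
    have "(M * norm (y - x))-lipschitz_on {0..1} (\<lambda>t. h (?s t))"
    proof (rule locally_lipschitz_imp_lipschitz)
      show "continuous_on {0..1} (\<lambda>t. h (?s t))"
        by (intro continuous_on_compose2[OF hc] continuous_intros) auto
      show "M * norm (y - x) \<ge> 0" using M0 by simp
      fix t u :: real assume t: "t \<in> {0..<1}" "t < u"
      obtain d where d: "d > 0" "\<And>z. z \<in> ball (?s t) d \<Longrightarrow> dist (h (?s t)) (h z) \<le> M * dist (?s t) z"
        using uni by blast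
      \<comment> \<open>A step short enough to stay within distance \<open>d\<close>; the
        \<open>+ 1\<close> covers the case \<open>x = y\<close>.\<close>
      define v where "v = min u (t + d / (2 * (norm (y - x) + 1)))"
      have n0: "norm (y - x) + 1 > 0" by (simp add: add_nonneg_pos)
      have v: "t < v" "v \<le> u" using t(2) d(1) n0 by (auto simp: v_def)
      have sv: "dist (?s t) (?s v) = (v - t) * norm (y - x)"
        using v(1) by (simp add: dist_norm scaleR_diff_left[symmetric] norm_minus_commute)
      have "(v - t) * norm (y - x) \<le> (d / (2 * (norm (y - x) + 1))) * (norm (y - x) + 1)"
        using v d(1) n0 by (intro mult_mono) (auto simp: v_def)
      also have "\<dots> < d"
      proof -
        have "(d / (2 * n)) * n < d" if "n > 0" for n using d(1) that by (simp add: field_simps)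
        then show ?thesis using n0 by blast
      qed
      finally have "?s v \<in> ball (?s t) d" unfolding mem_ball sv .
      then have "dist (h (?s t)) (h (?s v)) \<le> M * dist (?s t) (?s v)" by (rule d(2))
      then have "dist (h (?s v)) (h (?s t)) \<le> M * norm (y - x) * (v - t)"
        by (simp only: sv dist_commute[of "h (?s v)"] mult_ac)
      then show "\<exists>z\<in>{t<..u}. dist (h (?s z)) (h (?s t)) \<le> M * norm (y - x) * (z - t)"
        using v by (intro bexI[of _ v]) auto
    qed
    from lipschitz_onD[OF this, of 0 1] show "dist (h x) (h y) \<le> M * dist x y"
      by (simp add: dist_norm norm_minus_commute)
  qed (rule M0)
  then show ?thesis by (rule that)
qed

text \<open>Dominated convergence for the mollifications: the values converge uniformly, the
  gradients almost everywhere and boundedly, all within one compact set.\<close>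

lemma H0pair_lipschitz:
  fixes h :: "real^'d \<Rightarrow> complex"
  assumes S: "open S" and K: "compact K" "K \<subseteq> S" "\<And>x. x \<notin> K \<Longrightarrow> h x = 0" and L: "L-lipschitz_on UNIV h"
    and N: "AE x in lebesgue_on S. strict_grad h x (G x)" and G: "L2_on S G"
  shows "H0pair S h G"
proof -
  have Ss: "S \<in> sets lebesgue" using S by simp
  show ?thesis
  proof (rule mollify_lipschitz[OF S K L])
  fix \<phi> B C
  assume \<phi>: "\<And>n. test_function S (\<phi> n)" "compact B" "B \<subseteq> S" "K \<subseteq> B"
    "\<And>n x. x \<notin> B \<Longrightarrow> \<phi> n x = 0" "C \<ge> 0" "\<And>n x. norm (\<phi> n x - h x) \<le> C / real (Suc n)"
    "\<And>n x. norm (grad (\<phi> n) x) \<le> real CARD('d) * L"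
    "\<And>x D. strict_grad h x D \<Longrightarrow> (\<lambda>n. grad (\<phi> n) x) \<longlonglongrightarrow> D"
  let ?L = "real CARD('d) * L"
  have hL2: "L2_on S h"
    by (rule L2_on_compact_support[OF lipschitz_on_continuous_on[OF L] K(1,3) Ss])
  have ind: "integrable (lebesgue_on S) (\<lambda>x. (indicator B x :: real))"
  proof -
    have "(\<lambda>x. (norm (indicator B x :: real))\<^sup>2) = (\<lambda>x. indicator B x)" by (auto simp: indicator_def)
    then show ?thesis using L2_on_indicator_compact[OF \<phi>(2) Ss] by (simp add: L2_on_def)
  qed
  note T = test_function_L2[OF \<phi>(1) Ss]
  have gz: "grad (\<phi> n) x = 0" if "x \<notin> B" for n x
    by (rule grad_zero_outside[OF compact_imp_closed[OF \<phi>(2)] \<phi>(5) that])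
  have "(\<lambda>n. \<integral>x. (norm (h x - \<phi> n x))\<^sup>2 \<partial>lebesgue_on S) \<longlonglongrightarrow> (\<integral>x. 0 \<partial>lebesgue_on S)"
  proof (rule integral_dominated_convergence[where w = "\<lambda>x. C\<^sup>2 * indicator B x"])
    show "(\<lambda>x. (norm (h x - \<phi> n x))\<^sup>2) \<in> borel_measurable (lebesgue_on S)" for n
      using L2_on_diff[OF hL2 T(1)[of n]] by (auto simp: L2_on_def)
    show "integrable (lebesgue_on S) (\<lambda>x. C\<^sup>2 * indicator B x)" using ind by simp
    show "AE x in lebesgue_on S. (\<lambda>n. (norm (h x - \<phi> n x))\<^sup>2) \<longlonglongrightarrow> 0"
    proof (rule AE_I2)
      fix x
      have "(\<lambda>n. C / real (Suc n)) \<longlonglongrightarrow> 0"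
        by (rule real_tendsto_divide_at_top[OF tendsto_const]) (rule filterlim_compose[OF filterlim_real_sequentially filterlim_Suc])
      from LIMSEQ_of_norm_bound[OF \<phi>(7)[of _ x] this]
      have "(\<lambda>n. (norm (h x - \<phi> n x))\<^sup>2) \<longlonglongrightarrow> (norm (h x - h x))\<^sup>2"
        by (intro tendsto_intros)
      then show "(\<lambda>n. (norm (h x - \<phi> n x))\<^sup>2) \<longlonglongrightarrow> 0" by simp
    qed
    show "AE x in lebesgue_on S. norm ((norm (h x - \<phi> n x))\<^sup>2) \<le> C\<^sup>2 * indicator B x" for n
    proof (rule AE_I2)
      fix x
      show "norm ((norm (h x - \<phi> n x))\<^sup>2) \<le> C\<^sup>2 * indicator B x"
      proof (cases "x \<in> B")
        case True
        have "C / real (Suc n) \<le> C" using \<phi>(6) by (simp add: field_simps)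
        then have "norm (h x - \<phi> n x) \<le> C" using \<phi>(7)[of n x] by (simp add: norm_minus_commute)
        then show ?thesis using True by (simp add: power_mono)
      next
        case False
        then show ?thesis using \<phi>(4,5) K(3) by auto
      qed
    qed
  qed auto
  then have l1: "(\<lambda>n. L2_norm S (\<lambda>x. h x - \<phi> n x)) \<longlonglongrightarrow> 0"
    unfolding L2_norm_def using tendsto_real_sqrt by fastforce
  have "(\<lambda>n. \<integral>x. (norm (G x - grad (\<phi> n) x))\<^sup>2 \<partial>lebesgue_on S) \<longlonglongrightarrow> (\<integral>x. 0 \<partial>lebesgue_on S)"
  \<comment> \<open>The dominating function is \<open>2 * a^2 + 2 * b^2\<close>, an upper bound of
    \<open>(a + b)^2\<close>, where \<open>b\<close> bounds the gradients of the mollifications;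
    these vanish outside \<open>B\<close>.\<close>
  proof (rule integral_dominated_convergence[where w = "\<lambda>x. 2 * (norm (G x))\<^sup>2 + 2 * ?L\<^sup>2 * indicator B x"])
    show "(\<lambda>x. (norm (G x - grad (\<phi> n) x))\<^sup>2) \<in> borel_measurable (lebesgue_on S)" for n
      using L2_on_diff[OF G T(2)[of n]] by (auto simp: L2_on_def)
    show "integrable (lebesgue_on S) (\<lambda>x. 2 * (norm (G x))\<^sup>2 + 2 * ?L\<^sup>2 * indicator B x)"
      using ind G by (simp add: L2_on_def)
    show "AE x in lebesgue_on S. (\<lambda>n. (norm (G x - grad (\<phi> n) x))\<^sup>2) \<longlonglongrightarrow> 0"
      using N
    proof eventually_elim
      case (elim x)
      from \<phi>(9)[OF this] have "(\<lambda>n. (norm (G x - grad (\<phi> n) x))\<^sup>2) \<longlonglongrightarrow> (norm (G x - G x))\<^sup>2"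
        by (intro tendsto_intros)
      then show ?case by simp
    qed
    show "AE x in lebesgue_on S. norm ((norm (G x - grad (\<phi> n) x))\<^sup>2) \<le> 2 * (norm (G x))\<^sup>2 + 2 * ?L\<^sup>2 * indicator B x" for n
    proof (rule AE_I2)
      fix x
      have "norm (G x - grad (\<phi> n) x) \<le> norm (G x) + ?L * indicator B x"
        using norm_triangle_ineq4[of "G x" "grad (\<phi> n) x"] \<phi>(8)[of n x] gz[of x n] by (cases "x \<in> B") auto
      then have "(norm (G x - grad (\<phi> n) x))\<^sup>2 \<le> (norm (G x) + ?L * indicator B x)\<^sup>2"
        by (intro power_mono) auto
      also have "\<dots> \<le> 2 * (norm (G x))\<^sup>2 + 2 * (?L * indicator B x)\<^sup>2"
        using sum_squares_bound[of "norm (G x)" "?L * indicator B x"] by (simp add: power2_sum)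
      finally show "norm ((norm (G x - grad (\<phi> n) x))\<^sup>2) \<le> 2 * (norm (G x))\<^sup>2 + 2 * ?L\<^sup>2 * indicator B x"
        by (auto simp: indicator_def)
    qed
  qed auto
  then have l2: "(\<lambda>n. L2_norm S (\<lambda>x. G x - grad (\<phi> n) x)) \<longlonglongrightarrow> 0"
    unfolding L2_norm_def using tendsto_real_sqrt by fastforce
  show ?thesis
    by (rule H0pair_limit[OF hL2 G H0pair_test[OF \<phi>(1) Ss] l1 l2 Ss])
  qed
qed

section \<open>Geometry of complementary media\<close>

locale complementary_geometry =
  fixes r1 r2 r3 :: real and F G :: "real^'d \<Rightarrow> real^'d" and x1 x2 :: "real^'d"
  assumes dim: "CARD('d) \<in> {2, 3}"
    and r1: "0 < r1" and r12: "r1 < r2" and r23: "r2 < r3"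
    and F_shell: "diffeo (ball 0 r2 - cball 0 r1) (ball 0 r3 - cball 0 r2) F"
    and F_bdry: "fixes_boundary (ball 0 r2 - cball 0 r1) (sphere 0 r2) F"
    and x1: "x1 \<in> ball 0 r1"
    and F_ext: "diffeo (ball 0 r2 - {x1}) (- cball 0 r2) F"
    and x2: "x2 \<in> ball 0 r3"
    and G_ext: "diffeo (- cball 0 r3) (ball 0 r3 - {x2}) G"
    and G_bdry: "fixes_boundary (- cball 0 r3) (sphere 0 r3) G"
    and GF: "diffeo (ball 0 r1) (ball 0 r3) ((G \<circ> F)(x1 := x2))"
begin

definition Psi :: "real^'d \<Rightarrow> real^'d" where "Psi = (G \<circ> F)(x1 := x2)"
text \<open>Inverse of the extended \<open>F\<close>; on the outer shell it coincides with the
  inverse of the restriction of \<open>F\<close> to the inner shell.\<close>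

definition SF :: "real^'d \<Rightarrow> real^'d" where "SF = inv_into (ball 0 r2 - {x1}) F"
definition SPsi :: "real^'d \<Rightarrow> real^'d" where "SPsi = inv_into (ball 0 r1) Psi"

lemma F_pair: "C1_pair (ball 0 r2 - {x1}) (- cball 0 r2) F SF"
  unfolding SF_def by (rule diffeo_C1_pair[OF F_ext])

lemma Psi_pair: "C1_pair (ball 0 r1) (ball 0 r3) Psi SPsi"
  unfolding SPsi_def Psi_def by (rule diffeo_C1_pair[OF GF])

lemma F_in: "norm x < r2 \<Longrightarrow> x \<noteq> x1 \<Longrightarrow> r2 < norm (F x) \<and> SF (F x) = x"
  using C1_pairD(1)[OF F_pair, of x] by auto

lemma SF_in: "r2 < norm y \<Longrightarrow> norm (SF y) < r2 \<and> SF y \<noteq> x1 \<and> F (SF y) = y"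
  using C1_pairD(2)[OF F_pair, of y] by auto

lemma Psi_in: "norm x < r1 \<Longrightarrow> norm (Psi x) < r3 \<and> SPsi (Psi x) = x"
  using C1_pairD(1)[OF Psi_pair, of x] by auto

lemma SPsi_in: "norm y < r3 \<Longrightarrow> norm (SPsi y) < r1 \<and> Psi (SPsi y) = y"
  using C1_pairD(2)[OF Psi_pair, of y] by auto

lemma norm_x1: "norm x1 < r1" using x1 by simp

lemma F_maps_shell: "r1 < norm x \<Longrightarrow> norm x < r2 \<Longrightarrow> norm (F x) < r3"
proof -
  assume x: "r1 < norm x" "norm x < r2"
  have "bij_betw F (ball 0 r2 - cball 0 r1) (ball 0 r3 - cball 0 r2)"
    using F_shell unfolding diffeo_def by blast
  from bij_betw_apply[OF this, of x] x show "norm (F x) < r3" by simp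
qed

lemma SF_maps_shell:
  assumes "r2 < norm y" "norm y < r3"
  shows "r1 < norm (SF y)"
proof -
  have "F ` (ball 0 r2 - cball 0 r1) = ball 0 r3 - cball 0 r2"
    using F_shell unfolding diffeo_def bij_betw_def by blast
  moreover have "y \<in> ball 0 r3 - cball 0 r2" using assms by simp
  ultimately have "y \<in> F ` (ball 0 r2 - cball 0 r1)" by simp
  then obtain x where x: "norm x < r2" "r1 < norm x" "F x = y" by auto
  have "x \<noteq> x1" using x(2) norm_x1 by auto
  then have "SF y = x" using F_in[OF x(1)] x(3) by auto
  then show ?thesis using x by simp
qed

text \<open>The shell between \<open>r2\<close> and \<open>r3\<close> is already filled by the image
  of the inner shell, so by injectivity no other point can land there.\<close>

lemma F_outside:
  assumes "norm x \<le> r1" "x \<noteq> x1"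
  shows "r3 \<le> norm (F x)"
proof (rule ccontr)
  assume "\<not> r3 \<le> norm (F x)"
  then have "r1 < norm (SF (F x))" using SF_maps_shell[of "F x"] F_in[of x] assms r12 by auto
  then show False using F_in[of x] assms r12 by auto
qed

lemma F_isCont: "norm x < r2 \<Longrightarrow> x \<noteq> x1 \<Longrightarrow> isCont F x"
proof -
  have "continuous_on (ball 0 r2 - {x1}) F" "open (ball 0 r2 - {x1})"
    using F_pair C1_on_continuous unfolding C1_pair_def by blast+
  then show "norm x < r2 \<Longrightarrow> x \<noteq> x1 \<Longrightarrow> isCont F x" using continuous_on_eq_continuous_at by fastforce
qed

lemma SF_isCont: "r2 < norm y \<Longrightarrow> isCont SF y"
proof -
  have "continuous_on (- cball 0 r2) SF" "open (- cball (0::real^'d) r2)"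
    using F_pair C1_on_continuous unfolding C1_pair_def by blast+
  then show "r2 < norm y \<Longrightarrow> isCont SF y" using continuous_on_eq_continuous_at by fastforce
qed

lemma scale_near:
  fixes x :: "'b::real_normed_vector"
  assumes "norm x = r" "r > 0" "d > 0"
  shows "dist ((1 + d / (2 * r)) *\<^sub>R x) x < d" "norm ((1 + d / (2 * r)) *\<^sub>R x) = r + d / 2"
    "d < r \<Longrightarrow> dist ((1 - d / (2 * r)) *\<^sub>R x) x < d" "d < r \<Longrightarrow> norm ((1 - d / (2 * r)) *\<^sub>R x) = r - d / 2"
proof -
  have e: "(1 + c) *\<^sub>R x - x = c *\<^sub>R x" "(1 - c) *\<^sub>R x - x = - (c *\<^sub>R x)" for c
    by (simp_all add: algebra_simps)
  show "dist ((1 + d / (2 * r)) *\<^sub>R x) x < d" "dist ((1 - d / (2 * r)) *\<^sub>R x) x < d"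
    using assms by (simp_all add: dist_norm e)
  have "norm ((1 + d / (2 * r)) *\<^sub>R x) = (1 + d / (2 * r)) * r"
    using assms by (simp add: abs_of_pos add_pos_pos)
  then show "norm ((1 + d / (2 * r)) *\<^sub>R x) = r + d / 2"
    using assms by (simp add: field_simps)
  assume "d < r"
  then have "0 < 1 - d / (2 * r)" using assms by (simp add: field_simps)
  then have "norm ((1 - d / (2 * r)) *\<^sub>R x) = (1 - d / (2 * r)) * r"
    unfolding norm_scaleR assms(1) by (simp only: abs_of_pos)
  moreover have "(1 - d / (2 * r)) * r = r - d / 2"
    using assms(2) by (simp add: field_simps)
  ultimately show "norm ((1 - d / (2 * r)) *\<^sub>R x) = r - d / 2" by (simp only:)
qed

text \<open>Points slightly outside the sphere of radius \<open>r1\<close> are mapped into the ball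
  of radius \<open>r3\<close>, which by continuity bounds the norm from above;
  \<open>F_outside\<close> bounds it from below.\<close>

lemma F_sphere:
  assumes x: "norm x = r1"
  shows "norm (F x) = r3"
proof (rule antisym)
  have ne: "x \<noteq> x1" using x norm_x1 by auto
  show "r3 \<le> norm (F x)" using F_outside[of x] x ne by simp
  show "norm (F x) \<le> r3"
  proof (rule ccontr)
    assume "\<not> norm (F x) \<le> r3"
    moreover have "isCont (\<lambda>z. norm (F z)) x" using F_isCont[of x] x ne r12 by (intro continuous_intros) auto
    ultimately obtain d where d: "d > 0" "\<And>z. dist z x < d \<Longrightarrow> dist (norm (F z)) (norm (F x)) < norm (F x) - r3"
      unfolding continuous_at_eps_delta by (metis diff_gt_0_iff_gt not_le)
    \<comment> \<open>The point is moved radially outwards by \<open>d' / 2\<close> and has to stay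
      inside \<open>ball 0 r2\<close>.\<close>
    define d' where "d' = min d (r2 - r1)"
    have d': "d' > 0" "d' \<le> d" "d' / 2 < r2 - r1" using d(1) r12 by (auto simp: d'_def)
    let ?z = "(1 + d' / (2 * r1)) *\<^sub>R x"
    note s = scale_near(1,2)[OF x r1 d'(1)]
    have "norm (F ?z) < r3" by (rule F_maps_shell) (use s d' in auto)
    moreover have "dist (norm (F ?z)) (norm (F x)) < norm (F x) - r3"
      by (rule d(2)) (use s(1) d'(2) in linarith)
    ultimately show False by (simp add: dist_real_def abs_if split: if_splits)
  qed
qed

text \<open>The continuity argument for the inverse, approaching the sphere of radius
  \<open>r3\<close> from inside.\<close>

lemma SF_sphere:
  assumes y: "norm y = r3"
  shows "norm (SF y) = r1"
proof (rule antisym)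
  have y2: "r2 < norm y" using y r23 by simp
  note S = SF_in[OF y2]
  show "norm (SF y) \<le> r1"
  proof (rule ccontr)
    assume "\<not> norm (SF y) \<le> r1"
    then have "norm (F (SF y)) < r3" using S by (intro F_maps_shell) auto
    then show False using S y by simp
  qed
  show "r1 \<le> norm (SF y)"
  proof (rule ccontr)
    assume "\<not> r1 \<le> norm (SF y)"
    moreover have "isCont (\<lambda>z. norm (SF z)) y" using SF_isCont[OF y2] by (intro continuous_intros) auto
    ultimately obtain d where d: "d > 0" "\<And>z. dist z y < d \<Longrightarrow> dist (norm (SF z)) (norm (SF y)) < r1 - norm (SF y)"
      unfolding continuous_at_eps_delta by (metis diff_gt_0_iff_gt not_le)
    have r3: "r3 > 0" using r1 r12 r23 by linarith
    define d' where "d' = min d (r3 - r2)"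
    have d': "d' > 0" "d' \<le> d" "d' / 2 < r3 - r2" "d' < r3" using d(1) r23 r1 r12 by (auto simp: d'_def)
    let ?z = "(1 - d' / (2 * r3)) *\<^sub>R y"
    note s = scale_near(3,4)[OF y r3 d'(1,4)]
    have "r1 < norm (SF ?z)" by (rule SF_maps_shell) (use s d' in auto)
    moreover have "dist (norm (SF ?z)) (norm (SF y)) < r1 - norm (SF y)"
      by (rule d(2)) (use s(1) d'(2) in linarith)
    ultimately show False by (simp add: dist_real_def abs_if split: if_splits)
  qed
qed

lemma F_inner:
  assumes "norm x < r1" "x \<noteq> x1"
  shows "r3 < norm (F x)"
  using F_outside[of x] SF_sphere[of "F x"] F_in[of x] assms r12 by fastforce

section \<open>Completion of the maps on closed shells and balls\<close>

definition F_cl :: "real^'d \<Rightarrow> real^'d" where "F_cl x = (if norm x = r2 then x else F x)"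
definition SF_cl :: "real^'d \<Rightarrow> real^'d" where "SF_cl y = (if norm y = r2 then y else SF y)"
text \<open>The boundary value is that of \<open>F\<close> because \<open>F\<close> sends the sphere
  of radius \<open>r1\<close> to that of radius \<open>r3\<close>, on which \<open>G\<close> extends
  by the identity.\<close>

definition Psi_cl :: "real^'d \<Rightarrow> real^'d" where "Psi_cl x = (if norm x = r1 then F x else Psi x)"
definition SPsi_cl :: "real^'d \<Rightarrow> real^'d" where "SPsi_cl y = (if norm y = r3 then SF y else SPsi y)"

abbreviation "shell1 \<equiv> cball 0 r2 - ball (0 :: real^'d) r1"
abbreviation "shell2 \<equiv> cball 0 r3 - ball (0 :: real^'d) r2"

lemma F_cl_inverse: "x \<in> shell1 \<Longrightarrow> F_cl x \<in> shell2 \<and> SF_cl (F_cl x) = x"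
proof -
  assume "x \<in> shell1"
  then consider "norm x = r2" | "r1 < norm x" "norm x < r2" | "norm x = r1" by force
  then show ?thesis
  proof cases
    case 2
    then have "x \<noteq> x1" using norm_x1 by auto
    with 2 show ?thesis using F_in[of x] F_maps_shell[of x] by (auto simp: F_cl_def SF_cl_def)
  next
    case 3
    then show ?thesis using F_in[of x] F_sphere[of x] norm_x1 r12 r23 by (auto simp: F_cl_def SF_cl_def)
  qed (use r23 r12 in \<open>auto simp: F_cl_def SF_cl_def\<close>)
qed

lemma SF_cl_inverse: "y \<in> shell2 \<Longrightarrow> SF_cl y \<in> shell1 \<and> F_cl (SF_cl y) = y"
proof -
  assume "y \<in> shell2"
  then consider "norm y = r2" | "r2 < norm y" "norm y < r3" | "norm y = r3" by force
  then show ?thesis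
  proof cases
    case 2
    then show ?thesis using SF_in[of y] SF_maps_shell[of y] by (auto simp: F_cl_def SF_cl_def)
  next
    case 3
    then show ?thesis using SF_in[of y] SF_sphere[of y] r12 r23 by (auto simp: F_cl_def SF_cl_def)
  qed (use r23 r12 in \<open>auto simp: F_cl_def SF_cl_def\<close>)
qed

lemma Psi_cl_inverse: "x \<in> cball 0 r1 \<Longrightarrow> Psi_cl x \<in> cball 0 r3 \<and> SPsi_cl (Psi_cl x) = x"
  using F_sphere[of x] F_in[of x] Psi_in[of x] norm_x1 r12 by (auto simp: Psi_cl_def SPsi_cl_def)

lemma SPsi_cl_inverse: "y \<in> cball 0 r3 \<Longrightarrow> SPsi_cl y \<in> cball 0 r1 \<and> Psi_cl (SPsi_cl y) = y"
  using SF_sphere[of y] SF_in[of y] SPsi_in[of y] r23 by (auto simp: Psi_cl_def SPsi_cl_def)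

lemma open_ball_in: "open W \<Longrightarrow> p \<in> W \<Longrightarrow> \<exists>e>0. ball p e \<subseteq> W"
  using openE by metis

text \<open>At radius \<open>r2\<close> the extension granted by \<open>fixes_boundary\<close> is
  used; elsewhere, also at radius \<open>r1\<close>, the extended \<open>F\<close> is itself a
  diffeomorphism near \<open>p\<close>.\<close>

lemma F_cl_loc: "p \<in> shell1 \<Longrightarrow> loc_diffeo shell1 F_cl p"
proof (cases "norm p = r2")
  case True
  obtain W T' where w: "open W" "sphere 0 r2 \<subseteq> W" "diffeo W (T' ` W) T'"
     "\<And>x. x \<in> W \<inter> (ball 0 r2 - cball 0 r1) \<Longrightarrow> T' x = F x" "\<And>x. x \<in> sphere 0 r2 \<Longrightarrow> T' x = x"
    using F_bdry unfolding fixes_boundary_def by blast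
  \<comment> \<open>Removing \<open>cball 0 r1\<close> confines the ball to points where, below
    radius \<open>r2\<close>, the extension is known to equal \<open>F\<close>.\<close>
  have "open (W - cball 0 r1)" "p \<in> W - cball 0 r1" using w True r12 by auto
  then obtain e where e: "e > 0" "ball p e \<subseteq> W - cball 0 r1" using open_ball_in by blast
  have "T' x = F_cl x" if "x \<in> ball p e \<inter> shell1" for x
  proof (cases "norm x = r2")
    case True
    then show ?thesis using w(5)[of x] by (simp add: F_cl_def)
  next
    case False
    then have "x \<in> W \<inter> (ball 0 r2 - cball 0 r1)" using that e(2) by auto
    then show ?thesis using w(4) False by (simp add: F_cl_def)
  qed
  then show ?thesis
    unfolding loc_diffeo_def using diffeo_C1_pair[OF w(3)] e by blast
next
  case False
  assume "p \<in> shell1"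
  then have "p \<in> ball 0 r2 - {x1}" "open (ball 0 r2 - {x1})" using False norm_x1 by auto
  then obtain e where e: "e > 0" "ball p e \<subseteq> ball 0 r2 - {x1}" using open_ball_in by blast
  have "F x = F_cl x" if "x \<in> ball p e \<inter> shell1" for x
    using e(2) that by (auto simp: F_cl_def)
  then show ?thesis
    unfolding loc_diffeo_def using F_pair e by blast
qed

text \<open>Across the sphere of radius \<open>r1\<close> the map \<open>G \<circ> F\<close> is
  continued by replacing \<open>G\<close> with its extension near the sphere of radius
  \<open>r3\<close>.\<close>

lemma Psi_cl_loc: "p \<in> cball 0 r1 \<Longrightarrow> loc_diffeo (cball 0 r1) Psi_cl p"
proof (cases "norm p = r1")
  case True
  obtain W T' where w: "open W" "sphere 0 r3 \<subseteq> W" "diffeo W (T' ` W) T'"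
     "\<And>x. x \<in> W \<inter> (- cball 0 r3) \<Longrightarrow> T' x = G x" "\<And>x. x \<in> sphere 0 r3 \<Longrightarrow> T' x = x"
    using G_bdry unfolding fixes_boundary_def by blast
  note c = C1_pair_compose[OF F_pair diffeo_C1_pair[OF w(3)]]
  let ?U = "{x \<in> ball 0 r2 - {x1}. F x \<in> W}"
  have "open ?U" using c by (simp add: C1_pair_def)
  moreover have "p \<in> ?U" using True r12 norm_x1 F_sphere[of p] w(2) by auto
  ultimately obtain e where e: "e > 0" "ball p e \<subseteq> ?U" using open_ball_in by blast
  have "(T' \<circ> F) x = Psi_cl x" if x: "x \<in> ball p e \<inter> cball 0 r1" for x
  proof (cases "norm x = r1")
    case True
    then show ?thesis using w(5)[of "F x"] F_sphere[of x] by (simp add: Psi_cl_def)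
  next
    case False
    have xU: "x \<in> ?U" using e(2) x by blast
    have "F x \<in> W \<inter> (- cball 0 r3)" using F_inner[of x] xU x False by auto
    then show ?thesis using w(4) False xU by (auto simp: Psi_cl_def Psi_def)
  qed
  then show ?thesis
    unfolding loc_diffeo_def using c e by blast
next
  case False
  assume "p \<in> cball 0 r1"
  then have "p \<in> ball 0 r1" using False by auto
  then obtain e where e: "e > 0" "ball p e \<subseteq> ball 0 r1" using open_ball_in open_ball by blast
  have "Psi x = Psi_cl x" if "x \<in> ball p e \<inter> cball 0 r1" for x
    using e(2) that by (auto simp: Psi_cl_def)
  then show ?thesis
    unfolding loc_diffeo_def using Psi_pair e by blast
qed

lemma compact_shell1: "compact shell1" by (rule compact_diff) auto
lemma compact_shell2: "compact shell2" by (rule compact_diff) auto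

lemma SF_cl_loc: "q \<in> shell2 \<Longrightarrow> loc_diffeo shell2 SF_cl q"
  by (rule loc_diffeo_inverse[OF compact_shell1 F_cl_inverse SF_cl_inverse F_cl_loc])

lemma SPsi_cl_loc: "q \<in> cball 0 r3 \<Longrightarrow> loc_diffeo (cball 0 r3) SPsi_cl q"
  by (rule loc_diffeo_inverse[OF compact_cball Psi_cl_inverse SPsi_cl_inverse Psi_cl_loc])

definition U12 :: "(real^'d) set" where "U12 = ball 0 r2 - cball 0 r1"
definition U23 :: "(real^'d) set" where "U23 = ball 0 r3 - cball 0 r2"

lemma open_U: "open U12" "open U23"
  by (auto simp: U12_def U23_def)

text \<open>The completed maps are locally diffeomorphisms on compact sets, so none of the four
  Jacobians degenerates at the spheres or at \<open>x1\<close> and \<open>x2\<close>.\<close>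

lemma tame: "\<exists>K\<ge>0. tame_diffeo U12 U23 F SF K \<and> tame_diffeo (ball 0 r1) (ball 0 r3) Psi SPsi K"
proof -
  have s: "U12 \<subseteq> shell1" "U23 \<subseteq> shell2" by (auto simp: U12_def U23_def)
  have e: "\<And>x. x \<in> U12 \<Longrightarrow> F_cl x = F x" "\<And>x. x \<in> U23 \<Longrightarrow> SF_cl x = SF x"
    "\<And>x. x \<in> ball 0 r1 \<Longrightarrow> Psi_cl x = Psi x" "\<And>x. x \<in> ball 0 r3 \<Longrightarrow> SPsi_cl x = SPsi x"
    by (auto simp: U12_def U23_def F_cl_def SF_cl_def Psi_cl_def SPsi_cl_def)
  obtain C1 where C1: "\<forall>x\<in>U12. \<forall>i j. \<bar>jac F x $ i $ j\<bar> \<le> C1"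
    using loc_diffeo_jac_bounded[OF compact_shell1 F_cl_loc open_U(1) s(1) e(1)] by blast
  obtain C2 where C2: "\<forall>x\<in>U23. \<forall>i j. \<bar>jac SF x $ i $ j\<bar> \<le> C2"
    using loc_diffeo_jac_bounded[OF compact_shell2 SF_cl_loc open_U(2) s(2) e(2)] by blast
  obtain C3 where C3: "\<forall>x\<in>ball 0 r1. \<forall>i j. \<bar>jac Psi x $ i $ j\<bar> \<le> C3"
    using loc_diffeo_jac_bounded[OF compact_cball Psi_cl_loc open_ball ball_subset_cball e(3)] by blast
  obtain C4 where C4: "\<forall>x\<in>ball 0 r3. \<forall>i j. \<bar>jac SPsi x $ i $ j\<bar> \<le> C4"
    using loc_diffeo_jac_bounded[OF compact_cball SPsi_cl_loc open_ball ball_subset_cball e(4)] by blast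
  define K where "K = max (max 0 C1) (max C2 (max C3 C4))"
  have KC: "C1 \<le> K" "C2 \<le> K" "C3 \<le> K" "C4 \<le> K" "0 \<le> K" by (auto simp: K_def)
  have c: "C1_on (ball 0 r2 - {x1}) F" "C1_on (- cball 0 r2) SF"
    using F_pair by (simp_all add: C1_pair_def)
  have "C1_on U12 F"
    by (rule C1_on_subset[OF c(1)]) (use norm_x1 in \<open>auto simp: U12_def\<close>)
  moreover have "C1_on U23 SF"
    by (rule C1_on_subset[OF c(2)]) (auto simp: U23_def)
  moreover have "F x \<in> U23 \<and> SF (F x) = x" if "x \<in> U12" for x
  proof -
    have "norm x < r2" "r1 < norm x" "x \<noteq> x1" using that norm_x1 by (auto simp: U12_def)
    then show ?thesis using F_in[of x] F_maps_shell[of x] by (auto simp: U23_def)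
  qed
  moreover have "SF y \<in> U12 \<and> F (SF y) = y" if "y \<in> U23" for y
    using SF_in[of y] SF_maps_shell[of y] that by (auto simp: U12_def U23_def)
  ultimately have "tame_diffeo U12 U23 F SF K"
    unfolding tame_diffeo_def using open_U C1 C2 KC by (meson order_trans)
  moreover have "tame_diffeo (ball 0 r1) (ball 0 r3) Psi SPsi K"
    using Psi_pair C3 C4 KC unfolding tame_diffeo_def C1_pair_def by (meson order_trans)
  ultimately show ?thesis using KC by blast
qed

lemma pushforward_F:
  assumes "y \<in> U23"
  shows "pushforward (ball 0 r2 - cball 0 r1) F A y = push_matrix (jac F (SF y)) (A (SF y))"
proof -
  have y: "r2 < norm y" "norm y < r3" using assms by (auto simp: U23_def)
  have x: "SF y \<in> ball 0 r2 - cball 0 r1" "F (SF y) = y" using SF_in[OF y(1)] SF_maps_shell[OF y] by auto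
  have "inj_on F (ball 0 r2 - cball 0 r1)" using F_shell by (simp add: diffeo_def bij_betw_def)
  from inv_into_f_f[OF this x(1)] have "inv_into (ball 0 r2 - cball 0 r1) F y = SF y" using x(2) by simp
  then show ?thesis by (simp add: pushforward_eq_push_matrix)
qed

lemma push_matrix_compose:
  fixes J J' M :: "real^'n^'n"
  shows "push_matrix J (push_matrix J' M) = push_matrix (J ** J') M"
proof -
  have "J ** (c *\<^sub>R N) ** L = c *\<^sub>R (J ** N ** L)" for c and N L :: "real^'n^'n"
    by (simp add: matrix_matrix_mult_def vec_eq_iff sum_distrib_left sum_distrib_right mult_ac)
  then show ?thesis
    by (simp add: push_matrix_def det_mul abs_mult matrix_transpose_mul matrix_mul_assoc)
qed

text \<open>Push-forward is functorial, and \<open>Psi\<close> is \<open>G \<circ> F\<close> near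
  the preimage of \<open>y\<close>. The point \<open>x2\<close> is outside the range of
  \<open>G\<close> and has to be left out.\<close>

lemma GF_pushforward_eq:
  assumes y: "y \<in> ball 0 r3" "y \<noteq> x2"
  shows "GF_pushforward r2 r3 A F G x1 y = push_matrix (jac Psi (SPsi y)) (A (SPsi y))"
proof -
  let ?z = "inv_into (- cball 0 r3) G y"
  have Gp: "C1_pair (- cball 0 r3) (ball 0 r3 - {x2}) G (inv_into (- cball 0 r3) G)"
    by (rule diffeo_C1_pair[OF G_ext])
  have z: "r3 < norm ?z" "G ?z = y" using C1_pairD(2)[OF Gp, of y] y by auto
  let ?x = "SF ?z"
  have x: "norm ?x < r2" "?x \<noteq> x1" "F ?x = ?z" using SF_in[of ?z] z(1) r23 by auto
  have xr1: "norm ?x < r1"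
    using F_maps_shell[of ?x] F_sphere[of ?x] x z(1) by (metis less_asym less_linear)
  have "Psi ?x = y" using x z(2) by (simp add: Psi_def)
  then have Sx: "SPsi y = ?x" using Psi_in[OF xr1] by auto
  have "jac Psi ?x = jac (G \<circ> F) ?x"
    by (rule jac_cong_open[of "ball 0 r1 - {x1}"]) (use xr1 x in \<open>auto simp: Psi_def\<close>)
  also have "\<dots> = jac G ?z ** jac F ?x"
  proof -
    have "F differentiable (at ?x)" using F_pair x C1_on_differentiable unfolding C1_pair_def by force
    moreover have "G differentiable (at (F ?x))" using Gp z(1) x(3) C1_on_differentiable unfolding C1_pair_def by force
    ultimately show ?thesis using jac_compose[of F ?x G] x(3) by simp
  qed
  finally have J: "jac Psi ?x = jac G ?z ** jac F ?x" .
  have "GF_pushforward r2 r3 A F G x1 y = push_matrix (jac G ?z) (push_matrix (jac F ?x) (A ?x))"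
    by (simp add: GF_pushforward_def pushforward_eq_push_matrix SF_def)
  then show ?thesis by (simp add: push_matrix_compose Sx J)
qed

section \<open>Lifts of test functions and folds of solutions\<close>

definition lift :: "(real^'d \<Rightarrow> complex) \<Rightarrow> real^'d \<Rightarrow> complex" where
  "lift \<phi> x = (if r2 \<le> norm x then \<phi> x else if r1 \<le> norm x then \<phi> (F x) else \<phi> (Psi x))"

text \<open>The spheres of radius \<open>r1\<close> and \<open>r2\<close> belong to none of the
  three regions; the value \<open>0\<close> there is harmless because they are null sets.\<close>

definition lift_grad :: "(real^'d \<Rightarrow> complex^'d) \<Rightarrow> real^'d \<Rightarrow> complex^'d" where
  "lift_grad k x = (if r2 < norm x then k x else 0) + (if x \<in> U12 then pull F k x else 0)
     + (if x \<in> ball 0 r1 then pull Psi k x else 0)"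

text \<open>The jumps of the cut-off terms cancel in pairs: those of the first two at radius
  \<open>r2\<close>, those of the last two at radius \<open>r3\<close>.\<close>

definition fold :: "(real^'d \<Rightarrow> complex) \<Rightarrow> real^'d \<Rightarrow> complex" where
  "fold u x = (if r2 < norm x then u x else 0) - (if x \<in> U23 then u (SF x) else 0)
     + (if x \<in> ball 0 r3 then u (SPsi x) else 0)"

definition fold_grad :: "(real^'d \<Rightarrow> complex^'d) \<Rightarrow> real^'d \<Rightarrow> complex^'d" where
  "fold_grad g x = (if r2 < norm x then g x else 0) - (if x \<in> U23 then pull SF g x else 0)
     + (if x \<in> ball 0 r3 then pull SPsi g x else 0)"

lemma norm_near:
  fixes x p :: "'b::real_normed_vector"
  assumes "x \<in> ball p e"
  shows "norm x < norm p + e" "norm p - e < norm x"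
proof -
  have "norm (x - p) < e" "norm (p - x) < e" using assms by (simp_all add: dist_norm norm_minus_commute)
  then show "norm x < norm p + e" "norm p - e < norm x"
    using norm_triangle_sub[of x p] norm_triangle_sub[of p x] by linarith+
qed

text \<open>Three closed regions, on each of which \<open>lift \<phi>\<close> has local Lipschitz
  extensions, are glued across the two spheres they share.\<close>

lemma lift_loc_lip:
  assumes \<phi>: "C1_on UNIV \<phi>"
  shows "loc_lip (lift \<phi>) p"
proof -
  let ?out = "- ball (0 :: real^'d) r2"
  have o: "loc_ext ?out (lift \<phi>) q" for q
    by (rule loc_ext_cong[OF loc_ext_C1[OF \<phi>]]) (simp add: lift_def)
  have m: "loc_ext shell1 (lift \<phi>) q" if "q \<in> shell1" for q
    by (rule loc_ext_cong[OF loc_ext_compose[OF \<phi> F_cl_loc[OF that]]]) (auto simp: lift_def F_cl_def)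
  have i: "loc_ext (cball 0 r1) (lift \<phi>) q" if "q \<in> cball 0 r1" for q
    by (rule loc_ext_cong[OF loc_ext_compose[OF \<phi> Psi_cl_loc[OF that]]]) (use r12 in \<open>auto simp: lift_def Psi_cl_def\<close>)
  consider "norm p < r1" | "norm p = r1" | "r1 < norm p" "norm p < r2" | "norm p = r2" | "r2 < norm p" by linarith
  then show ?thesis
  proof cases
    case 1
    then obtain e where "e > 0" "ball p e \<subseteq> ball 0 r1" using open_ball_in[OF open_ball, of p 0 r1] by auto
    then show ?thesis using loc_lip_interior[OF i[of p]] 1 ball_subset_cball by (meson less_imp_le mem_cball_0 subset_trans)
  next
    case 2
    show ?thesis
    proof (rule loc_lip_glue[OF i _ m, of p "r2 - r1" r1])
      fix x assume "x \<in> ball p (r2 - r1)"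
      then have "norm x < r2" using norm_near[of x p "r2 - r1"] 2 by simp
      then show "r1 \<le> norm x \<Longrightarrow> x \<in> shell1" by auto
    qed (use 2 r12 in auto)
  next
    case 3
    then have "p \<in> U12" by (auto simp: U12_def)
    then obtain e where e: "e > 0" "ball p e \<subseteq> U12" using open_ball_in[OF open_U(1)] by blast
    have "U12 \<subseteq> shell1" by (auto simp: U12_def)
    then show ?thesis using loc_lip_interior[OF m[of p] e(1)] e(2) 3 by auto
  next
    case 4
    show ?thesis
    proof (rule loc_lip_glue[OF m _ o, of p "r2 - r1" r2])
      fix x assume "x \<in> ball p (r2 - r1)"
      then have "r1 < norm x" using norm_near[of x p "r2 - r1"] 4 by simp
      then show "norm x \<le> r2 \<Longrightarrow> x \<in> shell1" by auto
    qed (use 4 r12 in auto)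
  next
    case 5
    have "open (- cball (0 :: real^'d) r2)" by auto
    then obtain e where e: "e > 0" "ball p e \<subseteq> - cball 0 r2" using open_ball_in[of "- cball 0 r2" p] 5 by auto
    moreover have "- cball 0 r2 \<subseteq> ?out" by auto
    ultimately show ?thesis using loc_lip_interior[OF o e(1)] by blast
  qed
qed

lemma fold_loc_lip:
  assumes \<phi>: "C1_on UNIV \<phi>"
  shows "loc_lip (fold \<phi>) p"
proof -
  let ?out = "- ball (0 :: real^'d) r3"
  have o: "loc_ext ?out (fold \<phi>) q" for q
    by (rule loc_ext_cong[OF loc_ext_C1[OF \<phi>]]) (use r23 in \<open>auto simp: fold_def U23_def\<close>)
  have m: "loc_ext shell2 (fold \<phi>) q" if "q \<in> shell2" for q
  proof (rule loc_ext_cong)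
    have "loc_diffeo shell2 SPsi_cl q" by (rule loc_diffeo_mono[OF SPsi_cl_loc]) (use that in auto)
    then show "loc_ext shell2 (\<lambda>x. \<phi> x - \<phi> (SF_cl x) + \<phi> (SPsi_cl x)) q"
      by (intro loc_ext_combine loc_ext_C1[OF \<phi>] loc_ext_compose[OF \<phi>] SF_cl_loc that)
    fix x assume "x \<in> shell2"
    then show "\<phi> x - \<phi> (SF_cl x) + \<phi> (SPsi_cl x) = fold \<phi> x"
      using r23 by (auto simp: fold_def U23_def SF_cl_def SPsi_cl_def)
  qed
  have i: "loc_ext (cball 0 r2) (fold \<phi>) q" if "q \<in> cball 0 r2" for q
  proof (rule loc_ext_cong)
    have "loc_diffeo (cball 0 r2) SPsi_cl q" by (rule loc_diffeo_mono[OF SPsi_cl_loc]) (use that r23 in auto)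
    then show "loc_ext (cball 0 r2) (\<lambda>x. \<phi> (SPsi_cl x)) q"
      by (rule loc_ext_compose[OF \<phi>])
    fix x :: "real^'d" assume "x \<in> cball 0 r2"
    then show "\<phi> (SPsi_cl x) = fold \<phi> x"
      using r23 by (auto simp: fold_def U23_def SPsi_cl_def)
  qed
  consider "norm p < r2" | "norm p = r2" | "r2 < norm p" "norm p < r3" | "norm p = r3" | "r3 < norm p" by linarith
  then show ?thesis
  proof cases
    case 1
    then obtain e where "e > 0" "ball p e \<subseteq> ball 0 r2" using open_ball_in[OF open_ball, of p 0 r2] by auto
    then show ?thesis using loc_lip_interior[OF i[of p]] 1 ball_subset_cball by (meson less_imp_le mem_cball_0 subset_trans)
  next
    case 2
    show ?thesis
    proof (rule loc_lip_glue[OF i _ m, of p "r3 - r2" r2])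
      fix x assume "x \<in> ball p (r3 - r2)"
      then have "norm x < r3" using norm_near[of x p "r3 - r2"] 2 by simp
      then show "r2 \<le> norm x \<Longrightarrow> x \<in> shell2" by auto
    qed (use 2 r23 in auto)
  next
    case 3
    then have "p \<in> U23" by (auto simp: U23_def)
    then obtain e where e: "e > 0" "ball p e \<subseteq> U23" using open_ball_in[OF open_U(2)] by blast
    have "U23 \<subseteq> shell2" by (auto simp: U23_def)
    then show ?thesis using loc_lip_interior[OF m[of p] e(1)] e(2) 3 by auto
  next
    case 4
    show ?thesis
    proof (rule loc_lip_glue[OF m _ o, of p "r3 - r2" r3])
      fix x assume "x \<in> ball p (r3 - r2)"
      then have "r2 < norm x" using norm_near[of x p "r3 - r2"] 4 by simp
      then show "norm x \<le> r3 \<Longrightarrow> x \<in> shell2" by auto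
    qed (use 4 r23 in auto)
  next
    case 5
    have "open (- cball (0 :: real^'d) r3)" by auto
    then obtain e where e: "e > 0" "ball p e \<subseteq> - cball 0 r3" using open_ball_in[of "- cball 0 r3" p] 5 by auto
    moreover have "- cball 0 r3 \<subseteq> ?out" by auto
    ultimately show ?thesis using loc_lip_interior[OF o e(1)] by blast
  qed
qed

end

section \<open>Folding and lifting\<close>

lemma integral_cut:
  fixes w :: "real^'d \<Rightarrow> 'b::{banach,second_countable_topology}"
  assumes "V \<in> sets lebesgue" "S \<in> sets lebesgue" "V \<subseteq> S"
  shows "integrable (lebesgue_on S) (\<lambda>x. if x \<in> V then w x else 0) \<longleftrightarrow> integrable (lebesgue_on V) w"
    and "integral\<^sup>L (lebesgue_on S) (\<lambda>x. if x \<in> V then w x else 0) = integral\<^sup>L (lebesgue_on V) w"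
proof -
  have e: "(\<lambda>x. indicator S x *\<^sub>R (if x \<in> V then w x else 0)) = (\<lambda>x. indicator V x *\<^sub>R w x)"
    using assms(3) by (auto simp: indicator_def fun_eq_iff)
  show "integrable (lebesgue_on S) (\<lambda>x. if x \<in> V then w x else 0) \<longleftrightarrow> integrable (lebesgue_on V) w"
    using assms(1,2) by (simp add: integrable_restrict_space e)
  show "integral\<^sup>L (lebesgue_on S) (\<lambda>x. if x \<in> V then w x else 0) = integral\<^sup>L (lebesgue_on V) w"
    using assms(1,2) by (simp add: integral_restrict_space e)
qed

lemma measurable_cut:
  fixes w :: "real^'d \<Rightarrow> 'b::euclidean_space"
  assumes V: "V \<in> sets lebesgue" and w: "w \<in> borel_measurable (lebesgue_on V)"
  shows "(\<lambda>x. if x \<in> V then w x else 0) \<in> borel_measurable (lebesgue_on S)"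
proof -
  have "(\<lambda>x. indicator V x *\<^sub>R w x) \<in> borel_measurable lebesgue"
    using w V by (simp add: borel_measurable_restrict_space_iff)
  moreover have "(\<lambda>x. indicator V x *\<^sub>R w x) = (\<lambda>x. if x \<in> V then w x else 0)"
    by (auto simp: indicator_def fun_eq_iff)
  ultimately show ?thesis by (simp add: measurable_restrict_space1)
qed

lemma L2_cut:
  fixes w :: "real^'d \<Rightarrow> 'b::euclidean_space"
  assumes V: "V \<in> sets lebesgue" "S \<in> sets lebesgue" "V \<subseteq> S" and w: "L2_on V w"
  shows "L2_on S (\<lambda>x. if x \<in> V then w x else 0)"
    and "L2_norm S (\<lambda>x. if x \<in> V then w x else 0) = L2_norm V w"
proof -
  have e: "(\<lambda>x. (norm (if x \<in> V then w x else 0))\<^sup>2) = (\<lambda>x. if x \<in> V then (norm (w x))\<^sup>2 else 0)"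
    by auto
  show "L2_on S (\<lambda>x. if x \<in> V then w x else 0)"
    unfolding L2_on_def e
    using integral_cut(1)[OF V, of "\<lambda>x. (norm (w x))\<^sup>2"] measurable_cut[OF V(1), of w S] w by (simp add: L2_on_def)
  show "L2_norm S (\<lambda>x. if x \<in> V then w x else 0) = L2_norm V w"
    unfolding L2_norm_def e using integral_cut(2)[OF V, of "\<lambda>x. (norm (w x))\<^sup>2"] by simp
qed

lemma L2_combine:
  fixes a b c :: "real^'d \<Rightarrow> 'b::euclidean_space"
  assumes a: "L2_on S a" "L2_norm S a \<le> \<alpha>" and b: "L2_on S b" "L2_norm S b \<le> \<beta>" and c: "L2_on S c" "L2_norm S c \<le> \<gamma>"
  shows "L2_on S (\<lambda>x. a x - b x + c x)" "L2_norm S (\<lambda>x. a x - b x + c x) \<le> \<alpha> + \<beta> + \<gamma>"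
    and "L2_on S (\<lambda>x. a x + b x + c x)" "L2_norm S (\<lambda>x. a x + b x + c x) \<le> \<alpha> + \<beta> + \<gamma>"
proof -
  show "L2_on S (\<lambda>x. a x - b x + c x)" "L2_on S (\<lambda>x. a x + b x + c x)"
    by (rule L2_on_add[OF L2_on_diff[OF a(1) b(1)] c(1)]) (rule L2_on_add[OF L2_on_add[OF a(1) b(1)] c(1)])
  have "L2_norm S (\<lambda>x. a x + - b x) \<le> L2_norm S a + L2_norm S b"
    using L2_norm_triangle[OF a(1) L2_on_uminus[OF b(1)]] by simp
  then show "L2_norm S (\<lambda>x. a x - b x + c x) \<le> \<alpha> + \<beta> + \<gamma>"
    using L2_norm_triangle[OF L2_on_diff[OF a(1) b(1)] c(1)] a(2) b(2) c(2) by simp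
  show "L2_norm S (\<lambda>x. a x + b x + c x) \<le> \<alpha> + \<beta> + \<gamma>"
    using L2_norm_triangle[OF L2_on_add[OF a(1) b(1)] c(1)] L2_norm_triangle[OF a(1) b(1)] a(2) b(2) c(2) by simp
qed

lemma strict_grad_combine:
  assumes "strict_grad f x D" "strict_grad g x E"
  shows "strict_grad (\<lambda>x. f x + g x) x (D + E)" "strict_grad (\<lambda>x. f x - g x) x (D - E)"
proof -
  \<comment> \<open>One argument for sum and difference, with a sign \<open>s\<close>.\<close>
  have "strict_grad (\<lambda>x. f x + s *\<^sub>R g x) x (D + s *\<^sub>R E)" if s: "\<bar>s\<bar> = 1" for s :: real
    unfolding strict_grad_def
  proof (intro allI impI)
    fix \<eta> :: real assume "\<eta> > 0"
    then have e2: "\<eta> / 2 > 0" by simp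
    obtain e1 where e1: "e1 > 0" "\<And>y z. y \<in> ball x e1 \<Longrightarrow> z \<in> ball x e1 \<Longrightarrow>
        norm (f z - f y - (\<Sum>i\<in>UNIV. ((z - y) $ i) *\<^sub>R D $ i)) \<le> (\<eta>/2) * norm (z - y)"
      using assms(1) e2 unfolding strict_grad_def by meson
    obtain e3 where e3: "e3 > 0" "\<And>y z. y \<in> ball x e3 \<Longrightarrow> z \<in> ball x e3 \<Longrightarrow>
        norm (g z - g y - (\<Sum>i\<in>UNIV. ((z - y) $ i) *\<^sub>R E $ i)) \<le> (\<eta>/2) * norm (z - y)"
      using assms(2) e2 unfolding strict_grad_def by meson
    have "norm (f z + s *\<^sub>R g z - (f y + s *\<^sub>R g y) - (\<Sum>i\<in>UNIV. ((z - y) $ i) *\<^sub>R (D + s *\<^sub>R E) $ i)) \<le> \<eta> * norm (z - y)"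
      if yz: "y \<in> ball x (min e1 e3)" "z \<in> ball x (min e1 e3)" for y z
    proof -
      let ?a = "f z - f y - (\<Sum>i\<in>UNIV. ((z - y) $ i) *\<^sub>R D $ i)"
      let ?b = "g z - g y - (\<Sum>i\<in>UNIV. ((z - y) $ i) *\<^sub>R E $ i)"
      have "f z + s *\<^sub>R g z - (f y + s *\<^sub>R g y) - (\<Sum>i\<in>UNIV. ((z - y) $ i) *\<^sub>R (D + s *\<^sub>R E) $ i) = ?a + s *\<^sub>R ?b"
        by (simp add: scaleR_add_right scaleR_diff_right sum.distrib scaleR_sum_right mult.commute)
      also have "norm \<dots> \<le> norm ?a + norm ?b"
        using norm_triangle_ineq[of ?a "s *\<^sub>R ?b"] s by simp
      also have "\<dots> \<le> (\<eta>/2) * norm (z - y) + (\<eta>/2) * norm (z - y)"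
        by (intro add_mono e1(2) e3(2)) (use yz in auto)
      finally show ?thesis by simp
    qed
    then show "\<exists>e>0. \<forall>y\<in>ball x e. \<forall>z\<in>ball x e. norm (f z + s *\<^sub>R g z - (f y + s *\<^sub>R g y) - (\<Sum>i\<in>UNIV. ((z - y) $ i) *\<^sub>R (D + s *\<^sub>R E) $ i)) \<le> \<eta> * norm (z - y)"
      using e1(1) e3(1) by (intro exI[of _ "min e1 e3"]) auto
  qed
  from this[of 1] this[of "-1"]
  show "strict_grad (\<lambda>x. f x + g x) x (D + E)" "strict_grad (\<lambda>x. f x - g x) x (D - E)" by simp_all
qed

lemma strict_grad_cong_open:
  assumes f: "strict_grad f x D" and U: "open U" "x \<in> U" "\<And>z. z \<in> U \<Longrightarrow> f z = g z"
  shows "strict_grad g x D"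
  unfolding strict_grad_def
proof (intro allI impI)
  fix \<eta> :: real assume "\<eta> > 0"
  obtain e1 where e1: "e1 > 0" "\<And>y z. y \<in> ball x e1 \<Longrightarrow> z \<in> ball x e1 \<Longrightarrow>
      norm (f z - f y - (\<Sum>i\<in>UNIV. ((z - y) $ i) *\<^sub>R D $ i)) \<le> \<eta> * norm (z - y)"
    using f \<open>\<eta> > 0\<close> unfolding strict_grad_def by meson
  obtain e2 where e2: "e2 > 0" "ball x e2 \<subseteq> U" using openE[OF U(1,2)] by blast
  have "norm (g z - g y - (\<Sum>i\<in>UNIV. ((z - y) $ i) *\<^sub>R D $ i)) \<le> \<eta> * norm (z - y)"
    if yz: "y \<in> ball x (min e1 e2)" "z \<in> ball x (min e1 e2)" for y z
  proof -
    have "f y = g y" "f z = g z" using U(3) e2(2) yz by auto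
    then show ?thesis using e1(2)[of y z] yz by simp
  qed
  then show "\<exists>e>0. \<forall>y\<in>ball x e. \<forall>z\<in>ball x e. norm (g z - g y - (\<Sum>i\<in>UNIV. ((z - y) $ i) *\<^sub>R D $ i)) \<le> \<eta> * norm (z - y)"
    using e1(1) e2(1) by (intro exI[of _ "min e1 e2"]) auto
qed

lemma strict_grad_compose:
  fixes \<phi> :: "real^'d \<Rightarrow> complex"
  assumes \<phi>: "C1_on UNIV \<phi>" and T: "C1_on U T" and U: "open U" "x \<in> U"
  shows "strict_grad (\<lambda>x. \<phi> (T x)) x (pull T (grad \<phi>) x)"
proof -
  have "C1_on U (\<phi> \<circ> T)" by (rule C1_on_compose[OF T \<phi>]) simp
  from C1_on_strict_grad[OF this U]
  have "strict_grad (\<phi> \<circ> T) x (grad (\<phi> \<circ> T) x)" .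
  moreover have "grad (\<phi> \<circ> T) x = pull T (grad \<phi>) x"
    by (rule grad_compose) (use C1_on_differentiable[OF T U(2)] C1_on_differentiable[OF \<phi>] in auto)
  ultimately show ?thesis by (simp add: o_def)
qed

locale complementary_domain = complementary_geometry r1 r2 r3 F G x1 x2
  for r1 r2 r3 :: real and F G :: "real^'d \<Rightarrow> real^'d" and x1 x2 :: "real^'d" +
  fixes \<Omega> :: "(real^'d) set"
  assumes Om: "open \<Omega>" "bounded \<Omega>" and r3_Om: "cball 0 r3 \<subseteq> \<Omega>"
begin

definition K where "K = (SOME K. 0 \<le> K \<and> tame_diffeo U12 U23 F SF K \<and> tame_diffeo (ball 0 r1) (ball 0 r3) Psi SPsi K)"

lemma K: "0 \<le> K" "tame_diffeo U12 U23 F SF K" "tame_diffeo (ball 0 r1) (ball 0 r3) Psi SPsi K"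
  using someI_ex[OF tame] unfolding K_def by blast+

lemma Om_sets: "\<Omega> \<in> sets lebesgue" using Om by simp

definition Vout :: "(real^'d) set" where "Vout = \<Omega> - cball 0 r2"

lemma regions:
  "Vout \<subseteq> \<Omega>" "U12 \<subseteq> \<Omega>" "U23 \<subseteq> \<Omega>" "ball 0 r1 \<subseteq> \<Omega>" "ball 0 r3 \<subseteq> \<Omega>"
  "Vout \<in> sets lebesgue" "U12 \<in> sets lebesgue" "U23 \<in> sets lebesgue"
  "ball (0::real^'d) r1 \<in> sets lebesgue" "ball (0::real^'d) r3 \<in> sets lebesgue"
proof -
  show "Vout \<in> sets lebesgue" using Om by (simp add: Vout_def open_Diff)
  have "x \<in> \<Omega>" if "norm x < r3" for x using r3_Om that by (auto simp: subset_iff)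
  then show "U12 \<subseteq> \<Omega>" "U23 \<subseteq> \<Omega>" "ball 0 r1 \<subseteq> \<Omega>" "ball 0 r3 \<subseteq> \<Omega>"
    using r12 r23 by (auto simp: U12_def U23_def)
qed (auto simp: Vout_def U12_def U23_def)

abbreviation "sq \<equiv> sqrt (fact CARD('d) * K ^ CARD('d))"
abbreviation "pq \<equiv> (real CARD('d))\<^sup>2 * K * sq"

lemma sq_nonneg: "0 \<le> sq" using K(1) by simp
lemma pq_nonneg: "0 \<le> pq" using K(1) by simp

lemma cut_out: "x \<in> \<Omega> \<Longrightarrow> (if r2 < norm x then w x else 0) = (if x \<in> Vout then w x else 0)"
  by (auto simp: Vout_def)

lemma L2_out:
  fixes w :: "real^'d \<Rightarrow> 'b::euclidean_space"
  assumes "L2_on \<Omega> w"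
  shows "L2_on \<Omega> (\<lambda>x. if r2 < norm x then w x else 0)" "L2_norm \<Omega> (\<lambda>x. if r2 < norm x then w x else 0) \<le> L2_norm \<Omega> w"
proof -
  note s = L2_norm_subset[OF assms regions(6) Om_sets regions(1)]
  note c = L2_cut[OF regions(6) Om_sets regions(1) s(1)]
  show "L2_on \<Omega> (\<lambda>x. if r2 < norm x then w x else 0)"
    using c(1) by (subst L2_on_cong[OF cut_out])
  show "L2_norm \<Omega> (\<lambda>x. if r2 < norm x then w x else 0) \<le> L2_norm \<Omega> w"
    using c(2) s(2) by (subst L2_norm_cong[OF cut_out]) auto
qed

text \<open>The constant is \<open>1\<close> for the part outside radius \<open>r2\<close>, plus
  \<open>sq\<close> for each of the two composed terms.\<close>

lemma fold_L2:
  assumes u: "L2_on \<Omega> u"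
  shows "L2_on \<Omega> (fold u)" "L2_norm \<Omega> (fold u) \<le> (1 + 2 * sq) * L2_norm \<Omega> u"
proof -
  note s1 = L2_norm_subset[OF u regions(7) Om_sets regions(2)] and s2 = L2_norm_subset[OF u regions(9) Om_sets regions(4)]
  note t1 = tame_diffeo_L2[OF dim K(2) s1(1)] and t2 = tame_diffeo_L2[OF dim K(3) s2(1)]
  note c1 = L2_cut[OF regions(8) Om_sets regions(3) t1(1)] and c2 = L2_cut[OF regions(10) Om_sets regions(5) t2(1)]
  have b1: "L2_norm \<Omega> (\<lambda>x. if x \<in> U23 then u (SF x) else 0) \<le> sq * L2_norm \<Omega> u"
    unfolding c1(2) using t1(2) mult_left_mono[OF s1(2) sq_nonneg] by linarith
  have b2: "L2_norm \<Omega> (\<lambda>x. if x \<in> ball 0 r3 then u (SPsi x) else 0) \<le> sq * L2_norm \<Omega> u"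
    unfolding c2(2) using t2(2) mult_left_mono[OF s2(2) sq_nonneg] by linarith
  note L = L2_combine[OF L2_out[OF u] c1(1) b1 c2(1) b2]
  show "L2_on \<Omega> (fold u)" using L(1) by (simp add: fold_def[abs_def])
  show "L2_norm \<Omega> (fold u) \<le> (1 + 2 * sq) * L2_norm \<Omega> u"
    using L(2) by (simp add: fold_def[abs_def] algebra_simps)
qed

lemma fold_grad_L2:
  assumes g: "L2_on \<Omega> g"
  shows "L2_on \<Omega> (fold_grad g)" "L2_norm \<Omega> (fold_grad g) \<le> (1 + 2 * pq) * L2_norm \<Omega> g"
proof -
  note s1 = L2_norm_subset[OF g regions(7) Om_sets regions(2)] and s2 = L2_norm_subset[OF g regions(9) Om_sets regions(4)]
  note t1 = tame_diffeo_pull_L2[OF dim K(2) K(1) s1(1)] and t2 = tame_diffeo_pull_L2[OF dim K(3) K(1) s2(1)]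
  note c1 = L2_cut[OF regions(8) Om_sets regions(3) t1(1)] and c2 = L2_cut[OF regions(10) Om_sets regions(5) t2(1)]
  have b1: "L2_norm \<Omega> (\<lambda>x. if x \<in> U23 then pull SF g x else 0) \<le> pq * L2_norm \<Omega> g"
    unfolding c1(2) using t1(2) mult_left_mono[OF s1(2) pq_nonneg] by linarith
  have b2: "L2_norm \<Omega> (\<lambda>x. if x \<in> ball 0 r3 then pull SPsi g x else 0) \<le> pq * L2_norm \<Omega> g"
    unfolding c2(2) using t2(2) mult_left_mono[OF s2(2) pq_nonneg] by linarith
  note L = L2_combine[OF L2_out[OF g] c1(1) b1 c2(1) b2]
  show "L2_on \<Omega> (fold_grad g)" using L(1) by (simp add: fold_grad_def[abs_def])
  show "L2_norm \<Omega> (fold_grad g) \<le> (1 + 2 * pq) * L2_norm \<Omega> g"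
    using L(2) by (simp add: fold_grad_def[abs_def] algebra_simps)
qed

lemma pull_F_L2:
  assumes k: "L2_on \<Omega> k"
  shows "L2_on U12 (pull F k)" "L2_norm U12 (pull F k) \<le> pq * L2_norm \<Omega> k"
    and "L2_on (ball 0 r1) (pull Psi k)"
proof -
  note s1 = L2_norm_subset[OF k regions(8) Om_sets regions(3)] and s2 = L2_norm_subset[OF k regions(10) Om_sets regions(5)]
  note t1 = tame_diffeo_pull_L2[OF dim tame_diffeo_sym[OF K(2)] K(1) s1(1)]
    and t2 = tame_diffeo_pull_L2[OF dim tame_diffeo_sym[OF K(3)] K(1) s2(1)]
  show "L2_on U12 (pull F k)" "L2_on (ball 0 r1) (pull Psi k)" by (fact t1(1)) (fact t2(1))
  show "L2_norm U12 (pull F k) \<le> pq * L2_norm \<Omega> k"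
    using t1(2) mult_left_mono[OF s1(2) pq_nonneg] by linarith
qed

lemma lift_grad_L2:
  assumes k: "L2_on \<Omega> k"
  shows "L2_on \<Omega> (lift_grad k)"
proof -
  note c1 = L2_cut[OF regions(7) Om_sets regions(2) pull_F_L2(1)[OF k]]
    and c2 = L2_cut[OF regions(9) Om_sets regions(4) pull_F_L2(3)[OF k]]
  show ?thesis
    using L2_combine(3)[OF L2_out[OF k] c1(1) order_refl c2(1) order_refl] by (simp add: lift_grad_def[abs_def])
qed

lemma spheres_AE:
  assumes "S \<in> sets lebesgue"
  shows "AE x in lebesgue_on S. norm (x :: real^'d) \<noteq> r1 \<and> norm x \<noteq> r2 \<and> norm x \<noteq> r3"
proof -
  have "negligible (sphere (0::real^'d) r1 \<union> sphere 0 r2 \<union> sphere 0 r3)"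
    by (intro negligible_Un negligible_sphere)
  then show ?thesis
    unfolding negligible_AE_lebesgue_on[OF assms] by (rule negligible_subset) auto
qed

text \<open>Off the spheres, a null set, exactly one branch of the lift is active and the chain rule
  yields its strict gradient; the Lipschitz property excludes a singular part of the gradient on the
  spheres.\<close>

lemma lift_H0pair:
  assumes \<phi>: "test_function \<Omega> \<phi>"
  shows "H0pair \<Omega> (lift \<phi>) (lift_grad (grad \<phi>))"
proof -
  obtain K0 where K0: "compact K0" "K0 \<subseteq> \<Omega>" "\<And>x. x \<notin> K0 \<Longrightarrow> \<phi> x = 0"
    using test_function_support[OF \<phi>] by blast
  let ?K = "K0 \<union> cball 0 r2"
  have cK: "compact ?K" using K0 by auto
  have "cball (0::real^'d) r2 \<subseteq> cball 0 r3" using r23 by (intro subset_cball) simp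
  then have sK: "?K \<subseteq> \<Omega>" using K0 r3_Om by blast
  have zero: "lift \<phi> x = 0" if "x \<notin> ?K" for x using that K0(3)[of x] by (auto simp: lift_def)
  note C1 = test_function_C1[OF \<phi>]
  obtain L where L: "L-lipschitz_on UNIV (lift \<phi>)"
    using loc_lip_imp_lipschitz[OF lift_loc_lip[OF C1] cK zero] by blast
  have C1T: "C1_on U12 F" "C1_on (ball 0 r1) Psi" using K(2,3) by (auto simp: tame_diffeo_def)
  show ?thesis
  proof (rule H0pair_lipschitz[OF Om(1) cK sK zero L])
    show "L2_on \<Omega> (lift_grad (grad \<phi>))"
      by (rule lift_grad_L2[OF test_function_L2(2)[OF \<phi> Om_sets]])
    show "AE x in lebesgue_on \<Omega>. strict_grad (lift \<phi>) x (lift_grad (grad \<phi>) x)"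
      using spheres_AE[OF Om_sets]
    proof eventually_elim
      case (elim x)
      then consider "r2 < norm x" | "x \<in> U12" | "norm x < r1" by (force simp: U12_def)
      then show ?case
      proof cases
        case 1
        have "strict_grad \<phi> x (grad \<phi> x)" by (rule C1_on_strict_grad[OF C1 open_UNIV UNIV_I])
        then have "strict_grad (lift \<phi>) x (grad \<phi> x)"
          by (rule strict_grad_cong_open[where U = "- cball 0 r2"]) (use 1 in \<open>auto simp: lift_def\<close>)
        moreover have "lift_grad (grad \<phi>) x = grad \<phi> x" using 1 r12 by (auto simp: lift_grad_def U12_def)
        ultimately show ?thesis by simp
      next
        case 2
        from strict_grad_compose[OF C1 C1T(1) open_U(1) 2]
        have "strict_grad (lift \<phi>) x (pull F (grad \<phi>) x)"
          by (rule strict_grad_cong_open[OF _ open_U(1) 2]) (auto simp: lift_def U12_def)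
        moreover have "lift_grad (grad \<phi>) x = pull F (grad \<phi>) x" using 2 r12 by (auto simp: lift_grad_def U12_def)
        ultimately show ?thesis by simp
      next
        case 3
        then have x: "x \<in> ball 0 r1" by simp
        from strict_grad_compose[OF C1 C1T(2) open_ball x]
        have "strict_grad (lift \<phi>) x (pull Psi (grad \<phi>) x)"
          by (rule strict_grad_cong_open[OF _ open_ball x]) (use r12 in \<open>auto simp: lift_def\<close>)
        moreover have "lift_grad (grad \<phi>) x = pull Psi (grad \<phi>) x" using 3 r12 by (auto simp: lift_grad_def U12_def)
        ultimately show ?thesis by simp
      qed
    qed
  qed
qed

lemma fold_test_H0pair:
  assumes \<phi>: "test_function \<Omega> \<phi>"
  shows "H0pair \<Omega> (fold \<phi>) (fold_grad (grad \<phi>))"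
proof -
  obtain K0 where K0: "compact K0" "K0 \<subseteq> \<Omega>" "\<And>x. x \<notin> K0 \<Longrightarrow> \<phi> x = 0"
    using test_function_support[OF \<phi>] by blast
  let ?K = "K0 \<union> cball 0 r3"
  have cK: "compact ?K" using K0 by auto
  have sK: "?K \<subseteq> \<Omega>" using K0 r3_Om by blast
  have zero: "fold \<phi> x = 0" if "x \<notin> ?K" for x using that K0(3)[of x] by (auto simp: fold_def U23_def)
  note C1 = test_function_C1[OF \<phi>]
  obtain L where L: "L-lipschitz_on UNIV (fold \<phi>)"
    using loc_lip_imp_lipschitz[OF fold_loc_lip[OF C1] cK zero] by blast
  have C1T: "C1_on U23 SF" "C1_on (ball 0 r3) SPsi" using K(2,3) by (auto simp: tame_diffeo_def)
  have s1: "strict_grad \<phi> x (grad \<phi> x)" for x by (rule C1_on_strict_grad[OF C1 open_UNIV UNIV_I])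
  have s3: "strict_grad (\<lambda>x. \<phi> (SPsi x)) x (pull SPsi (grad \<phi>) x)" if "norm x < r3" for x
    by (rule strict_grad_compose[OF C1 C1T(2) open_ball]) (use that in simp)
  show ?thesis
  proof (rule H0pair_lipschitz[OF Om(1) cK sK zero L])
    show "L2_on \<Omega> (fold_grad (grad \<phi>))"
      by (rule fold_grad_L2(1)[OF test_function_L2(2)[OF \<phi> Om_sets]])
    show "AE x in lebesgue_on \<Omega>. strict_grad (fold \<phi>) x (fold_grad (grad \<phi>) x)"
      using spheres_AE[OF Om_sets]
    proof eventually_elim
      case (elim x)
      then consider "r3 < norm x" | "x \<in> U23" | "norm x < r2" by (force simp: U23_def)
      then show ?case
      proof cases
        case 1
        have "strict_grad (fold \<phi>) x (grad \<phi> x)"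
          by (rule strict_grad_cong_open[OF s1, where U = "- cball 0 r3"]) (use 1 r23 in \<open>auto simp: fold_def U23_def\<close>)
        moreover have "fold_grad (grad \<phi>) x = grad \<phi> x" using 1 r23 by (auto simp: fold_grad_def U23_def)
        ultimately show ?thesis by simp
      next
        case 2
        have x3: "norm x < r3" using 2 by (simp add: U23_def)
        have "strict_grad (\<lambda>x. \<phi> x - \<phi> (SF x) + \<phi> (SPsi x)) x (grad \<phi> x - pull SF (grad \<phi>) x + pull SPsi (grad \<phi>) x)"
          by (intro strict_grad_combine s1 s3[OF x3] strict_grad_compose[OF C1 C1T(1) open_U(2) 2])
        then have "strict_grad (fold \<phi>) x (grad \<phi> x - pull SF (grad \<phi>) x + pull SPsi (grad \<phi>) x)"
          by (rule strict_grad_cong_open[OF _ open_U(2) 2]) (auto simp: fold_def U23_def)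
        moreover have "fold_grad (grad \<phi>) x = grad \<phi> x - pull SF (grad \<phi>) x + pull SPsi (grad \<phi>) x"
          using 2 by (auto simp: fold_grad_def U23_def)
        ultimately show ?thesis by simp
      next
        case 3
        have "strict_grad (fold \<phi>) x (pull SPsi (grad \<phi>) x)"
          by (rule strict_grad_cong_open[OF s3, where U = "ball 0 r2"]) (use 3 r23 in \<open>auto simp: fold_def U23_def\<close>)
        moreover have "fold_grad (grad \<phi>) x = pull SPsi (grad \<phi>) x" using 3 r23 by (auto simp: fold_grad_def U23_def)
        ultimately show ?thesis by simp
      qed
    qed
  qed
qed

lemma fold_diff: "fold (\<lambda>x. u x - v x) = (\<lambda>x. fold u x - fold v x)"
  by (auto simp: fold_def fun_eq_iff)

lemma fold_grad_diff: "fold_grad (\<lambda>x. g x - k x) = (\<lambda>x. fold_grad g x - fold_grad k x)"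
  by (auto simp: fold_grad_def pull_def fun_eq_iff matrix_vector_mult_diff_distrib)

text \<open>Folding is linear and bounded in \<open>L^2\<close>, on functions and on gradients, so
  the property passes from test functions to their limits.\<close>

lemma fold_H0pair:
  assumes p: "H0pair \<Omega> u g"
  shows "H0pair \<Omega> (fold u) (fold_grad g)"
proof -
  obtain \<phi> where \<phi>: "\<And>n. test_function \<Omega> (\<phi> n)" "(\<lambda>n. L2_norm \<Omega> (\<lambda>x. u x - \<phi> n x)) \<longlonglongrightarrow> 0"
    "(\<lambda>n. L2_norm \<Omega> (\<lambda>x. g x - grad (\<phi> n) x)) \<longlonglongrightarrow> 0"
    using H0pair_sequence[OF p] by blast
  note L = H0pair_L2[OF p] and T = test_function_L2[OF \<phi>(1) Om_sets]
  have 1: "(\<lambda>n. L2_norm \<Omega> (\<lambda>x. fold u x - fold (\<phi> n) x)) \<longlonglongrightarrow> 0"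
  proof (rule Lim_null_comparison)
    show "\<forall>\<^sub>F n in sequentially. norm (L2_norm \<Omega> (\<lambda>x. fold u x - fold (\<phi> n) x)) \<le> (1 + 2 * sq) * L2_norm \<Omega> (\<lambda>x. u x - \<phi> n x)"
      using fold_L2(2)[OF L2_on_diff[OF L(1) T(1)]] by (simp add: fold_diff)
    show "(\<lambda>n. (1 + 2 * sq) * L2_norm \<Omega> (\<lambda>x. u x - \<phi> n x)) \<longlonglongrightarrow> 0"
      by (rule tendsto_mult_right_zero[OF \<phi>(2)])
  qed
  have 2: "(\<lambda>n. L2_norm \<Omega> (\<lambda>x. fold_grad g x - fold_grad (grad (\<phi> n)) x)) \<longlonglongrightarrow> 0"
  proof (rule Lim_null_comparison)
    show "\<forall>\<^sub>F n in sequentially. norm (L2_norm \<Omega> (\<lambda>x. fold_grad g x - fold_grad (grad (\<phi> n)) x)) \<le> (1 + 2 * pq) * L2_norm \<Omega> (\<lambda>x. g x - grad (\<phi> n) x)"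
      using fold_grad_L2(2)[OF L2_on_diff[OF L(2) T(2)]] by (simp add: fold_grad_diff)
    show "(\<lambda>n. (1 + 2 * pq) * L2_norm \<Omega> (\<lambda>x. g x - grad (\<phi> n) x)) \<longlonglongrightarrow> 0"
      by (rule tendsto_mult_right_zero[OF \<phi>(3)])
  qed
  show ?thesis
    by (rule H0pair_limit[OF fold_L2(1)[OF L(1)] fold_grad_L2(1)[OF L(2)] fold_test_H0pair[OF \<phi>(1)] 1 2 Om_sets])
qed

end

section \<open>Complementary coefficients\<close>

lemma AE_lebesgue_on_iff:
  "S \<in> sets lebesgue \<Longrightarrow> (AE x in lebesgue_on S. P x) \<longleftrightarrow> (AE x in lebesgue. x \<in> S \<longrightarrow> P x)"
  by (rule AE_restrict_space_iff) simp

lemma AE_lebesgue_on_subset: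
  assumes "AE x in lebesgue_on S. P x" "T \<in> sets lebesgue" "S \<in> sets lebesgue" "T \<subseteq> S"
  shows "AE x in lebesgue_on T. P x"
  using assms(1) unfolding AE_lebesgue_on_iff[OF assms(2)] AE_lebesgue_on_iff[OF assms(3)]
  by eventually_elim (use assms(4) in auto)

lemma bounded_matrix_subset:
  assumes "bounded_matrix S M K" "T \<in> sets lebesgue" "S \<in> sets lebesgue" "T \<subseteq> S"
  shows "bounded_matrix T M K"
  using assms(1) AE_lebesgue_on_subset[OF _ assms(2-4)] measurable_restrict_mono[OF _ assms(4)]
  unfolding bounded_matrix_def by blast

lemma form_add_left:
  assumes "bounded_matrix S M K" "L2_on S g" "L2_on S g'" "L2_on S k"
  shows "form S M (\<lambda>x. g x + g' x) k = form S M g k + form S M g' k"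
  unfolding form_def
  by (simp add: matrix_vector_right_distrib bounded_bilinear.add_left[OF bounded_bilinear_bdot]
      Bochner_Integration.integral_add[OF form_integrable[OF assms(1,2,4)] form_integrable[OF assms(1,3,4)]])

lemma form_cut:
  assumes "V \<in> sets lebesgue" "S \<in> sets lebesgue" "V \<subseteq> S"
  shows "form S M (\<lambda>x. if x \<in> V then g x else 0) k = form V M g k"
    and "form S M g (\<lambda>x. if x \<in> V then k x else 0) = form V M g k"
proof -
  have "bdot (M x *v (if x \<in> V then g x else 0)) (k x) = (if x \<in> V then bdot (M x *v g x) (k x) else 0)"
    "bdot (M x *v g x) (if x \<in> V then k x else 0) = (if x \<in> V then bdot (M x *v g x) (k x) else 0)" for x
    by (simp_all add: bdot_def)
  then show "form S M (\<lambda>x. if x \<in> V then g x else 0) k = form V M g k"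
    "form S M g (\<lambda>x. if x \<in> V then k x else 0) = form V M g k"
    using integral_cut(2)[OF assms, of "\<lambda>x. bdot (M x *v g x) (k x)"] by (simp_all add: form_def)
qed

lemma form_cong_matrix:
  assumes "integrable (lebesgue_on S) (\<lambda>x. bdot (M x *v g x) (k x))" "integrable (lebesgue_on S) (\<lambda>x. bdot (N x *v g x) (k x))"
    and "AE x in lebesgue_on S. M x = N x"
  shows "form S M g k = form S N g k"
  unfolding form_def
proof (rule integral_cong_AE)
  show "AE x in lebesgue_on S. bdot (M x *v g x) (k x) = bdot (N x *v g x) (k x)"
    using assms(3) by eventually_elim simp
qed (use assms(1,2) in auto)

lemma elliptic_at_mono: "elliptic_at c C M \<Longrightarrow> c' \<le> c \<Longrightarrow> C \<le> C' \<Longrightarrow> elliptic_at c' C' M"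
  unfolding elliptic_at_def by (meson mult_right_mono order_trans zero_le_power2)

text \<open>Polarisation: four times an entry is the difference of the quadratic form at
  \<open>e i + e j\<close> and at \<open>e i - e j\<close>. These vectors have norm at most
  \<open>2\<close>, so both values lie between \<open>0\<close> and
  \<open>4 * \<Lambda>\<close>.\<close>

lemma elliptic_atI:
  fixes M :: "real^'d^'d"
  assumes sym: "transpose M = M" and L: "\<Lambda> \<ge> 1"
    and q: "\<And>\<xi>. (1 / \<Lambda>) * (norm \<xi>)\<^sup>2 \<le> (M *v \<xi>) \<bullet> \<xi> \<and> (M *v \<xi>) \<bullet> \<xi> \<le> \<Lambda> * (norm \<xi>)\<^sup>2"
  shows "elliptic_at (1 / \<Lambda>) \<Lambda> M"
  unfolding elliptic_at_def
proof (intro conjI allI)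
  fix i j
  define e :: "'d \<Rightarrow> real^'d" where "e = (\<lambda>i. axis i 1)"
  have ent: "(M *v e j) \<bullet> e i = M $ i $ j" for i j
    by (simp add: e_def inner_axis matrix_vector_mul_component inner_axis_axis matrix_vector_mult_basis column_def)
  have "(M *v e i) \<bullet> e j = (M *v e j) \<bullet> e i"
    using sym by (simp add: ent transpose_def vec_eq_iff)
  then have "(M *v (e i + e j)) \<bullet> (e i + e j) - (M *v (e i - e j)) \<bullet> (e i - e j) = 4 * M $ i $ j"
    by (simp add: matrix_vector_right_distrib matrix_vector_mult_diff_distrib inner_add_left inner_add_right inner_diff_left inner_diff_right ent[symmetric])
  moreover have "0 \<le> (M *v \<xi>) \<bullet> \<xi>" for \<xi>
  proof -
    have "0 \<le> (1 / \<Lambda>) * (norm \<xi>)\<^sup>2" using L by simp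
    then show ?thesis using q[of \<xi>] by linarith
  qed
  moreover have "(M *v \<xi>) \<bullet> \<xi> \<le> 4 * \<Lambda>" if "norm \<xi> \<le> 2" for \<xi>
  proof -
    have "(norm \<xi>)\<^sup>2 \<le> 2\<^sup>2" using that by (intro power_mono) auto
    then have "\<Lambda> * (norm \<xi>)\<^sup>2 \<le> \<Lambda> * 4" using L by (intro mult_left_mono) auto
    then show ?thesis using q[of \<xi>] by linarith
  qed
  moreover have "norm (e i + e j) \<le> 2" "norm (e i - e j) \<le> 2"
    using norm_triangle_ineq[of "e i" "e j"] norm_triangle_ineq4[of "e i" "e j"] by (simp_all add: e_def)
  ultimately show "\<bar>M $ i $ j\<bar> \<le> \<Lambda>" by (smt (verit))
qed (use assms in auto)

lemma elliptic_imp_AE_elliptic_at: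
  assumes "symmetric_uniformly_elliptic S A"
  shows "\<exists>\<Lambda>\<ge>1. AE x in lebesgue_on S. elliptic_at (1 / \<Lambda>) \<Lambda> (A x)"
proof -
  obtain \<Lambda> where L: "\<Lambda> \<ge> 1" "AE x in lebesgue_on S. \<forall>\<xi>. (1 / \<Lambda>) * (norm \<xi>)\<^sup>2 \<le> (A x *v \<xi>) \<bullet> \<xi> \<and> (A x *v \<xi>) \<bullet> \<xi> \<le> \<Lambda> * (norm \<xi>)\<^sup>2"
    and s: "AE x in lebesgue_on S. transpose (A x) = A x"
    using assms unfolding symmetric_uniformly_elliptic_def by blast
  from s L(2) have "AE x in lebesgue_on S. elliptic_at (1 / \<Lambda>) \<Lambda> (A x)"
    by eventually_elim (rule elliptic_atI[OF _ L(1)], auto)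
  then show ?thesis using L(1) by blast
qed

text \<open>The form of a real symmetric matrix at \<open>\<xi>\<close> and its conjugate is real
  and nonnegative, so only \<open>Re (\<theta> * s x)\<close> enters.\<close>

lemma coercive_of_elliptic:
  assumes e: "AE x in lebesgue_on S. elliptic_at c C (A x)" and c: "c > 0"
    and \<theta>: "\<And>x. Re (\<theta> * s x) \<ge> 1"
  shows "coercive S (scaled_matrix s A) \<theta> c"
  unfolding coercive_def
proof (intro conjI c)
  show "AE x in lebesgue_on S. \<forall>\<xi>. c * (norm \<xi>)\<^sup>2 \<le> Re (\<theta> * bdot (scaled_matrix s A x *v \<xi>) (\<chi> i. cnj (\<xi> $ i)))"
    using e
  proof (eventually_elim, intro allI)
    fix x :: "real^'a" and \<xi> :: "complex^'a"
    assume x: "elliptic_at c C (A x)"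
    let ?b = "bdot (cmat (A x) *v \<xi>) (\<chi> i. cnj (\<xi> $ i))"
    note E = elliptic_at_complex[OF x, of \<xi>]
    have "0 \<le> c * (norm \<xi>)\<^sup>2" using c by simp
    then have "1 * Re ?b \<le> Re (\<theta> * s x) * Re ?b" using E(1) \<theta> by (intro mult_right_mono) auto
    also have "\<dots> = Re (\<theta> * bdot (scaled_matrix s A x *v \<xi>) (\<chi> i. cnj (\<xi> $ i)))"
      using E(2) by (simp add: scaled_matrix_vec bdot_smult_left mult.assoc[symmetric] del: times_complex.sel) simp
    finally show "c * (norm \<xi>)\<^sup>2 \<le> Re (\<theta> * bdot (scaled_matrix s A x *v \<xi>) (\<chi> i. cnj (\<xi> $ i)))"
      using E(1) by linarith
  qed
qed

lemma bounded_matrix_of_elliptic: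
  assumes e: "AE x in lebesgue_on S. elliptic_at c C (A x)" and C: "C \<ge> 0" "s \<in> borel_measurable (lebesgue_on S)"
    and m: "\<And>i j. (\<lambda>x. A x $ i $ j) \<in> borel_measurable (lebesgue_on S)" and s: "\<And>x. norm (s x) \<le> B"
  shows "bounded_matrix S (scaled_matrix s A) (B * C)"
  unfolding bounded_matrix_def
proof (intro conjI allI)
  have B: "0 \<le> B" using s norm_ge_zero order_trans by blast
  then show "0 \<le> B * C" using C by simp
  show "(\<lambda>x. scaled_matrix s A x $ i $ j) \<in> borel_measurable (lebesgue_on S)" for i j
    using m[of i j] C(2) by (simp add: scaled_matrix_def)
  show "AE x in lebesgue_on S. \<forall>i j. cmod (scaled_matrix s A x $ i $ j) \<le> B * C"
    using e
  proof (eventually_elim, intro allI)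
    fix x :: "real^'a" and i j :: 'a assume "elliptic_at c C (A x)"
    then show "cmod (scaled_matrix s A x $ i $ j) \<le> B * C"
      using s[of x] B by (auto simp: scaled_matrix_def norm_mult elliptic_at_def intro!: mult_mono)
  qed
qed

lemma measurable_push_matrix:
  fixes J M :: "'a \<Rightarrow> real^'d^'d"
  assumes [measurable]: "\<And>i j. (\<lambda>x. J x $ i $ j) \<in> borel_measurable N" "\<And>i j. (\<lambda>x. M x $ i $ j) \<in> borel_measurable N"
  shows "(\<lambda>x. push_matrix (J x) (M x) $ i $ j) \<in> borel_measurable N"
  unfolding push_matrix_def det_def matrix_matrix_mult_def transpose_def
  by (simp del: of_int_mult) measurable

text \<open>Off the support every point has a neighbourhood in which \<open>f\<close> vanishes
  almost everywhere, and a locally negligible set is negligible.\<close>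

lemma AE_zero_outside_ess_support:
  assumes S: "open S" and B: "open B" "B \<subseteq> S" and f: "ess_support S f \<subseteq> S - B"
  shows "AE x in lebesgue_on B. f x = 0"
proof -
  let ?N = "{x \<in> B. f x \<noteq> 0}"
  have "\<exists>U. openin (top_of_set ?N) U \<and> x \<in> U \<and> negligible U" if x: "x \<in> ?N" for x
  proof -
    have "x \<in> S" "x \<notin> ess_support S f" using x f B by auto
    then obtain U where U: "open U" "x \<in> U" "AE y in lebesgue_on (S \<inter> U). f y = 0"
      unfolding ess_support_def by blast
    have "S \<inter> U \<in> sets lebesgue" using S U(1) by (simp add: open_Int)
    then have n: "negligible {y \<in> S \<inter> U. \<not> f y = 0}" using U(3) by (simp add: negligible_AE_lebesgue_on)
    show ?thesis
    proof (intro exI conjI)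
      show "openin (top_of_set ?N) (?N \<inter> U)" using U(1) by (simp add: openin_open_Int)
      show "x \<in> ?N \<inter> U" using x U(2) by simp
      show "negligible (?N \<inter> U)" by (rule negligible_subset[OF n]) (use B in auto)
    qed
  qed
  then have "negligible ?N" unfolding locally_negligible_alt[of ?N] by blast
  then show ?thesis using B by (simp add: negligible_AE_lebesgue_on)
qed

section \<open>The medium and its folded coefficient\<close>

locale complementary_medium = complementary_domain r1 r2 r3 F G x1 x2 \<Omega>
  for r1 r2 r3 :: real and F G :: "real^'d \<Rightarrow> real^'d" and x1 x2 :: "real^'d" and \<Omega> +
  fixes A :: "real^'d \<Rightarrow> real^'d^'d" and \<Lambda> :: real
  assumes L1: "\<Lambda> \<ge> 1" and A_ell: "AE x in lebesgue_on \<Omega>. elliptic_at (1 / \<Lambda>) \<Lambda> (A x)"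
    and A_meas: "A \<in> borel_measurable (lebesgue_on \<Omega>)"
    and F_A: "AE y in lebesgue_on (ball 0 r3 - cball 0 r2). pushforward (ball 0 r2 - cball 0 r1) F A y = A y"
    and GF_A: "AE y in lebesgue_on (ball 0 r3 - cball 0 r2). GF_pushforward r2 r3 A F G x1 y = A y"
begin

abbreviation "Ah \<equiv> A_hat r2 r3 A F G x1"
abbreviation "Mh \<equiv> scaled_matrix (\<lambda>x. 1) Ah"
abbreviation "MA \<equiv> scaled_matrix (\<lambda>x. 1) A"
abbreviation "Ms \<delta> \<equiv> scaled_matrix (s_coeff r1 r2 \<delta>) A"

lemma A_entry: "(\<lambda>x. A x $ i $ j) \<in> borel_measurable (lebesgue_on \<Omega>)"
  by (rule borel_measurable_vec_nth[OF borel_measurable_vec_nth[OF A_meas]])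

lemma MA_bounded: "bounded_matrix \<Omega> MA \<Lambda>"
  using bounded_matrix_of_elliptic[OF A_ell, of "\<lambda>x. 1" 1] L1 A_entry by simp

lemma s_measurable: "s_coeff r1 r2 \<delta> \<in> borel_measurable (lebesgue_on \<Omega>)"
proof -
  have "s_coeff r1 r2 \<delta> = (\<lambda>x::real^'d. if x \<in> ball 0 r2 - ball 0 r1 then - 1 + \<i> * complex_of_real \<delta> else 1)"
    by (simp add: s_coeff_def fun_eq_iff)
  also have "\<dots> \<in> borel_measurable borel" by (rule measurable_If_set) (auto intro: sets.Diff)
  finally show ?thesis by (intro measurable_restrict_space1 measurable_completion) simp
qed

lemma Ms_bounded: "bounded_matrix \<Omega> (Ms \<delta>) ((1 + \<bar>\<delta>\<bar>) * \<Lambda>)"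
proof (rule bounded_matrix_of_elliptic[OF A_ell])
  show "norm (s_coeff r1 r2 \<delta> x) \<le> 1 + \<bar>\<delta>\<bar>" for x :: "real^'d"
    using norm_triangle_ineq[of "-1" "\<i> * complex_of_real \<delta>"] by (simp add: s_coeff_def norm_mult)
qed (use L1 A_entry s_measurable in auto)

text \<open>\<open>\<theta> = 1 - 2 * i / \<delta>\<close> gives
  \<open>Re (\<theta> * (-1 + i * \<delta>)) = 1\<close> in the shell and
  \<open>Re \<theta> = 1\<close> elsewhere. As \<open>\<theta>\<close> blows up when
  \<open>\<delta>\<close> tends to \<open>0\<close>, this serves uniqueness for fixed
  \<open>\<delta>\<close>, not uniform estimates.\<close>

lemma Ms_coercive:
  assumes "\<delta> > 0"
  shows "coercive \<Omega> (Ms \<delta>) (Complex 1 (- 2 / \<delta>)) (1 / \<Lambda>)"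
  by (rule coercive_of_elliptic[OF A_ell]) (use L1 assms in \<open>auto simp: s_coeff_def\<close>)

lemma Ah_inside: "y \<in> ball 0 r3 \<Longrightarrow> y \<noteq> x2 \<Longrightarrow> Ah y = push_matrix (jac Psi (SPsi y)) (A (SPsi y))"
  using GF_pushforward_eq by (simp add: A_hat_def)

lemma AE_not_x2: "S \<in> sets lebesgue \<Longrightarrow> AE y in lebesgue_on S. y \<noteq> x2"
  unfolding negligible_AE_lebesgue_on by (rule negligible_subset[OF negligible_sing[of x2]]) auto

lemma Ah_measurable: "(\<lambda>y. Ah y $ i $ j) \<in> borel_measurable (lebesgue_on \<Omega>)"
proof -
  let ?m = "\<lambda>x. push_matrix (jac Psi x) (A x) $ i $ j"
  have C1: "C1_on (ball 0 r1) Psi" using K(3) by (simp add: tame_diffeo_def)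
  have "?m \<in> borel_measurable (lebesgue_on (ball 0 r1))"
    by (rule measurable_push_matrix)
       (use continuous_imp_measurable_on_sets_lebesgue[OF continuous_on_jac[OF C1]] measurable_restrict_mono[OF A_entry regions(4)] in auto)
  from tame_diffeo_measurable[OF K(3) this]
  have 1: "(\<lambda>y. ?m (SPsi y)) \<in> borel_measurable (lebesgue_on (ball 0 r3 - {x2}))"
    by (rule measurable_restrict_mono) auto
  have 2: "(\<lambda>y. A y $ i $ j) \<in> borel_measurable (lebesgue_on (\<Omega> - ball 0 r3))"
    by (rule measurable_restrict_mono[OF A_entry]) auto
  have 3: "(\<lambda>y. Ah x2 $ i $ j) \<in> borel_measurable (lebesgue_on {x2})" by simp
  have "(\<lambda>y. (if y \<in> ball 0 r3 - {x2} then ?m (SPsi y) else 0) + (if y \<in> \<Omega> - ball 0 r3 then A y $ i $ j else 0)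
      + (if y \<in> {x2} then Ah x2 $ i $ j else 0)) \<in> borel_measurable (lebesgue_on \<Omega>)"
    by (intro borel_measurable_add measurable_cut 1 2 3) (use Om in \<open>auto intro: sets.Diff\<close>)
  then show ?thesis
    by (rule measurable_cong[THEN iffD1, rotated]) (use x2 Ah_inside in \<open>auto simp: A_hat_def\<close>)
qed

lemma Ah_elliptic: "\<exists>c>0. \<exists>C\<ge>0. AE x in lebesgue_on \<Omega>. elliptic_at c C (Ah x)"
proof -
  define D :: real where "D = fact CARD('d) * K ^ CARD('d)"
  define c' where "c' = (1 / \<Lambda>) / (D * ((real CARD('d))\<^sup>2 * K)\<^sup>2)"
  define C' where "C' = D * ((real CARD('d))\<^sup>2 * (K * \<Lambda> * K))"
  have push: "elliptic_at c' C' (push_matrix (jac Psi (SPsi y)) M)" "D > 0" "K > 0"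
    if y: "y \<in> ball 0 r3" and M: "elliptic_at (1 / \<Lambda>) \<Lambda> M" for y M
  proof -
    have x: "SPsi y \<in> ball 0 r1" "Psi (SPsi y) = y" using K(3) y by (auto simp: tame_diffeo_def)
    have b: "\<bar>jac Psi (SPsi y) $ i $ j\<bar> \<le> K" "\<bar>jac SPsi (Psi (SPsi y)) $ i $ j\<bar> \<le> K" for i j
      using K(3) x y by (auto simp: tame_diffeo_def)
    have n: "1 / \<Lambda> \<ge> 0" using L1 by simp
    note P = elliptic_at_push[OF M n tame_diffeo_jac_inverse[OF K(3) x(1)] b D_def]
    show "elliptic_at c' C' (push_matrix (jac Psi (SPsi y)) M)" "D > 0" "K > 0"
      unfolding c'_def C'_def by (rule P)+
  qed
  \<comment> \<open>The identity matrix at the point \<open>0\<close> is a dummy input that extracts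
    \<open>D > 0\<close> and \<open>K > 0\<close> from \<open>push\<close>.\<close>
  have "elliptic_at (1 / \<Lambda>) \<Lambda> (mat 1 :: real^'d^'d)"
  proof (rule elliptic_atI[OF transpose_mat L1])
    fix \<xi> :: "real^'d"
    have "1 / \<Lambda> * (norm \<xi>)\<^sup>2 \<le> 1 * (norm \<xi>)\<^sup>2" "1 * (norm \<xi>)\<^sup>2 \<le> \<Lambda> * (norm \<xi>)\<^sup>2"
      by (intro mult_right_mono; use L1 in simp)+
    then show "1 / \<Lambda> * (norm \<xi>)\<^sup>2 \<le> (mat 1 *v \<xi>) \<bullet> \<xi> \<and> (mat 1 *v \<xi>) \<bullet> \<xi> \<le> \<Lambda> * (norm \<xi>)\<^sup>2"
      by (simp add: power2_norm_eq_inner)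
  qed
  from push(2,3)[OF _ this, of 0] have D: "D > 0" "K > 0" using r1 r12 r23 by auto
  have c': "c' > 0" "C' \<ge> 0" using D L1 by (auto simp: c'_def C'_def)
  have in_r3: "AE y in lebesgue_on (ball 0 r3). elliptic_at (1 / \<Lambda>) \<Lambda> (A (SPsi y))"
    by (rule tame_diffeo_AE[OF K(3) AE_lebesgue_on_subset[OF A_ell regions(9) Om_sets regions(4)]])
  have "AE y in lebesgue. y \<in> \<Omega> \<longrightarrow> elliptic_at (min c' (1 / \<Lambda>)) (max C' \<Lambda>) (Ah y)"
    using A_ell[unfolded AE_lebesgue_on_iff[OF Om_sets]] in_r3[unfolded AE_lebesgue_on_iff[OF regions(10)]]
      AE_not_x2[OF Om_sets, unfolded AE_lebesgue_on_iff[OF Om_sets]]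
  proof eventually_elim
    case (elim y)
    show ?case
    proof
      assume y: "y \<in> \<Omega>"
      show "elliptic_at (min c' (1 / \<Lambda>)) (max C' \<Lambda>) (Ah y)"
      proof (cases "y \<in> ball 0 r3")
        case True
        then have "elliptic_at c' C' (Ah y)"
          using push(1)[OF True] elim y by (simp add: Ah_inside)
        then show ?thesis by (rule elliptic_at_mono) auto
      next
        case False
        then have "Ah y = A y" unfolding A_hat_def by (rule if_not_P)
        then have "elliptic_at (1 / \<Lambda>) \<Lambda> (Ah y)" using elim(1) y by simp
        then show ?thesis by (rule elliptic_at_mono) auto
      qed
    qed
  qed
  moreover have "min c' (1 / \<Lambda>) > 0" "max C' \<Lambda> \<ge> 0" using c' L1 by auto
  ultimately show ?thesis unfolding AE_lebesgue_on_iff[OF Om_sets] by blast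
qed

lemma Mh_coercive: "\<exists>KM \<mu>. bounded_matrix \<Omega> Mh KM \<and> coercive \<Omega> Mh 1 \<mu>"
proof -
  obtain c C where c: "c > 0" "C \<ge> 0" "AE x in lebesgue_on \<Omega>. elliptic_at c C (Ah x)"
    using Ah_elliptic by blast
  have "bounded_matrix \<Omega> Mh (1 * C)"
    by (rule bounded_matrix_of_elliptic[OF c(3,2)]) (use Ah_measurable in auto)
  moreover have "coercive \<Omega> Mh 1 c"
    by (rule coercive_of_elliptic[OF c(3,1)]) simp
  ultimately show ?thesis by blast
qed

lemma Ah_outside: "AE y in lebesgue_on Vout. Ah y = A y"
proof -
  have "AE y in lebesgue. y \<in> Vout \<longrightarrow> Ah y = A y"
    using GF_A[folded U23_def, unfolded AE_lebesgue_on_iff[OF regions(8)]]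
    by eventually_elim (auto simp: A_hat_def U23_def Vout_def)
  then show ?thesis unfolding AE_lebesgue_on_iff[OF regions(6)] .
qed

text \<open>Both identities of double complementarity enter: \<open>Ah = A\<close> by the one for
  \<open>G\<close> and \<open>F\<close>, and \<open>A\<close> is its own push-forward by
  \<open>F\<close>.\<close>

lemma Ah_shell: "AE y in lebesgue_on U23. Ah y = push_matrix (jac F (SF y)) (A (SF y))"
  using F_A[folded U23_def] GF_A[folded U23_def] AE_space
proof eventually_elim
  case (elim y)
  then show ?case using pushforward_F[of y A] by (simp add: A_hat_def U23_def)
qed

lemma Ah_core: "AE y in lebesgue_on (ball 0 r3). Ah y = push_matrix (jac Psi (SPsi y)) (A (SPsi y))"
  using AE_not_x2[OF regions(10)] AE_space by eventually_elim (use Ah_inside in simp)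

text \<open>Each part of the fold is transported back by its own diffeomorphism. This requires
  \<open>Ah\<close> to be \<open>A\<close>, its push-forward by \<open>F\<close> and its
  push-forward by \<open>Psi\<close> on three regions that overlap in the outer shell; double
  complementarity says that the three matrices coincide there.\<close>

lemma form_fold:
  assumes g: "L2_on \<Omega> g" and k: "L2_on \<Omega> k"
  shows "form \<Omega> Mh (fold_grad g) k = form Vout MA g k - form U12 MA g (pull F k) + form (ball 0 r1) MA g (pull Psi k)"
proof -
  obtain KM where M: "bounded_matrix \<Omega> Mh KM" using Mh_coercive by blast
  note s = L2_norm_subset(1)[OF g _ Om_sets] and sk = L2_norm_subset(1)[OF k _ Om_sets]
  note t1 = tame_diffeo_pull_L2(1)[OF dim K(2) K(1) s[OF regions(7,2)]]
    and t2 = tame_diffeo_pull_L2(1)[OF dim K(3) K(1) s[OF regions(9,4)]]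
  note o1 = s[OF regions(6,1)]
  note c0 = L2_cut(1)[OF regions(6) Om_sets regions(1) o1]
    and c1 = L2_cut(1)[OF regions(8) Om_sets regions(3) t1] and c2 = L2_cut(1)[OF regions(10) Om_sets regions(5) t2]
  have "form \<Omega> Mh (fold_grad g) k = form \<Omega> Mh (\<lambda>x. (if x \<in> Vout then g x else 0)
      - (if x \<in> U23 then pull SF g x else 0) + (if x \<in> ball 0 r3 then pull SPsi g x else 0)) k"
    unfolding form_def by (rule Bochner_Integration.integral_cong[OF refl]) (simp add: fold_grad_def cut_out)
  also have "\<dots> = form Vout Mh g k - form U23 Mh (pull SF g) k + form (ball 0 r3) Mh (pull SPsi g) k"
    unfolding form_add_left[OF M L2_on_diff[OF c0 c1] c2 k] form_diff_left[OF M c0 c1 k]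
      form_cut(1)[OF regions(6) Om_sets regions(1)] form_cut(1)[OF regions(8) Om_sets regions(3)]
      form_cut(1)[OF regions(10) Om_sets regions(5)] ..
  also have "form Vout Mh g k = form Vout MA g k"
  proof (rule form_cong_matrix)
    note sub = regions(6) Om_sets regions(1)
    show "integrable (lebesgue_on Vout) (\<lambda>x. bdot (Mh x *v g x) (k x))" "integrable (lebesgue_on Vout) (\<lambda>x. bdot (MA x *v g x) (k x))"
      by (rule form_integrable[OF bounded_matrix_subset[OF M sub] o1 sk[OF regions(6,1)]])
         (rule form_integrable[OF bounded_matrix_subset[OF MA_bounded sub] o1 sk[OF regions(6,1)]])
    show "AE x in lebesgue_on Vout. Mh x = MA x"
      using Ah_outside by eventually_elim (simp add: scaled_matrix_one)
  qed
  also have "form U23 Mh (pull SF g) k = form U12 MA g (pull F k)"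
  proof -
    note sub = regions(7) Om_sets regions(2)
    have i: "integrable (lebesgue_on U12) (\<lambda>x. bdot (cmat (A x) *v g x) (pull F k x))"
      using form_integrable[OF bounded_matrix_subset[OF MA_bounded sub] s[OF regions(7,2)] pull_F_L2(1)[OF k]]
      by (simp add: scaled_matrix_one)
    note T = tame_diffeo_form[OF dim K(2) i]
    have "form U23 Mh (pull SF g) k = form U23 (\<lambda>y. cmat (push_matrix (jac F (SF y)) (A (SF y)))) (pull SF g) k"
    proof (rule form_cong_matrix[OF _ T(1)])
      show "integrable (lebesgue_on U23) (\<lambda>x. bdot (Mh x *v pull SF g x) (k x))"
        by (rule form_integrable[OF bounded_matrix_subset[OF M regions(8) Om_sets regions(3)] t1 sk[OF regions(8,3)]])
      show "AE y in lebesgue_on U23. Mh y = cmat (push_matrix (jac F (SF y)) (A (SF y)))"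
        using Ah_shell by eventually_elim (simp add: scaled_matrix_one)
    qed
    also have "\<dots> = form U12 MA g (pull F k)" using T(2) by (simp add: form_def scaled_matrix_one)
    finally show ?thesis .
  qed
  also have "form (ball 0 r3) Mh (pull SPsi g) k = form (ball 0 r1) MA g (pull Psi k)"
  proof -
    note sub = regions(9) Om_sets regions(4)
    have i: "integrable (lebesgue_on (ball 0 r1)) (\<lambda>x. bdot (cmat (A x) *v g x) (pull Psi k x))"
      using form_integrable[OF bounded_matrix_subset[OF MA_bounded sub] s[OF regions(9,4)] pull_F_L2(3)[OF k]]
      by (simp add: scaled_matrix_one)
    note T = tame_diffeo_form[OF dim K(3) i]
    have "form (ball 0 r3) Mh (pull SPsi g) k = form (ball 0 r3) (\<lambda>y. cmat (push_matrix (jac Psi (SPsi y)) (A (SPsi y)))) (pull SPsi g) k"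
    proof (rule form_cong_matrix[OF _ T(1)])
      show "integrable (lebesgue_on (ball 0 r3)) (\<lambda>x. bdot (Mh x *v pull SPsi g x) (k x))"
        by (rule form_integrable[OF bounded_matrix_subset[OF M regions(10) Om_sets regions(5)] t2 sk[OF regions(10,5)]])
      show "AE y in lebesgue_on (ball 0 r3). Mh y = cmat (push_matrix (jac Psi (SPsi y)) (A (SPsi y)))"
        using Ah_core by eventually_elim (simp add: scaled_matrix_one)
    qed
    also have "\<dots> = form (ball 0 r1) MA g (pull Psi k)" using T(2) by (simp add: form_def scaled_matrix_one)
    finally show ?thesis .
  qed
  finally show ?thesis .
qed

lemma form_const:
  assumes "\<And>x. x \<in> V \<Longrightarrow> s_coeff r1 r2 \<delta> x = c"
  shows "form V (Ms \<delta>) g k = c * form V MA g k"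
proof -
  have "form V (Ms \<delta>) g k = (\<integral>x. c * bdot (MA x *v g x) (k x) \<partial>lebesgue_on V)"
    unfolding form_def by (rule Bochner_Integration.integral_cong[OF refl])
      (use assms in \<open>simp add: scaled_matrix_vec bdot_smult_left\<close>)
  then show ?thesis by (simp add: form_def)
qed

lemma form_lift:
  assumes g: "L2_on \<Omega> g" and k: "L2_on \<Omega> k"
  shows "form \<Omega> (Ms \<delta>) g (lift_grad k) = form Vout MA g k + (- 1 + \<i> * \<delta>) * form U12 MA g (pull F k) + form (ball 0 r1) MA g (pull Psi k)"
proof -
  note M = Ms_bounded[of \<delta>]
  note c0 = L2_cut(1)[OF regions(6) Om_sets regions(1) L2_norm_subset(1)[OF k regions(6) Om_sets regions(1)]]
    and c1 = L2_cut(1)[OF regions(7) Om_sets regions(2) pull_F_L2(1)[OF k]]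
    and c2 = L2_cut(1)[OF regions(9) Om_sets regions(4) pull_F_L2(3)[OF k]]
  have "form \<Omega> (Ms \<delta>) g (lift_grad k) = form \<Omega> (Ms \<delta>) g (\<lambda>x. (if x \<in> Vout then k x else 0)
      + (if x \<in> U12 then pull F k x else 0) + (if x \<in> ball 0 r1 then pull Psi k x else 0))"
    unfolding form_def by (rule Bochner_Integration.integral_cong[OF refl]) (simp add: lift_grad_def cut_out)
  also have "\<dots> = form Vout (Ms \<delta>) g k + form U12 (Ms \<delta>) g (pull F k) + form (ball 0 r1) (Ms \<delta>) g (pull Psi k)"
    unfolding form_add_right[OF M g L2_on_add[OF c0 c1] c2] form_add_right[OF M g c0 c1]
      form_cut(2)[OF regions(6) Om_sets regions(1)] form_cut(2)[OF regions(7) Om_sets regions(2)]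
      form_cut(2)[OF regions(9) Om_sets regions(4)] ..
  also have "form Vout (Ms \<delta>) g k = 1 * form Vout MA g k"
    by (rule form_const) (auto simp: s_coeff_def Vout_def)
  also have "form U12 (Ms \<delta>) g (pull F k) = (- 1 + \<i> * \<delta>) * form U12 MA g (pull F k)"
    by (rule form_const) (auto simp: s_coeff_def U12_def)
  also have "form (ball 0 r1) (Ms \<delta>) g (pull Psi k) = 1 * form (ball 0 r1) MA g (pull Psi k)"
    by (rule form_const) (auto simp: s_coeff_def)
  finally show ?thesis by simp
qed

text \<open>The two expansions differ only by \<open>-1\<close> against
  \<open>-1 + i * \<delta>\<close> in the inner shell.\<close>

lemma form_fold_lift:
  assumes "L2_on \<Omega> g" "L2_on \<Omega> k"
  shows "form \<Omega> Mh (fold_grad g) k = form \<Omega> (Ms \<delta>) g (lift_grad k) - \<i> * \<delta> * form U12 MA g (pull F k)"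
  unfolding form_fold[OF assms] form_lift[OF assms] by (simp add: algebra_simps)

text \<open>The constant of \<open>norm_form_le\<close> for coefficients bounded by
  \<open>\<Lambda>\<close>, times the norm bound for pulling back by \<open>F\<close>.\<close>

definition Cr :: real where "Cr = real CARD('d) ^ 3 * \<Lambda> * pq"

lemma Cr_nonneg: "0 \<le> Cr" using L1 pq_nonneg by (simp add: Cr_def)

lemma fold_residual:
  assumes \<delta>: "\<delta> > 0" and f: "L2_on \<Omega> f" "AE x in lebesgue_on (ball 0 r2). f x = 0"
    and g: "L2_on \<Omega> g" and sol: "weak_sol \<Omega> (Ms \<delta>) f g" and \<phi>: "test_function \<Omega> \<phi>"
  shows "norm (form \<Omega> Mh (fold_grad g) (grad \<phi>) + pairing \<Omega> f \<phi>)
    \<le> (Cr * (\<delta> * L2_norm (ball 0 r2 - ball 0 r1) g)) * L2_norm \<Omega> (grad \<phi>)"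
proof -
  note k = test_function_L2(2)[OF \<phi> Om_sets] and l = lift_H0pair[OF \<phi>]
  have sub: "ball 0 r2 - ball 0 r1 \<subseteq> \<Omega>" "U12 \<subseteq> ball 0 r2 - ball 0 r1"
    using r3_Om r23 by (auto simp: U12_def subset_iff)
  have "ball (0::real^'d) r2 \<in> sets lebesgue" by simp
  \<comment> \<open>The lift differs from \<open>\<phi>\<close> only in \<open>ball 0 r2\<close>,
    where \<open>f\<close> vanishes.\<close>
  have "pairing \<Omega> f (lift \<phi>) = pairing \<Omega> f \<phi>"
    unfolding pairing_def
  proof (rule integral_cong_AE)
    show "(\<lambda>x. f x * lift \<phi> x) \<in> borel_measurable (lebesgue_on \<Omega>)" "(\<lambda>x. f x * \<phi> x) \<in> borel_measurable (lebesgue_on \<Omega>)"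
      using pairing_integrable[OF f(1) H0pair_L2(1)[OF l]] pairing_integrable[OF f(1) test_function_L2(1)[OF \<phi> Om_sets]] by auto
    have "AE x in lebesgue. x \<in> \<Omega> \<longrightarrow> f x * lift \<phi> x = f x * \<phi> x"
      using f(2)[unfolded AE_lebesgue_on_iff[OF \<open>ball 0 r2 \<in> sets lebesgue\<close>]]
      by eventually_elim (auto simp: lift_def)
    then show "AE x in lebesgue_on \<Omega>. f x * lift \<phi> x = f x * \<phi> x"
      unfolding AE_lebesgue_on_iff[OF Om_sets] .
  qed
  then have "form \<Omega> Mh (fold_grad g) (grad \<phi>) + pairing \<Omega> f \<phi> = - (\<i> * \<delta> * form U12 MA g (pull F (grad \<phi>)))"
    unfolding form_fold_lift[OF g k, of \<delta>] weak_sol_H0pair[OF Om_sets Ms_bounded f(1) g sol l] by simp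
  then have "norm (form \<Omega> Mh (fold_grad g) (grad \<phi>) + pairing \<Omega> f \<phi>) = \<delta> * norm (form U12 MA g (pull F (grad \<phi>)))"
    using \<delta> by (simp add: norm_mult)
  also have "\<dots> \<le> \<delta> * ((real CARD('d)^3 * \<Lambda>) * (L2_norm U12 g * L2_norm U12 (pull F (grad \<phi>))))"
    using \<delta> by (intro mult_left_mono norm_form_le[OF bounded_matrix_subset[OF MA_bounded regions(7) Om_sets regions(2)]
        L2_norm_subset(1)[OF g regions(7) Om_sets regions(2)] pull_F_L2(1)[OF k]]) auto
  also have "\<dots> \<le> \<delta> * ((real CARD('d)^3 * \<Lambda>) * (L2_norm (ball 0 r2 - ball 0 r1) g * (pq * L2_norm \<Omega> (grad \<phi>))))"
  proof (intro mult_left_mono mult_mono pull_F_L2(2)[OF k])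
    have "ball (0::real^'d) r2 - ball 0 r1 \<in> sets lebesgue" by auto
    then show "L2_norm U12 g \<le> L2_norm (ball 0 r2 - ball 0 r1) g"
      using L2_norm_subset(2)[OF L2_norm_subset(1)[OF g _ Om_sets sub(1)] regions(7) _ sub(2)] by blast
  qed (use \<delta> L1 in auto)
  finally show ?thesis by (simp add: Cr_def mult_ac)
qed

end

section \<open>Limits of the folded solutions\<close>

text \<open>The common source term cancels in differences, so coercivity bounds
  \<open>H m - H n\<close> by a multiple of \<open>e m + e n\<close>. The Poincare inequality and
  completeness produce the limit, to which the residual estimate passes.\<close>

lemma weak_sol_limit:
  fixes M :: "real^'d \<Rightarrow> complex^'d^'d"
  assumes S: "open S" "S \<subseteq> cball 0 R" and M: "bounded_matrix S M K" and co: "coercive S M \<theta> \<mu>" and f: "L2_on S f"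
    and p: "\<And>n. H0pair S (W n) (H n)" and e: "\<And>n. 0 \<le> e n" "e \<longlonglongrightarrow> 0"
    and res: "\<And>n \<phi>. test_function S \<phi> \<Longrightarrow> norm (form S M (H n) (grad \<phi>) + pairing S f \<phi>) \<le> e n * L2_norm S (grad \<phi>)"
  shows "\<exists>w h. H0pair S w h \<and> weak_sol S M f h \<and>
    (\<lambda>n. L2_norm S (\<lambda>x. w x - W n x)) \<longlonglongrightarrow> 0 \<and> (\<lambda>n. L2_norm S (\<lambda>x. h x - H n x)) \<longlonglongrightarrow> 0"
proof -
  have Ss: "S \<in> sets lebesgue" using S(1) by simp
  have bS: "S \<in> lmeasurable" using S by (meson bounded_cball bounded_subset lmeasurable_open)
  note L = H0pair_L2[OF p]
  have \<mu>: "\<mu> > 0" using co by (simp add: coercive_def)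
  have dH: "L2_norm S (\<lambda>x. H m x - H n x) \<le> norm \<theta> * (e m + e n) / \<mu>" for m n
  proof (rule coercive_bound[OF Ss M co H0pair_diff[OF Ss p p]])
    show "0 \<le> e m + e n" using e(1) by (simp add: add_nonneg_nonneg)
    fix \<phi> :: "real^'d \<Rightarrow> complex" assume \<phi>: "test_function S \<phi>"
    let ?a = "\<lambda>n. form S M (H n) (grad \<phi>) + pairing S f \<phi>"
    have "form S M (\<lambda>x. H m x - H n x) (grad \<phi>) = ?a m - ?a n"
      by (simp add: form_diff_left[OF M L(2) L(2) test_function_L2(2)[OF \<phi> Ss]])
    then show "norm (form S M (\<lambda>x. H m x - H n x) (grad \<phi>)) \<le> (e m + e n) * L2_norm S (grad \<phi>)"
      using norm_triangle_ineq4[of "?a m" "?a n"] res[OF \<phi>, of m] res[OF \<phi>, of n] by (simp add: distrib_right)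
  qed
  have small: "\<exists>N. \<forall>n\<ge>N. c * e n < \<epsilon>" if "\<epsilon> > 0" for c \<epsilon>
  proof -
    have "(\<lambda>n. c * e n) \<longlonglongrightarrow> 0" by (rule tendsto_mult_right_zero[OF e(2)])
    from order_tendstoD(2)[OF this that] show ?thesis by (simp add: eventually_sequentially)
  qed
  have cauchy: "\<exists>N. \<forall>m\<ge>N. \<forall>n\<ge>N. d m n < \<epsilon>" if \<epsilon>: "\<epsilon> > 0" and d: "\<And>m n. d m n \<le> c * (e m + e n)" for d :: "nat \<Rightarrow> nat \<Rightarrow> real" and c \<epsilon>
  proof -
    obtain N where N: "\<And>n. n \<ge> N \<Longrightarrow> c * e n < \<epsilon> / 2" using small[of "\<epsilon> / 2" c] \<epsilon> by auto
    have "d m n < \<epsilon>" if "m \<ge> N" "n \<ge> N" for m n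
      using N[OF that(1)] N[OF that(2)] d[of m n] unfolding distrib_left by linarith
    then show ?thesis by blast
  qed
  have dH': "L2_norm S (\<lambda>x. H m x - H n x) \<le> (norm \<theta> / \<mu>) * (e m + e n)" for m n using dH[of m n] by simp
  have dW: "L2_norm S (\<lambda>x. W m x - W n x) \<le> (2 * \<bar>R\<bar> * (norm \<theta> / \<mu>)) * (e m + e n)" for m n
    using H0pair_poincare[OF H0pair_diff[OF Ss p p] Ss S(2), of m n] mult_left_mono[OF dH'[of m n], of "2 * \<bar>R\<bar>"] by (simp add: mult_ac)
  obtain h where h: "L2_on S h" "(\<lambda>n. L2_norm S (\<lambda>x. h x - H n x)) \<longlonglongrightarrow> 0"
    by (rule L2_complete[OF bS L(2) cauchy[OF _ dH']]) (simp_all add: L2_norm_minus_commute)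
  obtain w where w: "L2_on S w" "(\<lambda>n. L2_norm S (\<lambda>x. w x - W n x)) \<longlonglongrightarrow> 0"
    by (rule L2_complete[OF bS L(1) cauchy[OF _ dW]]) (simp_all add: L2_norm_minus_commute)
  have "H0pair S w h" by (rule H0pair_limit[OF w(1) h(1) p w(2) h(2) Ss])
  moreover have "weak_sol S M f h"
    unfolding weak_sol_def
  proof (intro allI impI)
    fix \<phi> :: "real^'d \<Rightarrow> complex" assume \<phi>: "test_function S \<phi>"
    have "(\<lambda>n. form S M (H n) (grad \<phi>) + pairing S f \<phi>) \<longlonglongrightarrow> form S M h (grad \<phi>) + pairing S f \<phi>"
      by (rule tendsto_add[OF form_tendsto_left[OF M h(1) L(2) test_function_L2(2)[OF \<phi> Ss] h(2)] tendsto_const])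
    moreover have "(\<lambda>n. form S M (H n) (grad \<phi>) + pairing S f \<phi>) \<longlonglongrightarrow> 0"
      by (rule LIMSEQ_of_norm_bound[where b = "\<lambda>n. e n * L2_norm S (grad \<phi>)"])
         (use res[OF \<phi>] tendsto_mult_left_zero[OF e(2)] in auto)
    ultimately have "form S M h (grad \<phi>) + pairing S f \<phi> = 0" by (rule LIMSEQ_unique)
    then show "form S M h (grad \<phi>) = - pairing S f \<phi>" by (simp add: eq_neg_iff_add_eq_0)
  qed
  ultimately show ?thesis using w h by blast
qed

text \<open>A test function for \<open>T\<close> is one for \<open>S\<close> and vanishes off
  \<open>T\<close>, so all integrals may be cut down to \<open>T\<close>.\<close>

lemma has_weak_gradient_subset:
  fixes u :: "real^'d \<Rightarrow> complex"
  assumes T: "open T" "T \<subseteq> S" "open S" and w: "has_weak_gradient S u g"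
  shows "has_weak_gradient T u g"
  unfolding has_weak_gradient_def
proof (intro allI impI)
  fix \<phi> :: "real^'d \<Rightarrow> real" and i assume \<phi>: "test_function T \<phi>"
  have z: "partial_deriv i \<phi> x = 0 \<and> \<phi> x = 0" if "x \<notin> T" for x
  proof -
    obtain K where "K \<subseteq> T" "\<And>x. x \<notin> K \<Longrightarrow> \<phi> x = 0" "\<And>x. x \<notin> K \<Longrightarrow> grad \<phi> x = 0"
      using test_function_support[OF \<phi>] by blast
    then have "\<phi> x = 0" "grad \<phi> x = 0" using that by auto
    then show ?thesis by (simp add: grad_def vec_eq_iff)
  qed
  have cut: "(\<integral>x. q x *\<^sub>R v x \<partial>lebesgue_on S) = (\<integral>x. q x *\<^sub>R v x \<partial>lebesgue_on T)"
    if "\<And>x. x \<notin> T \<Longrightarrow> q x = 0" for q :: "real^'d \<Rightarrow> real" and v :: "real^'d \<Rightarrow> complex"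
  proof -
    have "(\<lambda>x. q x *\<^sub>R v x) = (\<lambda>x. if x \<in> T then q x *\<^sub>R v x else 0)" using that by auto
    then show ?thesis using integral_cut(2)[of T S "\<lambda>x. q x *\<^sub>R v x"] T by simp
  qed
  have "test_function S \<phi>" using \<phi> T(2) by (auto simp: test_function_def)
  then show "(\<integral>x. partial_deriv i \<phi> x *\<^sub>R u x \<partial>lebesgue_on T) = - (\<integral>x. \<phi> x *\<^sub>R (g x $ i) \<partial>lebesgue_on T)"
    using w cut[of "partial_deriv i \<phi>" u] cut[of \<phi> "\<lambda>x. g x $ i"] z unfolding has_weak_gradient_def by simp
qed

lemma has_weak_gradient_cong:
  assumes "\<And>x. x \<in> S \<Longrightarrow> u x = v x"
  shows "has_weak_gradient S u g \<longleftrightarrow> has_weak_gradient S v g"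
proof -
  have "(\<integral>x. q x *\<^sub>R u x \<partial>lebesgue_on S) = (\<integral>x. q x *\<^sub>R v x \<partial>lebesgue_on S)" for q :: "real^'a \<Rightarrow> real"
    by (rule Bochner_Integration.integral_cong) (use assms in auto)
  then show ?thesis by (simp add: has_weak_gradient_def)
qed

lemma H0pair_restrict:
  fixes u :: "real^'d \<Rightarrow> complex"
  assumes T: "open T" "T \<subseteq> S" "open S" and p: "H0pair S v g" and e: "\<And>x. x \<in> T \<Longrightarrow> u x = v x"
  shows "H1_on T u" "H1_norm T u \<le> L2_norm S v + L2_norm S g"
proof -
  have s: "S \<in> sets lebesgue" "T \<in> sets lebesgue" using T by auto
  note Lv = L2_norm_subset[OF H0pair_L2(1)[OF p] s(2,1) T(2)] and Lg = L2_norm_subset[OF H0pair_L2(2)[OF p] s(2,1) T(2)]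
  have Lu: "L2_on T u" "L2_norm T u \<le> L2_norm S v"
    using Lv L2_on_cong[of T u v] L2_norm_cong[of T u v] e by auto
  have w: "has_weak_gradient T u g"
    using has_weak_gradient_subset[OF T H0pair_weak_gradient[OF s(1) p]] has_weak_gradient_cong[of T u v] e by blast
  show "H1_on T u" using Lu(1) Lg(1) w by (auto simp: H1_on_def)
  have "H1_norm T u \<le> L2_norm T u + L2_norm T g"
    unfolding H1_norm_eq[OF T(1) Lu(1) Lg(1) w] by (rule sqrt_sum_squares_le_sum) auto
  then show "H1_norm T u \<le> L2_norm S v + L2_norm S g" using Lu(2) Lg(2) by linarith
qed

text \<open>Norm convergence of \<open>W n\<close> on \<open>S\<close> restricts to
  \<open>T\<close>, and \<open>u n\<close> has to agree with \<open>W n\<close> on \<open>T\<close>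
  only. In the applications \<open>W n\<close> is a folded solution, which differs from the solution
  inside the ball of radius \<open>r3\<close>.\<close>

lemma H1_weakly_convergesI:
  fixes u :: "nat \<Rightarrow> real^'d \<Rightarrow> complex"
  assumes T: "open T" "T \<subseteq> S" "open S" and w: "H0pair S w h"
    and ev: "\<forall>\<^sub>F n in sequentially. H0pair S (W n) (H n) \<and> (\<forall>x\<in>T. u n x = W n x)"
    and l: "(\<lambda>n. L2_norm S (\<lambda>x. w x - W n x)) \<longlonglongrightarrow> 0" "(\<lambda>n. L2_norm S (\<lambda>x. h x - H n x)) \<longlonglongrightarrow> 0"
  shows "H1_weakly_converges T u w"
proof -
  have Ss: "S \<in> sets lebesgue" using T by simp
  note w1 = H0pair_restrict(1)[OF T w refl]
  have u1: "\<forall>\<^sub>F n in sequentially. H1_on T (u n)"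
    using ev by eventually_elim (rule H0pair_restrict(1)[OF T], auto)
  have "(\<lambda>n. l (u n)) \<longlonglongrightarrow> l w" if "H1_functional T l" for l
  proof -
    have add: "\<And>u w. H1_on T u \<Longrightarrow> H1_on T w \<Longrightarrow> l (\<lambda>x. u x + w x) = l u + l w"
      and mul: "\<And>c u. H1_on T u \<Longrightarrow> l (\<lambda>x. c * u x) = c * l u"
      and "\<exists>C. \<forall>u. H1_on T u \<longrightarrow> cmod (l u) \<le> C * H1_norm T u"
      using that by (simp_all only: H1_functional_def)
    then obtain C where C: "\<And>u. H1_on T u \<Longrightarrow> cmod (l u) \<le> C * H1_norm T u" by auto
    let ?b = "\<lambda>n. \<bar>C\<bar> * (L2_norm S (\<lambda>x. w x - W n x) + L2_norm S (\<lambda>x. h x - H n x))"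
    have "\<forall>\<^sub>F n in sequentially. norm (l (u n) - l w) \<le> ?b n"
      using ev u1
    proof eventually_elim
      case (elim n)
      \<comment> \<open>The difference is written as a sum with \<open>- 1 * w x\<close>, the shape
        in which additivity and homogeneity of the functional apply.\<close>
      note neg = H0pair_restrict[OF T H0pair_cmult[OF Ss w, of "- 1"], of "\<lambda>x. - 1 * w x"]
      note d = H0pair_restrict[OF T H0pair_diff[OF Ss conjunct1[OF elim(1)] w], of "\<lambda>x. u n x + - 1 * w x"]
      have d': "H1_on T (\<lambda>x. u n x + - 1 * w x)"
        "H1_norm T (\<lambda>x. u n x + - 1 * w x) \<le> L2_norm S (\<lambda>x. w x - W n x) + L2_norm S (\<lambda>x. h x - H n x)"
        using d elim(1) by (simp_all add: L2_norm_minus_commute[of S w] L2_norm_minus_commute[of S h])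
      have "l (u n) - l w = l (\<lambda>x. u n x + - 1 * w x)"
        using add[OF elim(2) neg(1)] mul[OF w1, of "- 1"] by simp
      then have "norm (l (u n) - l w) \<le> C * H1_norm T (\<lambda>x. u n x + - 1 * w x)"
        using C[OF d'(1)] by simp
      also have "\<dots> \<le> \<bar>C\<bar> * H1_norm T (\<lambda>x. u n x + - 1 * w x)"
        by (intro mult_right_mono) (auto simp: H1_norm_def)
      also have "\<dots> \<le> ?b n" by (intro mult_left_mono d'(2)) auto
      finally show ?case .
    qed
    moreover have "?b \<longlonglongrightarrow> 0"
      using tendsto_mult_right_zero[OF tendsto_add_zero[OF l]] .
    ultimately have "(\<lambda>n. l (u n) - l w) \<longlonglongrightarrow> 0" by (rule Lim_null_comparison)
    then show ?thesis by (simp add: LIM_zero_iff)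
  qed
  then show ?thesis using u1 w1 by (simp add: H1_weakly_converges_def)
qed

lemma H10_solution_H0pair:
  fixes M :: "real^'d \<Rightarrow> complex^'d^'d"
  assumes S: "open S" and M: "bounded_matrix S M K" and f: "L2_on S f" and u: "H10_solution S M f u"
  shows "H0pair S u (weak_gradient S u)" "weak_sol S M f (weak_gradient S u)"
  using u H10_imp_H0pair[OF S] unfolding H10_solution_iff[OF S M f] by auto

lemma unique_H10_solutionI:
  fixes M :: "real^'d \<Rightarrow> complex^'d^'d"
  assumes S: "open S" "S \<subseteq> cball 0 R" and M: "bounded_matrix S M K" "coercive S M \<theta> \<mu>" and f: "L2_on S f"
    and p: "H0pair S u g" and w: "weak_sol S M f g"
  shows "unique_H10_solution S M f u"
  unfolding unique_H10_solution_def
proof (intro conjI allI impI)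
  have Ss: "S \<in> sets lebesgue" using S(1) by simp
  note h = H0pair_imp_H10[OF S(1) p]
  have "weak_sol S M f (weak_gradient S u)"
    using w form_cong_AE[OF M(1) H0pair_L2(2)[OF H10_imp_H0pair[OF S(1) h(1)]] H0pair_L2(2)[OF p] test_function_L2(2)[OF _ Ss] h(2)]
    by (simp add: weak_sol_def)
  then show "H10_solution S M f u"
    unfolding H10_solution_iff[OF S(1) M(1) f] using h(1) by blast
  fix v assume "H10_solution S M f v"
  note v = H10_solution_H0pair[OF S(1) M(1) f this]
  show "AE x in lebesgue_on S. v x = u x"
    by (rule coercive_unique(1)[OF S M f v p w])
qed

lemma norm_smult_complex: "norm (c *s v) = cmod c * norm v" for v :: "complex^'d"
  by (simp add: norm_vec_def norm_mult L2_set_right_distrib)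

lemma L2_norm_smult: "L2_norm S (\<lambda>x. c *s g x) = cmod c * L2_norm S g" for g :: "real^'d \<Rightarrow> complex^'d"
  by (simp add: L2_norm_def norm_smult_complex power_mult_distrib real_sqrt_mult)

lemma weak_sol_cmult: "weak_sol S M f g \<Longrightarrow> weak_sol S M (\<lambda>x. c * f x) (\<lambda>x. c *s g x)"
  by (simp add: weak_sol_def form_smult_left pairing_def mult.assoc)

lemma L2_on_cmult: "L2_on S f \<Longrightarrow> L2_on S (\<lambda>x. c * f x :: complex)"
  by (rule L2_on_bounded_linear[OF _ bounded_linear_mult_right])

lemma tendsto_0_of_power2:
  fixes a :: "nat \<Rightarrow> real"
  assumes "(\<lambda>n. (a n)\<^sup>2) \<longlonglongrightarrow> 0"
  shows "a \<longlonglongrightarrow> 0"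
proof -
  have "(\<lambda>n. \<bar>a n\<bar>) \<longlonglongrightarrow> 0" using tendsto_real_sqrt[OF assms] by simp
  then show ?thesis by (simp add: tendsto_rabs_zero_iff)
qed

text \<open>\<open>(\<delta> * N)^2 = \<delta> * (\<delta> * N^2) \<le> \<delta> * B\<close>, so the
  product decays at least like the square root of \<open>\<delta>\<close>.\<close>

lemma tendsto_mult_of_bounded_energy:
  fixes \<delta> N :: "nat \<Rightarrow> real"
  assumes \<delta>: "\<And>n. \<delta> n > 0" "\<delta> \<longlonglongrightarrow> 0" and B: "\<forall>\<^sub>F n in sequentially. \<delta> n * (N n)\<^sup>2 \<le> B"
  shows "(\<lambda>n. \<delta> n * N n) \<longlonglongrightarrow> 0"
proof (rule tendsto_0_of_power2, rule Lim_null_comparison)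
  show "\<forall>\<^sub>F n in sequentially. norm ((\<delta> n * N n)\<^sup>2) \<le> \<delta> n * B"
    using B
  proof eventually_elim
    case (elim n)
    have "(\<delta> n * N n)\<^sup>2 = \<delta> n * (\<delta> n * (N n)\<^sup>2)" by (simp add: power2_eq_square)
    also have "\<dots> \<le> \<delta> n * B" using elim \<delta>(1)[of n] by (intro mult_left_mono) auto
    finally show ?case by simp
  qed
  show "(\<lambda>n. \<delta> n * B) \<longlonglongrightarrow> 0" by (rule tendsto_mult_left_zero[OF \<delta>(2)])
qed

section \<open>Bounded and unbounded energy\<close>

context complementary_medium
begin

abbreviation "energy_norm v \<equiv> L2_norm (ball 0 r2 - ball 0 r1) (weak_gradient \<Omega> v)"

lemma Om_cball: "\<exists>R. \<Omega> \<subseteq> cball 0 R"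
  using Om(2) by (auto simp: bounded_iff subset_iff)

lemma fold_outside: "x \<in> \<Omega> - cball 0 r3 \<Longrightarrow> u x = fold u x"
  using r23 by (auto simp: fold_def U23_def)

lemma outer_open: "open (\<Omega> - cball 0 r3)" "\<Omega> - cball 0 r3 \<subseteq> \<Omega>"
  using Om by (auto intro: open_Diff)

text \<open>The second part concerns an arbitrary solution \<open>v\<close>: by uniqueness its
  gradient is almost everywhere \<open>c\<close> times that of \<open>u\<close>, whichever
  representatives \<open>weak_gradient\<close> selects.\<close>

lemma solution_cmult:
  assumes \<delta>: "\<delta> > 0" and f: "L2_on \<Omega> f" and u: "H10_solution \<Omega> (Ms \<delta>) f u"
  shows "unique_H10_solution \<Omega> (Ms \<delta>) (\<lambda>x. c * f x) (\<lambda>x. c * u x)"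
    and "H10_solution \<Omega> (Ms \<delta>) (\<lambda>x. c * f x) v \<Longrightarrow> energy_norm v = cmod c * energy_norm u"
proof -
  obtain R where R: "\<Omega> \<subseteq> cball 0 R" using Om_cball by blast
  note p = H10_solution_H0pair[OF Om(1) Ms_bounded f u] and cf = L2_on_cmult[OF f, of c]
  note cp = H0pair_cmult[OF Om_sets p(1), of c] and cw = weak_sol_cmult[OF p(2), of c]
  show "unique_H10_solution \<Omega> (Ms \<delta>) (\<lambda>x. c * f x) (\<lambda>x. c * u x)"
    by (rule unique_H10_solutionI[OF Om(1) R Ms_bounded Ms_coercive[OF \<delta>] cf cp cw])
  assume "H10_solution \<Omega> (Ms \<delta>) (\<lambda>x. c * f x) v"
  note q = H10_solution_H0pair[OF Om(1) Ms_bounded cf this]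
  have s: "ball 0 r2 - ball 0 r1 \<in> sets lebesgue" "ball 0 r2 - ball 0 r1 \<subseteq> \<Omega>"
    using r3_Om r23 by (auto simp: subset_iff)
  have "energy_norm v = L2_norm (ball 0 r2 - ball 0 r1) (\<lambda>x. c *s weak_gradient \<Omega> u x)"
  proof (rule L2_norm_cong_AE)
    show "AE x in lebesgue_on (ball 0 r2 - ball 0 r1). weak_gradient \<Omega> v x = c *s weak_gradient \<Omega> u x"
      by (rule AE_lebesgue_on_subset[OF coercive_unique(2)[OF Om(1) R Ms_bounded Ms_coercive[OF \<delta>] cf q cp cw] s(1) Om_sets s(2)])
  qed (rule L2_on_measurable[OF L2_norm_subset(1)[OF H0pair_L2(2) s(1) Om_sets s(2)]], fact q cp)+
  then show "energy_norm v = cmod c * energy_norm u" by (simp add: L2_norm_smult)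
qed

context
  fixes f :: "real^'d \<Rightarrow> complex" and \<delta> :: "nat \<Rightarrow> real" and u :: "nat \<Rightarrow> real^'d \<Rightarrow> complex"
  assumes f: "L2_on \<Omega> f" "AE x in lebesgue_on (ball 0 r2). f x = 0"
    and \<delta>: "\<And>n. \<delta> n > 0" "\<delta> \<longlonglongrightarrow> 0"
    and u: "\<And>n. H10_solution \<Omega> (Ms (\<delta> n)) f (u n)"
begin

lemma bounded_energy:
  assumes "bounded (range (\<lambda>n. \<delta> n * (energy_norm (u n))\<^sup>2))"
  shows "\<exists>w. unique_H10_solution \<Omega> Mh f w \<and> H1_weakly_converges (\<Omega> - cball 0 r3) u w"
proof -
  obtain R where R: "\<Omega> \<subseteq> cball 0 R" using Om_cball by blast
  obtain KM \<mu> where M: "bounded_matrix \<Omega> Mh KM" "coercive \<Omega> Mh 1 \<mu>" using Mh_coercive by blast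
  obtain B where "\<And>n. \<bar>\<delta> n * (energy_norm (u n))\<^sup>2\<bar> \<le> B" using assms by (auto simp: bounded_iff)
  then have "\<forall>\<^sub>F n in sequentially. \<delta> n * (energy_norm (u n))\<^sup>2 \<le> B"
    by (intro always_eventually allI) (rule order_trans[OF abs_ge_self])
  note e = tendsto_mult_of_bounded_energy[OF \<delta> this]
  note p = H10_solution_H0pair[OF Om(1) Ms_bounded f(1) u]
  have "\<exists>w h. H0pair \<Omega> w h \<and> weak_sol \<Omega> Mh f h \<and>
    (\<lambda>n. L2_norm \<Omega> (\<lambda>x. w x - fold (u n) x)) \<longlonglongrightarrow> 0 \<and>
    (\<lambda>n. L2_norm \<Omega> (\<lambda>x. h x - fold_grad (weak_gradient \<Omega> (u n)) x)) \<longlonglongrightarrow> 0"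
  proof (rule weak_sol_limit[OF Om(1) R M f(1) fold_H0pair[OF p(1)]])
    show "0 \<le> Cr * (\<delta> n * energy_norm (u n))" for n
      using Cr_nonneg \<delta>(1)[of n] by simp
    show "(\<lambda>n. Cr * (\<delta> n * energy_norm (u n))) \<longlonglongrightarrow> 0" by (rule tendsto_mult_right_zero[OF e])
    show "norm (form \<Omega> Mh (fold_grad (weak_gradient \<Omega> (u n))) (grad \<phi>) + pairing \<Omega> f \<phi>)
        \<le> Cr * (\<delta> n * energy_norm (u n)) * L2_norm \<Omega> (grad \<phi>)" if "test_function \<Omega> \<phi>" for n \<phi>
      by (rule fold_residual[OF \<delta>(1) f H0pair_L2(2)[OF p(1)] p(2) that])
  qed
  then obtain w h where w: "H0pair \<Omega> w h" "weak_sol \<Omega> Mh f h"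
    and l: "(\<lambda>n. L2_norm \<Omega> (\<lambda>x. w x - fold (u n) x)) \<longlonglongrightarrow> 0"
      "(\<lambda>n. L2_norm \<Omega> (\<lambda>x. h x - fold_grad (weak_gradient \<Omega> (u n)) x)) \<longlonglongrightarrow> 0"
    by blast
  have "H1_weakly_converges (\<Omega> - cball 0 r3) u w"
    by (rule H1_weakly_convergesI[OF outer_open Om(1) w(1) _ l])
       (use fold_H0pair[OF p(1)] fold_outside in \<open>auto intro!: always_eventually\<close>)
  then show ?thesis using unique_H10_solutionI[OF Om(1) R M f(1) w] by blast
qed

text \<open>Scaling by the inverse square root of the energy normalises it. The energy is known to
  be positive only from some index on, hence the eventual quantifier.\<close>

lemma normalized_solution:
  assumes E: "filterlim (\<lambda>n. \<delta> n * (energy_norm (u n))\<^sup>2) at_top sequentially"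
  shows "\<exists>c v. \<forall>\<^sub>F n in sequentially. c n > 0 \<and>
     unique_H10_solution \<Omega> (Ms (\<delta> n)) (\<lambda>x. complex_of_real (c n) * f x) (v n) \<and> \<delta> n * (energy_norm (v n))\<^sup>2 = 1"
proof (intro exI)
  let ?E = "\<lambda>n. \<delta> n * (energy_norm (u n))\<^sup>2"
  let ?c = "\<lambda>n. 1 / sqrt (?E n)"
  let ?v = "\<lambda>n x. complex_of_real (?c n) * u n x"
  have "\<forall>\<^sub>F n in sequentially. ?E n > 0" using E by (simp add: filterlim_at_top_dense)
  then show "\<forall>\<^sub>F n in sequentially. ?c n > 0 \<and>
     unique_H10_solution \<Omega> (Ms (\<delta> n)) (\<lambda>x. complex_of_real (?c n) * f x) (?v n) \<and> \<delta> n * (energy_norm (?v n))\<^sup>2 = 1"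
  proof eventually_elim
    case (elim n)
    note s = solution_cmult[OF \<delta>(1) f(1) u, of n "complex_of_real (?c n)"]
    have "energy_norm (?v n) = cmod (complex_of_real (?c n)) * energy_norm (u n)"
      by (rule s(2)) (use s(1) in \<open>simp add: unique_H10_solution_def\<close>)
    then have "\<delta> n * (energy_norm (?v n))\<^sup>2 = (?c n)\<^sup>2 * ?E n"
      by (simp only: norm_of_real power_mult_distrib power2_abs mult_ac)
    also have "\<dots> = 1" using elim by (auto simp: power_divide real_sqrt_pow2)
    finally show ?case using s(1) elim by simp
  qed
qed

text \<open>Since the limit is zero, coercivity bounds the folded gradients directly and no Cauchy
  argument is needed.\<close>

lemma normalized_solutions_vanish:
  assumes E: "filterlim (\<lambda>n. \<delta> n * (energy_norm (u n))\<^sup>2) at_top sequentially"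
    and v: "\<forall>\<^sub>F n in sequentially. c n > 0 \<and>
     H10_solution \<Omega> (Ms (\<delta> n)) (\<lambda>x. complex_of_real (c n) * f x) (v n) \<and> \<delta> n * (energy_norm (v n))\<^sup>2 = 1"
  shows "H1_weakly_converges (\<Omega> - cball 0 r3) v (\<lambda>x. 0)"
proof -
  obtain R where R: "\<Omega> \<subseteq> cball 0 R" using Om_cball by blast
  obtain KM \<mu> where M: "bounded_matrix \<Omega> Mh KM" "coercive \<Omega> Mh 1 \<mu>" using Mh_coercive by blast
  let ?E = "\<lambda>n. \<delta> n * (energy_norm (u n))\<^sup>2"
  \<comment> \<open>By uniqueness the energy of \<open>v n\<close> is \<open>(c n)^2\<close> times
    that of \<open>u n\<close>, so the normalisation determines \<open>(c n)^2\<close>.\<close>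
  have "\<forall>\<^sub>F n in sequentially. inverse (?E n) = (c n)\<^sup>2"
    using v
  proof eventually_elim
    case (elim n)
    have "energy_norm (v n) = cmod (complex_of_real (c n)) * energy_norm (u n)"
      by (rule solution_cmult(2)[OF \<delta>(1) f(1) u]) (use elim in blast)
    then have "1 = \<delta> n * (c n * energy_norm (u n))\<^sup>2" using elim by simp
    also have "\<dots> = (c n)\<^sup>2 * ?E n" by (simp only: power_mult_distrib mult_ac)
    finally show ?case by (metis inverse_unique mult.commute)
  qed
  from Lim_transform_eventually[OF tendsto_inverse_0_at_top[OF E] this]
  have c0: "c \<longlonglongrightarrow> 0" by (rule tendsto_0_of_power2)
  have "\<forall>\<^sub>F n in sequentially. \<delta> n * (energy_norm (v n))\<^sup>2 \<le> 1" using v by eventually_elim simp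
  note \<delta>v = tendsto_mult_of_bounded_energy[OF \<delta> this]
  \<comment> \<open>The first summand is the source scaled by \<open>c n\<close>, with
    \<open>2 * \<bar>R\<bar>\<close> from the Poincare inequality; the second is the fold residual,
    small because the energy of \<open>v n\<close> is \<open>1\<close>.\<close>
  define e where "e n = c n * (L2_norm \<Omega> f * (2 * \<bar>R\<bar>)) + Cr * (\<delta> n * energy_norm (v n))" for n
  have e0: "e \<longlonglongrightarrow> 0"
    unfolding e_def by (rule tendsto_add_zero[OF tendsto_mult_left_zero[OF c0] tendsto_mult_right_zero[OF \<delta>v]])
  let ?g = "\<lambda>n. weak_gradient \<Omega> (v n)"
  have pair: "H0pair \<Omega> (fold (v n)) (fold_grad (?g n)) \<and> L2_norm \<Omega> (fold_grad (?g n)) \<le> (1 / \<mu>) * e n"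
    if n: "c n > 0" "H10_solution \<Omega> (Ms (\<delta> n)) (\<lambda>x. complex_of_real (c n) * f x) (v n)" for n
  proof -
    note cf = L2_on_cmult[OF f(1), of "complex_of_real (c n)"]
    note p = H10_solution_H0pair[OF Om(1) Ms_bounded cf n(2)]
    have z: "AE x in lebesgue_on (ball 0 r2). complex_of_real (c n) * f x = 0" using f(2) by eventually_elim simp
    have "L2_norm \<Omega> (fold_grad (?g n)) \<le> norm (1 :: complex) * e n / \<mu>"
    proof (rule coercive_bound[OF Om_sets M fold_H0pair[OF p(1)]])
      show "0 \<le> e n" using n(1) Cr_nonneg \<delta>(1)[of n] by (simp add: e_def)
      fix \<phi> :: "real^'d \<Rightarrow> complex" assume \<phi>: "test_function \<Omega> \<phi>"
      let ?F = "form \<Omega> Mh (fold_grad (?g n)) (grad \<phi>)" and ?p = "pairing \<Omega> (\<lambda>x. complex_of_real (c n) * f x) \<phi>"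
      have "norm ?p = c n * norm (pairing \<Omega> f \<phi>)"
        using n(1) by (simp add: pairing_def mult.assoc norm_mult)
      also have "\<dots> \<le> c n * (L2_norm \<Omega> f * L2_norm \<Omega> \<phi>)"
        using n(1) by (intro mult_left_mono norm_pairing_le[OF f(1) test_function_L2(1)[OF \<phi> Om_sets]]) auto
      also have "\<dots> \<le> c n * (L2_norm \<Omega> f * (2 * \<bar>R\<bar> * L2_norm \<Omega> (grad \<phi>)))"
        using n(1) by (intro mult_left_mono test_function_poincare[OF \<phi> Om_sets R]) auto
      finally have "norm ?p \<le> (c n * (L2_norm \<Omega> f * (2 * \<bar>R\<bar>))) * L2_norm \<Omega> (grad \<phi>)" by (simp add: mult_ac)
      moreover have "norm (?F + ?p) \<le> (Cr * (\<delta> n * energy_norm (v n))) * L2_norm \<Omega> (grad \<phi>)"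
        by (rule fold_residual[OF \<delta>(1) cf z H0pair_L2(2)[OF p(1)] p(2) \<phi>])
      moreover have "norm ?F \<le> norm (?F + ?p) + norm ?p" using norm_triangle_ineq4[of "?F + ?p" ?p] by simp
      ultimately show "norm ?F \<le> e n * L2_norm \<Omega> (grad \<phi>)" unfolding e_def distrib_right by linarith
    qed
    then show ?thesis using fold_H0pair[OF p(1)] by simp
  qed
  \<comment> \<open>The zero pair arises as \<open>0\<close> times a solution.\<close>
  have zero: "H0pair \<Omega> (\<lambda>x. 0) (\<lambda>x. 0)"
    using H0pair_cmult[OF Om_sets H10_solution_H0pair(1)[OF Om(1) Ms_bounded f(1) u], of 0] by simp
  have gl: "(\<lambda>n. L2_norm \<Omega> (fold_grad (?g n))) \<longlonglongrightarrow> 0"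
  proof (rule Lim_null_comparison)
    show "\<forall>\<^sub>F n in sequentially. norm (L2_norm \<Omega> (fold_grad (?g n))) \<le> (1 / \<mu>) * e n"
      using v by eventually_elim (use pair in auto)
    show "(\<lambda>n. (1 / \<mu>) * e n) \<longlonglongrightarrow> 0" by (rule tendsto_mult_right_zero[OF e0])
  qed
  have vl: "(\<lambda>n. L2_norm \<Omega> (fold (v n))) \<longlonglongrightarrow> 0"
  proof (rule Lim_null_comparison)
    show "\<forall>\<^sub>F n in sequentially. norm (L2_norm \<Omega> (fold (v n))) \<le> 2 * \<bar>R\<bar> * L2_norm \<Omega> (fold_grad (?g n))"
      using v by eventually_elim (use pair H0pair_poincare[OF _ Om_sets R] in auto)
    show "(\<lambda>n. 2 * \<bar>R\<bar> * L2_norm \<Omega> (fold_grad (?g n))) \<longlonglongrightarrow> 0" by (rule tendsto_mult_right_zero[OF gl])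
  qed
  show ?thesis
  proof (rule H1_weakly_convergesI[OF outer_open Om(1) zero])
    show "\<forall>\<^sub>F n in sequentially. H0pair \<Omega> (fold (v n)) (fold_grad (?g n)) \<and> (\<forall>x\<in>\<Omega> - cball 0 r3. v n x = fold (v n) x)"
      using v by eventually_elim (use pair fold_outside in blast)
  qed (use gl vl in simp_all)
qed

end

end
theorem theorem1p1:
  fixes \<Omega> :: "(real^'d) set"
    and A :: "real^'d \<Rightarrow> real^'d^'d"
    and r1 r2 r3 :: real
    and F G :: "real^'d \<Rightarrow> real^'d"
    and x1 x2 :: "real^'d"
    and f :: "real^'d \<Rightarrow> complex"
    and \<delta> :: "nat \<Rightarrow> real"
    and u :: "nat \<Rightarrow> real^'d \<Rightarrow> complex"
  assumes dim: "CARD('d) \<in> {2, 3}"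
    and Omega: "smooth_bounded_open \<Omega>"
    and radii: "0 < r1" "r1 < r2" "closure (ball 0 r2) \<subseteq> \<Omega>"
    and elliptic: "symmetric_uniformly_elliptic \<Omega> A"
    and doubly: "doubly_complementary \<Omega> r1 r2 A r3 F G x1 x2"
    and regular: "Ck_closure 3 (ball 0 r3 - cball 0 r2) A"
    and f_L2: "L2_on \<Omega> f"
    and f_supp: "ess_support \<Omega> f \<subseteq> \<Omega> - ball 0 r2"
    and delta: "\<forall>n. \<delta> n > 0" "\<delta> \<longlonglongrightarrow> 0"
    and u: "\<forall>n. H10_solution \<Omega> (scaled_matrix (s_coeff r1 r2 (\<delta> n)) A) f (u n)"
  shows
    "(filterlim (\<lambda>n. \<delta> n * (L2_norm (ball 0 r2 - ball 0 r1) (weak_gradient \<Omega> (u n)))\<^sup>2)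
        at_top sequentially \<longrightarrow>
      (\<exists>c v. \<forall>\<^sub>F n in sequentially.
         c n > 0 \<and>
         unique_H10_solution \<Omega> (scaled_matrix (s_coeff r1 r2 (\<delta> n)) A)
           (\<lambda>x. complex_of_real (c n) * f x) (v n) \<and>
         \<delta> n * (L2_norm (ball 0 r2 - ball 0 r1) (weak_gradient \<Omega> (v n)))\<^sup>2 = 1) \<and>
      (\<forall>c v. (\<forall>\<^sub>F n in sequentially.
         c n > 0 \<and>
         H10_solution \<Omega> (scaled_matrix (s_coeff r1 r2 (\<delta> n)) A)
           (\<lambda>x. complex_of_real (c n) * f x) (v n) \<and>
         \<delta> n * (L2_norm (ball 0 r2 - ball 0 r1) (weak_gradient \<Omega> (v n)))\<^sup>2 = 1) \<longrightarrow>
         H1_weakly_converges (\<Omega> - cball 0 r3) v (\<lambda>x. 0)))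
     \<and>
     (bounded (range (\<lambda>n. \<delta> n * (L2_norm (ball 0 r2 - ball 0 r1) (weak_gradient \<Omega> (u n)))\<^sup>2)) \<longrightarrow>
      (\<exists>w. unique_H10_solution \<Omega> (scaled_matrix (\<lambda>x. 1) (A_hat r2 r3 A F G x1)) f w \<and>
           H1_weakly_converges (\<Omega> - cball 0 r3) u w))"

proof -
  have Om: "open \<Omega>" "bounded \<Omega>" using Omega by (auto simp: smooth_bounded_open_def)
  obtain \<Lambda> where L: "\<Lambda> \<ge> 1" "AE x in lebesgue_on \<Omega>. elliptic_at (1 / \<Lambda>) \<Lambda> (A x)"
    using elliptic_imp_AE_elliptic_at[OF elliptic] by blast
  have A: "A \<in> borel_measurable (lebesgue_on \<Omega>)" using elliptic by (simp add: symmetric_uniformly_elliptic_def)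
  have "r3 > 0" "closure (ball 0 r3) \<subseteq> \<Omega>" using doubly by (auto simp: doubly_complementary_def)
  then have r3: "cball 0 r3 \<subseteq> \<Omega>" by simp
  note D = doubly[unfolded doubly_complementary_def reflecting_complementary_def]
  interpret complementary_medium r1 r2 r3 F G x1 x2 \<Omega> A \<Lambda>
    by unfold_locales (use dim radii D Om L A r3 in auto)
  \<comment> \<open>The support is taken relative to \<open>\<Omega>\<close>; since the closed ball
    of radius \<open>r2\<close> lies in \<open>\<Omega>\<close>, \<open>f\<close> vanishes almost
    everywhere on the whole of \<open>ball 0 r2\<close>.\<close>
  have f0: "AE x in lebesgue_on (ball 0 r2). f x = 0"
    by (rule AE_zero_outside_ess_support[OF Om(1) open_ball _ f_supp]) (use radii in auto)
  have \<delta>: "\<And>n. \<delta> n > 0" using delta(1) by blast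
  have sol: "\<And>n. H10_solution \<Omega> (scaled_matrix (s_coeff r1 r2 (\<delta> n)) A) f (u n)" using u by blast
  show ?thesis
    using normalized_solution[OF f_L2 f0 \<delta> delta(2) sol] normalized_solutions_vanish[OF f_L2 f0 \<delta> delta(2) sol]
      bounded_energy[OF f_L2 f0 \<delta> delta(2) sol] by blast
qed

end
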